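(* Let $1<\alpha\le 2$ and let $p\in\mathbb{N}$ with $p\ge 3$ and $p>\frac{\alpha}{\alpha-1}$. There exists $\varepsilon=\varepsilon(\alpha,p)>0$ such that the following holds. Let $\omega_+,\omega_-\in\mathbb{R}$ and let $\Phi(x)=\omega_+|x|^{-\alpha/p}$ for $x>0$, $\Phi(x)=\omega_-|x|^{-\alpha/p}$ for $x<0$, and assume $\|A_\alpha(1)\Phi\|_{L^{p+1}(\mathbb{R})}\le\varepsilon$. Then there exists a real-valued function $v\in C_b(\mathbb{R})$ (bounded and continuous) such that $$u(t,x)=t^{-\frac{\alpha}{(\alpha+1)p}}\,v\!\left(\frac{x}{t^{1/(\alpha+1)}}\right),\qquad t>0,\ x\in\mathbb{R},$$ is a self-similar solution of the initial value problem $u_t+D^\alpha u_x+u^pu_x=0$, $u(0)=\Phi$, in the following sense: for every $t>0$ and every $x\in\mathbb{R}$, $$u(t,x)=(A_\alpha(t)\Phi)(x)-\int_0^t\big[A_\alpha(t-t')(u^pu_x)(t')\big](x)\,dt',$$ and $u(t)\to\Phi$ in $\mathcal{S}'(\mathbb{R})$ as $t\to0$, $t>0$.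
   Context: $D^\alpha$ is the Fourier multiplier on $\mathbb{R}$ with symbol $|\xi|^\alpha$. $A_\alpha(t)=e^{-tD^\alpha\partial_x}$ ($t\in\mathbb{R}$) is the linear group of $u_t+D^\alpha u_x=0$, i.e. the Fourier multiplier with symbol $e^{-it\xi|\xi|^\alpha}$; it acts on $\Phi$ through the Fourier transform of $\Phi$, which is a locally integrable function (a linear combination of $|\xi|^{\alpha/p-1}$ and $\mathrm{sgn}(\xi)|\xi|^{\alpha/p-1}$). In the Duhamel integral, $u^pu_x$ is understood as $\frac1{p+1}\partial_x(u^{p+1})$ in the sense of distributions, and $\int_0^t$ is understood as the limit, as $\epsilon\to0^+$, of $\int_\epsilon^t$, where each integral over $[\epsilon,t]$ is (represented by) a continuous function of $x$. *)

theory Defs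
  imports "HOL-Analysis.Analysis"
begin

section \<open>Schwartz functions\<close>

definition vderiv :: "(real \<Rightarrow> complex) \<Rightarrow> real \<Rightarrow> complex" where
  "vderiv f = (\<lambda>x. vector_derivative f (at x))"

definition schwartz :: "(real \<Rightarrow> complex) set" where
  "schwartz = {\<phi>. \<forall>n::nat.
      (\<forall>x. ((vderiv ^^ n) \<phi>) differentiable (at x)) \<and>
      (\<forall>k::nat. bounded (range (\<lambda>x. of_real (x ^ k) * (vderiv ^^ n) \<phi> x)))}"

text \<open>The normalisation in which \<open>d/dx\<close> has symbol \<open>\<i> \<xi>\<close>.\<close>

definition fourier :: "(real \<Rightarrow> complex) \<Rightarrow> real \<Rightarrow> complex" where
  "fourier \<phi> \<xi> = (LINT x|lborel. cis (- (x * \<xi>)) * \<phi> x)"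

definition inv_fourier :: "(real \<Rightarrow> complex) \<Rightarrow> real \<Rightarrow> complex" where
  "inv_fourier \<phi> x = of_real (1 / (2 * pi)) * (LINT \<xi>|lborel. cis (x * \<xi>) * \<phi> \<xi>)"

section \<open>Tempered distributions\<close>

text \<open>A distribution is a functional of which only the values on \<open>schwartz\<close> matter. Every
  distribution used below comes from functions in \<open>tempered_fun\<close> by differentiation, Fourier
  transform, multipliers and integration in time, so linearity and continuity on \<open>schwartz\<close>
  need not be demanded separately.\<close>

type_synonym distr = "(real \<Rightarrow> complex) \<Rightarrow> complex"

text \<open>Locally integrable functions that define a tempered distribution.\<close>

definition tempered_fun :: "(real \<Rightarrow> complex) \<Rightarrow> bool" where
  "tempered_fun f \<longleftrightarrow> f \<in> borel_measurable lborel \<and>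
     (\<exists>N::nat. integrable lborel (\<lambda>x. f x / of_real ((1 + \<bar>x\<bar>) ^ N)))"

definition fun_distr :: "(real \<Rightarrow> complex) \<Rightarrow> distr" where
  "fun_distr f = (\<lambda>\<phi>. LINT x|lborel. f x * \<phi> x)"

definition represents :: "(real \<Rightarrow> complex) \<Rightarrow> distr \<Rightarrow> bool" where
  "represents f T \<longleftrightarrow> tempered_fun f \<and> (\<forall>\<phi>\<in>schwartz. T \<phi> = fun_distr f \<phi>)"

definition cont_represents :: "(real \<Rightarrow> complex) \<Rightarrow> distr \<Rightarrow> bool" where
  "cont_represents f T \<longleftrightarrow> continuous_on UNIV f \<and> represents f T"

definition distr_deriv :: "distr \<Rightarrow> distr" where
  "distr_deriv T = (\<lambda>\<phi>. - T (vderiv \<phi>))"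

definition distr_fourier :: "distr \<Rightarrow> distr" where
  "distr_fourier T = (\<lambda>\<phi>. T (fourier \<phi>))"

text \<open>\<open>T\<close> is represented by a function in \<open>L\<^sup>q\<close> of norm at most \<open>c\<close>.\<close>

definition Lp_norm_le :: "real \<Rightarrow> distr \<Rightarrow> real \<Rightarrow> bool" where
  "Lp_norm_le q T c \<longleftrightarrow> (\<exists>f. represents f T \<and>
     integrable lborel (\<lambda>x. cmod (f x) powr q) \<and>
     (LINT x|lborel. cmod (f x) powr q) powr (1 / q) \<le> c)"

section \<open>Fourier multipliers and the linear group\<close>

text \<open>The symbols \<open>m\<close> of interest are bounded but not smooth at \<open>0\<close>, so the multiplier acts only
  on distributions whose Fourier transform is a function \<open>g\<close>; the result is the inverse Fourier
  transform of \<open>m g\<close>. As \<open>g\<close> is unique up to null sets, the choice made by \<open>SOME\<close> is immaterial.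
  Outside \<open>fourier_is_fun\<close> the value of \<open>fourier_multiplier\<close> is meaningless.\<close>

definition fourier_is_fun :: "distr \<Rightarrow> bool" where
  "fourier_is_fun T \<longleftrightarrow> (\<exists>g. represents g (distr_fourier T))"

definition fourier_multiplier :: "(real \<Rightarrow> complex) \<Rightarrow> distr \<Rightarrow> distr" where
  "fourier_multiplier m T =
     (let g = (SOME g. represents g (distr_fourier T))
      in (\<lambda>\<phi>. fun_distr (\<lambda>\<xi>. m \<xi> * g \<xi>) (inv_fourier \<phi>)))"

definition lin_group :: "real \<Rightarrow> real \<Rightarrow> distr \<Rightarrow> distr" where
  "lin_group \<alpha> t = fourier_multiplier (\<lambda>\<xi>. cis (- (t * \<xi> * \<bar>\<xi>\<bar> powr \<alpha>)))"

section \<open>Duhamel's formula\<close>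

definition nonlinearity :: "nat \<Rightarrow> (real \<Rightarrow> real) \<Rightarrow> distr" where
  "nonlinearity p w = (\<lambda>\<phi>. of_real (1 / (real p + 1)) *
     distr_deriv (fun_distr (\<lambda>x. of_real (w x ^ (p + 1)))) \<phi>)"

definition weak_integrable :: "(real \<Rightarrow> distr) \<Rightarrow> real \<Rightarrow> real \<Rightarrow> bool" where
  "weak_integrable W a b \<longleftrightarrow> (\<forall>\<phi>\<in>schwartz. set_integrable lborel {a..b} (\<lambda>s. W s \<phi>))"

definition weak_integral :: "(real \<Rightarrow> distr) \<Rightarrow> real \<Rightarrow> real \<Rightarrow> distr" where
  "weak_integral W a b = (\<lambda>\<phi>. LINT s:{a..b}|lborel. W s \<phi>)"

text \<open>\<open>L\<close> is \<open>A(t) \<Phi>\<close> and \<open>I \<epsilon>\<close> is the Duhamel integral over \<open>[\<epsilon>, t]\<close>, both as (necessarily unique)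
  continuous functions.\<close>

definition duhamel_solution ::
  "real \<Rightarrow> nat \<Rightarrow> (real \<Rightarrow> real) \<Rightarrow> (real \<Rightarrow> real \<Rightarrow> real) \<Rightarrow> bool" where
  "duhamel_solution \<alpha> p \<Phi> u \<longleftrightarrow>
     fourier_is_fun (fun_distr (\<lambda>x. of_real (\<Phi> x))) \<and>
     (\<forall>s>0. tempered_fun (\<lambda>x. of_real (u s x ^ (p + 1))) \<and>
            fourier_is_fun (nonlinearity p (u s))) \<and>
     (\<forall>t>0. \<exists>L I.
        cont_represents L (lin_group \<alpha> t (fun_distr (\<lambda>x. of_real (\<Phi> x)))) \<and>
        (\<forall>\<epsilon>. 0 < \<epsilon> \<and> \<epsilon> < t \<longrightarrow>
          weak_integrable (\<lambda>s. lin_group \<alpha> (t - s) (nonlinearity p (u s))) \<epsilon> t \<and>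
          cont_represents (I \<epsilon>)
            (weak_integral (\<lambda>s. lin_group \<alpha> (t - s) (nonlinearity p (u s))) \<epsilon> t)) \<and>
        (\<forall>x. \<exists>J. ((\<lambda>\<epsilon>. I \<epsilon> x) \<longlongrightarrow> J) (at_right 0) \<and> of_real (u t x) = L x - J))"

definition tendsto_tempered ::
  "(real \<Rightarrow> real \<Rightarrow> real) \<Rightarrow> (real \<Rightarrow> real) \<Rightarrow> real filter \<Rightarrow> bool" where
  "tendsto_tempered u \<Phi> F \<longleftrightarrow> (\<forall>\<phi>\<in>schwartz.
     ((\<lambda>t. fun_distr (\<lambda>x. of_real (u t x)) \<phi>) \<longlongrightarrow> fun_distr (\<lambda>x. of_real (\<Phi> x)) \<phi>) F)"

definition self_similar :: "real \<Rightarrow> nat \<Rightarrow> (real \<Rightarrow> real) \<Rightarrow> real \<Rightarrow> real \<Rightarrow> real" where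
  "self_similar \<alpha> p v t x =
     t powr (- (\<alpha> / ((\<alpha> + 1) * real p))) * v (x / t powr (1 / (\<alpha> + 1)))"

end

theory Submission
  imports Defs "HOL-Probability.Probability"
begin

text \<open>Put \<open>\<gamma> = 1 - \<alpha> / p\<close> and \<open>w = v ^ (p + 1)\<close>. On the Fourier side, the substitution
  \<open>\<eta> = s powr (1 / (\<alpha> + 1)) * \<xi>\<close> in Duhamel's integral turns the equation for a self-similar solution into one
  for the profile \<open>v\<close>: for \<open>\<xi> > 0\<close> the transform of \<open>v\<close> is \<open>exp (- \<i> \<xi> powr (\<alpha> + 1)) * a \<xi>\<close> with
  \<open>a \<xi> = \<xi> powr (- \<gamma>) * (c - \<i> (\<alpha> + 1) / (p + 1) * H \<xi>)\<close>, where \<open>c\<close> depends on the data and \<open>H \<xi>\<close> is the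
  integral over \<open>{0..\<xi>}\<close> of \<open>exp (\<i> \<eta> powr (\<alpha> + 1)) * \<eta> powr \<gamma> * fourier w \<eta>\<close>. Van der Corput's estimate
  bounds \<open>H\<close> by the \<open>L\<^sup>1\<close> norm of \<open>w\<close>. The derivative of \<open>a\<close> is merely bounded, but
  this suffices: splitting the inverse Fourier integral at the stationary point of
  \<open>x * \<xi> - \<xi> powr (\<alpha> + 1)\<close> shows that it is at most a multiple of \<open>(1 + \<bar>x\<bar>) powr (- 1 / p)\<close>. Here
  \<open>\<xi> powr (- \<alpha> * (1 - 1 / p))\<close> has to be integrable at infinity, which is the condition \<open>p > \<alpha> / (\<alpha> - 1)\<close>.
  Functions \<open>v\<close> with that decay have integrable powers \<open>w\<close>, so the equation is a fixed point problem in a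
  weighted space of bounded continuous functions, and the map is a contraction on a small ball if \<open>c\<close> is small.
  The assumption on the norm controls \<open>c\<close>, since two Gaussian test functions detect this one complex parameter.\<close>

section \<open>Oscillatory integrals\<close>

text \<open>The source \<open>w\<close> is merely integrable: its transform is bounded without decay
  and no moment of it is available. In the derivative of \<open>a\<close> only the powers
  \<open>\<xi> powr gam\<close> and \<open>\<xi> powr (- gam)\<close> cancel, so a single
  integration by parts has to suffice. Far from the stationary point this leaves an integral of 1 /
  |dphase|. For x < 0 the decay in x is bought by interpolating between -x and
  \<open>\<xi> powr \<alpha>\<close>, which costs a factor \<open>\<xi> powr (\<alpha> / p)\<close>.
  Near the stationary point z it leaves a logarithm, \<open>z powr (1 - \<alpha>) * ln z\<close>,
  which must stay below \<open>z powr (- \<alpha> / p)\<close>. Both times the price is the strict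
  inequality \<alpha> / p < \<alpha> - 1. On the stationary window there is no cancellation:
  amplitude times width must be at most \<open>z powr (- \<alpha> / p)\<close>. If the width alone
  is too large for this, the amplitude must decay. The linear part decays like
  \<open>\<xi> powr (- gam)\<close>; for the nonlinear part the decay comes from the second
  derivative test applied to \<open>H\<close>. The rate 1 / p exceeds 1 / (p + 1), so that
  \<open>v ^ (p + 1)\<close> is integrable and the estimates close.\<close>

lemma has_vector_derivative_cis:
  "(f has_real_derivative f') (at x within S) \<Longrightarrow>
   ((\<lambda>x. cis (f x)) has_vector_derivative f' *\<^sub>R (\<i> * cis (f x))) (at x within S)"
  unfolding has_vector_derivative_def has_field_derivative_def
  by (drule has_derivative_cis) (simp add: mult.commute)

text \<open>Integration by parts, with \<open>cis f\<close> written as its own derivative divided by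
  \<i> f'. Since f'' \<le> 0, the function 1 / f' is nondecreasing, so its variation is a difference
  of end values, at most 2 / m; together with the two boundary terms this gives 4 * A / m.
  \<open>G\<close> is a primitive of any majorant of |a'| / |f'|, to be chosen according to the
  region.\<close>

lemma oscillatory_first_derivative:
  fixes f f' f'' G G' :: "real \<Rightarrow> real" and a a' :: "real \<Rightarrow> complex"
  assumes "c \<le> d"
    and f: "\<And>x. x \<in> {c..d} \<Longrightarrow> (f has_real_derivative f' x) (at x within {c..d})"
    and f': "\<And>x. x \<in> {c..d} \<Longrightarrow> (f' has_real_derivative f'' x) (at x within {c..d})"
    and f''c: "continuous_on {c..d} f''" and f'': "\<And>x. x \<in> {c..d} \<Longrightarrow> f'' x \<le> 0"
    and a: "\<And>x. x \<in> {c..d} \<Longrightarrow> (a has_vector_derivative a' x) (at x within {c..d})"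
    and a'c: "continuous_on {c..d} a'"
    and m: "0 < m" "\<And>x. x \<in> {c..d} \<Longrightarrow> m \<le> \<bar>f' x\<bar>"
    and A: "\<And>x. x \<in> {c..d} \<Longrightarrow> cmod (a x) \<le> A"
    and G: "\<And>x. x \<in> {c..d} \<Longrightarrow> (G has_real_derivative G' x) (at x within {c..d})"
    and G': "\<And>x. x \<in> {c..d} \<Longrightarrow> cmod (a' x) \<le> G' x * \<bar>f' x\<bar>"
  shows "cmod (integral {c..d} (\<lambda>x. cis (f x) * a x)) \<le> 4 * A / m + (G d - G c)"
proof -
  have nz: "f' x \<noteq> 0" if "x \<in> {c..d}" for x using m that by fastforce
  have fc: "continuous_on {c..d} f" using f by (rule DERIV_continuous_on)
  have f'c: "continuous_on {c..d} f'" using f' by (rule DERIV_continuous_on)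
  have ac: "continuous_on {c..d} a"
    unfolding continuous_on_eq_continuous_within using a has_vector_derivative_continuous by blast
  have A0: "0 \<le> A" using \<open>c \<le> d\<close> by (intro order_trans[OF norm_ge_zero A[of c]]) auto
  define r where "r = (\<lambda>x. inverse (f' x))"
  define r' where "r' = (\<lambda>x. - (f'' x / (f' x)\<^sup>2))"
  have r: "(r has_real_derivative r' x) (at x within {c..d})" if "x \<in> {c..d}" for x
    unfolding r_def r'_def using nz[OF that] 
    by (auto intro!: derivative_eq_intros f'[OF that] simp: field_simps power2_eq_square)
  have r'0: "0 \<le> r' x" if "x \<in> {c..d}" for x
    unfolding r'_def using f''[OF that] by (simp add: divide_nonpos_nonneg)
  have rm: "\<bar>r x\<bar> \<le> 1 / m" if "x \<in> {c..d}" for x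
    unfolding r_def using m(1) m(2)[OF that] by (simp add: field_simps abs_inverse le_imp_inverse_le)
  \<comment> \<open>\<open>F\<close> is the boundary term. Its derivative exceeds the integrand by
    \<open>E\<close>, where either \<open>a\<close> or 1 / f' has been differentiated.\<close>
  define F where "F = (\<lambda>x. - \<i> * (cis (f x) * (a x * of_real (r x))))"
  define E where "E = (\<lambda>x. - \<i> * (cis (f x) * (a' x * of_real (r x) + a x * of_real (r' x))))"
  have F: "(F has_vector_derivative (cis (f x) * a x + E x)) (at x within {c..d})" if x: "x \<in> {c..d}" for x
  proof -
    have "((\<lambda>x. of_real (r x) :: complex) has_vector_derivative of_real (r' x)) (at x within {c..d})"
      by (rule has_vector_derivative_of_real[OF r[OF x]])
    from has_vector_derivative_mult_right[OF has_vector_derivative_mult[OF has_vector_derivative_cis[OF f[OF x]]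
        has_vector_derivative_mult[OF a[OF x] this]], of "- \<i>"]
    show ?thesis unfolding F_def
      by (rule has_vector_derivative_eq_rhs)
         (use nz[OF x] in \<open>simp add: E_def r_def scaleR_conv_of_real field_simps\<close>)
  qed
  have "((\<lambda>x. cis (f x) * a x + E x) has_integral (F d - F c)) {c..d}"
    by (rule fundamental_theorem_of_calculus[OF \<open>c \<le> d\<close> F])
  moreover have "continuous_on {c..d} (\<lambda>x. cis (f x) * a x)"
    by (intro continuous_intros fc ac)
  moreover have Ec: "continuous_on {c..d} E"
    unfolding E_def r_def r'_def using nz
    by (intro continuous_intros fc ac a'c f'c f''c) auto
  ultimately have eq: "integral {c..d} (\<lambda>x. cis (f x) * a x) = F d - F c - integral {c..d} E"
    by (simp add: has_integral_iff integrable_continuous_interval integral_add eq_diff_eq)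
  have Hd: "((\<lambda>x. G' x + A * r' x) has_integral ((G d + A * r d) - (G c + A * r c))) {c..d}"
    using \<open>c \<le> d\<close>
    by (intro fundamental_theorem_of_calculus)
       (auto simp flip: has_real_derivative_iff_has_vector_derivative intro!: derivative_eq_intros G r)
  have Eb: "cmod (E x) \<le> G' x + A * r' x" if x: "x \<in> {c..d}" for x
  proof -
    have "cmod (E x) \<le> cmod (a' x) * \<bar>r x\<bar> + cmod (a x) * r' x"
      unfolding E_def using norm_triangle_ineq[of "a' x * of_real (r x)" "a x * of_real (r' x)"] r'0[OF x]
      by (simp add: norm_mult)
    also have "cmod (a' x) * \<bar>r x\<bar> \<le> G' x"
      using G'[OF x] nz[OF x] by (simp add: r_def abs_inverse field_simps)
    also have "cmod (a x) * r' x \<le> A * r' x" by (intro mult_right_mono A x r'0)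
    finally show ?thesis by simp
  qed
  have "cmod (integral {c..d} E) \<le> (G d + A * r d) - (G c + A * r c)"
    using integral_norm_bound_integral[OF integrable_continuous_interval[OF Ec] has_integral_integrable[OF Hd]] Eb
      integral_unique[OF Hd] by simp
  moreover have "A * r d - A * r c \<le> A * (1/m) + A * (1/m)"
    using rm[of d] rm[of c] \<open>c \<le> d\<close> A0 mult_left_mono[of "r d - r c" "1/m + 1/m" A]
    by (simp add: algebra_simps abs_le_iff)
  moreover have Fb: "cmod (F x) \<le> A / m" if x: "x \<in> {c..d}" for x
    unfolding F_def using mult_mono[OF A[OF x] rm[OF x] A0] by (simp add: norm_mult)
  moreover have "cmod (F c) \<le> A / m" "cmod (F d) \<le> A / m" using \<open>c \<le> d\<close> by (auto intro: Fb)
  ultimately show ?thesis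
    unfolding eq using norm_triangle_ineq4[of "F d - F c" "integral {c..d} E"]
      norm_triangle_ineq4[of "F d" "F c"] by argo
qed

section \<open>Exponents and the phase of the linear group\<close>

locale gkdv =
  fixes \<alpha> :: real and p :: nat
  assumes alpha_gt: "1 < \<alpha>" and alpha_le: "\<alpha> \<le> 2" and p_ge: "p \<ge> 3" and p_gt: "real p > \<alpha> / (\<alpha> - 1)"
begin

text \<open>\<open>sg\<close> is the decay exponent of the datum and \<open>- gam\<close> the
  exponent of its Fourier transform. The second derivative of the phase has order
  \<open>\<xi> powr (2 * mu)\<close>, so \<open>\<xi> powr (- mu)\<close> is the width of the region
  in which the phase is stationary.\<close>

definition sg :: real where "sg = \<alpha> / real p"
definition gam :: real where "gam = 1 - sg"
definition mu :: real where "mu = (\<alpha> - 1) / 2"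
definition rho :: real where "rho = max 0 (sg - mu)"

lemma p_pos: "real p > 0" "real p \<ge> 3" using p_ge by auto
lemma sg_pos: "0 < sg" using p_pos alpha_gt by (simp add: sg_def)
text \<open>The hypothesis p > \<alpha> / (\<alpha> - 1), rewritten in the form in which the
  estimates use it.\<close>

lemma sg_lt: "sg < \<alpha> - 1" using p_gt p_pos alpha_gt by (simp add: sg_def field_simps)
lemma sg_le: "sg \<le> 2 / 3"
  using p_pos alpha_le alpha_gt by (simp add: sg_def field_simps)
lemma sg_le': "sg \<le> \<alpha> / 3"
  using p_pos alpha_gt by (simp add: sg_def field_simps)
lemma gam_pos: "0 < gam" and gam_lt: "gam < 1" using sg_le sg_pos by (auto simp: gam_def)
lemma mu_pos: "0 < mu" and mu_le: "mu \<le> 1/2" using alpha_gt alpha_le by (auto simp: mu_def)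
lemma two_mu: "\<alpha> - 1 = 2 * mu" by (simp add: mu_def)
lemma rho_ge: "0 \<le> rho" and rho_mu: "sg \<le> rho + mu" by (auto simp: rho_def)
lemma rho_le_mu: "rho \<le> mu" using sg_lt mu_pos unfolding rho_def two_mu by auto
text \<open>By p \<ge> 3 in the form \<open>sg_le'\<close>, the inequality 2 * sg < 1 + mu reduces
  to \<alpha> < 3. It makes the linear amplitude \<open>\<xi> powr (- gam)\<close> admissible at
  infinity and keeps \<open>gam - rho\<close>, the growth exponent allowed for \<open>H\<close>,
  positive.\<close>

lemma rho_lt_gam: "rho < gam" 
proof -
  have "sg - mu < gam" using sg_le' alpha_le unfolding gam_def mu_def by (simp add: field_simps)
  then show ?thesis using gam_pos by (simp add: rho_def)
qed
lemma inv_p_le_sg: "1 / real p \<le> sg" using alpha_gt p_pos by (simp add: sg_def divide_right_mono)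
lemma sg_alpha: "sg = \<alpha> * (1 / real p)" by (simp add: sg_def)

definition phase :: "real \<Rightarrow> real \<Rightarrow> real" where "phase x \<xi> = x * \<xi> - \<xi> powr (\<alpha> + 1)"
definition dphase :: "real \<Rightarrow> real \<Rightarrow> real" where "dphase x \<xi> = x - (\<alpha> + 1) * \<xi> powr \<alpha>"

lemma phase_deriv: "0 < \<xi> \<Longrightarrow> (phase x has_real_derivative dphase x \<xi>) (at \<xi> within S)"
  unfolding phase_def[abs_def] dphase_def
  by (rule DERIV_subset[OF _ subset_UNIV]) (auto intro!: derivative_eq_intros)

lemma dphase_deriv: "0 < \<xi> \<Longrightarrow> (dphase x has_real_derivative - ((\<alpha> + 1) * \<alpha> * \<xi> powr (\<alpha> - 1))) (at \<xi> within S)"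
  unfolding dphase_def[abs_def]
  by (rule DERIV_subset[OF _ subset_UNIV]) (auto intro!: derivative_eq_intros)

lemma phase_bound:
  assumes "0 < c" "c \<le> d"
    and a: "\<And>\<xi>. \<xi> \<in> {c..d} \<Longrightarrow> (a has_vector_derivative a' \<xi>) (at \<xi> within {c..d})"
    and a'c: "continuous_on {c..d} a'"
    and m: "0 < m" "\<And>\<xi>. \<xi> \<in> {c..d} \<Longrightarrow> m \<le> \<bar>dphase x \<xi>\<bar>"
    and A: "\<And>\<xi>. \<xi> \<in> {c..d} \<Longrightarrow> cmod (a \<xi>) \<le> A"
    and G: "\<And>\<xi>. \<xi> \<in> {c..d} \<Longrightarrow> (G has_real_derivative G' \<xi>) (at \<xi> within {c..d})"
    and G': "\<And>\<xi>. \<xi> \<in> {c..d} \<Longrightarrow> cmod (a' \<xi>) \<le> G' \<xi> * \<bar>dphase x \<xi>\<bar>"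
  shows "cmod (integral {c..d} (\<lambda>\<xi>. cis (phase x \<xi>) * a \<xi>)) \<le> 4 * A / m + (G d - G c)"
proof (rule oscillatory_first_derivative[OF \<open>c \<le> d\<close> phase_deriv dphase_deriv _ _ a a'c m A G G'])
  show "continuous_on {c..d} (\<lambda>\<xi>. - ((\<alpha> + 1) * \<alpha> * \<xi> powr (\<alpha> - 1)))"
    using \<open>0 < c\<close> by (intro continuous_intros) auto
qed (use assms(1) alpha_gt in auto)

text \<open>Stands in for a lower bound on the second derivative of the phase.\<close>

lemma powr_diff_ge:
  assumes "0 \<le> r" "r \<le> s" "0 < s"
  shows "s powr (\<alpha> - 1) * (s - r) \<le> s powr \<alpha> - r powr \<alpha>"
proof -
  have "r powr \<alpha> = r * r powr (\<alpha> - 1)"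
    using assms(1) by (simp add: powr_mult_base)
  also have "\<dots> \<le> r * s powr (\<alpha> - 1)"
    using assms alpha_gt by (intro mult_left_mono powr_mono2) auto
  finally have "r powr \<alpha> \<le> r * s powr (\<alpha> - 1)" .
  moreover have "s powr \<alpha> = s * s powr (\<alpha> - 1)" using assms by (simp add: powr_mult_base)
  ultimately show ?thesis by (simp add: algebra_simps)
qed

lemma phase_cont: "S \<subseteq> {0..} \<Longrightarrow> continuous_on S (\<lambda>\<xi>. cis (phase x \<xi>))"
  unfolding phase_def using alpha_gt by (intro continuous_intros continuous_on_powr') auto

text \<open>Van der Corput's second derivative test. A window of radius \<delta> =
  \<open>c powr (- mu)\<close> about the stationary point is estimated by its length, at most 2 *
  \<delta>. Outside it |dphase| is at least 2 / \<delta>, so each side contributes at most 2 *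
  \<delta>.\<close>

lemma phase_integral_bound:
  assumes "0 < c" "c \<le> d" 
  shows "cmod (integral {c..d} (\<lambda>\<xi>. cis (phase x \<xi>))) \<le> 6 * c powr (- mu)"
proof -
  let ?I = "\<lambda>u v. integral {u..v} (\<lambda>\<xi>. cis (phase x \<xi>))"
  \<comment> \<open>The stationary point, or 0 if x \<le> 0 and there is none; \<open>s\<close> is
    its projection to \<open>{c..d}\<close>.\<close>
  define z where "z = (max x 0 / (\<alpha> + 1)) powr (1 / \<alpha>)"
  define s where "s = max c (min d z)"
  define \<delta> where "\<delta> = c powr (- mu)"
  have \<delta>: "\<delta> > 0" using assms by (simp add: \<delta>_def)
  have z: "(\<alpha> + 1) * z powr \<alpha> = max x 0" "0 \<le> z"
    using alpha_gt by (auto simp: z_def powr_powr)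
  have s: "c \<le> s" "s \<le> d" using assms by (auto simp: s_def)
  have cm: "c powr (\<alpha> - 1) * \<delta> = c powr mu"
    using assms by (simp add: \<delta>_def two_mu flip: powr_add)
  have R: "2 * c powr mu \<le> \<bar>dphase x \<xi>\<bar>" if "s + \<delta> \<le> \<xi>" "\<xi> \<le> d" for \<xi>
  proof -
    \<comment> \<open>There is room between \<open>s\<close> and \<open>d\<close>, so
      \<open>s\<close> has not been cut off from above and lies at or to the right of
      \<open>z\<close>.\<close>
    have zs: "z \<le> s" using that \<delta> s by (auto simp: s_def max_def min_def split: if_splits)
    have "c powr mu = c powr (\<alpha> - 1) * \<delta>" by (simp add: cm)
    also have "\<dots> \<le> \<xi> powr (\<alpha> - 1) * (\<xi> - z)"
      using that zs s \<delta> assms alpha_gt by (intro mult_mono powr_mono2) auto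
    also have "\<dots> \<le> \<xi> powr \<alpha> - z powr \<alpha>" using that zs z s \<delta> assms by (intro powr_diff_ge) auto
    finally have "(\<alpha> + 1) * c powr mu \<le> (\<alpha> + 1) * \<xi> powr \<alpha> - max x 0"
      unfolding z(1)[symmetric] right_diff_distrib[symmetric] by (rule mult_left_mono) (use alpha_gt in auto)
    moreover have "2 * c powr mu \<le> (\<alpha> + 1) * c powr mu" using alpha_gt by (intro mult_right_mono) auto
    ultimately show ?thesis by (simp add: dphase_def)
  qed
  have L: "2 * c powr mu \<le> \<bar>dphase x \<xi>\<bar>" if "\<xi> \<le> s - \<delta>" "c \<le> \<xi>" for \<xi>
  proof -
    have sz: "s \<le> z" using that \<delta> s by (auto simp: s_def max_def min_def split: if_splits)
    \<comment> \<open>Here z \<ge> s \<ge> c > 0, which excludes the default value z = 0 of the case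
      x \<le> 0.\<close>
    then have xp: "x > 0" using s assms z by (smt (verit) alpha_gt divide_eq_0_iff max_def powr_0 z_def)
    have "c powr mu = c powr (\<alpha> - 1) * \<delta>" by (simp add: cm)
    also have "\<dots> \<le> z powr (\<alpha> - 1) * (z - \<xi>)"
      using that sz s \<delta> assms alpha_gt by (intro mult_mono powr_mono2) auto
    also have "\<dots> \<le> z powr \<alpha> - \<xi> powr \<alpha>" using that sz z s \<delta> assms by (intro powr_diff_ge) auto
    finally have "(\<alpha> + 1) * c powr mu \<le> max x 0 - (\<alpha> + 1) * \<xi> powr \<alpha>"
      unfolding z(1)[symmetric] right_diff_distrib[symmetric] by (rule mult_left_mono) (use alpha_gt in auto)
    moreover have "2 * c powr mu \<le> (\<alpha> + 1) * c powr mu" using alpha_gt by (intro mult_right_mono) auto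
    ultimately show ?thesis using xp by (simp add: dphase_def)
  qed
  have int: "(\<lambda>\<xi>. cis (phase x \<xi>)) integrable_on {u..v}" if "c \<le> u" for u v
    using that assms by (intro integrable_continuous_interval phase_cont) auto
  have far: "cmod (?I u v) \<le> 2 * \<delta>" if "c \<le> u" "u \<le> v" "v \<le> d" "\<And>\<xi>. \<xi> \<in> {u..v} \<Longrightarrow> 2 * c powr mu \<le> \<bar>dphase x \<xi>\<bar>" for u v
  proof -
    have "cmod (integral {u..v} (\<lambda>\<xi>. cis (phase x \<xi>) * 1)) \<le> 4 * 1 / (2 * c powr mu) + (0 - 0)"
      using that assms
      by (intro phase_bound[where a'="\<lambda>_. 0" and G'="\<lambda>_. 0"]) auto
    then show ?thesis using assms by (simp add: \<delta>_def powr_minus field_simps)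
  qed
  have near: "cmod (?I u v) \<le> v - u" if "c \<le> u" "u \<le> v" for u v
    using integral_norm_bound_integral[OF int[OF that(1)] integrable_const_ivl, of v 1] that by simp
  define u where "u = max c (s - \<delta>)"
  define v where "v = min d (s + \<delta>)"
  have uv: "c \<le> u" "u \<le> s" "s \<le> v" "v \<le> d" using s \<delta> by (auto simp: u_def v_def)
  have "?I c d = ?I c u + ?I u v + ?I v d"
    using uv Henstock_Kurzweil_Integration.integral_combine[OF _ _ int, of c u v] Henstock_Kurzweil_Integration.integral_combine[OF _ _ int, of c v d] by simp
  moreover have "cmod (?I c u) \<le> 2 * \<delta>"
  proof (cases "c = u")
    case False
    then have "u = s - \<delta>" by (auto simp: u_def)
    then show ?thesis using uv L by (intro far) auto
  qed (use \<delta> in auto)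
  moreover have "cmod (?I v d) \<le> 2 * \<delta>"
  proof (cases "v = d")
    case False
    then have "v = s + \<delta>" by (auto simp: v_def)
    then show ?thesis using uv R by (intro far) auto
  qed (use \<delta> in auto)
  moreover have "cmod (?I u v) \<le> 2 * \<delta>"
    using near[of u v] uv by (auto simp: u_def v_def)
  ultimately show ?thesis
    using norm_triangle_ineq[of "?I c u + ?I u v" "?I v d"] norm_triangle_ineq[of "?I c u" "?I u v"]
    by (simp add: \<delta>_def)
qed

end

section \<open>Integrals with a power singularity at the origin\<close>

lemma set_integrable_powr_bound:
  fixes f :: "real \<Rightarrow> complex"
  assumes f: "continuous_on {0<..R} f" and e: "-1 < e"
    and b: "\<And>x. 0 < x \<Longrightarrow> x \<le> R \<Longrightarrow> cmod (f x) \<le> K * x powr e"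
  shows "set_integrable lborel {0<..R} f"
proof -
  have i: "set_integrable lborel {0<..R} (\<lambda>x. x powr e)" if "0 \<le> R"
  proof -
    have "(\<lambda>x. x powr e) absolutely_integrable_on {0..R}"
      by (rule nonnegative_absolutely_integrable_1[OF integrable_on_powr_from_0[OF e that]]) auto
    then have "set_integrable lebesgue {0<..R} (\<lambda>x. x powr e)"
      by (rule set_integrable_subset) auto
    then show ?thesis
      unfolding set_integrable_def
      by (subst (asm) integrable_completion) auto
  qed
  show ?thesis
  proof (cases "0 \<le> R")
    case True
    show ?thesis
    proof (rule set_integrable_bound[OF set_integrable_mult_right[OF i[OF True], of K]])
      show "set_borel_measurable lborel {0<..R} f"
        unfolding set_borel_measurable_def
        using borel_measurable_continuous_on_indicator[OF _ f] by simp
      show "AE x in lborel. x \<in> {0<..R} \<longrightarrow> cmod (f x) \<le> norm (K * x powr e)"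
        using b by (force intro!: AE_I2)
    qed
  qed (auto simp: set_integrable_def)
qed

lemma absolutely_integrable_powr_bound:
  fixes f :: "real \<Rightarrow> complex"
  assumes f: "continuous_on {0<..R} f" and e: "-1 < e"
    and b: "\<And>x. 0 < x \<Longrightarrow> x \<le> R \<Longrightarrow> cmod (f x) \<le> K * x powr e"
  shows "f absolutely_integrable_on {0..R}"
proof -
  have "set_integrable lborel {0<..R} f" using set_integrable_powr_bound[OF f e b] .
  then have "f absolutely_integrable_on {0<..R}"
    unfolding set_integrable_def by (auto intro: integrable_completion[THEN iffD2] borel_measurable_integrable)
  moreover have "negligible ({0..R} - {0<..R})"
    by (rule negligible_subset[of "{0}"]) auto
  moreover have "{0<..R} - {0..R} = {}" by auto
  ultimately show ?thesis
    by (intro absolutely_integrable_spike_set[of "{0<..R}" f "{0..R}"]) (auto elim!: negligible_subset)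
qed

lemma norm_integral_powr_le:
  fixes f :: "real \<Rightarrow> complex"
  assumes f: "f integrable_on {c..d}" and cd: "0 \<le> c" "c \<le> d" "d \<le> R" and e: "-1 < e"
    and b: "\<And>x. 0 < x \<Longrightarrow> x \<le> R \<Longrightarrow> cmod (f x) \<le> K * x powr e" and K: "0 \<le> K"
  shows "cmod (integral {c..d} f) \<le> K * R powr (e + 1) / (e + 1)"
proof -
  \<comment> \<open>The hypothesis leaves \<open>f 0\<close> free while \<open>0 powr e\<close> is
    0, so the majorant may fail at that single point; there the function is reset.\<close>
  define f' where "f' = (\<lambda>x. if x = 0 then 0 else f x)"
  have f'i: "f' integrable_on {c..d}"
    by (rule integrable_spike[OF f, of "{0}"]) (auto simp: f'_def)
  have eq: "integral {c..d} f = integral {c..d} f'"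
    by (rule integral_spike[of "{0}"]) (auto simp: f'_def)
  have g: "((\<lambda>x. x powr e) has_integral (R powr (e+1) / (e+1))) {0..R}"
    using has_integral_powr_from_0[OF e, of R] cd by simp
  have gi: "(\<lambda>x. x powr e) integrable_on {c..d}"
    by (rule integrable_on_subinterval[OF has_integral_integrable[OF g]]) (use cd in auto)
  have "cmod (integral {c..d} f') \<le> integral {c..d} (\<lambda>x. K * x powr e)"
    by (rule integral_norm_bound_integral[OF f'i]) (use integrable_on_mult_right[OF gi] b cd K in \<open>auto simp: f'_def\<close>)
  also have "\<dots> \<le> integral {0..R} (\<lambda>x. K * x powr e)"
    by (rule integral_subset_le) (use integrable_on_mult_right[OF gi] integrable_on_mult_right[OF has_integral_integrable[OF g]] cd K in auto)
  also have "\<dots> = K * R powr (e + 1) / (e + 1)" using integral_unique[OF g] by simp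
  finally show ?thesis by (simp add: eq)
qed

section \<open>Power weights and amplitudes\<close>

context gkdv begin

text \<open>The weight is differentiated and the remaining integral \<open>T c\<close> of
  \<open>cis (phase y)\<close> over \<open>{c..\<xi>}\<close> is its partner. The tail is used
  because it decays in c, by \<open>phase_integral_bound\<close>, so that the weight loses a power.
  The interval \<open>{0..1}\<close> contributes at most 1 and \<open>T 1\<close> at most 6, whence
  the 7.\<close>

lemma phase_powr_integral_bound:
  assumes "1 \<le> \<xi>"
  shows "cmod (integral {0..\<xi>} (\<lambda>\<eta>. cis (phase y \<eta>) * of_real (\<eta> powr gam)))
    \<le> (7 + 6 * gam / (gam - rho)) * \<xi> powr (gam - rho)"
proof -
  let ?f = "\<lambda>\<eta>. cis (phase y \<eta>) * of_real (\<eta> powr gam)"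
  have gr: "gam - rho > 0" using rho_lt_gam by simp
  have fc: "continuous_on {0..} ?f"
    using gam_pos by (intro continuous_intros phase_cont continuous_on_powr') auto
  have fi: "?f integrable_on {u..v}" if "0 \<le> u" for u v
    by (intro integrable_continuous_interval continuous_on_subset[OF fc]) (use that in auto)
  define T where "T = (\<lambda>c. integral {1..\<xi>} (\<lambda>\<eta>. cis (phase y \<eta>)) - integral {1..c} (\<lambda>\<eta>. cis (phase y \<eta>)))"
  have ci: "(\<lambda>\<eta>. cis (phase y \<eta>)) integrable_on {u..v}" if "0 \<le> u" for u v
    by (intro integrable_continuous_interval phase_cont) (use that in auto)
  have T: "cmod (T c) \<le> 6 * c powr (- mu)" if "c \<in> {1..\<xi>}" for c
  proof -
    have "T c = integral {c..\<xi>} (\<lambda>\<eta>. cis (phase y \<eta>))"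
      unfolding T_def using that by (subst Henstock_Kurzweil_Integration.integral_combine[symmetric, of 1 c]) (auto intro: ci)
    then show ?thesis using phase_integral_bound[of c \<xi> y] that by simp
  qed
  have Td: "(T has_vector_derivative (- cis (phase y c))) (at c within {1..\<xi>})" if "c \<in> {1..\<xi>}" for c
  proof -
    have "((\<lambda>c. integral {1..c} (\<lambda>\<eta>. cis (phase y \<eta>))) has_vector_derivative cis (phase y c)) (at c within {1..\<xi>})"
      by (rule integral_has_vector_derivative[OF phase_cont]) (use that in auto)
    from has_vector_derivative_diff[OF has_vector_derivative_const this] show ?thesis
      unfolding T_def by simp
  qed
  have Tc: "continuous_on {1..\<xi>} T"
    unfolding continuous_on_eq_continuous_within using Td has_vector_derivative_continuous by blast
  have "((\<lambda>c. of_real (c powr gam) * (- cis (phase y c)) + of_real (gam * c powr (gam - 1)) * T c) has_integral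
     (of_real (\<xi> powr gam) * T \<xi> - of_real (1 powr gam) * T 1)) {1..\<xi>}"
  proof (rule fundamental_theorem_of_calculus[OF assms])
    fix c assume c: "c \<in> {1..\<xi>}"
    have "((\<lambda>c. c powr gam) has_real_derivative (gam * c powr (gam - 1))) (at c within {1..\<xi>})"
      by (rule DERIV_subset[OF _ subset_UNIV]) (use c in \<open>auto intro!: derivative_eq_intros\<close>)
    then show "((\<lambda>c. of_real (c powr gam) * T c) has_vector_derivative
       (of_real (c powr gam) * (- cis (phase y c)) + of_real (gam * c powr (gam - 1)) * T c)) (at c within {1..\<xi>})"
      by (rule has_vector_derivative_mult[OF has_vector_derivative_of_real Td[OF c]])
  qed
  then have 1: "((\<lambda>c. - ?f c + of_real (gam * c powr (gam - 1)) * T c) has_integral (- T 1)) {1..\<xi>}"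
    by (simp add: T_def mult.commute)
  have Ei: "(\<lambda>c. of_real (gam * c powr (gam - 1)) * T c) integrable_on {1..\<xi>}"
    by (intro integrable_continuous_interval continuous_intros Tc) auto
  have "- T 1 = - integral {1..\<xi>} ?f + integral {1..\<xi>} (\<lambda>c. of_real (gam * c powr (gam - 1)) * T c)"
    by (rule has_integral_unique[OF 1 has_integral_add[OF has_integral_neg[OF integrable_integral[OF fi]] integrable_integral[OF Ei]]]) simp
  then have eq: "integral {1..\<xi>} ?f = T 1 + integral {1..\<xi>} (\<lambda>c. of_real (gam * c powr (gam - 1)) * T c)"
    by (simp add: algebra_simps)
  have Gi: "((\<lambda>c. 6 * gam * c powr (gam - rho - 1)) has_integral
     (6 * gam / (gam - rho) * \<xi> powr (gam - rho) - 6 * gam / (gam - rho) * 1 powr (gam - rho))) {1..\<xi>}"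
  proof (rule fundamental_theorem_of_calculus[OF assms])
    fix c assume c: "c \<in> {1..\<xi>}"
    have "((\<lambda>c. 6 * gam / (gam - rho) * c powr (gam - rho)) has_real_derivative (6 * gam * c powr (gam - rho - 1))) (at c within {1..\<xi>})"
      by (rule DERIV_subset[OF _ subset_UNIV]) (use c gr in \<open>auto intro!: derivative_eq_intros\<close>)
    then show "((\<lambda>c. 6 * gam / (gam - rho) * c powr (gam - rho)) has_vector_derivative (6 * gam * c powr (gam - rho - 1))) (at c within {1..\<xi>})"
      by (simp add: has_real_derivative_iff_has_vector_derivative)
  qed
  have "cmod (integral {1..\<xi>} (\<lambda>c. of_real (gam * c powr (gam - 1)) * T c)) \<le> integral {1..\<xi>} (\<lambda>c. 6 * gam * c powr (gam - rho - 1))"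
  proof (rule integral_norm_bound_integral[OF Ei has_integral_integrable[OF Gi]])
    fix c assume c: "c \<in> {1..\<xi>}"
    have "cmod (of_real (gam * c powr (gam - 1)) * T c) \<le> gam * c powr (gam - 1) * (6 * c powr (- mu))"
      using T[OF c] gam_pos by (simp add: norm_mult mult_left_mono)
    \<comment> \<open>The full gain \<open>mu\<close> may exceed \<open>gam\<close> (for \<alpha> =
      2, p = 3 they are 1/2 and 1/3); with \<open>rho\<close> the exponent of the primitive is
      positive.\<close>
    also have "\<dots> \<le> gam * c powr (gam - 1) * (6 * c powr (- rho))"
      using gam_pos c rho_le_mu by (intro mult_left_mono powr_mono) auto
    also have "\<dots> = 6 * gam * c powr (gam - rho - 1)"
      by (simp add: algebra_simps flip: powr_add)
    finally show "cmod (of_real (gam * c powr (gam - 1)) * T c) \<le> 6 * gam * c powr (gam - rho - 1)" .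
  qed
  also have "\<dots> \<le> 6 * gam / (gam - rho) * \<xi> powr (gam - rho)"
    using integral_unique[OF Gi] gr gam_pos by simp
  finally have 1: "cmod (integral {1..\<xi>} ?f) \<le> 6 + 6 * gam / (gam - rho) * \<xi> powr (gam - rho)"
    using T[of 1] assms eq norm_triangle_ineq[of "T 1" "integral {1..\<xi>} (\<lambda>c. of_real (gam * c powr (gam - 1)) * T c)"]
    by simp
  have 2: "cmod (integral {0..1} ?f) \<le> 1"
    
  proof -
    have "1 / (gam + 1) \<le> 1" using gam_pos by simp
    moreover have "cmod (integral {0..1} ?f) \<le> 1 * 1 powr (gam + 1) / (gam + 1)"
      by (rule norm_integral_powr_le[OF fi]) (use gam_pos in \<open>auto simp: norm_mult\<close>)
    ultimately show ?thesis by simp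
  qed
  have "integral {0..\<xi>} ?f = integral {0..1} ?f + integral {1..\<xi>} ?f"
    using assms by (subst Henstock_Kurzweil_Integration.integral_combine) (auto intro: fi)
  then have "cmod (integral {0..\<xi>} ?f) \<le> 7 + 6 * gam / (gam - rho) * \<xi> powr (gam - rho)"
    using 1 2 norm_triangle_ineq[of "integral {0..1} ?f" "integral {1..\<xi>} ?f"] by simp
  also have "7 \<le> 7 * \<xi> powr (gam - rho)" using assms gr by (simp add: ge_one_powr_ge_zero)
  finally show ?thesis by (simp add: algebra_simps)
qed

text \<open>Amplitudes \<open>a\<close> with derivative \<open>a'\<close>. The exponent \<open>rho\<close> is the smallest one for which the
  contribution of the stationary point, which lies near \<open>\<xi> = x powr (1 / \<alpha>)\<close> and has width \<open>\<xi> powr (- mu)\<close>, is of order \<open>x powr (- 1 / p)\<close>.\<close>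

definition amplitude :: "real \<Rightarrow> (real \<Rightarrow> complex) \<Rightarrow> (real \<Rightarrow> complex) \<Rightarrow> bool" where
  "amplitude K a a' \<longleftrightarrow> continuous_on {0<..} a' \<and> (\<forall>\<xi>>0. (a has_vector_derivative a' \<xi>) (at \<xi>)) \<and>
    (\<forall>\<xi>. 0 < \<xi> \<and> \<xi> \<le> 1 \<longrightarrow> cmod (a \<xi>) \<le> K * \<xi> powr (- gam) \<and> cmod (a' \<xi>) \<le> K * \<xi> powr (- gam - 1)) \<and>
    (\<forall>\<xi>\<ge>1. cmod (a \<xi>) \<le> K * \<xi> powr (- rho) \<and> cmod (a' \<xi>) \<le> K)"

lemma amplitudeD:
  assumes "amplitude K a a'"
  shows "continuous_on {0<..} a'" "0 < \<xi> \<Longrightarrow> (a has_vector_derivative a' \<xi>) (at \<xi>)"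
    "0 < \<xi> \<Longrightarrow> \<xi> \<le> 1 \<Longrightarrow> cmod (a \<xi>) \<le> K * \<xi> powr (- gam)"
    "0 < \<xi> \<Longrightarrow> \<xi> \<le> 1 \<Longrightarrow> cmod (a' \<xi>) \<le> K * \<xi> powr (- gam - 1)"
    "1 \<le> \<xi> \<Longrightarrow> cmod (a \<xi>) \<le> K * \<xi> powr (- rho)" "1 \<le> \<xi> \<Longrightarrow> cmod (a' \<xi>) \<le> K"
  using assms unfolding amplitude_def by blast+

lemma amplitude_K: "amplitude K a a' \<Longrightarrow> 0 \<le> K"
  using amplitudeD(6)[of K a a' 1] order_trans[OF norm_ge_zero] by auto

lemma amplitude_le: 
  assumes a: "amplitude K a a'" "1 \<le> \<xi>" shows "cmod (a \<xi>) \<le> K"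
proof -
  have "\<xi> powr (- rho) \<le> 1 powr (- rho)" using a rho_ge by (intro powr_mono2') auto
  then have "K * \<xi> powr (- rho) \<le> K" using amplitude_K[OF a(1)] by (simp add: mult_left_le)
  then show ?thesis using amplitudeD(5)[OF a] by simp
qed

lemma amplitude_cont: "amplitude K a a' \<Longrightarrow> continuous_on {0<..} a"
  unfolding amplitude_def continuous_on_eq_continuous_at[OF open_greaterThan]
  by (auto intro: has_vector_derivative_continuous)

text \<open>A single majorant with the integrable singularity on all of \<open>{0<..R}\<close>. Its
  constant grows with \<open>R\<close>, so it serves integrability and continuity on bounded ranges,
  while decay comes from the finer bounds.\<close>

lemma amplitude_powr: 
  assumes a: "amplitude K a a'" and "0 < \<xi>" "\<xi> \<le> R"
  shows "cmod (a \<xi>) \<le> K * (max 1 R) powr gam * \<xi> powr (- gam)"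
proof (cases "\<xi> \<le> 1")
  case True
  have "K * 1 * \<xi> powr (- gam) \<le> K * max 1 R powr gam * \<xi> powr (- gam)"
    using amplitude_K[OF a] gam_pos by (intro mult_right_mono mult_left_mono ge_one_powr_ge_zero) auto
  then show ?thesis using amplitudeD(3)[OF a _ True] assms by simp
next
  case False
  have "1 \<le> (max 1 R / \<xi>) powr gam"
    using False assms gam_pos by (intro ge_one_powr_ge_zero) (auto simp: field_simps)
  also have "\<dots> = max 1 R powr gam * \<xi> powr (- gam)"
    using False assms powr_divide[of "max 1 R" \<xi> gam] by (simp add: powr_minus_divide)
  finally have "K * 1 \<le> K * (max 1 R powr gam * \<xi> powr (- gam))"
    using amplitude_K[OF a] by (intro mult_left_mono) auto
  then show ?thesis using amplitude_le[OF a, of \<xi>] False by simp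
qed

lemma phase_cont': "continuous_on {0<..} (\<lambda>\<xi>. cis (phase x \<xi>))"
  by (rule phase_cont) auto

lemma amplitude_abs_integrable:
  assumes a: "amplitude K a a'"
  shows "(\<lambda>\<xi>. cis (phase x \<xi>) * a \<xi>) absolutely_integrable_on {0..R}"
proof (rule absolutely_integrable_powr_bound[where e="- gam"])
  show "continuous_on {0<..R} (\<lambda>\<xi>. cis (phase x \<xi>) * a \<xi>)"
    by (intro continuous_intros continuous_on_subset[OF phase_cont'] continuous_on_subset[OF amplitude_cont[OF a]]) auto
qed (use amplitude_powr[OF a] gam_lt in \<open>auto simp: norm_mult\<close>)

lemma amplitude_integrable:
  assumes a: "amplitude K a a'" "0 \<le> c"
  shows "(\<lambda>\<xi>. cis (phase x \<xi>) * a \<xi>) integrable_on {c..d}"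
proof -
  have "(\<lambda>\<xi>. cis (phase x \<xi>) * a \<xi>) integrable_on {0..d}"
    using amplitude_abs_integrable[OF a(1)] absolutely_integrable_on_def by blast
  then show ?thesis by (rule integrable_on_subinterval) (use a in auto)
qed

section \<open>Bounds of oscillatory integrals, region by region\<close>

definition osc_bounded :: "real \<Rightarrow> (real \<Rightarrow> complex) \<Rightarrow> real \<Rightarrow> real \<Rightarrow> real \<Rightarrow> bool" where
  "osc_bounded x a l u B \<longleftrightarrow> (\<forall>c d. l \<le> c \<and> c \<le> d \<and> d \<le> u \<longrightarrow> cmod (integral {c..d} (\<lambda>\<xi>. cis (phase x \<xi>) * a \<xi>)) \<le> B)"

lemma osc_bounded_mono: "osc_bounded x a l u B \<Longrightarrow> B \<le> B' \<Longrightarrow> osc_bounded x a l u B'"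
  unfolding osc_bounded_def by (meson order_trans)

text \<open>A subinterval of \<open>{l..u}\<close> either lies on one side of \<open>m\<close> or is
  cut by it into one subinterval of each part. This is why \<open>osc_bounded\<close> quantifies
  over all subintervals: bounds on adjacent ranges then simply add, and the result holds for every
  truncation.\<close>

lemma osc_bounded_glue:
  assumes a: "amplitude K a a'" and 1: "osc_bounded x a l m B1" and 2: "osc_bounded x a m u B2" and l: "0 \<le> l" "l \<le> m" "m \<le> u"
  shows "osc_bounded x a l u (B1 + B2)"
  unfolding osc_bounded_def
proof safe
  let ?f = "\<lambda>\<xi>. cis (phase x \<xi>) * a \<xi>"
  fix c d assume cd: "l \<le> c" "c \<le> d" "d \<le> u"
  have "cmod (integral {l..l} ?f) \<le> B1" "cmod (integral {m..m} ?f) \<le> B2"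
    using 1 2 l unfolding osc_bounded_def by blast+
  then have B: "0 \<le> B1" "0 \<le> B2" by auto
  consider "d \<le> m" | "m \<le> c" | "c \<le> m" "m \<le> d" by linarith
  then show "cmod (integral {c..d} ?f) \<le> B1 + B2"
  proof cases
    case 3
    have "integral {c..d} ?f = integral {c..m} ?f + integral {m..d} ?f"
      using 3 cd l by (subst Henstock_Kurzweil_Integration.integral_combine) (auto intro: amplitude_integrable[OF a])
    moreover have "cmod (integral {c..m} ?f) \<le> B1" using 1 3 cd unfolding osc_bounded_def by auto
    moreover have "cmod (integral {m..d} ?f) \<le> B2" using 2 3 cd unfolding osc_bounded_def by auto
    ultimately show ?thesis by (smt (verit) norm_triangle_ineq)
  next
    case 1 then have "cmod (integral {c..d} ?f) \<le> B1" using \<open>osc_bounded x a l m B1\<close> cd unfolding osc_bounded_def by auto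
    then show ?thesis using B by simp
  next
    case 2 then have "cmod (integral {c..d} ?f) \<le> B2" using \<open>osc_bounded x a m u B2\<close> cd unfolding osc_bounded_def by auto
    then show ?thesis using B by simp
  qed
qed

text \<open>With 0 \<le> G \<le> B the increment of \<open>G\<close> over any subinterval is at most
  \<open>B\<close>, which makes \<open>phase_bound\<close> uniform over subintervals.\<close>

lemma osc_bounded_piece:
  assumes a: "amplitude K a a'" "0 < l"
    and m: "0 < m" "\<And>\<xi>. \<lbrakk>l \<le> \<xi>; \<xi> \<le> u\<rbrakk> \<Longrightarrow> m \<le> \<bar>dphase x \<xi>\<bar>"
    and A: "\<And>\<xi>. \<lbrakk>l \<le> \<xi>; \<xi> \<le> u\<rbrakk> \<Longrightarrow> cmod (a \<xi>) \<le> A"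
    and G: "\<And>\<xi>. \<lbrakk>l \<le> \<xi>; \<xi> \<le> u\<rbrakk> \<Longrightarrow> (G has_real_derivative G' \<xi>) (at \<xi>)"
    and G': "\<And>\<xi>. \<lbrakk>l \<le> \<xi>; \<xi> \<le> u\<rbrakk> \<Longrightarrow> cmod (a' \<xi>) \<le> G' \<xi> * \<bar>dphase x \<xi>\<bar>"
    and B: "\<And>\<xi>. \<lbrakk>l \<le> \<xi>; \<xi> \<le> u\<rbrakk> \<Longrightarrow> 0 \<le> G \<xi> \<and> G \<xi> \<le> B"
  shows "osc_bounded x a l u (4 * A / m + B)"
  unfolding osc_bounded_def
proof safe
  fix c d assume cd: "l \<le> c" "c \<le> d" "d \<le> u"
  have "cmod (integral {c..d} (\<lambda>\<xi>. cis (phase x \<xi>) * a \<xi>)) \<le> 4 * A / m + (G d - G c)"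
  proof (rule phase_bound[where a'=a' and G'=G'])
    show "continuous_on {c..d} a'" using cd \<open>0 < l\<close> by (intro continuous_on_subset[OF amplitudeD(1)[OF a(1)]]) auto
    show "(a has_vector_derivative a' \<xi>) (at \<xi> within {c..d})" if "\<xi> \<in> {c..d}" for \<xi>
      by (rule has_vector_derivative_at_within[OF amplitudeD(2)[OF a(1)]]) (use that cd \<open>0 < l\<close> in auto)
    show "(G has_real_derivative G' \<xi>) (at \<xi> within {c..d})" if "\<xi> \<in> {c..d}" for \<xi>
      by (rule has_field_derivative_at_within[OF G]) (use that cd in auto)
    show "cmod (a \<xi>) \<le> A" if "\<xi> \<in> {c..d}" for \<xi> by (rule A) (use that cd in auto)
    show "cmod (a' \<xi>) \<le> G' \<xi> * \<bar>dphase x \<xi>\<bar>" if "\<xi> \<in> {c..d}" for \<xi> by (rule G') (use that cd in auto)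
    show "m \<le> \<bar>dphase x \<xi>\<bar>" if "\<xi> \<in> {c..d}" for \<xi> by (rule m) (use that cd in auto)
  qed (use cd a m in auto)
  then show "cmod (integral {c..d} (\<lambda>\<xi>. cis (phase x \<xi>) * a \<xi>)) \<le> 4 * A / m + B"
    using B[of c] B[of d] cd by linarith
qed

lemma osc_bounded_trivial:
  assumes a: "amplitude K a a'" "0 \<le> l" "l \<le> u" and A: "\<And>\<xi>. \<lbrakk>l \<le> \<xi>; \<xi> \<le> u\<rbrakk> \<Longrightarrow> cmod (a \<xi>) \<le> A"
  shows "osc_bounded x a l u (A * (u - l))"
  unfolding osc_bounded_def
proof safe
  fix c d assume cd: "l \<le> c" "c \<le> d" "d \<le> u"
  have A0: "0 \<le> A" using A[of l] a order_trans[OF norm_ge_zero] by auto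
  have "cmod (integral {c..d} (\<lambda>\<xi>. cis (phase x \<xi>) * a \<xi>)) \<le> integral {c..d} (\<lambda>\<xi>. A)"
    by (rule integral_norm_bound_integral) (use a cd A in \<open>auto simp: norm_mult intro: amplitude_integrable\<close>)
  also have "\<dots> \<le> A * (u - l)" using cd A0 by (simp add: mult.commute mult_left_mono)
  finally show "cmod (integral {c..d} (\<lambda>\<xi>. cis (phase x \<xi>) * a \<xi>)) \<le> A * (u - l)" .
qed


lemma powr_neg_le_one: "1 \<le> (x::real) \<Longrightarrow> e \<le> 0 \<Longrightarrow> x powr e \<le> 1"
  using powr_mono[of e 0 x] by simp

text \<open>Supplies \<open>G\<close> for majorants of the form
  \<open>C * \<xi> powr (- e - 1)\<close>. With \<open>B\<close> the value of
  \<open>\<xi> powr (- e)\<close> at the left end, \<open>G\<close> starts at 0 and stays below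
  \<open>C / e * B\<close>.\<close>

lemma powr_primitive:
  assumes "0 < \<xi>" "e \<noteq> 0"
  shows "((\<lambda>\<xi>. C / e * (B - \<xi> powr (- e))) has_real_derivative C * \<xi> powr (- e - 1)) (at \<xi>)"
  using assms by (auto intro!: derivative_eq_intros)

lemma scaled_diff_bounds:
  "0 \<le> (C::real) \<Longrightarrow> 0 < e \<Longrightarrow> 0 \<le> t \<Longrightarrow> t \<le> B \<Longrightarrow> 0 \<le> C / e * (B - t) \<and> C / e * (B - t) \<le> C / e * B"
  by (intro conjI mult_nonneg_nonneg mult_left_mono) auto

text \<open>The bounded derivative of \<open>a\<close>, divided by |dphase| \<ge>
  \<open>\<xi> powr \<alpha>\<close>, is integrable at infinity because \<alpha> > 1; its primitive
  from \<open>Z\<close> on is of size \<open>Z powr (1 - \<alpha>)\<close>, and the boundary terms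
  are smaller.\<close>

lemma osc_bounded_tail:
  assumes a: "amplitude K a a'" and Z: "1 \<le> Z" and ph: "\<And>\<xi>. Z \<le> \<xi> \<Longrightarrow> \<xi> powr \<alpha> \<le> \<bar>dphase x \<xi>\<bar>"
  shows "osc_bounded x a Z u (K * (4 + 1 / (\<alpha> - 1)) * Z powr (1 - \<alpha>))"
proof -
  note K = amplitude_K[OF a]
  define G where "G = (\<lambda>\<xi>. K / (\<alpha> - 1) * (Z powr (1 - \<alpha>) - \<xi> powr (- (\<alpha> - 1))))"
  have "osc_bounded x a Z u (4 * K / Z powr \<alpha> + K / (\<alpha> - 1) * Z powr (1 - \<alpha>))"
  proof (rule osc_bounded_piece[OF a, where G=G and G'="\<lambda>\<xi>. K * \<xi> powr (- (\<alpha> - 1) - 1)"])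
    fix \<xi> assume \<xi>: "Z \<le> \<xi>" "\<xi> \<le> u"
    show "Z powr \<alpha> \<le> \<bar>dphase x \<xi>\<bar>"
      by (rule order_trans[OF powr_mono2 ph[OF \<xi>(1)]]) (use Z \<xi> alpha_gt in auto)
    show "cmod (a \<xi>) \<le> K" using amplitude_le[OF a] \<xi> Z by simp
    show "(G has_real_derivative K * \<xi> powr (- (\<alpha> - 1) - 1)) (at \<xi>)"
      unfolding G_def by (rule powr_primitive) (use \<xi> Z alpha_gt in auto)
    have "cmod (a' \<xi>) \<le> K" using amplitudeD(6)[OF a] \<xi> Z by simp
    also have "K = K * \<xi> powr (- (\<alpha> - 1) - 1) * \<xi> powr \<alpha>" using \<xi> Z by (simp add: mult.assoc flip: powr_add)
    also have "\<dots> \<le> K * \<xi> powr (- (\<alpha> - 1) - 1) * \<bar>dphase x \<xi>\<bar>" using ph \<xi> K by (intro mult_left_mono) auto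
    finally show "cmod (a' \<xi>) \<le> K * \<xi> powr (- (\<alpha> - 1) - 1) * \<bar>dphase x \<xi>\<bar>" .
    have "\<xi> powr (- (\<alpha> - 1)) \<le> Z powr (- (\<alpha> - 1))" using \<xi> Z alpha_gt by (intro powr_mono2') auto
    then show "0 \<le> G \<xi> \<and> G \<xi> \<le> K / (\<alpha> - 1) * Z powr (1 - \<alpha>)"
      unfolding G_def using K alpha_gt by (intro scaled_diff_bounds) auto
  qed (use Z in auto)
  then show ?thesis
  proof (rule osc_bounded_mono)
    have "1 / Z powr \<alpha> \<le> Z powr (1 - \<alpha>)"
      using powr_mono[of "- \<alpha>" "1 - \<alpha>" Z] Z by (simp add: powr_minus_divide)
    then have "4 * K * (1 / Z powr \<alpha>) \<le> 4 * K * Z powr (1 - \<alpha>)" using K by (intro mult_left_mono) auto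
    then show "4 * K / Z powr \<alpha> + K / (\<alpha> - 1) * Z powr (1 - \<alpha>) \<le> K * (4 + 1 / (\<alpha> - 1)) * Z powr (1 - \<alpha>)"
      by (simp add: algebra_simps)
  qed
qed

lemma osc_bounded_origin_trivial:
  assumes a: "amplitude K a a'" and r: "0 \<le> r" "r \<le> 1"
  shows "osc_bounded x a 0 r (K * r powr sg / sg)"
  unfolding osc_bounded_def
proof safe
  fix c d :: real assume "0 \<le> c" "c \<le> d" "d \<le> r"
  then have "cmod (integral {c..d} (\<lambda>\<xi>. cis (phase x \<xi>) * a \<xi>)) \<le> K * r powr (- gam + 1) / (- gam + 1)"
    using r gam_lt amplitude_K[OF a] by (intro norm_integral_powr_le amplitude_integrable[OF a]) (auto simp: norm_mult amplitudeD(3)[OF a])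
  then show "cmod (integral {c..d} (\<lambda>\<xi>. cis (phase x \<xi>) * a \<xi>)) \<le> K * r powr sg / sg"
    by (simp add: gam_def)
qed

text \<open>The range is split at 1 / y, the scale on which a phase of slope y performs one
  oscillation. Below it the integral of \<open>\<xi> powr (- gam)\<close> is of size
  \<open>y powr (- sg)\<close>; above it the boundary terms \<open>y powr gam / y\<close> and the
  primitive of \<open>\<xi> powr (- gam - 1) / y\<close> have the same size.\<close>

lemma osc_bounded_origin:
  assumes a: "amplitude K a a'" and y: "1 \<le> y" and ph: "\<And>\<xi>. 0 < \<xi> \<Longrightarrow> \<xi> \<le> 1 \<Longrightarrow> y / 2 \<le> \<bar>dphase x \<xi>\<bar>"
  shows "osc_bounded x a 0 1 ((1 / sg + 8 + 2 / gam) * K * y powr (- sg))"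
proof -
  note K = amplitude_K[OF a]
  have 1: "osc_bounded x a 0 (1/y) (K * (1/y) powr sg / sg)" using y by (intro osc_bounded_origin_trivial[OF a]) auto
  define G where "G = (\<lambda>\<xi>. 2 * K / y / gam * (y powr gam - \<xi> powr (- gam)))"
  have 2: "osc_bounded x a (1/y) 1 (4 * (K * y powr gam) / (y / 2) + 2 * K / y / gam * y powr gam)"
  proof (rule osc_bounded_piece[OF a, where G=G and G'="\<lambda>\<xi>. 2 * K / y * \<xi> powr (- gam - 1)"])
    fix \<xi> assume \<xi>: "1 / y \<le> \<xi>" "\<xi> \<le> 1"
    have \<xi>0: "0 < \<xi>" using \<xi> y by (meson less_le_trans zero_less_divide_1_iff zero_less_one)
    show "y / 2 \<le> \<bar>dphase x \<xi>\<bar>" using ph \<xi> \<xi>0 by auto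
    have py: "\<xi> powr (- gam) \<le> y powr gam"
    proof -
      have "\<xi> powr (- gam) \<le> (1 / y) powr (- gam)" using \<xi> \<xi>0 y gam_pos by (intro powr_mono2') auto
      also have "\<dots> = y powr gam" using y by (simp add: powr_minus powr_divide)
      finally show ?thesis .
    qed
    have "cmod (a \<xi>) \<le> K * \<xi> powr (- gam)" using amplitudeD(3)[OF a] \<xi> \<xi>0 by simp
    also have "\<dots> \<le> K * y powr gam" using K py by (intro mult_left_mono)
    finally show "cmod (a \<xi>) \<le> K * y powr gam" .
    show "(G has_real_derivative 2 * K / y * \<xi> powr (- gam - 1)) (at \<xi>)"
      unfolding G_def by (rule powr_primitive) (use \<xi>0 gam_pos in auto)
    have "cmod (a' \<xi>) \<le> 2 * K / y * \<xi> powr (- gam - 1) * (y / 2)" using amplitudeD(4)[OF a] \<xi> \<xi>0 y by simp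
    also have "\<dots> \<le> 2 * K / y * \<xi> powr (- gam - 1) * \<bar>dphase x \<xi>\<bar>"
      using ph \<xi> \<xi>0 K y by (intro mult_left_mono) auto
    finally show "cmod (a' \<xi>) \<le> 2 * K / y * \<xi> powr (- gam - 1) * \<bar>dphase x \<xi>\<bar>" .
    show "0 \<le> G \<xi> \<and> G \<xi> \<le> 2 * K / y / gam * y powr gam"
      unfolding G_def using K y gam_pos py by (intro scaled_diff_bounds) auto
  qed (use y in auto)
  have "osc_bounded x a 0 1 (K * (1/y) powr sg / sg + (4 * (K * y powr gam) / (y / 2) + 2 * K / y / gam * y powr gam))"
    by (rule osc_bounded_glue[OF a 1 2]) (use y in auto)
  moreover have "y powr gam = y * y powr (- sg)" using y by (simp add: powr_mult_base gam_def)
  moreover have "(1/y) powr sg = y powr (- sg)" using y by (simp add: powr_minus_divide powr_divide)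
  ultimately show ?thesis using y by (simp add: field_simps)
qed

text \<open>There is no stationary point: |dphase| is at least y +
  \<open>\<xi> powr \<alpha>\<close> with y = -x. Beyond 1 the derivative of \<open>a\<close> is
  only bounded, and y alone would leave a divergent integral. A geometric mean of the two terms
  keeps \<open>y powr (1 / p)\<close> as a factor and leaves
  \<open>\<xi> powr (- (\<alpha> - sg))\<close>, integrable by \<open>sg_lt\<close>.\<close>

lemma osc_bounded_negative:
  assumes a: "amplitude K a a'" and x: "x \<le> - 1" and u: "1 \<le> u"
  shows "osc_bounded x a 0 u ((1 / sg + 12 + 2 / gam + 1 / (\<alpha> - sg - 1)) * K * (- x) powr (- (1 / real p)))"
proof -
  note K = amplitude_K[OF a]
  define y where "y = - x"
  have y: "1 \<le> y" using x by (simp add: y_def)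
  have e: "\<alpha> - sg - 1 > 0" using sg_lt by simp
  have ph: "y + \<xi> powr \<alpha> \<le> \<bar>dphase x \<xi>\<bar>" if "0 < \<xi>" for \<xi>
  proof -
    have "1 * \<xi> powr \<alpha> \<le> (\<alpha> + 1) * \<xi> powr \<alpha>" using alpha_gt by (intro mult_right_mono) auto
    then show ?thesis using y by (auto simp: dphase_def y_def)
  qed
  have 1: "osc_bounded x a 0 1 ((1 / sg + 8 + 2 / gam) * K * y powr (- sg))"
  proof (rule osc_bounded_origin[OF a y])
    fix \<xi> :: real assume "0 < \<xi>" "\<xi> \<le> 1"
    then show "y / 2 \<le> \<bar>dphase x \<xi>\<bar>" using ph[of \<xi>] y powr_ge_zero[of \<xi> \<alpha>] by linarith
  qed
  \<comment> \<open>Young's inequality with weights 1 / p and 1 - 1 / p, where \<alpha> * (1 - 1 /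
    p) = \<alpha> - sg. Replacing both terms by their maximum suffices.\<close>
  have young: "y powr (1 / real p) * \<xi> powr (\<alpha> - sg) \<le> y + \<xi> powr \<alpha>" if "0 < \<xi>" for \<xi>
  proof -
    define m where "m = max y (\<xi> powr \<alpha>)"
    have pp: "1 / real p \<le> 1" "0 \<le> 1 / real p" using p_pos by auto
    have m: "0 < m" using y by (simp add: m_def)
    have "\<xi> powr (\<alpha> - sg) = (\<xi> powr \<alpha>) powr (1 - 1 / real p)"
      by (simp add: powr_powr sg_alpha right_diff_distrib)
    then have "y powr (1 / real p) * \<xi> powr (\<alpha> - sg) \<le> m powr (1 / real p) * m powr (1 - 1 / real p)"
      using y pp by (auto intro!: mult_mono powr_mono2 simp: m_def)
    also have "\<dots> = m" using m by (simp flip: powr_add)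
    also have "\<dots> \<le> y + \<xi> powr \<alpha>" using y by (simp add: m_def)
    finally show ?thesis .
  qed
  define yp where "yp = y powr (- (1 / real p))"
  define G where "G = (\<lambda>\<xi>. K * yp / (\<alpha> - sg - 1) * (1 - \<xi> powr (- (\<alpha> - sg - 1))))"
  have 2: "osc_bounded x a 1 u (4 * K / y + K * yp / (\<alpha> - sg - 1))"
  proof (rule osc_bounded_piece[OF a, where G=G and G'="\<lambda>\<xi>. K * yp * \<xi> powr (- (\<alpha> - sg - 1) - 1)"])
    fix \<xi> assume \<xi>: "1 \<le> \<xi>" "\<xi> \<le> u"
    show "y \<le> \<bar>dphase x \<xi>\<bar>" using ph[of \<xi>] \<xi> powr_ge_zero[of \<xi> \<alpha>] by linarith
    show "cmod (a \<xi>) \<le> K" using amplitude_le[OF a] \<xi> by simp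
    show "(G has_real_derivative K * yp * \<xi> powr (- (\<alpha> - sg - 1) - 1)) (at \<xi>)"
      unfolding G_def by (rule powr_primitive) (use \<xi> e in auto)
    have "cmod (a' \<xi>) \<le> K" using amplitudeD(6)[OF a] \<xi> by simp
    also have "K = K * (yp * \<xi> powr (- (\<alpha> - sg - 1) - 1) * (y powr (1 / real p) * \<xi> powr (\<alpha> - sg)))"
    proof -
      have "yp * y powr (1 / real p) = 1" using y by (simp add: yp_def flip: powr_add)
      moreover have "\<xi> powr (- (\<alpha> - sg - 1) - 1) * \<xi> powr (\<alpha> - sg) = 1" using \<xi> by (simp flip: powr_add)
      ultimately have "(yp * y powr (1 / real p)) * (\<xi> powr (- (\<alpha> - sg - 1) - 1) * \<xi> powr (\<alpha> - sg)) = 1" by simp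
      then show ?thesis by (simp add: mult_ac)
    qed
    also have "\<dots> \<le> K * (yp * \<xi> powr (- (\<alpha> - sg - 1) - 1) * \<bar>dphase x \<xi>\<bar>)"
      using K \<xi> y order_trans[OF young ph, of \<xi>] by (intro mult_left_mono) (auto simp: yp_def)
    finally show "cmod (a' \<xi>) \<le> K * yp * \<xi> powr (- (\<alpha> - sg - 1) - 1) * \<bar>dphase x \<xi>\<bar>" by (simp add: mult.assoc)
    have "\<xi> powr (- (\<alpha> - sg - 1)) \<le> 1" using \<xi> e by (intro powr_neg_le_one) auto
    then have "0 \<le> G \<xi> \<and> G \<xi> \<le> K * yp / (\<alpha> - sg - 1) * 1"
      unfolding G_def using K e by (intro scaled_diff_bounds) (auto simp: yp_def)
    then show "0 \<le> G \<xi> \<and> G \<xi> \<le> K * yp / (\<alpha> - sg - 1)" by simp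
  qed (use y in auto)
  have "osc_bounded x a 0 u ((1 / sg + 8 + 2 / gam) * K * y powr (- sg) + (4 * K / y + K * yp / (\<alpha> - sg - 1)))"
    by (rule osc_bounded_glue[OF a 1 2]) (use u in auto)
  moreover have "(1 / sg + 8 + 2 / gam) * K * y powr (- sg) \<le> (1 / sg + 8 + 2 / gam) * K * yp"
    unfolding yp_def using K y sg_pos gam_pos inv_p_le_sg by (intro mult_left_mono powr_mono) auto
  moreover have "4 * K * (1 / y) \<le> 4 * K * yp"
    using K y p_pos powr_mono[of "-1" "- (1 / real p)" y] by (intro mult_left_mono) (auto simp: yp_def powr_minus_divide)
  ultimately show ?thesis
    unfolding y_def[symmetric] yp_def[symmetric] by (elim osc_bounded_mono) (simp add: algebra_simps)
qed

text \<open>For bounded x no decay has to be gained. The threshold is 12 = 4 * 3: for x \<ge> 12 one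
  has x / (\<alpha> + 1) \<ge> 4, so the stationary point is at least \<open>4 powr (1 / 2)\<close>
  = 2, as \<open>osc_bounded_positive\<close> requires.\<close>

lemma osc_bounded_near:
  assumes a: "amplitude K a a'" and x: "\<bar>x\<bar> \<le> 12" and u: "12 \<le> u"
  shows "osc_bounded x a 0 u ((1 / sg + 15 + 1 / (\<alpha> - 1)) * K)"
proof -
  note K = amplitude_K[OF a]
  have 1: "osc_bounded x a 0 1 (K * 1 powr sg / sg)" by (rule osc_bounded_origin_trivial[OF a]) auto
  have 2: "osc_bounded x a 1 12 (K * (12 - 1))" by (rule osc_bounded_trivial[OF a]) (use amplitude_le[OF a] in auto)
  have 3: "osc_bounded x a 12 u (K * (4 + 1 / (\<alpha> - 1)) * 12 powr (1 - \<alpha>))"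
  proof (rule osc_bounded_tail[OF a])
    fix \<xi> :: real assume \<xi>: "12 \<le> \<xi>"
    have "\<xi> powr 1 \<le> \<xi> powr \<alpha>" using \<xi> alpha_gt by (intro powr_mono) auto
    then have "12 \<le> \<xi> powr \<alpha>" using \<xi> by simp
    moreover have "2 * \<xi> powr \<alpha> \<le> (\<alpha> + 1) * \<xi> powr \<alpha>" using alpha_gt by (intro mult_right_mono) auto
    ultimately show "\<xi> powr \<alpha> \<le> \<bar>dphase x \<xi>\<bar>" using x by (auto simp: dphase_def)
  qed auto
  have "osc_bounded x a 0 u (K * 1 powr sg / sg + K * (12 - 1) + K * (4 + 1 / (\<alpha> - 1)) * 12 powr (1 - \<alpha>))"
    by (intro osc_bounded_glue[OF a osc_bounded_glue[OF a 1 2] 3]) (use u in auto)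
  moreover have "K * (4 + 1 / (\<alpha> - 1)) * 12 powr (1 - \<alpha>) \<le> K * (4 + 1 / (\<alpha> - 1))"
    using K alpha_gt by (intro mult_left_le powr_neg_le_one mult_nonneg_nonneg) auto
  ultimately show ?thesis by (elim osc_bounded_mono) (simp add: algebra_simps)
qed

text \<open>\<open>z\<close> is the stationary point, and \<open>z powr (- sg)\<close> is
  \<open>x powr (- 1 / p)\<close> up to a constant. The half-line is cut at 1, z / 2, z - \<delta>,
  z + \<delta> and 2 * z. The window of radius \<delta> costs \<open>z powr (- rho - mu)\<close>,
  admissible by the choice of \<open>rho\<close>. On the two pieces next to it |dphase| is at least
  2 * \<open>z powr (2 * mu)\<close> * |\<xi> - z|, so a bounded derivative of \<open>a\<close>
  produces logarithmic primitives; elsewhere the phase is monotone with a large slope.\<close>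

lemma osc_bounded_positive:
  assumes a: "amplitude K a a'" and z2: "2 \<le> z" and x: "x = (\<alpha> + 1) * z powr \<alpha>" and u: "2 * z \<le> u"
  shows "osc_bounded x a 0 u ((1 / sg + 33 + 2 / gam + 2 / (2 * mu - sg) + 1 / (\<alpha> - 1)) * K * z powr (- sg))"
proof -
  note K = amplitude_K[OF a]
  have nu: "0 < 2 * mu - sg" using sg_lt two_mu by simp
  define \<delta> where "\<delta> = z powr (- mu)"
  have \<delta>: "0 < \<delta>" "\<delta> \<le> 1" using z2 mu_pos powr_neg_le_one[of z "- mu"] by (auto simp: \<delta>_def)
  have dp: "dphase x \<xi> = (\<alpha> + 1) * (z powr \<alpha> - \<xi> powr \<alpha>)" for \<xi>
    by (simp add: dphase_def x algebra_simps)
  have za: "z \<le> z powr \<alpha>" using z2 alpha_gt powr_mono[of 1 \<alpha> z] by simp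
  have xz: "z powr \<alpha> \<le> x" "z \<le> x" using alpha_gt za mult_right_mono[of 1 "\<alpha> + 1" "z powr \<alpha>"] by (auto simp: x)
  have half: "(s / 2) powr \<alpha> \<le> s powr \<alpha> / 2" if "0 \<le> s" for s
  proof -
    have "2 powr 1 \<le> 2 powr \<alpha>" using alpha_gt by (intro powr_mono) auto
    then have "s powr \<alpha> / 2 powr \<alpha> \<le> s powr \<alpha> / 2" by (intro divide_left_mono) auto
    then show ?thesis using that by (simp add: powr_divide)
  qed
  have phL: "x / 2 \<le> \<bar>dphase x \<xi>\<bar>" if "0 < \<xi>" "\<xi> \<le> z / 2" for \<xi>
  proof -
    have "\<xi> powr \<alpha> \<le> (z / 2) powr \<alpha>" using that alpha_gt by (intro powr_mono2) auto
    then have "\<xi> powr \<alpha> \<le> z powr \<alpha> / 2" using half[of z] z2 by simp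
    then have "(\<alpha> + 1) * (z powr \<alpha> / 2) \<le> dphase x \<xi>" unfolding dp using alpha_gt by (intro mult_left_mono) auto
    then show ?thesis by (simp add: x)
  qed
  \<comment> \<open>The secant form of a second derivative bound: |dphase| grows at least linearly
    in the distance from \<open>z\<close>. The factor 2 is the lower bound for \<alpha> + 1.\<close>
  have phM: "2 * z powr (2 * mu) * \<bar>\<xi> - z\<bar> \<le> \<bar>dphase x \<xi>\<bar>" if "0 < \<xi>" for \<xi>
  proof (cases "\<xi> \<le> z")
    case True
    have "2 * (z powr (2 * mu) * (z - \<xi>)) \<le> (\<alpha> + 1) * (z powr \<alpha> - \<xi> powr \<alpha>)"
      using powr_diff_ge[of \<xi> z] True that alpha_gt z2 by (intro mult_mono) (auto simp: two_mu)
    then show ?thesis unfolding dp using True by simp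
  next
    case False
    have "z powr (2 * mu) * (\<xi> - z) \<le> \<xi> powr (2 * mu) * (\<xi> - z)"
      using False z2 mu_pos by (intro mult_right_mono powr_mono2) auto
    also have "\<dots> \<le> \<xi> powr \<alpha> - z powr \<alpha>"
      using powr_diff_ge[of z \<xi>] False that z2 by (auto simp: two_mu)
    finally have "2 * (z powr (2 * mu) * (\<xi> - z)) \<le> (\<alpha> + 1) * (\<xi> powr \<alpha> - z powr \<alpha>)"
      using False alpha_gt z2 by (intro mult_mono) auto
    then have "2 * z powr (2 * mu) * (\<xi> - z) \<le> - dphase x \<xi>" unfolding dp by (simp add: algebra_simps)
    then show ?thesis using False by simp
  qed
  \<comment> \<open>From z / 2 on the amplitude has its size at \<open>z\<close> up to
    \<open>2 powr rho\<close>, which is below 2 since rho \<le> mu \<le> 1/2.\<close>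
  have a2: "cmod (a \<xi>) \<le> 2 * K * z powr (- rho)" if "z / 2 \<le> \<xi>" for \<xi>
  proof -
    have "\<xi> powr (- rho) \<le> (z / 2) powr (- rho)" using that z2 rho_ge by (intro powr_mono2') auto
    also have "\<dots> = 2 powr rho * z powr (- rho)" using z2 by (simp add: powr_divide powr_minus field_simps)
    also have "\<dots> \<le> 2 powr 1 * z powr (- rho)"
      using rho_le_mu mu_le by (intro mult_right_mono powr_mono) auto
    finally have "K * \<xi> powr (- rho) \<le> K * (2 * z powr (- rho))" using K by (intro mult_left_mono) auto
    then show ?thesis using amplitudeD(5)[OF a, of \<xi>] that z2 by simp
  qed
  have zs: "z powr e \<le> z powr (- sg)" if "e \<le> - sg" for e using z2 that by (intro powr_mono) auto
  have dm: "z powr (2 * mu) * \<delta> = z powr mu" using z2 by (simp add: \<delta>_def flip: powr_add)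
  \<comment> \<open>The logarithm, of size (1 + mu) * ln z, is absorbed by the surplus power 2 * mu
    - sg > 0; without a strict inequality it would survive.\<close>
  have lnb: "K / (2 * z powr (2 * mu)) * (ln z - ln \<delta>) \<le> K / (2 * mu - sg) * z powr (- sg)"
  proof -
    have l0: "0 \<le> ln z" using z2 by simp
    have "ln z - ln \<delta> = (1 + mu) * ln z" using z2 by (simp add: \<delta>_def ln_powr algebra_simps)
    also have "\<dots> \<le> 2 * ln z" using mu_le l0 by (intro mult_right_mono) auto
    also have "ln z \<le> z powr (2 * mu - sg) / (2 * mu - sg)" using z2 nu by (intro ln_powr_bound) auto
    finally have "K / (2 * z powr (2 * mu)) * (ln z - ln \<delta>) \<le> K / (2 * z powr (2 * mu)) * (2 * (z powr (2 * mu - sg) / (2 * mu - sg)))"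
      using K by (intro mult_left_mono) auto
    also have "\<dots> = K / (2 * mu - sg) * z powr (- sg)"
      using z2 by (simp add: powr_diff powr_minus field_simps)
    finally show ?thesis .
  qed
  have ampm: "4 * (2 * K * z powr (- rho)) / (2 * z powr mu) \<le> 4 * K * z powr (- sg)"
  proof -
    have "4 * (2 * K * z powr (- rho)) / (2 * z powr mu) = 4 * K * z powr (- rho - mu)"
      using z2 by (simp add: powr_diff)
    also have "\<dots> \<le> 4 * K * z powr (- sg)" using rho_mu K by (intro mult_left_mono zs) auto
    finally show ?thesis .
  qed
  have b1: "osc_bounded x a 0 1 ((1 / sg + 8 + 2 / gam) * K * x powr (- sg))"
    using z2 xz by (intro osc_bounded_origin[OF a] phL) auto
  have c1: "(1 / sg + 8 + 2 / gam) * K * x powr (- sg) \<le> (1 / sg + 8 + 2 / gam) * K * z powr (- sg)"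
    using K sg_pos gam_pos xz z2 by (intro mult_left_mono powr_mono2') auto
  have b2: "osc_bounded x a 1 (z / 2) (4 * K / (x / 2) + K * z / x)"
  proof (rule osc_bounded_piece[OF a, where G="\<lambda>\<xi>. 2 * K / x * \<xi>" and G'="\<lambda>\<xi>. 2 * K / x"])
    fix \<xi> assume \<xi>: "1 \<le> \<xi>" "\<xi> \<le> z / 2"
    show "x / 2 \<le> \<bar>dphase x \<xi>\<bar>" using phL \<xi> by simp
    show "cmod (a \<xi>) \<le> K" using amplitude_le[OF a] \<xi> by simp
    have "cmod (a' \<xi>) \<le> 2 * K / x * (x / 2)" using amplitudeD(6)[OF a] \<xi> xz z2 by simp
    also have "\<dots> \<le> 2 * K / x * \<bar>dphase x \<xi>\<bar>" using phL \<xi> K xz z2 by (intro mult_left_mono) auto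
    finally show "cmod (a' \<xi>) \<le> 2 * K / x * \<bar>dphase x \<xi>\<bar>" .
    have "2 * K / x * \<xi> \<le> 2 * K / x * (z / 2)" using \<xi> K xz z2 by (intro mult_left_mono) auto
    then show "0 \<le> 2 * K / x * \<xi> \<and> 2 * K / x * \<xi> \<le> K * z / x"
      using K \<xi> xz z2 by simp
  qed (use xz z2 in \<open>auto intro!: derivative_eq_intros\<close>)
  have c2: "4 * K / (x / 2) + K * z / x \<le> 9 * K * z powr (- sg)"
  proof -
    have "z / x \<le> z / z powr \<alpha>" using xz z2 by (intro divide_left_mono) auto
    also have "\<dots> = z powr (1 - \<alpha>)" using z2 by (simp add: powr_diff)
    also have "\<dots> \<le> z powr (- sg)" using sg_lt by (intro zs) simp
    finally have q: "z / x \<le> z powr (- sg)" .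
    moreover have "1 / x \<le> z / x" using xz z2 by (intro divide_right_mono) auto
    ultimately have "8 * K * (1 / x) + K * (z / x) \<le> 8 * K * z powr (- sg) + K * z powr (- sg)"
      using K by (intro add_mono mult_left_mono) auto
    then show ?thesis by (simp add: algebra_simps)
  qed
  have b3: "osc_bounded x a (z / 2) (z - \<delta>) (4 * (2 * K * z powr (- rho)) / (2 * z powr mu) + K / (2 * z powr (2 * mu)) * (ln z - ln \<delta>))"
  proof (rule osc_bounded_piece[OF a, where G="\<lambda>\<xi>. K / (2 * z powr (2 * mu)) * (ln z - ln (z - \<xi>))" and G'="\<lambda>\<xi>. K / (2 * z powr (2 * mu)) * (1 / (z - \<xi>))"])
    fix \<xi> assume \<xi>: "z / 2 \<le> \<xi>" "\<xi> \<le> z - \<delta>"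
    have ab: "\<bar>\<xi> - z\<bar> = z - \<xi>" "\<delta> \<le> z - \<xi>" using \<xi> \<delta> by auto
    have "2 * (z powr (2 * mu) * \<delta>) \<le> 2 * z powr (2 * mu) * \<bar>\<xi> - z\<bar>" using ab by (simp add: mult_left_mono)
    then show "2 * z powr mu \<le> \<bar>dphase x \<xi>\<bar>" using phM[of \<xi>] \<xi> z2 by (simp add: dm)
    show "cmod (a \<xi>) \<le> 2 * K * z powr (- rho)" using a2 \<xi> by simp
    show "((\<lambda>\<xi>. K / (2 * z powr (2 * mu)) * (ln z - ln (z - \<xi>))) has_real_derivative K / (2 * z powr (2 * mu)) * (1 / (z - \<xi>))) (at \<xi>)"
      using ab \<delta> z2 by (auto intro!: derivative_eq_intros)
    have "cmod (a' \<xi>) \<le> K" using amplitudeD(6)[OF a] \<xi> z2 by simp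
    also have "K = K / (2 * z powr (2 * mu)) * (1 / (z - \<xi>)) * (2 * z powr (2 * mu) * \<bar>\<xi> - z\<bar>)"
      using ab \<delta> z2 by (simp add: field_simps)
    also have "\<dots> \<le> K / (2 * z powr (2 * mu)) * (1 / (z - \<xi>)) * \<bar>dphase x \<xi>\<bar>"
      using phM[of \<xi>] \<xi> z2 K ab \<delta> by (intro mult_left_mono) auto
    finally show "cmod (a' \<xi>) \<le> K / (2 * z powr (2 * mu)) * (1 / (z - \<xi>)) * \<bar>dphase x \<xi>\<bar>" .
    have "ln \<delta> \<le> ln (z - \<xi>)" "ln (z - \<xi>) \<le> ln z" using ab \<delta> \<xi> z2 by auto
    then show "0 \<le> K / (2 * z powr (2 * mu)) * (ln z - ln (z - \<xi>)) \<and>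
        K / (2 * z powr (2 * mu)) * (ln z - ln (z - \<xi>)) \<le> K / (2 * z powr (2 * mu)) * (ln z - ln \<delta>)"
      using K by (intro conjI mult_nonneg_nonneg mult_left_mono) auto
  qed (use z2 in auto)
  have b4: "osc_bounded x a (z - \<delta>) (z + \<delta>) (2 * K * z powr (- rho) * (z + \<delta> - (z - \<delta>)))"
    using z2 \<delta> a2 by (intro osc_bounded_trivial[OF a]) auto
  have c4: "2 * K * z powr (- rho) * (z + \<delta> - (z - \<delta>)) \<le> 4 * K * z powr (- sg)"
  proof -
    have "2 * K * z powr (- rho) * (z + \<delta> - (z - \<delta>)) = 4 * K * z powr (- rho - mu)"
      using z2 by (simp add: \<delta>_def powr_diff powr_minus field_simps)
    also have "\<dots> \<le> 4 * K * z powr (- sg)" using rho_mu K by (intro mult_left_mono zs) auto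
    finally show ?thesis .
  qed
  have b5: "osc_bounded x a (z + \<delta>) (2 * z) (4 * (2 * K * z powr (- rho)) / (2 * z powr mu) + K / (2 * z powr (2 * mu)) * (ln z - ln \<delta>))"
  proof (rule osc_bounded_piece[OF a, where G="\<lambda>\<xi>. K / (2 * z powr (2 * mu)) * (ln (\<xi> - z) - ln \<delta>)" and G'="\<lambda>\<xi>. K / (2 * z powr (2 * mu)) * (1 / (\<xi> - z))"])
    fix \<xi> assume \<xi>: "z + \<delta> \<le> \<xi>" "\<xi> \<le> 2 * z"
    have ab: "\<bar>\<xi> - z\<bar> = \<xi> - z" "\<delta> \<le> \<xi> - z" using \<xi> \<delta> by auto
    have "2 * (z powr (2 * mu) * \<delta>) \<le> 2 * z powr (2 * mu) * \<bar>\<xi> - z\<bar>" using ab by (simp add: mult_left_mono)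
    then show "2 * z powr mu \<le> \<bar>dphase x \<xi>\<bar>" using phM[of \<xi>] \<xi> z2 \<delta> by (simp add: dm)
    show "cmod (a \<xi>) \<le> 2 * K * z powr (- rho)" using a2 \<xi> z2 \<delta> by simp
    show "((\<lambda>\<xi>. K / (2 * z powr (2 * mu)) * (ln (\<xi> - z) - ln \<delta>)) has_real_derivative K / (2 * z powr (2 * mu)) * (1 / (\<xi> - z))) (at \<xi>)"
      using ab \<delta> z2 by (auto intro!: derivative_eq_intros)
    have "cmod (a' \<xi>) \<le> K" using amplitudeD(6)[OF a] \<xi> z2 \<delta> by simp
    also have "K = K / (2 * z powr (2 * mu)) * (1 / (\<xi> - z)) * (2 * z powr (2 * mu) * \<bar>\<xi> - z\<bar>)"
      using ab \<delta> z2 by (simp add: field_simps)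
    also have "\<dots> \<le> K / (2 * z powr (2 * mu)) * (1 / (\<xi> - z)) * \<bar>dphase x \<xi>\<bar>"
      using phM[of \<xi>] \<xi> z2 K ab \<delta> by (intro mult_left_mono) auto
    finally show "cmod (a' \<xi>) \<le> K / (2 * z powr (2 * mu)) * (1 / (\<xi> - z)) * \<bar>dphase x \<xi>\<bar>" .
    have "ln \<delta> \<le> ln (\<xi> - z)" "ln (\<xi> - z) \<le> ln z" using ab \<delta> \<xi> z2 by auto
    then show "0 \<le> K / (2 * z powr (2 * mu)) * (ln (\<xi> - z) - ln \<delta>) \<and>
        K / (2 * z powr (2 * mu)) * (ln (\<xi> - z) - ln \<delta>) \<le> K / (2 * z powr (2 * mu)) * (ln z - ln \<delta>)"
      using K by (intro conjI mult_nonneg_nonneg mult_left_mono) auto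
  qed (use z2 \<delta> in auto)
  have b6: "osc_bounded x a (2 * z) u (K * (4 + 1 / (\<alpha> - 1)) * (2 * z) powr (1 - \<alpha>))"
  proof (rule osc_bounded_tail[OF a])
    fix \<xi> assume \<xi>: "2 * z \<le> \<xi>"
    have "z powr \<alpha> \<le> (\<xi> / 2) powr \<alpha>" using \<xi> z2 alpha_gt by (intro powr_mono2) auto
    then have "\<xi> powr \<alpha> / 2 \<le> \<xi> powr \<alpha> - z powr \<alpha>" using half[of \<xi>] \<xi> z2 by simp
    then have "2 * (\<xi> powr \<alpha> / 2) \<le> (\<alpha> + 1) * (\<xi> powr \<alpha> - z powr \<alpha>)" using alpha_gt by (intro mult_mono) auto
    then show "\<xi> powr \<alpha> \<le> \<bar>dphase x \<xi>\<bar>" unfolding dp by (simp add: algebra_simps)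
  qed (use z2 in auto)
  have c6: "K * (4 + 1 / (\<alpha> - 1)) * (2 * z) powr (1 - \<alpha>) \<le> K * (4 + 1 / (\<alpha> - 1)) * z powr (- sg)"
  proof -
    have "(2 * z) powr (1 - \<alpha>) \<le> z powr (1 - \<alpha>)" using z2 alpha_gt by (intro powr_mono2') auto
    also have "\<dots> \<le> z powr (- sg)" using sg_lt by (intro zs) simp
    finally show ?thesis using K alpha_gt by (intro mult_left_mono) auto
  qed
  note osc_bounded_glue[OF a osc_bounded_glue[OF a osc_bounded_glue[OF a osc_bounded_glue[OF a osc_bounded_glue[OF a b1 b2] b3] b4] b5] b6]
  then have "osc_bounded x a 0 u ((1 / sg + 8 + 2 / gam) * K * x powr (- sg) + (4 * K / (x / 2) + K * z / x) +
      (4 * (2 * K * z powr (- rho)) / (2 * z powr mu) + K / (2 * z powr (2 * mu)) * (ln z - ln \<delta>)) +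
      2 * K * z powr (- rho) * (z + \<delta> - (z - \<delta>)) +
      (4 * (2 * K * z powr (- rho)) / (2 * z powr mu) + K / (2 * z powr (2 * mu)) * (ln z - ln \<delta>)) +
      K * (4 + 1 / (\<alpha> - 1)) * (2 * z) powr (1 - \<alpha>))"
    using z2 \<delta> u by auto
  then have "osc_bounded x a 0 u ((1 / sg + 8 + 2 / gam) * K * z powr (- sg) + 9 * K * z powr (- sg) +
      (4 * K * z powr (- sg) + K / (2 * mu - sg) * z powr (- sg)) + 4 * K * z powr (- sg) +
      (4 * K * z powr (- sg) + K / (2 * mu - sg) * z powr (- sg)) + K * (4 + 1 / (\<alpha> - 1)) * z powr (- sg))"
    by (rule osc_bounded_mono) (intro add_mono c1 c2 ampm lnb c4 c6)
  then show ?thesis by (rule osc_bounded_mono) (simp add: algebra_simps)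
qed

end

section \<open>The oscillatory integral as a function of position\<close>

lemma norm_cis_diff_le: "cmod (cis s - cis t) \<le> \<bar>s - t\<bar>"
proof -
  have "cis s - cis t = cis t * (cis (s - t) - 1)" by (simp add: algebra_simps cis_mult)
  then have "cmod (cis s - cis t) = cmod (cis (s - t) - 1)" by (simp add: norm_mult)
  also have "\<dots> \<le> \<bar>s - t\<bar>" using iexp_approx1[of "s - t" 0] by (simp add: cis_conv_exp)
  finally show ?thesis .
qed

context gkdv begin

definition dec :: "real \<Rightarrow> real" where "dec x = (1 + \<bar>x\<bar>) powr (- (1 / real p))"

lemma dec_pos: "0 < dec x" by (simp add: dec_def)

lemma dec_le_one: "dec x \<le> 1"
  unfolding dec_def using p_pos by (intro powr_neg_le_one) auto

text \<open>Comparable bases give comparable powers; the exponent 1 / p \<le> 1 turns the ratio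
  \<open>m\<close> into a factor of at most \<open>m\<close>.\<close>

lemma powr_le_dec:
  assumes "0 < y" "1 \<le> m" "1 + \<bar>x\<bar> \<le> m * y"
  shows "y powr (- (1 / real p)) \<le> m * dec x"
proof -
  have p: "0 < 1 / real p" "1 / real p \<le> 1" using p_pos by auto
  have "m powr (- 1) * y powr (- (1 / real p)) \<le> m powr (- (1 / real p)) * y powr (- (1 / real p))"
    using assms p by (intro mult_right_mono powr_mono) auto
  also have "\<dots> = (m * y) powr (- (1 / real p))" using assms by (simp add: powr_mult)
  also have "\<dots> \<le> dec x" unfolding dec_def using assms p by (intro powr_mono2') auto
  finally show ?thesis using assms by (simp add: powr_minus_divide field_simps)
qed

text \<open>Dominates the constants for negative, bounded and positive x together. The 13 is the
  ratio in 1 + |x| \<le> 13 * y, where y is the quantity whose power occurs in each of the three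
  regions.\<close>

definition osc_const :: real where
  "osc_const = 13 * (1 / sg + 33 + 2 / gam + 2 / (2 * mu - sg) + 1 / (\<alpha> - 1) + 1 / (\<alpha> - sg - 1))"

lemma osc_const_pos: "0 < osc_const"
proof -
  have "0 < 2 * mu - sg" "0 < \<alpha> - sg - 1" using sg_lt two_mu by auto
  then show ?thesis using alpha_gt sg_pos gam_pos
    unfolding osc_const_def by (intro mult_pos_pos add_pos_pos divide_pos_pos) auto
qed

abbreviation trunc :: "(real \<Rightarrow> complex) \<Rightarrow> real \<Rightarrow> real \<Rightarrow> complex" where
  "trunc a x R \<equiv> integral {0..R} (\<lambda>\<xi>. cis (phase x \<xi>) * a \<xi>)"

text \<open>The bound does not depend on the truncation \<open>R\<close>, so it passes to the limit
  and provides the majorant for dominated convergence in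
  \<open>profile_representation\<close>.\<close>

lemma trunc_bound:
  assumes a: "amplitude K a a'" and "0 \<le> R"
  shows "cmod (trunc a x R) \<le> osc_const * K * dec x"
proof -
  note K = amplitude_K[OF a]
  define C where "C = 1 / sg + 33 + 2 / gam + 2 / (2 * mu - sg) + 1 / (\<alpha> - 1) + 1 / (\<alpha> - sg - 1)"
  have nu: "0 < 2 * mu - sg" "0 < \<alpha> - sg - 1" using sg_lt two_mu by auto
  have pos: "0 < 1 / sg" "0 < 2 / gam" "0 < 2 / (2 * mu - sg)" "0 < 1 / (\<alpha> - 1)" "0 < 1 / (\<alpha> - sg - 1)"
    using nu alpha_gt sg_pos gam_pos by auto
  have fin: "cmod (trunc a x R) \<le> osc_const * K * dec x"
    if o: "osc_bounded x a 0 u (B * K * y powr (- (1 / real p)))" and "B \<le> C" "R \<le> u" "0 < y" "1 + \<bar>x\<bar> \<le> 13 * y" for B u y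
  proof -
    have "cmod (trunc a x R) \<le> B * K * y powr (- (1 / real p))" using o assms that unfolding osc_bounded_def by auto
    also have "\<dots> \<le> C * K * (13 * dec x)"
      using that pos K by (intro mult_mono powr_le_dec mult_nonneg_nonneg mult_right_mono) (auto simp: C_def dec_pos less_imp_le)
    finally show ?thesis by (simp add: osc_const_def C_def mult_ac)
  qed
  consider "x \<le> -1" | "\<bar>x\<bar> \<le> 12" | "12 \<le> x" by linarith
  then show ?thesis
  proof cases
    case 1
    show ?thesis by (rule fin[OF osc_bounded_negative[OF a 1, of "max 1 R"]]) (use pos 1 in \<open>auto simp: C_def\<close>)
  next
    case 2
    have "osc_bounded x a 0 (max 12 R) ((1 / sg + 15 + 1 / (\<alpha> - 1)) * K * 1 powr (- (1 / real p)))"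
      using osc_bounded_near[OF a 2, of "max 12 R"] by simp
    then show ?thesis by (rule fin) (use pos 2 in \<open>auto simp: C_def\<close>)
  next
    case 3
    define z where "z = (x / (\<alpha> + 1)) powr (1 / \<alpha>)"
    have z: "z powr \<alpha> = x / (\<alpha> + 1)" using 3 alpha_gt by (simp add: z_def powr_powr)
    have "4 * (\<alpha> + 1) \<le> x" using alpha_le 3 by simp
    then have x4: "4 \<le> x / (\<alpha> + 1)" using alpha_gt by (simp add: field_simps)
    have "(2::real) = 4 powr (1 / 2)" by (simp add: powr_half_sqrt)
    also have "\<dots> \<le> 4 powr (1 / \<alpha>)" using alpha_gt alpha_le by (intro powr_mono) (auto simp: field_simps)
    also have "\<dots> \<le> z" unfolding z_def using x4 alpha_gt by (intro powr_mono2) auto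
    finally have z2: "2 \<le> z" .
    have "z powr (- sg) = (z powr \<alpha>) powr (- (1 / real p))" by (simp add: powr_powr sg_alpha)
    then have o: "osc_bounded x a 0 (max (2 * z) R) ((1 / sg + 33 + 2 / gam + 2 / (2 * mu - sg) + 1 / (\<alpha> - 1)) * K * (z powr \<alpha>) powr (- (1 / real p)))"
      using osc_bounded_positive[OF a z2, of x "max (2 * z) R"] z alpha_gt by simp
    have "x \<le> 3 * (x / (\<alpha> + 1))" using 3 alpha_gt alpha_le by (simp add: field_simps)
    then have "1 + \<bar>x\<bar> \<le> 13 * z powr \<alpha>" using 3 unfolding z by linarith
    then show ?thesis by (intro fin[OF o]) (use pos z2 in \<open>auto simp: C_def\<close>)
  qed
qed

text \<open>The condition on |x| keeps the stationary point to the left of \<open>Z\<close>. As it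
  holds uniformly on bounded sets of x, so does the convergence of the truncations, and the limit is
  continuous.\<close>

lemma trunc_tail:
  assumes a: "amplitude K a a'" and Z: "1 \<le> Z" "\<bar>x\<bar> \<le> Z powr \<alpha>" "Z \<le> R" 
  shows "cmod (trunc a x R - trunc a x Z) \<le> K * (4 + 1 / (\<alpha> - 1)) * Z powr (1 - \<alpha>)"
proof -
  have "osc_bounded x a Z R (K * (4 + 1 / (\<alpha> - 1)) * Z powr (1 - \<alpha>))"
  proof (rule osc_bounded_tail[OF a Z(1)])
    fix \<xi> assume "Z \<le> \<xi>"
    then have "Z powr \<alpha> \<le> \<xi> powr \<alpha>" using Z alpha_gt by (intro powr_mono2) auto
    moreover have "2 * \<xi> powr \<alpha> \<le> (\<alpha> + 1) * \<xi> powr \<alpha>" using alpha_gt by (intro mult_right_mono) auto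
    ultimately show "\<xi> powr \<alpha> \<le> \<bar>dphase x \<xi>\<bar>" using Z by (auto simp: dphase_def)
  qed
  moreover have "trunc a x R - trunc a x Z = integral {Z..R} (\<lambda>\<xi>. cis (phase x \<xi>) * a \<xi>)"
    using Henstock_Kurzweil_Integration.integral_combine[of 0 Z R "\<lambda>\<xi>. cis (phase x \<xi>) * a \<xi>"] amplitude_integrable[OF a, of 0] Z
    by (simp add: algebra_simps)
  ultimately show ?thesis using Z unfolding osc_bounded_def by auto
qed

text \<open>An improper integral, since amplitudes need not be absolutely integrable at infinity.
  The limit runs over natural numbers; \<open>trunc_tendsto\<close> extends it to real
  truncations.\<close>

definition osc :: "(real \<Rightarrow> complex) \<Rightarrow> real \<Rightarrow> complex" where
  "osc a x = lim (\<lambda>n. trunc a x (real n))"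

lemma powr_tail_0: "(\<lambda>n. C * real n powr (1 - \<alpha>)) \<longlonglongrightarrow> 0"
  by (intro tendsto_mult_right_zero tendsto_neg_powr filterlim_real_sequentially) (use alpha_gt in auto)

lemma trunc_LIMSEQ:
  assumes a: "amplitude K a a'"
  shows "(\<lambda>n. trunc a x (real n)) \<longlonglongrightarrow> osc a x"
proof -
  have "Cauchy (\<lambda>n. trunc a x (real n))"
  proof (rule metric_CauchyI)
    fix e :: real assume e: "0 < e"
    have "\<forall>\<^sub>F n in sequentially. 2 * (K * (4 + 1 / (\<alpha> - 1))) * real n powr (1 - \<alpha>) < e"
      using order_tendstoD(2)[OF powr_tail_0 e] by simp
    moreover have "\<forall>\<^sub>F n in sequentially. 1 + \<bar>x\<bar> \<le> real n" by (rule filterlim_real_sequentially[unfolded filterlim_at_top, rule_format])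
    ultimately have "\<forall>\<^sub>F n in sequentially. 2 * (K * (4 + 1 / (\<alpha> - 1))) * real n powr (1 - \<alpha>) < e \<and> 1 + \<bar>x\<bar> \<le> real n"
      by (rule eventually_conj)
    then obtain N where N: "2 * (K * (4 + 1 / (\<alpha> - 1))) * real N powr (1 - \<alpha>) < e" "1 + \<bar>x\<bar> \<le> real N"
      by (auto simp: eventually_sequentially)
    have "real N powr 1 \<le> real N powr \<alpha>" using N alpha_gt by (intro powr_mono) auto
    then have NN: "1 \<le> real N" "\<bar>x\<bar> \<le> real N powr \<alpha>" using N by auto
    have "dist (trunc a x (real m)) (trunc a x (real n)) < e" if "N \<le> m" "N \<le> n" for m n
      using trunc_tail[OF a NN, of "real m"] trunc_tail[OF a NN, of "real n"] that N(1)
        dist_triangle2[of "trunc a x (real m)" "trunc a x (real n)" "trunc a x (real N)"] by (simp add: dist_norm)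
    then show "\<exists>N. \<forall>m\<ge>N. \<forall>n\<ge>N. dist (trunc a x (real m)) (trunc a x (real n)) < e" by blast
  qed
  then show ?thesis unfolding osc_def by (simp add: Cauchy_convergent_iff convergent_LIMSEQ_iff)
qed

lemma osc_tail:
  assumes a: "amplitude K a a'" and Z: "1 \<le> Z" "\<bar>x\<bar> \<le> Z powr \<alpha>"
  shows "cmod (osc a x - trunc a x Z) \<le> K * (4 + 1 / (\<alpha> - 1)) * Z powr (1 - \<alpha>)"
proof (rule Lim_bounded[OF tendsto_norm[OF tendsto_diff[OF trunc_LIMSEQ[OF a] tendsto_const]]])
  show "\<forall>n\<ge>nat \<lceil>Z\<rceil>. cmod (trunc a x (real n) - trunc a x Z) \<le> K * (4 + 1 / (\<alpha> - 1)) * Z powr (1 - \<alpha>)"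
    using trunc_tail[OF a Z] by (auto simp: nat_le_iff ceiling_le_iff)
qed

lemma osc_bound:
  assumes a: "amplitude K a a'"
  shows "cmod (osc a x) \<le> osc_const * K * dec x"
  by (rule Lim_bounded[OF tendsto_norm[OF trunc_LIMSEQ[OF a]], of 0]) (use trunc_bound[OF a] in auto)

lemma trunc_tendsto:
  assumes a: "amplitude K a a'"
  shows "((\<lambda>R. trunc a x R) \<longlongrightarrow> osc a x) at_top"
proof -
  have "((\<lambda>R. K * (4 + 1 / (\<alpha> - 1)) * R powr (1 - \<alpha>)) \<longlongrightarrow> 0) at_top"
    by (intro tendsto_mult_right_zero tendsto_neg_powr filterlim_ident) (use alpha_gt in auto)
  then have "((\<lambda>R. trunc a x R - osc a x) \<longlongrightarrow> 0) at_top"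
  proof (rule Lim_null_comparison[rotated])
    show "\<forall>\<^sub>F R in at_top. cmod (trunc a x R - osc a x) \<le> K * (4 + 1 / (\<alpha> - 1)) * R powr (1 - \<alpha>)"
      using eventually_ge_at_top[of "1 + \<bar>x\<bar>"]
    proof eventually_elim
      case (elim R)
      have "R powr 1 \<le> R powr \<alpha>" using elim alpha_gt by (intro powr_mono) auto
      then show ?case using osc_tail[OF a, of R x] elim by (simp add: norm_minus_commute)
    qed
  qed
  then show ?thesis by (simp add: LIM_zero_iff)
qed

lemma trunc_continuous:
  assumes a: "amplitude K a a'" and R: "0 \<le> R"
  shows "continuous_on UNIV (\<lambda>x. trunc a x R)"
proof -
  note K = amplitude_K[OF a]
  define L where "L = R * (K * max 1 R powr gam)"
  define M where "M = L * R powr (- gam + 1) / (- gam + 1)"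
  have L: "0 \<le> L" "0 \<le> M" using R K gam_lt by (auto simp: L_def M_def)
  have "M-lipschitz_on UNIV (\<lambda>x. trunc a x R)"
  proof (rule lipschitz_onI)
    fix x y :: real
    have "trunc a x R - trunc a y R = integral {0..R} (\<lambda>\<xi>. cis (phase x \<xi>) * a \<xi> - cis (phase y \<xi>) * a \<xi>)"
      by (rule integral_diff[symmetric]) (use amplitude_integrable[OF a] in auto)
    also have "cmod \<dots> \<le> (\<bar>x - y\<bar> * L) * R powr (- gam + 1) / (- gam + 1)"
    proof (rule norm_integral_powr_le)
      fix \<xi> assume \<xi>: "0 < \<xi>" "\<xi> \<le> R"
      have "cmod (cis (phase x \<xi>) * a \<xi> - cis (phase y \<xi>) * a \<xi>) = cmod (cis (phase x \<xi>) - cis (phase y \<xi>)) * cmod (a \<xi>)"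
        by (simp flip: norm_mult left_diff_distrib)
      also have "\<dots> \<le> \<bar>x * \<xi> - y * \<xi>\<bar> * (K * max 1 R powr gam * \<xi> powr (- gam))"
        using norm_cis_diff_le[of "phase x \<xi>" "phase y \<xi>"] amplitude_powr[OF a \<xi>]
        by (intro mult_mono) (auto simp: phase_def)
      also have "\<bar>x * \<xi> - y * \<xi>\<bar> = \<bar>x - y\<bar> * \<xi>" using \<xi> by (simp add: abs_mult flip: left_diff_distrib)
      also have "\<bar>x - y\<bar> * \<xi> * (K * max 1 R powr gam * \<xi> powr (- gam)) \<le> \<bar>x - y\<bar> * R * (K * max 1 R powr gam * \<xi> powr (- gam))"
        using \<xi> K by (intro mult_right_mono mult_left_mono) auto
      finally show "cmod (cis (phase x \<xi>) * a \<xi> - cis (phase y \<xi>) * a \<xi>) \<le> \<bar>x - y\<bar> * L * \<xi> powr (- gam)"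
        by (simp add: L_def mult.assoc)
    qed (use amplitude_integrable[OF a] R L gam_lt in \<open>auto intro!: integrable_diff\<close>)
    finally show "dist (trunc a x R) (trunc a y R) \<le> M * dist x y"
      by (simp add: dist_norm M_def mult_ac)
  qed (rule L)
  then show ?thesis by (rule lipschitz_on_continuous_on)
qed

lemma osc_continuous:
  assumes a: "amplitude K a a'"
  shows "continuous_on UNIV (osc a)"
proof -
  note K = amplitude_K[OF a]
  have "isCont (osc a) x" for x
  proof -
    let ?S = "ball x 1"
    have "continuous_on ?S (osc a)"
    proof (rule uniform_limit_theorem[where F=sequentially and f="\<lambda>n y. trunc a y (real n)"])
      show "\<forall>\<^sub>F n in sequentially. continuous_on ?S (\<lambda>y. trunc a y (real n))"
        by (intro always_eventually allI continuous_on_subset[OF trunc_continuous[OF a]]) auto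
      show "uniform_limit ?S (\<lambda>n y. trunc a y (real n)) (osc a) sequentially"
      proof (rule uniform_limitI)
        fix e :: real assume e: "0 < e"
        have "\<forall>\<^sub>F n in sequentially. K * (4 + 1 / (\<alpha> - 1)) * real n powr (1 - \<alpha>) < e"
          using order_tendstoD(2)[OF powr_tail_0 e] by simp
        moreover have "\<forall>\<^sub>F n in sequentially. 2 + \<bar>x\<bar> \<le> real n" by (rule filterlim_real_sequentially[unfolded filterlim_at_top, rule_format])
        ultimately show "\<forall>\<^sub>F n in sequentially. \<forall>y\<in>?S. dist (trunc a y (real n)) (osc a y) < e"
        proof eventually_elim
          case (elim n)
          have n: "real n powr 1 \<le> real n powr \<alpha>" using elim alpha_gt by (intro powr_mono) auto
          show ?case
          proof
            fix y assume "y \<in> ?S"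
            then have "\<bar>y\<bar> \<le> real n" "1 \<le> real n" using elim by (auto simp: dist_real_def simp del: One_nat_def)
            moreover have "\<bar>y\<bar> \<le> real n powr \<alpha>" using calculation n by simp
            ultimately have "cmod (osc a y - trunc a y (real n)) < e"
              using order_le_less_trans[OF osc_tail[OF a] elim(1)] by blast
            then show "dist (trunc a y (real n)) (osc a y) < e"
              by (simp add: dist_norm norm_minus_commute)
          qed
        qed
      qed
    qed auto
    then show ?thesis by (simp add: continuous_on_eq_continuous_at)
  qed
  then show ?thesis by (simp add: continuous_on_eq_continuous_at)
qed

lemma osc_diff:
  assumes a: "amplitude K a a'" and b: "amplitude L b b'"
  shows "osc (\<lambda>\<xi>. a \<xi> - b \<xi>) x = osc a x - osc b x"
proof -
  have "trunc (\<lambda>\<xi>. a \<xi> - b \<xi>) x R = trunc a x R - trunc b x R" for R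
    using amplitude_integrable[OF a order_refl, of x R] amplitude_integrable[OF b order_refl, of x R]
    by (simp add: right_diff_distrib integral_diff)
  then show ?thesis
    unfolding osc_def[of "\<lambda>\<xi>. a \<xi> - b \<xi>"]
    using tendsto_diff[OF trunc_LIMSEQ[OF a, of x] trunc_LIMSEQ[OF b, of x]] by (simp add: limI)
qed

text \<open>Extended to negative frequencies by conjugation, the symbol has as inverse Fourier
  integral 1 / (2 * pi) times twice the real part of its positive half.\<close>

definition profile :: "(real \<Rightarrow> complex) \<Rightarrow> real \<Rightarrow> real" where
  "profile a x = Re (osc a x) / pi"

lemma profile_bound:
  assumes a: "amplitude K a a'"
  shows "\<bar>profile a x\<bar> \<le> osc_const * K * dec x"
proof -
  have "\<bar>profile a x\<bar> \<le> cmod (osc a x) / pi" using abs_Re_le_cmod[of "osc a x"] by (simp add: profile_def divide_right_mono)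
  also have "\<dots> \<le> cmod (osc a x) / 1" using pi_gt3 by (intro divide_left_mono) auto
  finally show ?thesis using osc_bound[OF a, of x] by simp
qed

lemma profile_continuous: "amplitude K a a' \<Longrightarrow> continuous_on S (profile a)"
  unfolding profile_def[abs_def] 
  by (intro continuous_intros continuous_on_subset[OF osc_continuous]) auto

lemma profile_diff: "amplitude K a a' \<Longrightarrow> amplitude L b b' \<Longrightarrow> profile (\<lambda>\<xi>. a \<xi> - b \<xi>) x = profile a x - profile b x"
  by (simp add: profile_def osc_diff diff_divide_distrib)

end

section \<open>Fourier transforms of Schwartz functions\<close>

lemma cis_measurable [measurable]: "cis \<in> borel_measurable borel"
  unfolding cis_conv_exp[abs_def] by measurable

lemma LINT_Fubini_swap:
  fixes f :: "real \<Rightarrow> real \<Rightarrow> complex"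
  assumes f[measurable]: "(\<lambda>(x, y). f x y) \<in> borel_measurable (lborel \<Otimes>\<^sub>M lborel)"
    and "integrable lborel (\<lambda>x. LINT y|lborel. cmod (f x y))"
    and "AE x in lborel. integrable lborel (\<lambda>y. f x y)"
  shows "(LINT x|lborel. LINT y|lborel. f x y) = (LINT y|lborel. LINT x|lborel. f x y)"
    and "integrable lborel (\<lambda>x. LINT y|lborel. f x y)"
    and "integrable lborel (\<lambda>y. LINT x|lborel. f x y)"
proof -
  have i: "integrable (lborel \<Otimes>\<^sub>M lborel) (\<lambda>(x, y). f x y)"
    by (rule lborel_pair.Fubini_integrable) (use assms in auto)
  from lborel_pair.Fubini_integral[OF i]
  show "(LINT x|lborel. LINT y|lborel. f x y) = (LINT y|lborel. LINT x|lborel. f x y)" by simp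
  show "integrable lborel (\<lambda>x. LINT y|lborel. f x y)" using lborel_pair.integrable_fst'[OF i] by simp
  have "integrable (lborel \<Otimes>\<^sub>M lborel) (\<lambda>(x, y). f y x)"
    using lborel_pair.integrable_product_swap[OF i] by (simp add: case_prod_unfold)
  from lborel_pair.integrable_fst'[OF this]
  show "integrable lborel (\<lambda>y. LINT x|lborel. f x y)" by simp
qed

text \<open>A product majorant settles all integrability conditions of Fubini's theorem at once;
  most interchanges below are of this kind.\<close>

lemma LINT_Fubini_product:
  fixes f :: "real \<Rightarrow> real \<Rightarrow> complex"
  assumes f[measurable]: "(\<lambda>(x, y). f x y) \<in> borel_measurable (lborel \<Otimes>\<^sub>M lborel)"
    and g: "integrable lborel g" and h: "integrable lborel h"
    and b: "\<And>x y. cmod (f x y) \<le> g x * h y"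
  shows "(LINT x|lborel. LINT y|lborel. f x y) = (LINT y|lborel. LINT x|lborel. f x y)"
    and "integrable lborel (\<lambda>x. LINT y|lborel. f x y)"
    and "integrable lborel (\<lambda>y. LINT x|lborel. f x y)"
proof -
  have m: "f x \<in> borel_measurable lborel" for x using f by measurable
  have i: "integrable lborel (f x)" for x
    by (rule Bochner_Integration.integrable_bound[OF integrable_mult_right[OF h, of "g x"] m])
       (use b[of x] in \<open>auto intro!: AE_I2 order_trans[OF _ abs_ge_self]\<close>)
  have j: "integrable lborel (\<lambda>x. LINT y|lborel. cmod (f x y))"
  proof (rule Bochner_Integration.integrable_bound[OF integrable_mult_left[OF g, of "integral\<^sup>L lborel h"]])
    have "(LINT y|lborel. cmod (f x y)) \<le> g x * integral\<^sup>L lborel h" for x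
      using integral_mono[OF integrable_norm[OF i] integrable_mult_right[OF h] b] by simp
    then show "AE x in lborel. norm (LINT y|lborel. cmod (f x y)) \<le> norm (g x * integral\<^sup>L lborel h)"
      by (auto intro!: AE_I2 order_trans[OF _ abs_ge_self] simp: abs_of_nonneg integral_nonneg_AE)
  qed measurable
  show "(LINT x|lborel. LINT y|lborel. f x y) = (LINT y|lborel. LINT x|lborel. f x y)"
    "integrable lborel (\<lambda>x. LINT y|lborel. f x y)"
    "integrable lborel (\<lambda>y. LINT x|lborel. f x y)"
    using LINT_Fubini_swap[OF f j] i by auto
qed

lemma integrable_inverse_one_plus_square: "integrable lborel (\<lambda>x::real. 1 / (1 + x\<^sup>2))"
  using integrable_inverse_1_plus_square
  by (simp add: set_integrable_def einterval_def inverse_eq_divide)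

lemma integrable_decay:
  fixes f :: "real \<Rightarrow> complex"
  assumes "f \<in> borel_measurable lborel" and "\<And>x. (1 + x\<^sup>2) * cmod (f x) \<le> C"
  shows "integrable lborel f"
proof (rule Bochner_Integration.integrable_bound[OF integrable_mult_right[OF integrable_inverse_one_plus_square, of C] assms(1)])
  have "cmod (f x) \<le> C * (1 / (1 + x\<^sup>2))" for x
    using assms(2)[of x] by (simp add: pos_le_divide_eq sum_power2_gt_zero_iff add_pos_nonneg mult.commute)
  then show "AE x in lborel. cmod (f x) \<le> norm (C * (1 / (1 + x\<^sup>2)))"
    unfolding real_norm_def by (blast intro: AE_I2 order_trans abs_ge_self)
qed

lemma fourier_eq_inv_fourier: "fourier f \<xi> = of_real (2 * pi) * inv_fourier f (- \<xi>)"
proof -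
  have "of_real (2 * pi) * (of_real (1 / (2 * pi)) * z) = (z::complex)" for z
    unfolding mult.assoc[symmetric] of_real_mult[symmetric] by simp
  then show ?thesis unfolding fourier_def inv_fourier_def by (simp add: mult.commute)
qed

lemma integrable_cis_mult:
  fixes f :: "real \<Rightarrow> complex"
  assumes "integrable lborel f" "g \<in> borel_measurable lborel"
  shows "integrable lborel (\<lambda>x. cis (g x) * f x)"
  by (rule Bochner_Integration.integrable_bound[OF assms(1)])
     (use assms in \<open>auto simp: norm_mult dest: borel_measurable_integrable\<close>)

lemma fourier_bound: "integrable lborel f \<Longrightarrow> cmod (fourier f \<xi>) \<le> (LINT x|lborel. cmod (f x))"
  unfolding fourier_def by (rule order_trans[OF integral_norm_bound]) (simp add: norm_mult)

lemma inv_fourier_bound: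
  assumes "integrable lborel f"
  shows "cmod (inv_fourier f \<xi>) \<le> (LINT x|lborel. cmod (f x))"
proof -
  have "cmod (inv_fourier f \<xi>) = 1 / (2 * pi) * cmod (fourier f (- \<xi>))"
    by (simp add: fourier_eq_inv_fourier norm_mult)
  also have "\<dots> \<le> 1 * cmod (fourier f (- \<xi>))" using pi_gt3 by (intro mult_right_mono) auto
  finally show ?thesis using fourier_bound[OF assms, of "- \<xi>"] by simp
qed

lemma fourier_continuous:
  assumes f: "integrable lborel f"
  shows "continuous_on S (fourier f)"
proof -
  have "isCont (fourier f) \<xi>" for \<xi>
    unfolding continuous_at_sequentially comp_def
  proof safe
    fix X :: "nat \<Rightarrow> real" assume X: "X \<longlonglongrightarrow> \<xi>"
    have [measurable]: "f \<in> borel_measurable borel" using borel_measurable_integrable[OF f] by simp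
    show "(\<lambda>n. fourier f (X n)) \<longlonglongrightarrow> fourier f \<xi>"
      unfolding fourier_def
    proof (rule integral_dominated_convergence[where w="\<lambda>x. cmod (f x)"])
      show "AE x in lborel. (\<lambda>n. cis (- (x * X n)) * f x) \<longlonglongrightarrow> cis (- (x * \<xi>)) * f x"
        unfolding cis_conv_exp by (intro AE_I2 tendsto_intros X)
    qed (use f in \<open>auto simp: norm_mult\<close>)
  qed
  then show ?thesis by (simp add: continuous_at_imp_continuous_on)
qed

lemma inv_fourier_continuous:
  assumes f: "integrable lborel f"
  shows "continuous_on S (inv_fourier f)"
proof -
  have eq: "inv_fourier f = (\<lambda>\<xi>. of_real (1 / (2 * pi)) * fourier f (- \<xi>))"
    by (simp add: fun_eq_iff fourier_eq_inv_fourier)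
  have "continuous_on UNIV (\<lambda>\<xi>. fourier f (- \<xi>))"
    by (rule continuous_on_compose2[OF fourier_continuous[OF f, of UNIV]]) (auto intro: continuous_intros)
  then have "continuous_on UNIV (inv_fourier f)" unfolding eq by (intro continuous_intros)
  then show ?thesis by (rule continuous_on_subset) simp
qed

lemma fourier_measurable [measurable]: "integrable lborel f \<Longrightarrow> fourier f \<in> borel_measurable borel"
  by (intro borel_measurable_continuous_onI fourier_continuous)

lemma inv_fourier_measurable [measurable]: "integrable lborel f \<Longrightarrow> inv_fourier f \<in> borel_measurable borel"
  by (intro borel_measurable_continuous_onI inv_fourier_continuous)

lemma schwartz_vderiv: "\<phi> \<in> schwartz \<Longrightarrow> vderiv \<phi> \<in> schwartz"
  unfolding schwartz_def
proof safe
  fix n k x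
  assume h: "\<forall>n. (\<forall>x. (vderiv ^^ n) \<phi> differentiable at x) \<and> (\<forall>k. bounded (range (\<lambda>x. complex_of_real (x ^ k) * (vderiv ^^ n) \<phi> x)))"
  have eq: "(vderiv ^^ n) (vderiv \<phi>) = (vderiv ^^ Suc n) \<phi>" by (simp add: funpow_swap1)
  show "(vderiv ^^ n) (vderiv \<phi>) differentiable at x" "bounded (range (\<lambda>x. complex_of_real (x ^ k) * (vderiv ^^ n) (vderiv \<phi>) x))"
    unfolding eq using h by blast+
qed

lemma schwartz_has_derivative:
  assumes "\<phi> \<in> schwartz" shows "(\<phi> has_vector_derivative vderiv \<phi> x) (at x)"
proof -
  have "(vderiv ^^ 0) \<phi> differentiable at x" using assms unfolding schwartz_def by blast
  then show ?thesis by (simp add: vderiv_def vector_derivative_works)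
qed

lemma schwartz_continuous: "\<phi> \<in> schwartz \<Longrightarrow> continuous_on S \<phi>"
  by (intro continuous_at_imp_continuous_on ballI has_vector_derivative_continuous[OF schwartz_has_derivative])

lemma schwartz_measurable [measurable]: "\<phi> \<in> schwartz \<Longrightarrow> \<phi> \<in> borel_measurable borel"
  by (intro borel_measurable_continuous_onI schwartz_continuous)

lemma schwartz_bound:
  assumes "\<phi> \<in> schwartz"
  obtains C where "\<And>x. \<bar>x\<bar> ^ k * cmod (\<phi> x) \<le> C"
proof -
  have "bounded (range (\<lambda>x. complex_of_real (x ^ k) * (vderiv ^^ 0) \<phi> x))"
    using assms unfolding schwartz_def by blast
  then obtain C where "\<And>x. cmod (complex_of_real (x ^ k) * \<phi> x) \<le> C" by (auto simp: bounded_iff)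
  then show ?thesis by (intro that) (simp add: norm_mult power_abs norm_power)
qed

lemma schwartz_integrable_power:
  assumes "\<phi> \<in> schwartz"
  shows "integrable lborel (\<lambda>x. of_real (x ^ k) * \<phi> x)"
proof -
  obtain C where C: "\<And>x. \<bar>x\<bar> ^ k * cmod (\<phi> x) \<le> C" using schwartz_bound[OF assms] by blast
  obtain D where D: "\<And>x. \<bar>x\<bar> ^ (k + 2) * cmod (\<phi> x) \<le> D" using schwartz_bound[OF assms] by blast
  have [measurable]: "\<phi> \<in> borel_measurable borel" using assms by simp
  show ?thesis
  proof (rule integrable_decay[where C="C + D"])
    fix x show "(1 + x\<^sup>2) * cmod (complex_of_real (x ^ k) * \<phi> x) \<le> C + D"
      using C[of x] D[of x] by (simp add: norm_mult norm_power power_add algebra_simps power2_eq_square[of "\<bar>x\<bar>"] power2_eq_square)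
  qed measurable
qed

lemma schwartz_integrable: "\<phi> \<in> schwartz \<Longrightarrow> integrable lborel \<phi>"
  using schwartz_integrable_power[of \<phi> 0] by simp

lemma schwartz_tendsto_0:
  assumes "\<phi> \<in> schwartz" shows "(\<phi> \<longlongrightarrow> 0) at_top" "(\<phi> \<longlongrightarrow> 0) at_bot"
proof -
  obtain C where C: "\<And>x. \<bar>x\<bar> ^ 1 * cmod (\<phi> x) \<le> C" using schwartz_bound[OF assms] by blast
  have b: "cmod (\<phi> x) \<le> C / \<bar>x\<bar>" if "x \<noteq> 0" for x using C[of x] that by (simp add: field_simps)
  have "((\<lambda>x. C / \<bar>x\<bar>) \<longlongrightarrow> 0) at_top" "((\<lambda>x. C / \<bar>x\<bar>) \<longlongrightarrow> 0) at_bot"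
    by (intro real_tendsto_divide_at_top[OF tendsto_const]; simp add: filterlim_at_bot_mirror filterlim_abs_real)+
  note t = this
  show "(\<phi> \<longlongrightarrow> 0) at_top"
    by (rule Lim_null_comparison[OF _ t(1)], rule eventually_mono[OF eventually_gt_at_top[of 0]], rule b) auto
  show "(\<phi> \<longlongrightarrow> 0) at_bot"
    by (rule Lim_null_comparison[OF _ t(2)], rule eventually_mono[OF eventually_gt_at_bot[of 0]], rule b) auto
qed

lemma LINT_derivative_zero:
  fixes F f :: "real \<Rightarrow> complex"
  assumes F: "\<And>x. (F has_vector_derivative f x) (at x)" and f: "continuous_on UNIV f" "integrable lborel f"
    and 0: "(F \<longlongrightarrow> 0) at_top" "(F \<longlongrightarrow> 0) at_bot"
  shows "(LINT x|lborel. f x) = 0"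
proof -
  have "(LBINT x=-\<infinity>..\<infinity>. f x) = 0 - 0"
  proof (rule interval_integral_FTC_integrable)
    show "((F \<circ> real_of_ereal) \<longlongrightarrow> 0) (at_right (- \<infinity>))" "((F \<circ> real_of_ereal) \<longlongrightarrow> 0) (at_left \<infinity>)"
      using 0 by (auto simp: ereal_tendsto_simps)
    show "set_integrable lborel (einterval (-\<infinity>) \<infinity>) f" using f by (simp add: set_integrable_def einterval_def)
  qed (use F f in \<open>auto simp: continuous_on_eq_continuous_at\<close>)
  then show ?thesis by (simp add: interval_lebesgue_integral_def set_lebesgue_integral_def einterval_def)
qed

lemma inv_fourier_vderiv:
  assumes "\<phi> \<in> schwartz"
  shows "inv_fourier (vderiv \<phi>) \<xi> = - (\<i> * of_real \<xi>) * inv_fourier \<phi> \<xi>"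
proof -
  note [measurable] = schwartz_measurable[OF assms] schwartz_measurable[OF schwartz_vderiv[OF assms]]
  have i1: "integrable lborel (\<lambda>x. cis (x * \<xi>) * \<phi> x)" by (rule integrable_cis_mult[OF schwartz_integrable[OF assms]]) simp
  have i2: "integrable lborel (\<lambda>x. cis (x * \<xi>) * vderiv \<phi> x)" by (rule integrable_cis_mult[OF schwartz_integrable[OF schwartz_vderiv[OF assms]]]) simp
  have "(LINT x|lborel. \<i> * of_real \<xi> * (cis (x * \<xi>) * \<phi> x) + cis (x * \<xi>) * vderiv \<phi> x) = 0"
  proof (rule LINT_derivative_zero[where F="\<lambda>x. cis (x * \<xi>) * \<phi> x"])
    fix x
    have "((\<lambda>x. x * \<xi>) has_real_derivative \<xi>) (at x)" by (auto intro!: derivative_eq_intros)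
    from has_vector_derivative_mult[OF has_vector_derivative_cis[OF this] schwartz_has_derivative[OF assms]]
    show "((\<lambda>x. cis (x * \<xi>) * \<phi> x) has_vector_derivative (\<i> * of_real \<xi> * (cis (x * \<xi>) * \<phi> x) + cis (x * \<xi>) * vderiv \<phi> x)) (at x)"
      by (simp add: scaleR_conv_of_real mult_ac add.commute)
  next
    show "continuous_on UNIV (\<lambda>x. \<i> * of_real \<xi> * (cis (x * \<xi>) * \<phi> x) + cis (x * \<xi>) * vderiv \<phi> x)"
      by (intro continuous_intros schwartz_continuous assms schwartz_vderiv)
    show "integrable lborel (\<lambda>x. \<i> * of_real \<xi> * (cis (x * \<xi>) * \<phi> x) + cis (x * \<xi>) * vderiv \<phi> x)"
      by (intro Bochner_Integration.integrable_add integrable_mult_right i1 i2)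
    show "((\<lambda>x. cis (x * \<xi>) * \<phi> x) \<longlongrightarrow> 0) at_top" "((\<lambda>x. cis (x * \<xi>) * \<phi> x) \<longlongrightarrow> 0) at_bot"
      using schwartz_tendsto_0[OF assms, THEN tendsto_norm_zero] by (auto intro: tendsto_norm_zero_cancel simp: norm_mult)
  qed
  then have "\<i> * of_real \<xi> * (LINT x|lborel. cis (x * \<xi>) * \<phi> x) + (LINT x|lborel. cis (x * \<xi>) * vderiv \<phi> x) = 0"
    using i1 i2 by (simp add: integral_add)
  then have "(LINT x|lborel. cis (x * \<xi>) * vderiv \<phi> x) = - (\<i> * of_real \<xi>) * (LINT x|lborel. cis (x * \<xi>) * \<phi> x)"
    by (simp add: eq_neg_iff_add_eq_0 add.commute)
  then show ?thesis unfolding inv_fourier_def by (simp add: mult.commute[of \<xi>])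
qed

text \<open>Differentiating \<open>\<phi>\<close> k times multiplies the transform by a factor of
  modulus \<open>\<bar>\<xi>\<bar> ^ k\<close>, and each transform is bounded by an L1 norm.\<close>

lemma inv_fourier_decay:
  assumes "\<phi> \<in> schwartz"
  obtains C where "\<And>\<xi>. (1 + \<bar>\<xi>\<bar> ^ k) * cmod (inv_fourier \<phi> \<xi>) \<le> C"
proof -
  have it: "(vderiv ^^ k) \<phi> \<in> schwartz \<and> (\<forall>\<xi>. cmod (inv_fourier ((vderiv ^^ k) \<phi>) \<xi>) = \<bar>\<xi>\<bar> ^ k * cmod (inv_fourier \<phi> \<xi>))" for k
    by (induction k) (auto simp: assms schwartz_vderiv inv_fourier_vderiv norm_mult)
  show ?thesis
  proof (rule that)
    fix \<xi>
    show "(1 + \<bar>\<xi>\<bar> ^ k) * cmod (inv_fourier \<phi> \<xi>) \<le> (LINT x|lborel. cmod (\<phi> x)) + (LINT x|lborel. cmod ((vderiv ^^ k) \<phi> x))"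
      using inv_fourier_bound[OF schwartz_integrable[OF assms], of \<xi>] it[of k]
        inv_fourier_bound[OF schwartz_integrable[OF conjunct1[OF it[of k]]], of \<xi>]
      by (simp add: distrib_right)
  qed
qed

text \<open>Differentiation under the integral with an explicit error: the second order Taylor
  remainder of \<open>cis\<close> gives at most \<open>h\<^sup>2\<close> times the second absolute
  moment of \<open>\<phi>\<close>. It is needed because \<open>nonlinearity\<close> is a
  distributional derivative tested against \<open>fourier \<phi>\<close>.\<close>

lemma vderiv_fourier:
  assumes "\<phi> \<in> schwartz"
  shows "vderiv (fourier \<phi>) \<xi> = (LINT x|lborel. cis (- (x * \<xi>)) * (- \<i> * of_real x * \<phi> x))"
proof -
  have [measurable]: "\<phi> \<in> borel_measurable borel" using assms by simp
  define D where "D = (LINT x|lborel. cis (- (x * \<xi>)) * (- \<i> * of_real x * \<phi> x))"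
  define M where "M = (LINT x|lborel. cmod (of_real (x ^ 2) * \<phi> x))"
  have x1: "integrable lborel (\<lambda>x. of_real x * \<phi> x)" using schwartz_integrable_power[OF assms, of 1] by simp
  have i0: "integrable lborel (\<lambda>x. cis (- (x * \<eta>)) * \<phi> x)" for \<eta>
    by (rule integrable_cis_mult[OF schwartz_integrable[OF assms]]) simp
  have i1: "integrable lborel (\<lambda>x. cis (- (x * \<xi>)) * (- \<i> * of_real x * \<phi> x))"
    using integrable_mult_right[OF integrable_cis_mult[OF x1, of "\<lambda>x. - (x * \<xi>)"], of "- \<i>"] by (simp add: mult_ac)
  have q: "cmod (fourier \<phi> (\<xi> + h) - fourier \<phi> \<xi> - h *\<^sub>R D) \<le> h\<^sup>2 * M" for h
  proof -
    have "fourier \<phi> (\<xi> + h) - fourier \<phi> \<xi> - h *\<^sub>R D =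
      (LINT x|lborel. cis (- (x * (\<xi> + h))) * \<phi> x - cis (- (x * \<xi>)) * \<phi> x - of_real h * (cis (- (x * \<xi>)) * (- \<i> * of_real x * \<phi> x)))"
      unfolding fourier_def D_def scaleR_conv_of_real
      using i0 i1 by (simp add: Bochner_Integration.integral_diff)
    also have "cmod \<dots> \<le> (LINT x|lborel. h\<^sup>2 * cmod (of_real (x ^ 2) * \<phi> x))"
    proof (rule order_trans[OF integral_norm_bound integral_mono])
      fix x
      have e: "cis (- (x * (\<xi> + h))) * \<phi> x - cis (- (x * \<xi>)) * \<phi> x - of_real h * (cis (- (x * \<xi>)) * (- \<i> * of_real x * \<phi> x))
         = cis (- (x * \<xi>)) * \<phi> x * (cis (- (x * h)) - (1 + \<i> * of_real (- (x * h))))"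
      proof -
        have "cis (- (x * (\<xi> + h))) = cis (- (x * \<xi>)) * cis (- (x * h))" by (simp add: cis_mult distrib_left)
        then show ?thesis by (simp add: algebra_simps)
      qed
      have "cmod (cis (- (x * h)) - (1 + \<i> * of_real (- (x * h)))) \<le> \<bar>x * h\<bar> ^ 2 / 2"
        using iexp_approx1[of "- (x * h)" 1] by (simp add: cis_conv_exp numeral_2_eq_2)
      then have "cmod (cis (- (x * h)) - (1 + \<i> * of_real (- (x * h)))) \<le> x\<^sup>2 * h\<^sup>2"
        by (simp add: power_mult_distrib) (smt (verit) zero_le_power2 mult_nonneg_nonneg)
      then have "cmod (\<phi> x) * cmod (cis (- (x * h)) - (1 + \<i> * of_real (- (x * h)))) \<le> cmod (\<phi> x) * (x\<^sup>2 * h\<^sup>2)"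
        by (intro mult_left_mono) auto
      then show "cmod (cis (- (x * (\<xi> + h))) * \<phi> x - cis (- (x * \<xi>)) * \<phi> x - of_real h * (cis (- (x * \<xi>)) * (- \<i> * of_real x * \<phi> x))) \<le> h\<^sup>2 * cmod (of_real (x ^ 2) * \<phi> x)"
        unfolding e norm_mult by (simp add: norm_power mult_ac)
    next
      show "integrable lborel (\<lambda>x. h\<^sup>2 * cmod (complex_of_real (x\<^sup>2) * \<phi> x))"
        by (intro integrable_mult_right integrable_norm schwartz_integrable_power assms)
    next
      show "integrable lborel (\<lambda>x. cmod (cis (- (x * (\<xi> + h))) * \<phi> x - cis (- (x * \<xi>)) * \<phi> x - of_real h * (cis (- (x * \<xi>)) * (- \<i> * of_real x * \<phi> x))))"
        by (intro integrable_norm Bochner_Integration.integrable_diff integrable_mult_right i0 i1)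
    qed
    also have "\<dots> = h\<^sup>2 * M" by (simp add: M_def)
    finally show ?thesis .
  qed
  have "((\<lambda>h. cmod (fourier \<phi> (\<xi> + h) - fourier \<phi> \<xi> - h *\<^sub>R D) / cmod (of_real h)) \<longlongrightarrow> 0) (at 0)"
  proof (rule Lim_null_comparison)
    show "\<forall>\<^sub>F h in at 0. norm (cmod (fourier \<phi> (\<xi> + h) - fourier \<phi> \<xi> - h *\<^sub>R D) / cmod (of_real h)) \<le> \<bar>h\<bar> * M"
    proof (intro always_eventually allI)
      fix h :: real
      show "norm (cmod (fourier \<phi> (\<xi> + h) - fourier \<phi> \<xi> - h *\<^sub>R D) / cmod (of_real h)) \<le> \<bar>h\<bar> * M"
      proof (cases "h = 0")
        case False
        have "h\<^sup>2 = \<bar>h\<bar> * \<bar>h\<bar>" by (simp add: power2_eq_square)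
        then show ?thesis using q[of h] False by (simp add: pos_divide_le_eq mult_ac)
      qed simp
    qed
    show "((\<lambda>h. \<bar>h\<bar> * M) \<longlongrightarrow> 0) (at 0)"
      by (auto intro!: tendsto_eq_intros)
  qed
  then have "(fourier \<phi> has_vector_derivative D) (at \<xi>)"
    unfolding has_vector_derivative_def has_derivative_at
    by (auto simp: bounded_linear_scaleR_left)
  then show ?thesis unfolding vderiv_def D_def by (rule vector_derivative_at)
qed

section \<open>Gaussians\<close>

lemma gauss_integrable: "integrable lborel (\<lambda>x::real. exp (- x\<^sup>2 / 2))"
proof -
  have "integrable lborel (\<lambda>x. sqrt (2 * pi) * std_normal_density x)"
    using integrable_normal_density[of 1 0] by simp
  then show ?thesis by (simp add: std_normal_density_def)
qed

text \<open>Read off from the characteristic function of the standard normal distribution.\<close>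

lemma gauss_fourier: "(LINT x|lborel. cis (k * x) * of_real (exp (- x\<^sup>2 / 2))) = of_real (sqrt (2 * pi) * exp (- k\<^sup>2 / 2))"
proof -
  have "of_real (exp (- k\<^sup>2 / 2)) = (LINT x|std_normal_distribution. iexp (k * x))"
    using fun_cong[OF char_std_normal_distribution, of k] by (simp add: char_def)
  also have "\<dots> = (LINT x|lborel. std_normal_density x *\<^sub>R iexp (k * x))"
    by (subst integral_density) (auto simp: cis_conv_exp[symmetric])
  also have "\<dots> = (LINT x|lborel. of_real (1 / sqrt (2 * pi)) * (cis (k * x) * of_real (exp (- x\<^sup>2 / 2))))"
    by (simp add: std_normal_density_def scaleR_conv_of_real cis_conv_exp mult_ac)
  also have "\<dots> = of_real (1 / sqrt (2 * pi)) * (LINT x|lborel. cis (k * x) * of_real (exp (- x\<^sup>2 / 2)))"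
    by simp
  finally have "of_real (sqrt (2 * pi)) * of_real (exp (- k\<^sup>2 / 2)) = 
      of_real (sqrt (2 * pi)) * (of_real (1 / sqrt (2 * pi)) * (LINT x|lborel. cis (k * x) * of_real (exp (- x\<^sup>2 / 2))))"
    by simp
  also have "\<dots> = (LINT x|lborel. cis (k * x) * of_real (exp (- x\<^sup>2 / 2)))"
    unfolding mult.assoc[symmetric] of_real_mult[symmetric] by simp
  finally show ?thesis by simp
qed

lemma LINT_substitution:
  fixes f :: "real \<Rightarrow> complex"
  assumes "0 < r"
  shows "(LINT x|lborel. f x) = of_real r * (LINT x|lborel. f (m + r * x))"
  using lborel_integral_real_affine[of r f m] assms by (simp add: scaleR_conv_of_real)

text \<open>Normalised so that its inverse Fourier transform is the probability density
  \<open>normal_density m r\<close>. Testing with it on the x side is averaging over a density on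
  the frequency side.\<close>

definition gaussian :: "real \<Rightarrow> real \<Rightarrow> real \<Rightarrow> complex" where
  "gaussian m r x = cis (- (m * x)) * of_real (exp (- (r * x)\<^sup>2 / 2))"

lemma inv_fourier_gaussian:
  assumes "0 < r"
  shows "inv_fourier (gaussian m r) \<xi> = of_real (normal_density m r \<xi>)"
proof -
  have "inv_fourier (gaussian m r) \<xi> = of_real (1 / (2 * pi)) * (of_real (1 / r) * (LINT x|lborel. cis (\<xi> * (0 + 1 / r * x)) * gaussian m r (0 + 1 / r * x)))"
    unfolding inv_fourier_def using assms by (subst LINT_substitution[of "1 / r" _ 0]) auto
  also have "(LINT x|lborel. cis (\<xi> * (0 + 1 / r * x)) * gaussian m r (0 + 1 / r * x)) =
     (LINT x|lborel. cis (((\<xi> - m) / r) * x) * of_real (exp (- x\<^sup>2 / 2)))"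
    using assms by (intro Bochner_Integration.integral_cong)
      (auto simp: gaussian_def mult.assoc[symmetric] cis_mult diff_divide_distrib left_diff_distrib)
  also have "of_real (1 / (2 * pi)) * (of_real (1 / r) * \<dots>) = of_real (1 / (2 * pi) * (1 / r) * sqrt (2 * pi) * exp (- ((\<xi> - m) / r)\<^sup>2 / 2))"
    unfolding gauss_fourier by (simp only: of_real_mult mult.assoc)
  also have "1 / (2 * pi) * (1 / r) * sqrt (2 * pi) = 1 / (sqrt (2 * pi) * r)"
    using assms real_sqrt_mult_self[of "2 * pi"] by (simp add: field_simps del: real_sqrt_mult_self)
  also have "1 / (sqrt (2 * pi) * r) * exp (- ((\<xi> - m) / r)\<^sup>2 / 2) = normal_density m r \<xi>"
    using assms by (simp add: normal_density_def real_sqrt_mult power_divide)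
  finally show ?thesis .
qed

lemma power_le_fact_exp:
  assumes "0 \<le> (x::real)" shows "x ^ n \<le> fact n * exp x"
proof -
  have "(\<Sum>k\<in>{n}. x ^ k /\<^sub>R fact k) \<le> (\<Sum>k. x ^ k /\<^sub>R fact k)"
    using assms by (intro sum_le_suminf summable_exp_generic) auto
  then show ?thesis by (simp add: exp_def field_simps)
qed

text \<open>The real exponent \<open>q * x\<close> covers shifted Gaussian densities, up to a
  constant factor, and q = 0 gives the modulated ones, so that one membership proof serves
  both.\<close>

definition gauss_exp :: "real \<Rightarrow> real \<Rightarrow> real \<Rightarrow> real \<Rightarrow> complex" where
  "gauss_exp q m r x = cis (- (m * x)) * of_real (exp (q * x - (r * x)\<^sup>2 / 2))"

lemma gauss_exp_schwartz:
  assumes r: "0 < r"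
  shows "gauss_exp q m r \<in> schwartz"
proof -
  have d: "(gauss_exp q m r has_vector_derivative of_real (q - r\<^sup>2 * x) * gauss_exp q m r x + - \<i> * of_real m * gauss_exp q m r x) (at x)" for x
  proof -
    have "((\<lambda>x. exp (q * x - (r * x)\<^sup>2 / 2)) has_real_derivative ((q - r\<^sup>2 * x) * exp (q * x - (r * x)\<^sup>2 / 2))) (at x)"
      by (auto intro!: derivative_eq_intros simp: power2_eq_square)
    moreover have "((\<lambda>x. - (m * x)) has_real_derivative - m) (at x)" by (auto intro!: derivative_eq_intros)
    ultimately show ?thesis
      unfolding gauss_exp_def
      by (intro has_vector_derivative_eq_rhs[OF has_vector_derivative_mult[OF has_vector_derivative_cis has_vector_derivative_of_real]])
         (auto simp: scaleR_conv_of_real algebra_simps)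
  qed
  have P: "\<exists>P. (vderiv ^^ n) (gauss_exp q m r) = (\<lambda>x. poly P (of_real x) * gauss_exp q m r x)" for n
  proof (induction n)
    case 0 show ?case by (auto intro: exI[of _ 1])
  next
    case (Suc n)
    then obtain P where P: "(vderiv ^^ n) (gauss_exp q m r) = (\<lambda>x. poly P (of_real x) * gauss_exp q m r x)" by blast
    \<comment> \<open>Polynomial multiples of \<open>gauss_exp\<close> are closed under
      differentiation: the logarithmic derivative of \<open>gauss_exp\<close> is the linear
      polynomial in brackets.\<close>
    have "vderiv (\<lambda>x. poly P (of_real x) * gauss_exp q m r x) x = poly (pderiv P + [: of_real q - \<i> * of_real m, - of_real (r\<^sup>2) :] * P) (of_real x) * gauss_exp q m r x" for x
      unfolding vderiv_def
    proof (rule vector_derivative_at)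
      have "(poly P has_field_derivative poly (pderiv P) (of_real x)) (at (of_real x))" by (rule poly_DERIV)
      then have "((\<lambda>x. poly P (of_real x)) has_vector_derivative poly (pderiv P) (of_real x)) (at x)"
        by (rule has_vector_derivative_real_field)
      from has_vector_derivative_mult[OF this d[of x]]
      show "((\<lambda>x. poly P (of_real x) * gauss_exp q m r x) has_vector_derivative poly (pderiv P + [: of_real q - \<i> * of_real m, - of_real (r\<^sup>2) :] * P) (of_real x) * gauss_exp q m r x) (at x)"
        by (rule has_vector_derivative_eq_rhs) (simp add: algebra_simps)
    qed
    then have "(vderiv ^^ Suc n) (gauss_exp q m r) = (\<lambda>x. poly (pderiv P + [: of_real q - \<i> * of_real m, - of_real (r\<^sup>2) :] * P) (of_real x) * gauss_exp q m r x)"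
      unfolding funpow.simps o_apply P by (rule ext)
    then show ?case by (rule exI)
  qed
  have pb: "\<exists>B. \<forall>x. cmod (of_real (x ^ k) * gauss_exp q m r x) \<le> B" for k
  proof (intro exI allI)
    fix x
    define Q where "Q = 1 + \<bar>q\<bar>"
    have "cmod (of_real (x ^ k) * gauss_exp q m r x) = \<bar>x\<bar> ^ k * exp (q * x - (r * x)\<^sup>2 / 2)"
      by (simp add: gauss_exp_def norm_mult norm_power)
    also have "\<dots> \<le> (fact k * exp \<bar>x\<bar>) * exp (q * x - (r * x)\<^sup>2 / 2)"
      by (intro mult_right_mono power_le_fact_exp) auto
    also have "\<dots> = fact k * exp (\<bar>x\<bar> + (q * x - (r * x)\<^sup>2 / 2))" unfolding mult.assoc exp_add[symmetric] by simp
    \<comment> \<open>Complete the square: the linear terms are at most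
      \<open>Q * \<bar>x\<bar>\<close>, and the quadratic term wins at distance
      \<open>Q / r\<^sup>2\<close>.\<close>
    also have "\<bar>x\<bar> + (q * x - (r * x)\<^sup>2 / 2) \<le> Q\<^sup>2 / (2 * r\<^sup>2)"
    proof -
      have "(r * \<bar>x\<bar> - Q / r)\<^sup>2 = (r * x)\<^sup>2 - 2 * (Q * \<bar>x\<bar>) + Q\<^sup>2 / r\<^sup>2"
        using r by (simp add: power2_diff power_mult_distrib power_divide)
      then have "0 \<le> (r * x)\<^sup>2 - 2 * (Q * \<bar>x\<bar>) + Q\<^sup>2 / r\<^sup>2" by (metis zero_le_power2)
      moreover have "q * x \<le> \<bar>q\<bar> * \<bar>x\<bar>" by (metis abs_ge_self abs_mult)
      ultimately show ?thesis by (simp add: Q_def distrib_right)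
    qed
    finally show "cmod (of_real (x ^ k) * gauss_exp q m r x) \<le> fact k * exp ((1 + \<bar>q\<bar>)\<^sup>2 / (2 * r\<^sup>2))" by (simp add: Q_def)
  qed
  have "bounded (range (\<lambda>x. of_real (x ^ k) * (poly P (of_real x) * gauss_exp q m r x)))" for P k
  proof (induction P arbitrary: k)
    case 0 show ?case by simp
  next
    case (pCons a P)
    obtain B where B: "\<And>x. cmod (of_real (x ^ Suc k) * (poly P (of_real x) * gauss_exp q m r x)) \<le> B"
      using pCons(2)[of "Suc k"] by (auto simp: bounded_iff)
    obtain C where C: "\<And>x. cmod (of_real (x ^ k) * gauss_exp q m r x) \<le> C" using pb by blast
    show ?case unfolding bounded_iff
    proof (intro exI ballI, safe)
      fix x
      have "of_real (x ^ k) * (poly (pCons a P) (of_real x) * gauss_exp q m r x) =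
         a * (of_real (x ^ k) * gauss_exp q m r x) + of_real (x ^ Suc k) * (poly P (of_real x) * gauss_exp q m r x)"
        by (simp add: algebra_simps)
      also have "cmod \<dots> \<le> cmod a * C + B"
        by (intro order_trans[OF norm_triangle_ineq] add_mono B) (metis norm_mult mult_left_mono C norm_ge_zero)
      finally show "cmod (of_real (x ^ k) * (poly (pCons a P) (of_real x) * gauss_exp q m r x)) \<le> cmod a * C + B" .
    qed
  qed
  moreover have "(\<lambda>x. poly P (of_real x) * gauss_exp q m r x) differentiable at x" for P x
  proof -
    have "(poly P has_field_derivative poly (pderiv P) (of_real x)) (at (of_real x))" by (rule poly_DERIV)
    then have "((\<lambda>x. poly P (of_real x)) has_vector_derivative poly (pderiv P) (of_real x)) (at x)"
      by (rule has_vector_derivative_real_field)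
    from has_vector_derivative_mult[OF this d[of x]] show ?thesis by (rule differentiableI_vector)
  qed
  ultimately have "(\<forall>x. (vderiv ^^ n) (gauss_exp q m r) differentiable at x) \<and>
      (\<forall>k. bounded (range (\<lambda>x. of_real (x ^ k) * (vderiv ^^ n) (gauss_exp q m r) x)))" for n
    using P[of n] by auto
  then show ?thesis unfolding schwartz_def by blast
qed

lemma gaussian_schwartz: "0 < r \<Longrightarrow> gaussian m r \<in> schwartz"
  using gauss_exp_schwartz[of r 0 m] by (simp add: gaussian_def[abs_def] gauss_exp_def[abs_def])

section \<open>Fourier inversion and uniqueness of representing functions\<close>

lemma normal_density_shift:
  assumes "0 < s"
  shows "normal_density x s (x + s * \<eta>) = std_normal_density \<eta> / s"
  using assms by (simp add: normal_density_def real_sqrt_mult power_mult_distrib)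

text \<open>Rescaling moves the shrinking width into the argument of \<open>f\<close>; dominated
  convergence under the fixed standard density then uses continuity at the one point
  \<open>x\<close>.\<close>

lemma normal_density_approx:
  fixes f :: "real \<Rightarrow> complex"
  assumes [measurable]: "f \<in> borel_measurable borel" and C: "\<And>y. cmod (f y) \<le> C" and c: "isCont f x"
  shows "(\<lambda>n. LINT y|lborel. f y * of_real (normal_density x (1 / real (Suc n)) y)) \<longlonglongrightarrow> f x"
proof -
  have eq: "(LINT y|lborel. f y * of_real (normal_density x s y)) = (LINT \<eta>|lborel. f (x + s * \<eta>) * of_real (std_normal_density \<eta>))"
    if "0 < s" for s
  proof -
    have "(LINT y|lborel. f y * of_real (normal_density x s y)) =
      of_real s * (LINT \<eta>|lborel. f (x + s * \<eta>) * of_real (normal_density x s (x + s * \<eta>)))"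
      by (rule LINT_substitution[OF that])
    also have "\<dots> = (LINT \<eta>|lborel. f (x + s * \<eta>) * of_real (std_normal_density \<eta>))"
      using that by (subst integral_mult_right_zero[symmetric]) (simp add: normal_density_shift)
    finally show ?thesis .
  qed
  have "(LINT y|lborel. f y * of_real (normal_density x (1 / real (Suc n)) y)) =
    (LINT \<eta>|lborel. f (x + 1 / real (Suc n) * \<eta>) * of_real (std_normal_density \<eta>))" for n
    by (rule eq) simp
  moreover have "(\<lambda>n. LINT \<eta>|lborel. f (x + 1 / real (Suc n) * \<eta>) * of_real (std_normal_density \<eta>)) \<longlonglongrightarrow>
     (LINT \<eta>|lborel. f x * of_real (std_normal_density \<eta>))"
  proof (rule integral_dominated_convergence[where w="\<lambda>\<eta>. C * std_normal_density \<eta>"])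
    show "integrable lborel (\<lambda>\<eta>. C * std_normal_density \<eta>)" by simp
    show "AE \<eta> in lborel. (\<lambda>n. f (x + 1 / real (Suc n) * \<eta>) * of_real (std_normal_density \<eta>)) \<longlonglongrightarrow> f x * of_real (std_normal_density \<eta>)"
    proof (intro AE_I2 tendsto_mult tendsto_const)
      fix \<eta> :: real
      have "(\<lambda>n. x + 1 / real (Suc n) * \<eta>) \<longlonglongrightarrow> x + 0 * \<eta>"
        by (intro tendsto_intros LIMSEQ_Suc lim_1_over_n)
      then show "(\<lambda>n. f (x + 1 / real (Suc n) * \<eta>)) \<longlonglongrightarrow> f x"
        using isCont_tendsto_compose[OF c] by simp
    qed
    show "AE \<eta> in lborel. cmod (f (x + 1 / real (Suc n) * \<eta>) * of_real (std_normal_density \<eta>)) \<le> C * std_normal_density \<eta>" for n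
      using C by (intro AE_I2) (simp add: norm_mult mult_right_mono)
  qed measurable
  moreover have "(LINT \<eta>|lborel. f x * of_real (std_normal_density \<eta>)) = f x"
    by (simp add: integral_complex_of_real)
  ultimately show ?thesis by simp
qed

lemma inv_fourier_multiplication:
  assumes f: "integrable lborel f" and g: "integrable lborel g"
  shows "(LINT \<xi>|lborel. g \<xi> * inv_fourier f \<xi>) = (LINT y|lborel. f y * inv_fourier g y)"
proof -
  have [measurable]: "f \<in> borel_measurable borel" "g \<in> borel_measurable borel"
    using f g by (auto dest: borel_measurable_integrable)
  have "(LINT \<xi>|lborel. LINT y|lborel. g \<xi> * (cis (\<xi> * y) * f y)) = (LINT y|lborel. LINT \<xi>|lborel. g \<xi> * (cis (\<xi> * y) * f y))"
    by (rule LINT_Fubini_product(1)[OF _ integrable_norm[OF g] integrable_norm[OF f]]) (auto simp: norm_mult)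
  also have "(LINT \<xi>|lborel. LINT y|lborel. g \<xi> * (cis (\<xi> * y) * f y)) = (LINT \<xi>|lborel. g \<xi> * (LINT y|lborel. cis (\<xi> * y) * f y))"
    by simp
  also have "(LINT y|lborel. LINT \<xi>|lborel. g \<xi> * (cis (\<xi> * y) * f y)) = (LINT y|lborel. f y * (LINT \<xi>|lborel. cis (y * \<xi>) * g \<xi>))"
    by (simp add: mult_ac flip: integral_mult_right_zero)
  finally have e: "(LINT \<xi>|lborel. g \<xi> * (LINT y|lborel. cis (\<xi> * y) * f y)) = (LINT y|lborel. f y * (LINT \<xi>|lborel. cis (y * \<xi>) * g \<xi>))" .
  have "(LINT \<xi>|lborel. g \<xi> * inv_fourier f \<xi>) = of_real (1 / (2 * pi)) * (LINT \<xi>|lborel. g \<xi> * (LINT y|lborel. cis (\<xi> * y) * f y))"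
    unfolding inv_fourier_def by (subst integral_mult_right_zero[symmetric]) (simp add: mult_ac)
  also have "\<dots> = of_real (1 / (2 * pi)) * (LINT y|lborel. f y * (LINT \<xi>|lborel. cis (y * \<xi>) * g \<xi>))" by (simp only: e)
  also have "\<dots> = (LINT y|lborel. f y * inv_fourier g y)"
    unfolding inv_fourier_def by (subst integral_mult_right_zero[symmetric]) (simp add: mult_ac)
  finally show ?thesis .
qed

lemma inv_fourier_integrable_power:
  assumes "\<phi> \<in> schwartz"
  shows "integrable lborel (\<lambda>\<xi>. of_real (\<bar>\<xi>\<bar> ^ k) * inv_fourier \<phi> \<xi>)"
proof -
  obtain C where C: "\<And>\<xi>. (1 + \<bar>\<xi>\<bar> ^ k) * cmod (inv_fourier \<phi> \<xi>) \<le> C" using inv_fourier_decay[OF assms] by blast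
  obtain D where D: "\<And>\<xi>. (1 + \<bar>\<xi>\<bar> ^ (k + 2)) * cmod (inv_fourier \<phi> \<xi>) \<le> D" using inv_fourier_decay[OF assms] by blast
  note [measurable] = inv_fourier_measurable[OF schwartz_integrable[OF assms]]
  show ?thesis
  proof (rule integrable_decay[where C="C + D"])
    fix x
    have "(1 + x\<^sup>2) * cmod (complex_of_real (\<bar>x\<bar> ^ k) * inv_fourier \<phi> x) = (\<bar>x\<bar> ^ k + \<bar>x\<bar> ^ (k + 2)) * cmod (inv_fourier \<phi> x)"
      by (simp add: norm_mult norm_power power_add algebra_simps power2_eq_square)
    also have "\<dots> \<le> ((1 + \<bar>x\<bar> ^ k) + (1 + \<bar>x\<bar> ^ (k + 2))) * cmod (inv_fourier \<phi> x)"
      by (intro mult_right_mono) auto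
    also have "\<dots> \<le> C + D" using C[of x] D[of x] by (simp add: distrib_right)
    finally show "(1 + x\<^sup>2) * cmod (complex_of_real (\<bar>x\<bar> ^ k) * inv_fourier \<phi> x) \<le> C + D" .
  qed measurable
qed

lemma inv_fourier_integrable: "\<phi> \<in> schwartz \<Longrightarrow> integrable lborel (inv_fourier \<phi>)"
  using inv_fourier_integrable_power[of \<phi> 0] by simp

lemma gaussian_integrable: "0 < r \<Longrightarrow> integrable lborel (gaussian m r)"
  by (intro schwartz_integrable gaussian_schwartz)

text \<open>Gaussian summation. By the multiplication formula, the mean of \<open>\<phi>\<close>
  over a narrow normal density about \<open>x\<close> equals the Fourier integral of
  \<open>inv_fourier \<phi>\<close> damped by a wide Gaussian. As the width tends to 0, the two
  sides tend to \<open>\<phi> x\<close> and to the undamped integral.\<close>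

lemma fourier_inversion:
  assumes "\<phi> \<in> schwartz"
  shows "fourier (inv_fourier \<phi>) x = \<phi> x"
proof (rule LIMSEQ_unique)
  note [measurable] = inv_fourier_measurable[OF schwartz_integrable[OF assms]] schwartz_measurable[OF assms]
  obtain C where C: "\<And>y. \<bar>y\<bar> ^ 0 * cmod (\<phi> y) \<le> C" using schwartz_bound[OF assms] by blast
  show "(\<lambda>n. LINT y|lborel. \<phi> y * of_real (normal_density x (1 / real (Suc n)) y)) \<longlonglongrightarrow> \<phi> x"
    using C by (intro normal_density_approx has_vector_derivative_continuous[OF schwartz_has_derivative[OF assms]]) auto
  have eq: "(LINT y|lborel. \<phi> y * of_real (normal_density x (1 / real (Suc n)) y)) = (LINT \<xi>|lborel. gaussian x (1 / real (Suc n)) \<xi> * inv_fourier \<phi> \<xi>)" for n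
    by (subst inv_fourier_multiplication[OF schwartz_integrable[OF assms] gaussian_integrable]) (auto simp: inv_fourier_gaussian)
  show "(\<lambda>n. LINT y|lborel. \<phi> y * of_real (normal_density x (1 / real (Suc n)) y)) \<longlonglongrightarrow> fourier (inv_fourier \<phi>) x"
    unfolding eq fourier_def
  proof (rule integral_dominated_convergence[where w="\<lambda>\<xi>. cmod (inv_fourier \<phi> \<xi>)"])
    show "(\<lambda>\<xi>. gaussian x (1 / real (Suc n)) \<xi> * inv_fourier \<phi> \<xi>) \<in> borel_measurable lborel" for n
      unfolding gaussian_def by measurable
    show "AE \<xi> in lborel. (\<lambda>n. gaussian x (1 / real (Suc n)) \<xi> * inv_fourier \<phi> \<xi>) \<longlonglongrightarrow> cis (- (\<xi> * x)) * inv_fourier \<phi> \<xi>"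
    proof (intro AE_I2 tendsto_mult tendsto_const)
      fix \<xi>
      have "(\<lambda>n. cis (- (x * \<xi>)) * of_real (exp (- (1 / real (Suc n) * \<xi>)\<^sup>2 / 2))) \<longlonglongrightarrow> cis (- (x * \<xi>)) * of_real (exp (- (0 * \<xi>)\<^sup>2 / 2))"
        by (intro tendsto_intros LIMSEQ_Suc lim_1_over_n) auto
      then show "(\<lambda>n. gaussian x (1 / real (Suc n)) \<xi>) \<longlonglongrightarrow> cis (- (\<xi> * x))"
        by (simp add: gaussian_def mult.commute del: of_nat_Suc)
    qed
    show "AE \<xi> in lborel. cmod (gaussian x (1 / real (Suc n)) \<xi> * inv_fourier \<phi> \<xi>) \<le> cmod (inv_fourier \<phi> \<xi>)" for n
      by (intro AE_I2) (simp add: gaussian_def norm_mult mult_left_le_one_le)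
  qed (use inv_fourier_integrable[OF assms] in auto)
qed

text \<open>Half-open intervals generate the Borel sets and are stable under intersection, and the
  sets over which \<open>h\<close> integrates to 0 form a Dynkin system.\<close>

lemma AE_zero_of_interval_integrals:
  fixes h :: "real \<Rightarrow> complex"
  assumes h: "integrable lborel h" and z: "\<And>a b. (LINT x:{a<..b}|lborel. h x) = 0"
  shows "AE x in lborel. h x = 0"
proof (rule sigma_finite_measure.density_zero[OF lborel.sigma_finite_measure_axioms h])
  have si: "set_integrable lborel A h" if "A \<in> sets borel" for A
    unfolding set_integrable_def using that by (intro integrable_mult_indicator h) auto
  \<comment> \<open>Closure under complements requires the integral over the whole line, which no
    single interval provides.\<close>
  have tot: "(LINT x|lborel. h x) = 0"
  proof (rule LIMSEQ_unique)
    have [measurable]: "h \<in> borel_measurable borel" using h by (auto dest: borel_measurable_integrable)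
    show "(\<lambda>n. LINT x|lborel. indicator {- real n<..real n} x *\<^sub>R h x) \<longlonglongrightarrow> (LINT x|lborel. h x)"
    proof (rule integral_dominated_convergence[where w="\<lambda>x. cmod (h x)"])
      show "AE x in lborel. (\<lambda>n. indicator {- real n<..real n} x *\<^sub>R h x) \<longlonglongrightarrow> h x"
      proof (intro AE_I2 tendsto_eventually)
        fix x :: real
        have "\<forall>\<^sub>F n in sequentially. \<bar>x\<bar> + 1 \<le> real n" by (rule filterlim_real_sequentially[unfolded filterlim_at_top, rule_format])
        then show "\<forall>\<^sub>F n in sequentially. indicator {- real n<..real n} x *\<^sub>R h x = h x"
          by eventually_elim (auto simp: indicator_def)
      qed
    qed (use h in \<open>auto simp: indicator_def\<close>)
    show "(\<lambda>n. LINT x|lborel. indicator {- real n<..real n} x *\<^sub>R h x) \<longlonglongrightarrow> 0"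
      using z by (simp add: set_lebesgue_integral_def)
  qed
  fix A :: "real set" assume "A \<in> sets lborel"
  then have "A \<in> sigma_sets UNIV (range (\<lambda>(a, b). {a<..b::real}))"
    by (simp add: borel_sigma_sets_Ioc)
  then show "set_lebesgue_integral lborel A h = 0"
  proof (induction rule: sigma_sets_induct_disjoint[rotated 2, consumes 1, case_names basic empty compl union stable pow])
    case stable then show ?case by (auto simp: Int_stable_def)
  next
    case (basic A)
    then obtain a b where "A = {a<..b}" by auto
    then show ?case by (simp only: z)
  next
    case (compl A)
    then have A: "A \<in> sets borel" by (simp add: borel_sigma_sets_Ioc)
    have "(LINT x:UNIV|lborel. h x) = (LINT x:A|lborel. h x) + (LINT x:UNIV - A|lborel. h x)"
      using set_integral_Un[of A "UNIV - A" lborel h] A by (auto simp: si)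
    then show ?case using compl tot by (simp add: set_lebesgue_integral_def)
  next
    case (union A)
    have A: "A i \<in> sets borel" for i using union(2) by (auto simp: borel_sigma_sets_Ioc)
    have "(LINT x:(\<Union>i. A i)|lborel. h x) = (\<Sum>i. (LINT x:(A i)|lborel. h x))"
      by (rule lebesgue_integral_countable_add) (use A union(1) in \<open>auto simp: disjoint_family_on_def intro!: si\<close>)
    then show ?case using union(3) by simp
  qed (auto simp: set_lebesgue_integral_def)
qed

text \<open>The normal density is symmetric in its mean and its argument. By Fubini,
  \<open>h\<close> therefore integrates to 0 against every interval indicator smoothed by a
  Gaussian; as the width shrinks the smoothed indicators converge except at the two end
  points.\<close>

lemma AE_zero_of_gaussian_integrals:
  fixes h :: "real \<Rightarrow> complex"
  assumes h: "integrable lborel h" and z: "\<And>m r. 0 < r \<Longrightarrow> (LINT x|lborel. h x * of_real (normal_density m r x)) = 0"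
  shows "AE x in lborel. h x = 0"
proof (rule AE_zero_of_interval_integrals[OF h])
  fix a b :: real
  have [measurable]: "h \<in> borel_measurable borel" using h by (auto dest: borel_measurable_integrable)
  let ?i = "\<lambda>y. complex_of_real (indicator {a<..b} y)"
  let ?s = "\<lambda>n. 1 / real (Suc n)"
  have sym: "normal_density m r x = normal_density x r m" for m r x by (simp add: normal_density_def power2_commute)
  have zero: "(LINT x|lborel. h x * (LINT y|lborel. ?i y * of_real (normal_density x (?s n) y))) = 0" for n
  proof -
    have "(LINT x|lborel. LINT y|lborel. h x * (?i y * of_real (normal_density x (?s n) y))) =
      (LINT y|lborel. LINT x|lborel. h x * (?i y * of_real (normal_density x (?s n) y)))"
    proof (rule LINT_Fubini_product(1)[where g="\<lambda>x. cmod (h x)" and h="\<lambda>y. indicator {a<..b} y * (1 / sqrt (2 * pi * (?s n)\<^sup>2))"])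
      show "integrable lborel (\<lambda>y. indicator {a<..b} y * (1 / sqrt (2 * pi * (?s n)\<^sup>2)))"
        by (intro integrable_mult_left) (cases "a \<le> b"; simp add: integrable_indicator_iff)
      fix x y
      have "normal_density x (?s n) y \<le> 1 / sqrt (2 * pi * (?s n)\<^sup>2) * 1"
        unfolding normal_density_def by (intro mult_left_mono) auto
      then show "cmod (h x * (?i y * of_real (normal_density x (?s n) y))) \<le> cmod (h x) * (indicator {a<..b} y * (1 / sqrt (2 * pi * (?s n)\<^sup>2)))"
        unfolding norm_mult by (intro mult_left_mono mult_mono) auto
    next
      show "(\<lambda>(x, y). h x * (?i y * of_real (normal_density x (?s n) y))) \<in> borel_measurable (lborel \<Otimes>\<^sub>M lborel)"
        unfolding normal_density_def by measurable
    qed (use h in auto)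
    also have "\<dots> = (LINT y|lborel. ?i y * (LINT x|lborel. h x * of_real (normal_density y (?s n) x)))"
      by (subst sym, subst integral_mult_right_zero[symmetric]) (simp add: mult_ac)
    also have "\<dots> = 0" using z[of "?s n"] by simp
    finally show ?thesis by simp
  qed
  have "(\<lambda>n. LINT x|lborel. h x * (LINT y|lborel. ?i y * of_real (normal_density x (?s n) y))) \<longlonglongrightarrow> (LINT x|lborel. h x * ?i x)"
  proof (rule integral_dominated_convergence[where w="\<lambda>x. cmod (h x)"])
    have "\<forall>x. x \<notin> {a, b} \<longrightarrow> (\<lambda>n. LINT y|lborel. ?i y * of_real (normal_density x (?s n) y)) \<longlonglongrightarrow> ?i x"
    proof (intro allI impI)
      fix x assume x: "x \<notin> {a, b}"
      show "(\<lambda>n. LINT y|lborel. ?i y * of_real (normal_density x (?s n) y)) \<longlonglongrightarrow> ?i x"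
      proof (rule normal_density_approx[where C=1])
        have "{a<..<b} \<subseteq> interior {a<..b}" by (intro interior_maximal) auto
        then have "x \<notin> frontier {a<..b}" using x by (cases "a < b") (auto simp: frontier_def)
        then show "isCont ?i x" by (intro isCont_of_real) (simp add: isCont_indicator)
      qed (auto simp: indicator_def)
    qed
    then show "AE x in lborel. (\<lambda>n. h x * (LINT y|lborel. ?i y * of_real (normal_density x (?s n) y))) \<longlonglongrightarrow> h x * ?i x"
      by (intro AE_I'[of "{a, b}"]) (auto intro!: finite_imp_null_set_lborel tendsto_intros)
    show "AE x in lborel. cmod (h x * (LINT y|lborel. ?i y * of_real (normal_density x (?s n) y))) \<le> cmod (h x)" for n
    proof (intro AE_I2)
      fix x
      have "cmod (LINT y|lborel. ?i y * of_real (normal_density x (?s n) y)) \<le> (LINT y|lborel. normal_density x (?s n) y)"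
      proof (rule order_trans[OF integral_norm_bound integral_mono])
        show "integrable lborel (\<lambda>y. cmod (?i y * of_real (normal_density x (?s n) y)))"
          by (rule Bochner_Integration.integrable_bound[OF integrable_normal_density[of "?s n" x]]) (auto simp: norm_mult indicator_def)
      qed (auto simp: norm_mult indicator_def)
      also have "\<dots> = 1" by (intro integral_normal_density) simp
      finally show "cmod (h x * (LINT y|lborel. ?i y * of_real (normal_density x (?s n) y))) \<le> cmod (h x)"
        by (simp add: norm_mult mult_left_le)
    qed
    show "(\<lambda>x. h x * (LINT y|lborel. ?i y * of_real (normal_density x (?s n) y))) \<in> borel_measurable lborel" for n
      unfolding normal_density_def by measurable
  qed (use h in auto)
  then have "(LINT x|lborel. h x * ?i x) = 0" unfolding zero by (simp add: LIMSEQ_const_iff)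
  then show "(LINT x:{a<..b}|lborel. h x) = 0"
    by (simp add: set_lebesgue_integral_def scaleR_conv_of_real mult.commute)
qed

text \<open>The factor \<open>exp (- x\<^sup>2 / 2)\<close> makes \<open>f\<close> integrable. It
  turns a normal density into a multiple of another one, so the product inherits the
  hypothesis.\<close>

lemma tempered_AE_zero:
  assumes f: "tempered_fun f" and z: "\<And>m r. 0 < r \<Longrightarrow> (LINT x|lborel. f x * of_real (normal_density m r x)) = 0"
  shows "AE x in lborel. f x = 0"
proof -
  obtain N :: nat where [measurable]: "f \<in> borel_measurable borel" and N: "integrable lborel (\<lambda>x. f x / of_real ((1 + \<bar>x\<bar>) ^ N))"
    using f unfolding tempered_fun_def by auto
  define h where "h = (\<lambda>x. f x * of_real (exp (- x\<^sup>2 / 2)))"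
  have hi: "integrable lborel h"
  proof (rule Bochner_Integration.integrable_bound[OF integrable_mult_right[OF N, of "of_real (fact N * exp (3 / 2))"]])
    show "AE x in lborel. cmod (h x) \<le> cmod (of_real (fact N * exp (3 / 2)) * (f x / of_real ((1 + \<bar>x\<bar>) ^ N)))"
    proof (intro AE_I2)
      fix x :: real
      have p: "0 < (1 + \<bar>x\<bar>) ^ N" by (intro zero_less_power) auto
      have "(1 + \<bar>x\<bar>) ^ N * exp (- x\<^sup>2 / 2) \<le> fact N * exp (1 + \<bar>x\<bar>) * exp (- x\<^sup>2 / 2)"
        by (intro mult_right_mono power_le_fact_exp) auto
      also have "\<dots> = fact N * exp (1 + \<bar>x\<bar> - x\<^sup>2 / 2)" unfolding mult.assoc exp_add[symmetric] by simp
      also have "1 + \<bar>x\<bar> - x\<^sup>2 / 2 \<le> 3 / 2"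
        using zero_le_power2[of "\<bar>x\<bar> - 1"] by (simp add: power2_diff)
      finally have "exp (- x\<^sup>2 / 2) \<le> fact N * exp (3 / 2) / (1 + \<bar>x\<bar>) ^ N" using p by (simp add: field_simps)
      then have "cmod (f x) * exp (- x\<^sup>2 / 2) \<le> cmod (f x) * (fact N * exp (3 / 2) / (1 + \<bar>x\<bar>) ^ N)" by (intro mult_left_mono) auto
      then show "cmod (h x) \<le> cmod (of_real (fact N * exp (3 / 2)) * (f x / of_real ((1 + \<bar>x\<bar>) ^ N)))"
        using p unfolding h_def norm_mult norm_divide norm_of_real by (simp add: abs_of_pos mult_ac)
    qed
    show "h \<in> borel_measurable lborel" unfolding h_def by measurable
  qed
  have "AE x in lborel. h x = 0"
  proof (rule AE_zero_of_gaussian_integrals[OF hi])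
    fix m r :: real assume r: "0 < r"
    \<comment> \<open>Multiplying Gaussians adds their precisions: 1 / r'^2 = 1 + 1 / r^2, and m' /
      r'^2 = m / r^2.\<close>
    define r' where "r' = r / sqrt (1 + r\<^sup>2)"
    define m' where "m' = m / (1 + r\<^sup>2)"
    have q: "0 < 1 + r\<^sup>2" by (simp add: add_pos_nonneg)
    have r': "0 < r'" "r'\<^sup>2 = r\<^sup>2 / (1 + r\<^sup>2)" using r q by (auto simp: r'_def power_divide)
    define c where "c = r' / r * exp (- m\<^sup>2 / (2 * (1 + r\<^sup>2)))"
    have e: "exp (- x\<^sup>2 / 2) * normal_density m r x = c * normal_density m' r' x" for x
    proof -
      have "- x\<^sup>2 / 2 + - (x - m)\<^sup>2 / (2 * r\<^sup>2) = - m\<^sup>2 / (2 * (1 + r\<^sup>2)) + - (x - m')\<^sup>2 / (2 * r'\<^sup>2)"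
      proof -
        define R where "R = r\<^sup>2"
        define Q where "Q = 1 + R"
        have RQ: "R \<noteq> 0" "Q \<noteq> 0" using r q by (auto simp: R_def Q_def)
        have "R * Q * x\<^sup>2 + Q * (x - m)\<^sup>2 = R * m\<^sup>2 + (Q * x - m)\<^sup>2"
          unfolding Q_def power2_eq_square by (simp add: algebra_simps)
        moreover have "- x\<^sup>2 / 2 + - (x - m)\<^sup>2 / (2 * R) = - (R * Q * x\<^sup>2 + Q * (x - m)\<^sup>2) / (2 * R * Q)"
          using RQ by (simp add: add_divide_distrib diff_divide_distrib)
        moreover have "- m\<^sup>2 / (2 * Q) + - (x - m / Q)\<^sup>2 / (2 * (R / Q)) = - (R * m\<^sup>2 + (Q * x - m)\<^sup>2) / (2 * R * Q)"
        proof -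
          have "x - m / Q = (Q * x - m) / Q" using RQ by (simp add: diff_divide_distrib)
          then have e: "(x - m / Q)\<^sup>2 = (Q * x - m)\<^sup>2 / (Q * Q)" by (simp only: power_divide power2_eq_square[of Q])
          show ?thesis unfolding e using RQ by (simp add: add_divide_distrib diff_divide_distrib)
        qed
        ultimately show ?thesis unfolding r'(2) m'_def R_def[symmetric] Q_def[symmetric] by simp
      qed
      then have "exp (- x\<^sup>2 / 2) * exp (- (x - m)\<^sup>2 / (2 * r\<^sup>2)) = exp (- m\<^sup>2 / (2 * (1 + r\<^sup>2))) * exp (- (x - m')\<^sup>2 / (2 * r'\<^sup>2))"
        by (simp only: exp_add[symmetric])
      then show ?thesis unfolding normal_density_def c_def using r r'(1)
        by (simp add: real_sqrt_mult field_simps)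
    qed
    have "(LINT x|lborel. h x * of_real (normal_density m r x)) = (LINT x|lborel. of_real c * (f x * of_real (normal_density m' r' x)))"
    proof (intro Bochner_Integration.integral_cong refl)
      fix x
      have "h x * of_real (normal_density m r x) = f x * of_real (exp (- x\<^sup>2 / 2) * normal_density m r x)" by (simp add: h_def)
      also have "\<dots> = of_real c * (f x * of_real (normal_density m' r' x))" unfolding e by (simp add: mult_ac)
      finally show "h x * of_real (normal_density m r x) = of_real c * (f x * of_real (normal_density m' r' x))" .
    qed
    also have "\<dots> = 0" using z[OF r'(1)] by simp
    finally show "(LINT x|lborel. h x * of_real (normal_density m r x)) = 0" .
  qed
  then show ?thesis by eventually_elim (simp add: h_def)
qed

section \<open>Inverse Fourier transforms of self-similar symbols\<close>

lemma integral_Ioc_eq: "integral {0<..R} f = integral {0..R} (f :: real \<Rightarrow> complex)"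
  by (rule integral_spike_set) (auto intro: negligible_subset[of "{0}"])

lemma LINT_conj_symmetric:
  fixes F :: "real \<Rightarrow> complex"
  assumes F: "integrable lborel F" and s: "\<And>\<xi>. 0 < \<xi> \<Longrightarrow> F (- \<xi>) = cnj (F \<xi>)"
  shows "(LINT \<xi>|lborel. F \<xi>) = of_real (2 * Re (LINT \<xi>:{0<..}|lborel. F \<xi>))"
proof -
  have si: "set_integrable lborel A F" if "A \<in> sets borel" for A
    unfolding set_integrable_def using that by (intro integrable_mult_indicator F) auto
  have "(LINT \<xi>|lborel. F \<xi>) = (LINT \<xi>|lborel. indicator {0<..} \<xi> *\<^sub>R F \<xi> + indicator {..<0} \<xi> *\<^sub>R F \<xi>)"
  proof (rule integral_cong_AE)
    show "AE \<xi> in lborel. F \<xi> = indicator {0<..} \<xi> *\<^sub>R F \<xi> + indicator {..<0} \<xi> *\<^sub>R F \<xi>"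
      by (rule AE_I'[of "{0}"]) (auto simp: indicator_def)
  qed (use F in \<open>auto dest: borel_measurable_integrable\<close>)
  also have "\<dots> = (LINT \<xi>:{0<..}|lborel. F \<xi>) + (LINT \<xi>:{..<0}|lborel. F \<xi>)"
    using si[of "{0<..}"] si[of "{..<0}"] unfolding set_lebesgue_integral_def set_integrable_def
    by (intro Bochner_Integration.integral_add) auto
  also have "(LINT \<xi>:{..<0}|lborel. F \<xi>) = (LINT \<xi>|lborel. indicator {..<0} (0 + - 1 * \<xi>) *\<^sub>R F (0 + - 1 * \<xi>))"
    unfolding set_lebesgue_integral_def by (subst lborel_integral_real_affine[of "- 1" _ 0]) auto
  also have "\<dots> = (LINT \<xi>|lborel. cnj (indicator {0<..} \<xi> *\<^sub>R F \<xi>))"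
    using s by (intro Bochner_Integration.integral_cong) (auto simp: indicator_def)
  also have "\<dots> = cnj (LINT \<xi>:{0<..}|lborel. F \<xi>)"
    unfolding set_lebesgue_integral_def by (rule Bochner_Integration.integral_cnj)
  finally show ?thesis by (simp add: complex_add_cnj)
qed

lemma integrable_abs_powr:
  assumes "-1 < e"
  shows "integrable lborel (\<lambda>\<xi>::real. indicator {-R..R} \<xi> * \<bar>\<xi>\<bar> powr e)"
proof -
  have "set_integrable lborel {0<..R} (\<lambda>\<xi>::real. complex_of_real (\<xi> powr e))"
    by (rule set_integrable_powr_bound[where e=e and K=1]) (use assms in \<open>auto intro!: continuous_intros\<close>)
  then have 1: "integrable lborel (\<lambda>\<xi>::real. indicator {0<..R} \<xi> * \<xi> powr e)"
    unfolding set_integrable_def using integrable_norm by (fastforce simp: indicator_def if_distrib cong: if_cong)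
  have 2: "integrable lborel (\<lambda>\<xi>. indicator {0<..R} (0 + - 1 * \<xi>) * (0 + - 1 * \<xi>) powr e)"
    by (rule lborel_integrable_real_affine[OF 1]) auto
  show ?thesis
  proof (rule integrable_cong_AE[THEN iffD1, OF _ _ _ Bochner_Integration.integrable_add[OF 1 2]])
    show "AE \<xi> in lborel. indicator {0<..R} \<xi> * \<xi> powr e + indicator {0<..R} (0 + - 1 * \<xi>) * (0 + - 1 * \<xi>) powr e = indicator {-R..R} \<xi> * \<bar>\<xi>\<bar> powr e"
      by (rule AE_I'[of "{0}"]) (auto simp: indicator_def)
  qed measurable
qed

lemma integrable_powr_decay:
  fixes f :: "real \<Rightarrow> complex"
  assumes f[measurable]: "f \<in> borel_measurable borel" and D: "\<And>\<xi>. (1 + \<xi>\<^sup>2) * cmod (f \<xi>) \<le> D" and e: "-1 < e" "e \<le> 0"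
  shows "integrable lborel (\<lambda>\<xi>. of_real (\<bar>\<xi>\<bar> powr e) * f \<xi>)"
proof (rule Bochner_Integration.integrable_bound)
  show "integrable lborel (\<lambda>\<xi>. D * (indicator {-1..1} \<xi> * \<bar>\<xi>\<bar> powr e + 1 / (1 + \<xi>\<^sup>2)))"
    by (intro integrable_mult_right Bochner_Integration.integrable_add integrable_abs_powr e integrable_inverse_one_plus_square)
  show "AE \<xi> in lborel. cmod (of_real (\<bar>\<xi>\<bar> powr e) * f \<xi>) \<le> norm (D * (indicator {-1..1} \<xi> * \<bar>\<xi>\<bar> powr e + 1 / (1 + \<xi>\<^sup>2)))"
  proof (intro AE_I2)
    fix \<xi> :: real
    have q: "0 < 1 + \<xi>\<^sup>2" by (simp add: add_pos_nonneg)
    have D0: "0 \<le> D" using order_trans[OF norm_ge_zero, of "f 0" D] D[of 0] by simp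
    have f1: "cmod (f \<xi>) \<le> D / (1 + \<xi>\<^sup>2)" using D[of \<xi>] q by (simp add: field_simps)
    have q1: "1 / (1 + \<xi>\<^sup>2) \<le> 1" using q by simp
    have "\<bar>\<xi>\<bar> powr e * (1 / (1 + \<xi>\<^sup>2)) \<le> indicator {-1..1} \<xi> * \<bar>\<xi>\<bar> powr e + 1 / (1 + \<xi>\<^sup>2)"
    proof (cases "\<bar>\<xi>\<bar> \<le> 1")
      case True
      have "\<bar>\<xi>\<bar> powr e * (1 / (1 + \<xi>\<^sup>2)) \<le> \<bar>\<xi>\<bar> powr e * 1" using q1 by (intro mult_left_mono) auto
      then show ?thesis using True q by (simp add: indicator_def abs_le_iff add_increasing2)
    next
      case False
      have "\<bar>\<xi>\<bar> powr e \<le> 1" using False e powr_mono[of e 0 "\<bar>\<xi>\<bar>"] by (auto split: if_splits)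
      then have "\<bar>\<xi>\<bar> powr e * (1 / (1 + \<xi>\<^sup>2)) \<le> 1 * (1 / (1 + \<xi>\<^sup>2))" using q by (intro mult_right_mono) auto
      then show ?thesis by (simp add: add_increasing)
    qed
    then have "D * (\<bar>\<xi>\<bar> powr e * (1 / (1 + \<xi>\<^sup>2))) \<le> D * (indicator {-1..1} \<xi> * \<bar>\<xi>\<bar> powr e + 1 / (1 + \<xi>\<^sup>2))"
      using D0 by (rule mult_left_mono)
    moreover have "\<bar>\<xi>\<bar> powr e * cmod (f \<xi>) \<le> \<bar>\<xi>\<bar> powr e * (D / (1 + \<xi>\<^sup>2))" using f1 by (intro mult_left_mono) auto
    ultimately have "cmod (of_real (\<bar>\<xi>\<bar> powr e) * f \<xi>) \<le> D * (indicator {-1..1} \<xi> * \<bar>\<xi>\<bar> powr e + 1 / (1 + \<xi>\<^sup>2))"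
      by (simp add: norm_mult mult.commute[of D])
    then show "cmod (of_real (\<bar>\<xi>\<bar> powr e) * f \<xi>) \<le> norm (D * (indicator {-1..1} \<xi> * \<bar>\<xi>\<bar> powr e + 1 / (1 + \<xi>\<^sup>2)))"
      by (rule order_trans) simp
  qed
qed measurable

lemma inv_fourier_integrable_powr:
  assumes "\<phi> \<in> schwartz" "-1 < e" "e \<le> 0"
  shows "integrable lborel (\<lambda>\<xi>. of_real (\<bar>\<xi>\<bar> powr e) * inv_fourier \<phi> \<xi>)"
proof -
  obtain D where D: "\<And>\<xi>. (1 + \<bar>\<xi>\<bar> ^ 2) * cmod (inv_fourier \<phi> \<xi>) \<le> D" using inv_fourier_decay[OF assms(1)] by blast
  show ?thesis
    by (rule integrable_powr_decay[where D=D]) (use assms D in \<open>auto intro: inv_fourier_measurable schwartz_integrable\<close>)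
qed

context gkdv begin

text \<open>The scaling exponents: \<open>self_similar\<close> is
  \<open>t powr (- aa) * v (x / t powr bb)\<close>.\<close>

definition bb :: real where "bb = 1 / (\<alpha> + 1)"
definition aa :: real where "aa = \<alpha> / ((\<alpha> + 1) * real p)"

lemma bb_pos: "0 < bb" using alpha_gt by (simp add: bb_def)
lemma bb_gam: "bb * gam - bb = - aa" by (simp add: bb_def aa_def gam_def sg_def right_diff_distrib)
lemma bb_alpha: "bb * (\<alpha> + 1) = 1" using alpha_gt by (simp add: bb_def)

text \<open>The Fourier transform of the self-similar function with profile \<open>profile a\<close>.\<close>

definition self_similar_symbol :: "(real \<Rightarrow> complex) \<Rightarrow> real \<Rightarrow> real \<Rightarrow> complex" where
  "self_similar_symbol a t \<xi> = of_real (t powr (bb * gam)) * cis (- (t * \<xi> * \<bar>\<xi>\<bar> powr \<alpha>)) *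
     (if 0 < \<xi> then a (t powr bb * \<xi>) else if \<xi> < 0 then cnj (a (t powr bb * (- \<xi>))) else 0)"

lemma self_similar_symbol_minus: "0 < \<xi> \<Longrightarrow> self_similar_symbol a t (- \<xi>) = cnj (self_similar_symbol a t \<xi>)"
  by (simp add: self_similar_symbol_def cis_cnj)

lemma amplitude_measurable:
  assumes a: "amplitude K a a'"
  shows "(\<lambda>\<xi>. if 0 < \<xi> then a \<xi> else 0) \<in> borel_measurable borel"
proof -
  have "(\<lambda>\<xi>. indicator {0<..} \<xi> *\<^sub>R a \<xi>) \<in> borel_measurable borel"
    by (rule borel_measurable_continuous_on_indicator[OF _ amplitude_cont[OF a]]) simp
  moreover have "(\<lambda>\<xi>. indicator {0<..} \<xi> *\<^sub>R a \<xi>) = (\<lambda>\<xi>. if 0 < \<xi> then a \<xi> else 0)" by (auto simp: indicator_def)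
  ultimately show ?thesis by simp
qed

lemma self_similar_symbol_measurable:
  assumes a: "amplitude K a a'" and t: "0 < t"
  shows "self_similar_symbol a t \<in> borel_measurable borel"
proof -
  define A where "A = (\<lambda>\<xi>. if 0 < \<xi> then a \<xi> else 0)"
  have [measurable]: "A \<in> borel_measurable borel" unfolding A_def by (rule amplitude_measurable[OF a])
  have eq: "self_similar_symbol a t = (\<lambda>\<xi>. of_real (t powr (bb * gam)) * cis (- (t * \<xi> * \<bar>\<xi>\<bar> powr \<alpha>)) * (A (t powr bb * \<xi>) + cnj (A (t powr bb * (- \<xi>)))))"
  proof
    fix \<xi> :: real
    have "0 < t powr bb * \<xi> \<longleftrightarrow> 0 < \<xi>" "t powr bb * \<xi> < 0 \<longleftrightarrow> \<xi> < 0" using t by (simp_all add: zero_less_mult_iff mult_less_0_iff)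
    then show "self_similar_symbol a t \<xi> = of_real (t powr (bb * gam)) * cis (- (t * \<xi> * \<bar>\<xi>\<bar> powr \<alpha>)) * (A (t powr bb * \<xi>) + cnj (A (t powr bb * (- \<xi>))))"
      by (simp add: self_similar_symbol_def A_def)
  qed
  have [measurable]: "cnj \<in> borel_measurable borel"
    by (intro borel_measurable_continuous_onI continuous_intros)
  show ?thesis unfolding eq by measurable
qed

lemma amplitude_bound_sum:
  assumes a: "amplitude K a a'" and "0 < \<xi>"
  shows "cmod (a \<xi>) \<le> K * (\<xi> powr (- gam) + 1)"
proof (cases "\<xi> \<le> 1")
  case True then show ?thesis using amplitudeD(3)[OF a, of \<xi>] assms(2) amplitude_K[OF a] by (simp add: distrib_left)
next
  case False then show ?thesis using amplitude_le[OF a, of \<xi>] amplitude_K[OF a] by (simp add: distrib_left add_increasing)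
qed

lemma self_similar_symbol_bound:
  assumes a: "amplitude K a a'" and t: "0 < t"
  shows "cmod (self_similar_symbol a t \<xi>) \<le> t powr (bb * gam) * K * (t powr (- bb * gam) * \<bar>\<xi>\<bar> powr (- gam) + 1)"
proof -
  have K: "0 \<le> K" by (rule amplitude_K[OF a])
  have b: "cmod (a (t powr bb * y)) \<le> K * (t powr (- bb * gam) * y powr (- gam) + 1)" if "0 < y" for y
    using amplitude_bound_sum[OF a, of "t powr bb * y"] t that by (simp add: powr_mult powr_powr)
  show ?thesis
    using b[of \<xi>] b[of "- \<xi>"] K
    by (auto simp: self_similar_symbol_def norm_mult mult.assoc intro!: mult_left_mono mult_nonneg_nonneg add_nonneg_nonneg)
qed

lemma self_similar_symbol_inv_fourier_integrable:
  assumes a: "amplitude K a a'" and t: "0 < t" and \<phi>: "\<phi> \<in> schwartz"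
  shows "integrable lborel (\<lambda>\<xi>. t powr (bb * gam) * K * (t powr (- bb * gam) * \<bar>\<xi>\<bar> powr (- gam) + 1) * cmod (inv_fourier \<phi> \<xi>))"
    and "integrable lborel (\<lambda>\<xi>. self_similar_symbol a t \<xi> * inv_fourier \<phi> \<xi>)"
proof -
  have "integrable lborel (\<lambda>\<xi>. t powr (bb * gam) * K * (t powr (- bb * gam) * cmod (of_real (\<bar>\<xi>\<bar> powr (- gam)) * inv_fourier \<phi> \<xi>) + cmod (inv_fourier \<phi> \<xi>)))"
    by (intro integrable_mult_right Bochner_Integration.integrable_add integrable_norm inv_fourier_integrable_powr inv_fourier_integrable \<phi>)
       (use gam_pos gam_lt in auto)
  then show 1: "integrable lborel (\<lambda>\<xi>. t powr (bb * gam) * K * (t powr (- bb * gam) * \<bar>\<xi>\<bar> powr (- gam) + 1) * cmod (inv_fourier \<phi> \<xi>))"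
    by (simp add: norm_mult algebra_simps)
  note [measurable] = self_similar_symbol_measurable[OF a t] inv_fourier_measurable[OF schwartz_integrable[OF \<phi>]]
  show "integrable lborel (\<lambda>\<xi>. self_similar_symbol a t \<xi> * inv_fourier \<phi> \<xi>)"
  proof (rule Bochner_Integration.integrable_bound[OF 1])
    have "cmod (self_similar_symbol a t \<xi> * inv_fourier \<phi> \<xi>) \<le> t powr (bb * gam) * K * (t powr (- bb * gam) * \<bar>\<xi>\<bar> powr (- gam) + 1) * cmod (inv_fourier \<phi> \<xi>)" for \<xi>
      unfolding norm_mult by (intro mult_right_mono self_similar_symbol_bound[OF a t]) auto
    then show "AE \<xi> in lborel. cmod (self_similar_symbol a t \<xi> * inv_fourier \<phi> \<xi>) \<le> norm (t powr (bb * gam) * K * (t powr (- bb * gam) * \<bar>\<xi>\<bar> powr (- gam) + 1) * cmod (inv_fourier \<phi> \<xi>))"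
      unfolding real_norm_def by (blast intro: AE_I2 order_trans abs_ge_self)
  qed measurable
qed

text \<open>Cutting off at \<open>n\<close> makes the symbol integrable. The substitution \<zeta> =
  \<open>t powr bb * \<xi>\<close> turns the group phase into
  \<open>\<zeta> powr (\<alpha> + 1)\<close> because bb * (\<alpha> + 1) = 1, and conjugate symmetry
  leaves the positive frequencies.\<close>

lemma inv_fourier_truncated_symb:
  assumes a: "amplitude K a a'" and t: "0 < t" and n: "0 \<le> n"
  defines "g \<equiv> \<lambda>\<xi>. of_real (indicator {-n..n} \<xi>) * self_similar_symbol a t \<xi>"
  shows "integrable lborel g"
    and "inv_fourier g x = of_real (t powr (- aa) * (Re (trunc a (x / t powr bb) (t powr bb * n)) / pi))"
proof -
  have K: "0 \<le> K" by (rule amplitude_K[OF a])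
  note [measurable] = self_similar_symbol_measurable[OF a t]
  show gi: "integrable lborel g"
  proof (rule Bochner_Integration.integrable_bound)
    show "integrable lborel (\<lambda>\<xi>. t powr (bb * gam) * K * (t powr (- bb * gam) * (indicator {-n..n} \<xi> * \<bar>\<xi>\<bar> powr (- gam)) + indicator {-n..n} \<xi>))"
      using n by (intro integrable_mult_right Bochner_Integration.integrable_add integrable_abs_powr) (use gam_lt in \<open>auto simp: integrable_indicator_iff\<close>)
    have "cmod (g \<xi>) \<le> t powr (bb * gam) * K * (t powr (- bb * gam) * (indicator {-n..n} \<xi> * \<bar>\<xi>\<bar> powr (- gam)) + indicator {-n..n} \<xi>)" for \<xi>
      using self_similar_symbol_bound[OF a t, of \<xi>] by (cases "\<xi> \<in> {-n..n}") (auto simp: g_def)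
    then show "AE \<xi> in lborel. cmod (g \<xi>) \<le> norm (t powr (bb * gam) * K * (t powr (- bb * gam) * (indicator {-n..n} \<xi> * \<bar>\<xi>\<bar> powr (- gam)) + indicator {-n..n} \<xi>))"
      unfolding real_norm_def by (blast intro: AE_I2 order_trans abs_ge_self)
    show "g \<in> borel_measurable lborel" unfolding g_def by measurable
  qed
  define F where "F = (\<lambda>\<xi>. cis (x * \<xi>) * g \<xi>)"
  have Fi: "integrable lborel F" unfolding F_def by (rule integrable_cis_mult[OF gi]) simp
  have Fs: "F (- \<xi>) = cnj (F \<xi>)" if "0 < \<xi>" for \<xi>
    using self_similar_symbol_minus[OF that, of a t] by (auto simp: F_def g_def cis_cnj indicator_def)
  define R where "R = t powr bb * n"
  have tb: "0 < t powr bb" "0 < t powr (- bb)" using t by auto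
  have "(LINT \<xi>:{0<..}|lborel. F \<xi>) = (LINT \<xi>|lborel. indicator {0<..} \<xi> *\<^sub>R F \<xi>)" by (simp add: set_lebesgue_integral_def)
  also have "\<dots> = of_real (t powr (- bb)) * (LINT \<zeta>|lborel. indicator {0<..} (0 + t powr (- bb) * \<zeta>) *\<^sub>R F (0 + t powr (- bb) * \<zeta>))"
    by (rule LINT_substitution[OF tb(2)])
  also have "(LINT \<zeta>|lborel. indicator {0<..} (0 + t powr (- bb) * \<zeta>) *\<^sub>R F (0 + t powr (- bb) * \<zeta>)) =
     (LINT \<zeta>|lborel. of_real (t powr (bb * gam)) * (indicator {0<..R} \<zeta> *\<^sub>R (cis (phase (x / t powr bb) \<zeta>) * a \<zeta>)))"
  proof (intro Bochner_Integration.integral_cong refl)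
    fix \<zeta> :: real
    show "indicator {0<..} (0 + t powr (- bb) * \<zeta>) *\<^sub>R F (0 + t powr (- bb) * \<zeta>) = of_real (t powr (bb * gam)) * (indicator {0<..R} \<zeta> *\<^sub>R (cis (phase (x / t powr bb) \<zeta>) * a \<zeta>))"
    proof (cases "0 < \<zeta>")
      case True
      define \<xi> where "\<xi> = t powr (- bb) * \<zeta>"
      have \<xi>: "0 < \<xi>" using tb True by (simp add: \<xi>_def)
      have z: "t powr bb * \<xi> = \<zeta>" using t by (simp add: \<xi>_def mult.assoc[symmetric] flip: powr_add)
      have in_iff: "\<xi> \<in> {-n..n} \<longleftrightarrow> \<zeta> \<in> {0<..R}"
        using \<xi> True n tb unfolding R_def z[symmetric] by auto
      have "t * \<xi> * \<bar>\<xi>\<bar> powr \<alpha> = t * \<xi> powr (\<alpha> + 1)" using \<xi> by (simp add: powr_add mult_ac)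
      also have "\<dots> = t * (t powr (- bb * (\<alpha> + 1)) * \<zeta> powr (\<alpha> + 1))"
        unfolding \<xi>_def using t True by (simp add: powr_mult powr_powr)
      also have "\<dots> = \<zeta> powr (\<alpha> + 1)" using t by (simp add: bb_alpha powr_minus)
      finally have p1: "t * \<xi> * \<bar>\<xi>\<bar> powr \<alpha> = \<zeta> powr (\<alpha> + 1)" .
      have p2: "x * \<xi> = x / t powr bb * \<zeta>" by (simp add: \<xi>_def powr_minus divide_inverse)
      have c: "cis (x * \<xi>) * cis (- (t * \<xi> * \<bar>\<xi>\<bar> powr \<alpha>)) = cis (phase (x / t powr bb) \<zeta>)"
        unfolding cis_mult p1 p2 by (simp add: phase_def)
      have "F \<xi> = of_real (indicator {-n..n} \<xi>) * of_real (t powr (bb * gam)) * (cis (x * \<xi>) * cis (- (t * \<xi> * \<bar>\<xi>\<bar> powr \<alpha>))) * a (t powr bb * \<xi>)"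
        using \<xi> by (simp add: F_def g_def self_similar_symbol_def)
      then have "F \<xi> = of_real (indicator {0<..R} \<zeta>) * of_real (t powr (bb * gam)) * cis (phase (x / t powr bb) \<zeta>) * a \<zeta>"
        unfolding c z using in_iff by (simp add: indicator_def)
      then show ?thesis using True \<xi> by (simp add: \<xi>_def[symmetric] scaleR_conv_of_real)
    next
      case False
      then show ?thesis using tb by (auto simp: zero_less_mult_iff)
    qed
  qed
  also have "\<dots> = of_real (t powr (bb * gam)) * (LINT \<zeta>:{0<..R}|lborel. cis (phase (x / t powr bb) \<zeta>) * a \<zeta>)"
    unfolding set_lebesgue_integral_def by (rule integral_mult_right_zero)
  also have "(LINT \<zeta>:{0<..R}|lborel. cis (phase (x / t powr bb) \<zeta>) * a \<zeta>) = trunc a (x / t powr bb) R"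
  proof -
    have "set_integrable lborel {0<..R} (\<lambda>\<zeta>. cis (phase (x / t powr bb) \<zeta>) * a \<zeta>)"
    proof (rule set_integrable_powr_bound[where e="- gam"])
      show "continuous_on {0<..R} (\<lambda>\<zeta>. cis (phase (x / t powr bb) \<zeta>) * a \<zeta>)"
        by (intro continuous_intros continuous_on_subset[OF phase_cont'] continuous_on_subset[OF amplitude_cont[OF a]]) auto
    qed (use amplitude_powr[OF a] gam_lt in \<open>auto simp: norm_mult\<close>)
    from set_borel_integral_eq_integral(2)[OF this] show ?thesis by (simp add: integral_Ioc_eq)
  qed
  \<comment> \<open>The Jacobian \<open>t powr (- bb)\<close> and the prefactor of the symbol
    combine to the amplitude exponent of \<open>self_similar\<close>, by
    \<open>bb_gam\<close>.\<close>
  also have "of_real (t powr (- bb)) * (of_real (t powr (bb * gam)) * trunc a (x / t powr bb) R) = of_real (t powr (- aa)) * trunc a (x / t powr bb) R"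
    using t by (simp add: mult.assoc[symmetric] bb_gam[symmetric] flip: of_real_mult powr_add)
  finally have L: "(LINT \<xi>:{0<..}|lborel. F \<xi>) = of_real (t powr (- aa)) * trunc a (x / t powr bb) R" .
  have "inv_fourier g x = of_real (1 / (2 * pi)) * (LINT \<xi>|lborel. F \<xi>)" by (simp add: inv_fourier_def F_def)
  also have "\<dots> = of_real (1 / (2 * pi)) * of_real (2 * Re (of_real (t powr (- aa)) * trunc a (x / t powr bb) R))"
    by (simp only: LINT_conj_symmetric[OF Fi Fs] L)
  finally show "inv_fourier g x = of_real (t powr (- aa) * (Re (trunc a (x / t powr bb) (t powr bb * n)) / pi))"
    by (simp add: R_def field_simps)
qed

text \<open>For truncated symbols this is the multiplication formula. Both sides converge under
  domination: in frequency by the integrability of the symbol against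
  \<open>inv_fourier \<phi>\<close>, in space by the truncation-independent
  \<open>trunc_bound\<close>.\<close>

lemma profile_representation:
  assumes a: "amplitude K a a'" and t: "0 < t" and \<phi>: "\<phi> \<in> schwartz"
  shows "(LINT x|lborel. of_real (t powr (- aa) * profile a (x / t powr bb)) * \<phi> x) = (LINT \<xi>|lborel. self_similar_symbol a t \<xi> * inv_fourier \<phi> \<xi>)"
proof (rule LIMSEQ_unique)
  let ?g = "\<lambda>n \<xi>. of_real (indicator {-real n..real n} \<xi>) * self_similar_symbol a t \<xi>"
  have K: "0 \<le> K" by (rule amplitude_K[OF a])
  note [measurable] = self_similar_symbol_measurable[OF a t] inv_fourier_measurable[OF schwartz_integrable[OF \<phi>]] schwartz_measurable[OF \<phi>]
  have eq: "(LINT \<xi>|lborel. ?g n \<xi> * inv_fourier \<phi> \<xi>) =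
     (LINT x|lborel. \<phi> x * of_real (t powr (- aa) * (Re (trunc a (x / t powr bb) (t powr bb * real n)) / pi)))" for n
    by (subst inv_fourier_multiplication[OF schwartz_integrable[OF \<phi>] inv_fourier_truncated_symb(1)[OF a t]])
       (auto simp: inv_fourier_truncated_symb(2)[OF a t])
  show "(\<lambda>n. LINT \<xi>|lborel. ?g n \<xi> * inv_fourier \<phi> \<xi>) \<longlonglongrightarrow> (LINT \<xi>|lborel. self_similar_symbol a t \<xi> * inv_fourier \<phi> \<xi>)"
  proof (rule integral_dominated_convergence[where w="\<lambda>\<xi>. cmod (self_similar_symbol a t \<xi> * inv_fourier \<phi> \<xi>)"])
    show "AE \<xi> in lborel. (\<lambda>n. ?g n \<xi> * inv_fourier \<phi> \<xi>) \<longlonglongrightarrow> self_similar_symbol a t \<xi> * inv_fourier \<phi> \<xi>"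
    proof (intro AE_I2 tendsto_eventually)
      fix \<xi> :: real
      have "\<forall>\<^sub>F n in sequentially. \<bar>\<xi>\<bar> + 1 \<le> real n" by (rule filterlim_real_sequentially[unfolded filterlim_at_top, rule_format])
      then show "\<forall>\<^sub>F n in sequentially. ?g n \<xi> * inv_fourier \<phi> \<xi> = self_similar_symbol a t \<xi> * inv_fourier \<phi> \<xi>"
        by eventually_elim (auto simp: indicator_def)
    qed
  qed (use integrable_norm[OF self_similar_symbol_inv_fourier_integrable(2)[OF a t \<phi>]] in \<open>auto simp: indicator_def norm_mult\<close>)
  show "(\<lambda>n. LINT \<xi>|lborel. ?g n \<xi> * inv_fourier \<phi> \<xi>) \<longlonglongrightarrow> (LINT x|lborel. of_real (t powr (- aa) * profile a (x / t powr bb)) * \<phi> x)"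
    unfolding eq
  proof (rule integral_dominated_convergence[where w="\<lambda>x. t powr (- aa) * (osc_const * K) * cmod (\<phi> x)"])
    show "integrable lborel (\<lambda>x. t powr (- aa) * (osc_const * K) * cmod (\<phi> x))"
      by (intro integrable_mult_right integrable_norm schwartz_integrable \<phi>)
    have lim: "filterlim (\<lambda>n. t powr bb * real n) at_top sequentially"
      using t by (intro filterlim_tendsto_pos_mult_at_top[OF tendsto_const] filterlim_real_sequentially) auto
    show "AE x in lborel. (\<lambda>n. \<phi> x * of_real (t powr (- aa) * (Re (trunc a (x / t powr bb) (t powr bb * real n)) / pi))) \<longlonglongrightarrow> of_real (t powr (- aa) * profile a (x / t powr bb)) * \<phi> x"
      unfolding profile_def mult.commute[of "complex_of_real _" "\<phi> _"]
      by (intro AE_I2 tendsto_intros filterlim_compose[OF trunc_tendsto[OF a] lim]) auto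
    fix n
    show "AE x in lborel. cmod (\<phi> x * of_real (t powr (- aa) * (Re (trunc a (x / t powr bb) (t powr bb * real n)) / pi))) \<le> t powr (- aa) * (osc_const * K) * cmod (\<phi> x)"
    proof (intro AE_I2)
      fix x
      let ?T = "trunc a (x / t powr bb) (t powr bb * real n)"
      have "\<bar>Re ?T / pi\<bar> \<le> cmod ?T / 1"
        using abs_Re_le_cmod[of ?T] pi_gt3 unfolding abs_divide by (intro frac_le) auto
      also have "\<dots> \<le> osc_const * K * dec (x / t powr bb)"
        using trunc_bound[OF a, of "t powr bb * real n" "x / t powr bb"] t by simp
      also have "\<dots> \<le> osc_const * K" using osc_const_pos K dec_le_one by (intro mult_left_le mult_nonneg_nonneg) auto
      finally have "cmod (\<phi> x) * (t powr (- aa) * \<bar>Re ?T / pi\<bar>) \<le> cmod (\<phi> x) * (t powr (- aa) * (osc_const * K))"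
        by (intro mult_left_mono) auto
      then show "cmod (\<phi> x * of_real (t powr (- aa) * (Re ?T / pi))) \<le> t powr (- aa) * (osc_const * K) * cmod (\<phi> x)"
        by (simp add: norm_mult abs_mult mult_ac del: of_real_mult of_real_divide)
    qed
  next
    have c: "continuous_on UNIV (\<lambda>x. trunc a (x / t powr bb) (t powr bb * real n))" for n
      using t by (intro continuous_on_compose2[OF trunc_continuous[OF a]] continuous_intros) auto
    show "(\<lambda>x. \<phi> x * of_real (t powr (- aa) * (Re (trunc a (x / t powr bb) (t powr bb * real n)) / pi))) \<in> borel_measurable lborel" for n
      using borel_measurable_continuous_onI[OF c[of n]] by measurable
    have "continuous_on UNIV (\<lambda>x. profile a (x / t powr bb))"
      using t by (intro continuous_on_compose2[OF profile_continuous[OF a, of UNIV]] continuous_intros) auto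
    then have "(\<lambda>x. profile a (x / t powr bb)) \<in> borel_measurable borel" by (rule borel_measurable_continuous_onI)
    then show "(\<lambda>x. of_real (t powr (- aa) * profile a (x / t powr bb)) * \<phi> x) \<in> borel_measurable lborel" by measurable
  qed
qed

end

section \<open>Fourier transform of homogeneous data\<close>

lemma integrable_nonneg_of_has_integral:
  fixes f :: "real \<Rightarrow> real"
  assumes i: "f integrable_on S" and S: "S \<in> sets borel" and f: "f \<in> borel_measurable borel" and nn: "\<And>x. x \<in> S \<Longrightarrow> 0 \<le> f x"
  shows "integrable lborel (\<lambda>x. indicator S x * f x)"
proof -
  have "f absolutely_integrable_on S" by (rule nonnegative_absolutely_integrable_1[OF i nn])
  then have "integrable lebesgue (\<lambda>x. indicator S x *\<^sub>R f x)" by (simp add: set_integrable_def)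
  moreover have "(\<lambda>x. indicator S x *\<^sub>R f x) \<in> borel_measurable lborel"
    using S f by measurable
  ultimately show ?thesis by (simp add: integrable_completion)
qed

lemma norm_add_i_ge:
  fixes l \<xi> :: real
  assumes "0 < l"
  shows "max l \<bar>\<xi>\<bar> \<le> cmod (of_real l + \<i> * of_real \<xi>)"
  using abs_Re_le_cmod[of "of_real l + \<i> * of_real \<xi>"] abs_Im_le_cmod[of "of_real l + \<i> * of_real \<xi>"] assms by simp

lemma laplace_exponential:
  assumes l: "0 < l"
  shows "integrable lborel (\<lambda>x. indicator {0<..} x * exp (- (l * x)) :: real)"
    and "(LINT x|lborel. of_real (indicator {0<..} x * exp (- (l * x))) * cis (- (x * \<xi>))) = 1 / (of_real l + \<i> * of_real \<xi>)"
proof -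
  have i0: "integrable lborel (\<lambda>x. indicator {0..} x * exp (- l * x) :: real)"
    by (rule integrable_nonneg_of_has_integral[OF integrable_on_exp_minus_to_infinity[OF l]]) auto
  show 1: "integrable lborel (\<lambda>x. indicator {0<..} x * exp (- (l * x)) :: real)"
    by (rule Bochner_Integration.integrable_bound[OF i0]) (auto simp: indicator_def)
  define z where "z = of_real l + \<i> * of_real \<xi>"
  have z: "z \<noteq> 0" using l by (auto simp: z_def complex_eq_iff)
  have e: "of_real (exp (- (l * x))) * cis (- (x * \<xi>)) = exp (- (z * of_real x))" for x
    by (simp add: cis_conv_exp exp_of_real[symmetric] z_def algebra_simps flip: exp_add)
  let ?F = "\<lambda>x. - (exp (- (z * of_real x)) / z)"
  have i: "integrable lborel (\<lambda>x. cis (- (x * \<xi>)) * of_real (indicator {0<..} x * exp (- (l * x))))"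
    by (rule integrable_cis_mult[OF complex_of_real_integrable_eq[THEN iffD2, OF 1]]) simp
  have ind: "of_real (indicator {0<..} x * exp (- (l * x))) * cis (- (x * \<xi>)) = indicator {0<..} x *\<^sub>R exp (- (z * of_real x))" for x
    by (simp add: e[symmetric] indicator_def)
  have ei: "einterval 0 \<infinity> = {0::real<..}" by (auto simp: einterval_def)
  have "(LBINT x=0..\<infinity>. exp (- (z * of_real x))) = 0 - ?F 0"
  proof (rule interval_integral_FTC_integrable)
    show "(?F has_vector_derivative exp (- (z * of_real x))) (at x)" for x
    proof (rule has_vector_derivative_real_field)
      show "((\<lambda>w. - (exp (- (z * w)) / z)) has_field_derivative exp (- (z * of_real x))) (at (of_real x))"
        using z by (auto intro!: derivative_eq_intros)
    qed
    show "set_integrable lborel (einterval 0 \<infinity>) (\<lambda>x. exp (- (z * of_real x)))"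
      using i unfolding set_integrable_def ei ind[symmetric] by (simp add: mult.commute)
    show "((?F \<circ> real_of_ereal) \<longlongrightarrow> ?F 0) (at_right 0)"
    proof -
      have "((\<lambda>x. ?F x) \<longlongrightarrow> ?F 0) (at_right 0)" by (intro tendsto_intros) (use z in auto)
      then show ?thesis by (simp add: ereal_tendsto_simps zero_ereal_def)
    qed
    have "((\<lambda>x. exp (- (l * x)) / cmod z) \<longlongrightarrow> 0) at_top"
      using l by (auto intro!: tendsto_divide_zero filterlim_compose[OF exp_at_bot] filterlim_tendsto_pos_mult_at_top[OF tendsto_const] filterlim_ident simp: filterlim_uminus_at_bot)
    then have "(?F \<longlongrightarrow> 0) at_top"
      by (rule Lim_null_comparison[rotated]) (auto simp: norm_divide e[symmetric] norm_mult)
    then show "((?F \<circ> real_of_ereal) \<longlongrightarrow> 0) (at_left \<infinity>)" by (simp add: ereal_tendsto_simps)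
  qed (auto intro!: continuous_intros)
  moreover have "(LBINT x=0..\<infinity>. exp (- (z * of_real x))) = (LINT x|lborel. of_real (indicator {0<..} x * exp (- (l * x))) * cis (- (x * \<xi>)))"
    unfolding ind by (simp add: interval_lebesgue_integral_def set_lebesgue_integral_def ei)
  ultimately show "(LINT x|lborel. of_real (indicator {0<..} x * exp (- (l * x))) * cis (- (x * \<xi>))) = 1 / (of_real l + \<i> * of_real \<xi>)"
    by (simp add: z_def)
qed

context gkdv begin

text \<open>The power \<open>x powr (- sg)\<close> on the half-line is a superposition of the exponentials \<open>exp (- l * x)\<close> with
  weight \<open>l powr (- gam) / G0\<close>, where \<open>G0\<close> is \<open>Gamma sg\<close>. As \<open>exp (- l * x)\<close> has the Fourier
  transform \<open>1 / (l + \<i> \<xi>)\<close>, the transform of the power follows by scaling in \<open>l\<close>.\<close>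

definition kmax :: "real \<Rightarrow> real" where "kmax \<mu> = indicator {0<..} \<mu> * (\<mu> powr (- gam) / max \<mu> 1)"
definition kgam :: "real \<Rightarrow> real" where "kgam \<mu> = indicator {0<..} \<mu> * (\<mu> powr (- gam) * exp (- \<mu>))"
definition G0 :: real where "G0 = (LINT \<mu>|lborel. kgam \<mu>)"
definition M0 :: real where "M0 = (LINT \<mu>|lborel. kmax \<mu>)"
definition c0 :: complex where "c0 = of_real (1 / G0) * (LINT \<mu>|lborel. of_real (indicator {0<..} \<mu> * \<mu> powr (- gam)) / (of_real \<mu> + \<i>))"

text \<open>\<open>kmax\<close> dominates \<open>kgam\<close> and, because max \<mu> 1 \<le> |\<mu>
  + \<i>|, also the modulus of the integrand in \<open>c0\<close>. Its exponents are - gam > -1 at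
  the origin and - gam - 1 < -1 at infinity.\<close>

lemma kmax_integrable: "integrable lborel kmax"
proof -
  have 1: "integrable lborel (\<lambda>x::real. indicator {-1..1} x * \<bar>x\<bar> powr (- gam))" by (rule integrable_abs_powr) (use gam_lt in auto)
  have "(\<lambda>x::real. x powr (- gam - 1)) integrable_on {1..}"
    using has_integral_powr_to_inf[of "- gam - 1" 1] gam_pos by (auto intro: has_integral_integrable)
  then have 2: "integrable lborel (\<lambda>x::real. indicator {1..} x * x powr (- gam - 1))"
    by (rule integrable_nonneg_of_has_integral) auto
  show ?thesis
  proof (rule Bochner_Integration.integrable_bound[OF Bochner_Integration.integrable_add[OF 1 2]])
    show "kmax \<in> borel_measurable lborel" unfolding kmax_def[abs_def] by measurable
    have "kmax x \<le> indicator {-1..1} x * \<bar>x\<bar> powr (- gam) + indicator {1..} x * x powr (- gam - 1)" for x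
      by (auto simp: kmax_def indicator_def max_def powr_diff)
    then show "AE x in lborel. norm (kmax x) \<le> norm (indicator {-1..1} x * \<bar>x\<bar> powr (- gam) + indicator {1..} x * x powr (- gam - 1))"
      by (intro AE_I2) (simp add: kmax_def abs_of_nonneg)
  qed
qed

lemma kgam_le: "kgam \<mu> \<le> kmax \<mu>"
proof (cases "0 < \<mu>")
  case True
  have "exp (- \<mu>) \<le> 1 / max \<mu> 1"
  proof -
    have "max \<mu> 1 \<le> exp \<mu>" using exp_ge_add_one_self[of \<mu>] True by linarith
    then have "1 / exp \<mu> \<le> 1 / max \<mu> 1" using True by (intro divide_left_mono) auto
    then show ?thesis by (simp add: exp_minus inverse_eq_divide)
  qed
  then have "\<mu> powr (- gam) * exp (- \<mu>) \<le> \<mu> powr (- gam) * (1 / max \<mu> 1)" by (intro mult_left_mono) auto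
  then show ?thesis using True by (simp add: kgam_def kmax_def)
qed (simp add: kgam_def kmax_def)

lemma kgam_integrable: "integrable lborel kgam"
proof (rule Bochner_Integration.integrable_bound[OF kmax_integrable])
  show "kgam \<in> borel_measurable lborel" unfolding kgam_def[abs_def] by measurable
  show "AE x in lborel. norm (kgam x) \<le> norm (kmax x)"
  proof (intro AE_I2)
    fix x have "0 \<le> kgam x" "0 \<le> kmax x" by (auto simp: kgam_def kmax_def)
    then show "norm (kgam x) \<le> norm (kmax x)" using kgam_le[of x] by simp
  qed
qed

lemma G0_pos: "0 < G0"
proof -
  have "0 < exp (- 2) * 2 powr (- gam)" by simp
  also have "\<dots> = (LINT \<mu>|lborel. indicator {1..2::real} \<mu> * (exp (- 2) * 2 powr (- gam)))" by simp
  also have "\<dots> \<le> G0" unfolding G0_def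
  proof (rule integral_mono)
    show "integrable lborel kgam" by (rule kgam_integrable)
    fix \<mu> :: real
    show "indicator {1..2} \<mu> * (exp (- 2) * 2 powr (- gam)) \<le> kgam \<mu>"
    proof (cases "\<mu> \<in> {1..2}")
      case True
      have "2 powr (- gam) \<le> \<mu> powr (- gam)" using True gam_pos by (intro powr_mono2') auto
      then have "2 powr (- gam) * exp (- 2) \<le> \<mu> powr (- gam) * exp (- \<mu>)" using True by (intro mult_mono) auto
      then show ?thesis using True by (simp add: kgam_def mult.commute)
    qed (auto simp: kgam_def)
  qed (auto simp: integrable_indicator_iff intro!: integrable_mult_left)
  finally show ?thesis .
qed

lemma kgam_scaled: 
  assumes "0 < x"
  shows "(LINT l|lborel. indicator {0<..} l * (l powr (- gam) * exp (- (l * x)))) = x powr (- sg) * G0"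
proof -
  have "(LINT l|lborel. indicator {0<..} l * (l powr (- gam) * exp (- (l * x)))) =
     \<bar>1 / x\<bar> *\<^sub>R (LINT \<mu>|lborel. indicator {0<..} (0 + 1 / x * \<mu>) * ((0 + 1 / x * \<mu>) powr (- gam) * exp (- ((0 + 1 / x * \<mu>) * x))))"
    using assms by (intro lborel_integral_real_affine) auto
  also have "(LINT \<mu>|lborel. indicator {0<..} (0 + 1 / x * \<mu>) * ((0 + 1 / x * \<mu>) powr (- gam) * exp (- ((0 + 1 / x * \<mu>) * x)))) = (LINT \<mu>|lborel. x powr gam * kgam \<mu>)"
    using assms by (intro Bochner_Integration.integral_cong) (auto simp: kgam_def indicator_def powr_divide powr_minus zero_less_divide_iff field_simps)
  also have "\<bar>1 / x\<bar> *\<^sub>R \<dots> = x powr (- sg) * G0"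
    using assms by (simp add: G0_def gam_def powr_diff powr_minus field_simps)
  finally show ?thesis .
qed

text \<open>Bounds the integral over \<open>l\<close> of the weight times 1 / |l + \<i> \<xi>|, with
  y = |\<xi>|. The resulting \<open>y powr (- gam)\<close> is the singularity against which test
  functions are assumed integrable in \<open>fourier_half_power\<close>.\<close>

lemma kmax_scaled:
  assumes "0 < y"
  shows "integrable lborel (\<lambda>l. indicator {0<..} l * (l powr (- gam) / max l y))"
    "(LINT l|lborel. indicator {0<..} l * (l powr (- gam) / max l y)) = y powr (- gam) * M0"
proof -
  have e: "indicator {0<..} (y * \<mu>) * ((y * \<mu>) powr (- gam) / max (y * \<mu>) y) = y powr (- gam) / y * kmax \<mu>" for \<mu>
  proof -
    have "max (y * \<mu>) y = y * max \<mu> 1" using assms by (simp add: max_mult_distrib_left)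
    then show ?thesis using assms by (auto simp: kmax_def indicator_def powr_mult zero_less_mult_iff)
  qed
  have "integrable lborel (\<lambda>\<mu>. indicator {0<..} (0 + y * \<mu>) * ((0 + y * \<mu>) powr (- gam) / max (0 + y * \<mu>) y))"
    unfolding add_0 e by (intro integrable_mult_right kmax_integrable)
  then show "integrable lborel (\<lambda>l. indicator {0<..} l * (l powr (- gam) / max l y))"
    using lborel_integrable_real_affine_iff[of y "\<lambda>l. indicator {0<..} l * (l powr (- gam) / max l y)" 0] assms by auto
  show "(LINT l|lborel. indicator {0<..} l * (l powr (- gam) / max l y)) = y powr (- gam) * M0"
    using lborel_integral_real_affine[of y "\<lambda>l. indicator {0<..} l * (l powr (- gam) / max l y)" 0] assms
    unfolding add_0 e integral_mult_right_zero M0_def[symmetric] by simp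
qed

text \<open>The Fourier transform of \<open>x powr (- sg)\<close> on x > 0; \<open>c0\<close> is its
  value at \<xi> = 1, and homogeneity together with conjugation gives the rest.\<close>

definition half_line_fourier :: "real \<Rightarrow> complex" where
  "half_line_fourier \<xi> = of_real (\<bar>\<xi>\<bar> powr (- gam)) * (if 0 < \<xi> then c0 else cnj c0)"

lemma c0_scaled:
  assumes "\<xi> \<noteq> 0"
  shows "(LINT l|lborel. of_real (indicator {0<..} l * l powr (- gam)) / (of_real l + \<i> * of_real \<xi>)) = of_real G0 * half_line_fourier \<xi>"
proof -
  define k where "k = (\<lambda>\<mu>. of_real (indicator {0<..} \<mu> * \<mu> powr (- gam)) / (of_real \<mu> + \<i>))"
  define y where "y = \<bar>\<xi>\<bar>"
  have y: "0 < y" using assms by (simp add: y_def)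
  have "(LINT l|lborel. of_real (indicator {0<..} l * l powr (- gam)) / (of_real l + \<i> * of_real \<xi>)) =
    of_real y * (LINT \<mu>|lborel. of_real (indicator {0<..} (0 + y * \<mu>) * (0 + y * \<mu>) powr (- gam)) / (of_real (0 + y * \<mu>) + \<i> * of_real \<xi>))"
    by (rule LINT_substitution[OF y])
  also have "\<dots> = of_real (y powr (- gam)) * (LINT \<mu>|lborel. (if 0 < \<xi> then k \<mu> else cnj (k \<mu>)))"
  proof -
    have "of_real y * (of_real (indicator {0<..} (0 + y * \<mu>) * (0 + y * \<mu>) powr (- gam)) / (of_real (0 + y * \<mu>) + \<i> * of_real \<xi>)) =
       of_real (y powr (- gam)) * (if 0 < \<xi> then k \<mu> else cnj (k \<mu>))" for \<mu>
    proof (cases "0 < \<mu>")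
      case True
      have x: "complex_of_real \<xi> = of_real y * of_real (sgn \<xi>)"
        by (simp add: y_def abs_mult_sgn flip: of_real_mult)
      have d: "of_real (0 + y * \<mu>) + \<i> * of_real \<xi> = of_real y * (of_real \<mu> + \<i> * of_real (sgn \<xi>))"
        by (subst x) (simp add: algebra_simps)
      have "of_real (indicator {0<..} (0 + y * \<mu>) * (0 + y * \<mu>) powr (- gam)) = (of_real (y powr (- gam) * \<mu> powr (- gam)) :: complex)"
        using True y by (simp add: powr_mult)
      then show ?thesis unfolding d using True y assms
        by (auto simp: k_def sgn_if)
    next
      case False
      then show ?thesis using y by (auto simp: k_def zero_less_mult_iff indicator_def)
    qed
    then show ?thesis by (simp flip: integral_mult_right_zero)
  qed
  also have "(LINT \<mu>|lborel. (if 0 < \<xi> then k \<mu> else cnj (k \<mu>))) = of_real G0 * (if 0 < \<xi> then c0 else cnj c0)"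
  proof -
    have kk: "(LINT \<mu>|lborel. k \<mu>) = of_real G0 * c0" using G0_pos by (simp add: c0_def k_def)
    show ?thesis by (cases "0 < \<xi>") (simp_all add: kk)
  qed
  finally show ?thesis by (simp add: half_line_fourier_def y_def)
qed

text \<open>For each \<open>l\<close> the exponential is integrable and Fubini moves the transform
  off \<open>\<psi>\<close>; then both sides are integrated in \<open>l\<close> against the weight.
  The integrability assumptions replace membership in \<open>schwartz\<close>, because the lemma is
  applied to inverse Fourier transforms as well.\<close>

lemma fourier_half_power:
  assumes \<psi>: "integrable lborel \<psi>" and \<psi>g: "integrable lborel (\<lambda>\<xi>. of_real (\<bar>\<xi>\<bar> powr (- gam)) * \<psi> \<xi>)"
    and \<psi>f: "integrable lborel (\<lambda>x. of_real (\<bar>x\<bar> powr (- sg)) * fourier \<psi> x)"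
  shows "(LINT x|lborel. of_real (indicator {0<..} x * \<bar>x\<bar> powr (- sg)) * fourier \<psi> x) = (LINT \<xi>|lborel. half_line_fourier \<xi> * \<psi> \<xi>)"
proof -
  have [measurable]: "\<psi> \<in> borel_measurable borel" using \<psi> by (auto dest: borel_measurable_integrable)
  note [measurable] = fourier_measurable[OF \<psi>]
  define w where "w = (\<lambda>l. indicator {0<..} l * l powr (- gam))"
  have [measurable]: "w \<in> borel_measurable borel" unfolding w_def by measurable
  have w0: "0 \<le> w l" for l by (simp add: w_def)
  have lap: "(LINT x|lborel. of_real (indicator {0<..} x * exp (- (l * x))) * fourier \<psi> x) = (LINT \<xi>|lborel. \<psi> \<xi> / (of_real l + \<i> * of_real \<xi>))" if l: "0 < l" for l
  proof -
    have "(LINT x|lborel. LINT \<xi>|lborel. of_real (indicator {0<..} x * exp (- (l * x))) * (cis (- (\<xi> * x)) * \<psi> \<xi>)) =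
       (LINT \<xi>|lborel. LINT x|lborel. of_real (indicator {0<..} x * exp (- (l * x))) * (cis (- (\<xi> * x)) * \<psi> \<xi>))"
      by (rule LINT_Fubini_product(1)[OF _ laplace_exponential(1)[OF l] integrable_norm[OF \<psi>]]) (auto simp: norm_mult)
    also have "\<dots> = (LINT \<xi>|lborel. \<psi> \<xi> * (LINT x|lborel. of_real (indicator {0<..} x * exp (- (l * x))) * cis (- (x * \<xi>))))"
      by (simp add: mult_ac flip: integral_mult_right_zero)
    finally show ?thesis unfolding laplace_exponential(2)[OF l] by (simp add: fourier_def)
  qed
  \<comment> \<open>Integrating in \<open>l\<close> first reassembles the power,
    \<open>kgam_scaled\<close>.\<close>
  have A: "(LINT l|lborel. LINT x|lborel. of_real (w l) * (of_real (indicator {0<..} x * exp (- (l * x))) * fourier \<psi> x)) =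
    (LINT x|lborel. of_real (indicator {0<..} x * \<bar>x\<bar> powr (- sg)) * fourier \<psi> x) * of_real G0"
  proof -
    have wi: "(LINT l|lborel. w l * (indicator {0<..} x * exp (- (l * x)))) = indicator {0<..} x * \<bar>x\<bar> powr (- sg) * G0" for x
      using kgam_scaled[of x] by (cases "0 < x") (auto simp: w_def mult_ac)
    have wI: "integrable lborel (\<lambda>l. w l * (indicator {0<..} x * exp (- (l * x))))" for x
    proof (cases "0 < x")
      case True
      have "(\<lambda>\<mu>. w (0 + 1 / x * \<mu>) * (indicator {0<..} x * exp (- ((0 + 1 / x * \<mu>) * x)))) = (\<lambda>\<mu>. x powr gam * kgam \<mu>)"
        using True by (auto simp: w_def kgam_def indicator_def powr_divide powr_minus zero_less_divide_iff field_simps)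
      then show ?thesis
        using lborel_integrable_real_affine_iff[of "1 / x" "\<lambda>l. w l * (indicator {0<..} x * exp (- (l * x)))" 0] True kgam_integrable by auto
    qed simp
    have "(LINT x|lborel. LINT l|lborel. of_real (w l) * (of_real (indicator {0<..} x * exp (- (l * x))) * fourier \<psi> x)) =
      (LINT l|lborel. LINT x|lborel. of_real (w l) * (of_real (indicator {0<..} x * exp (- (l * x))) * fourier \<psi> x))"
    proof (rule LINT_Fubini_swap(1))
      have "cmod (of_real (w l) * (of_real (indicator {0<..} x * exp (- (l * x))) * fourier \<psi> x)) = (w l * (indicator {0<..} x * exp (- (l * x)))) * cmod (fourier \<psi> x)" for x l
        using w0 by (simp add: norm_mult indicator_def)
      then have e: "(LINT l|lborel. cmod (of_real (w l) * (of_real (indicator {0<..} x * exp (- (l * x))) * fourier \<psi> x))) = indicator {0<..} x * \<bar>x\<bar> powr (- sg) * G0 * cmod (fourier \<psi> x)" for x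
        by (simp add: wi)
      have "integrable lborel (\<lambda>x. G0 * (indicator {0<..} x *\<^sub>R cmod (of_real (\<bar>x\<bar> powr (- sg)) * fourier \<psi> x)))"
        by (intro integrable_mult_right integrable_mult_indicator integrable_norm \<psi>f) simp
      then show "integrable lborel (\<lambda>x. LINT l|lborel. cmod (of_real (w l) * (of_real (indicator {0<..} x * exp (- (l * x))) * fourier \<psi> x)))"
        unfolding e by (simp add: norm_mult mult_ac)
      have "integrable lborel (\<lambda>l. of_real (w l * (indicator {0<..} x * exp (- (l * x)))) * fourier \<psi> x)" for x
        using wI[of x] by (intro integrable_mult_left) (simp only: complex_of_real_integrable_eq)
      then show "AE x in lborel. integrable lborel (\<lambda>l. of_real (w l) * (of_real (indicator {0<..} x * exp (- (l * x))) * fourier \<psi> x))"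
        by (simp add: mult.assoc)
    qed measurable
    moreover have "(LINT l|lborel. of_real (w l) * (of_real (indicator {0<..} x * exp (- (l * x))) * fourier \<psi> x)) = of_real (indicator {0<..} x * \<bar>x\<bar> powr (- sg) * G0) * fourier \<psi> x" for x
      unfolding mult.assoc[symmetric] of_real_mult[symmetric] wi[symmetric] integral_mult_left_zero integral_complex_of_real ..
    ultimately show ?thesis by (simp add: mult_ac flip: integral_mult_right_zero)
  qed
  \<comment> \<open>Integrating in \<open>l\<close> first gives \<open>c0_scaled\<close>. The point
    \<xi> = 0, where the inner integral may diverge, is a null set.\<close>
  have B: "(LINT l|lborel. LINT \<xi>|lborel. of_real (w l) * (\<psi> \<xi> / (of_real l + \<i> * of_real \<xi>))) = (LINT \<xi>|lborel. half_line_fourier \<xi> * \<psi> \<xi>) * of_real G0"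
  proof -
    have bd: "cmod (of_real (w l) * (\<psi> \<xi> / (of_real l + \<i> * of_real \<xi>))) \<le> (indicator {0<..} l * (l powr (- gam) / max l \<bar>\<xi>\<bar>)) * cmod (\<psi> \<xi>)" if "\<xi> \<noteq> 0" for l \<xi>
    proof (cases "0 < l")
      case True
      have "cmod (\<psi> \<xi>) / cmod (of_real l + \<i> * of_real \<xi>) \<le> cmod (\<psi> \<xi>) / max l \<bar>\<xi>\<bar>"
        using norm_add_i_ge[OF True, of \<xi>] True that by (intro divide_left_mono mult_pos_pos) auto
      then have "l powr (- gam) * (cmod (\<psi> \<xi>) / cmod (of_real l + \<i> * of_real \<xi>)) \<le> l powr (- gam) * (cmod (\<psi> \<xi>) / max l \<bar>\<xi>\<bar>)"
        by (intro mult_left_mono) auto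
      then show ?thesis using True by (simp add: w_def norm_mult norm_divide)
    qed (simp add: w_def)
    have ii: "integrable lborel (\<lambda>l. of_real (w l) * (\<psi> \<xi> / (of_real l + \<i> * of_real \<xi>)))" if "\<xi> \<noteq> 0" for \<xi>
    proof (rule Bochner_Integration.integrable_bound[OF integrable_mult_left[OF kmax_scaled(1)[of "\<bar>\<xi>\<bar>"], of "cmod (\<psi> \<xi>)"]])
      show "AE l in lborel. cmod (of_real (w l) * (\<psi> \<xi> / (of_real l + \<i> * of_real \<xi>))) \<le> norm (indicator {0<..} l * (l powr (- gam) / max l \<bar>\<xi>\<bar>) * cmod (\<psi> \<xi>))"
        unfolding real_norm_def by (rule AE_I2, rule order_trans[OF bd[OF that] abs_ge_self])
    qed (use that in \<open>auto\<close>)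
    have "(LINT \<xi>|lborel. LINT l|lborel. of_real (w l) * (\<psi> \<xi> / (of_real l + \<i> * of_real \<xi>))) =
      (LINT l|lborel. LINT \<xi>|lborel. of_real (w l) * (\<psi> \<xi> / (of_real l + \<i> * of_real \<xi>)))"
    proof (rule LINT_Fubini_swap(1))
      show "AE \<xi> in lborel. integrable lborel (\<lambda>l. of_real (w l) * (\<psi> \<xi> / (of_real l + \<i> * of_real \<xi>)))"
        by (rule AE_I'[of "{0}"]) (use ii in auto)
      show "integrable lborel (\<lambda>\<xi>. LINT l|lborel. cmod (of_real (w l) * (\<psi> \<xi> / (of_real l + \<i> * of_real \<xi>))))"
      proof (rule Bochner_Integration.integrable_bound[OF integrable_mult_right[OF integrable_norm[OF \<psi>g], of M0]])
        have "(LINT l|lborel. cmod (of_real (w l) * (\<psi> \<xi> / (of_real l + \<i> * of_real \<xi>)))) \<le> M0 * cmod (of_real (\<bar>\<xi>\<bar> powr (- gam)) * \<psi> \<xi>)" if "\<xi> \<noteq> 0" for \<xi>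
        proof -
          have "(LINT l|lborel. cmod (of_real (w l) * (\<psi> \<xi> / (of_real l + \<i> * of_real \<xi>)))) \<le> (LINT l|lborel. (indicator {0<..} l * (l powr (- gam) / max l \<bar>\<xi>\<bar>)) * cmod (\<psi> \<xi>))"
            by (rule integral_mono[OF integrable_norm[OF ii[OF that]] integrable_mult_left[OF kmax_scaled(1)] bd[OF that]]) (use that in auto)
          also have "\<dots> = \<bar>\<xi>\<bar> powr (- gam) * M0 * cmod (\<psi> \<xi>)"
          proof -
            have "0 < \<bar>\<xi>\<bar>" using that by simp
            from kmax_scaled(2)[OF this] show ?thesis by (simp only: integral_mult_left_zero)
          qed
          finally show ?thesis by (simp add: norm_mult mult_ac)
        qed
        moreover have "0 \<le> (LINT l|lborel. cmod (of_real (w l) * (\<psi> \<xi> / (of_real l + \<i> * of_real \<xi>))))" for \<xi>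
          by (intro integral_nonneg_AE) simp
        ultimately show "AE \<xi> in lborel. norm (LINT l|lborel. cmod (of_real (w l) * (\<psi> \<xi> / (of_real l + \<i> * of_real \<xi>)))) \<le> norm (M0 * cmod (of_real (\<bar>\<xi>\<bar> powr (- gam)) * \<psi> \<xi>))"
          by (intro AE_I'[of "{0}"]) (auto simp del: norm_mult intro: order_trans[OF _ abs_ge_self])
      qed measurable
    qed measurable
    also have "(LINT \<xi>|lborel. LINT l|lborel. of_real (w l) * (\<psi> \<xi> / (of_real l + \<i> * of_real \<xi>))) = (LINT \<xi>|lborel. half_line_fourier \<xi> * \<psi> \<xi> * of_real G0)"
    proof (rule integral_cong_AE)
      have "(LINT l|lborel. of_real (w l) * (\<psi> \<xi> / (of_real l + \<i> * of_real \<xi>))) = half_line_fourier \<xi> * \<psi> \<xi> * of_real G0" if "\<xi> \<noteq> 0" for \<xi>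
      proof -
        have "(LINT l|lborel. of_real (w l) * (\<psi> \<xi> / (of_real l + \<i> * of_real \<xi>))) = (LINT l|lborel. \<psi> \<xi> * (of_real (indicator {0<..} l * l powr (- gam)) / (of_real l + \<i> * of_real \<xi>)))"
          by (simp add: w_def mult_ac)
        also have "\<dots> = \<psi> \<xi> * (of_real G0 * half_line_fourier \<xi>)" by (simp only: integral_mult_right_zero c0_scaled[OF that])
        finally show ?thesis by (simp add: mult_ac)
      qed
      then show "AE \<xi> in lborel. (LINT l|lborel. of_real (w l) * (\<psi> \<xi> / (of_real l + \<i> * of_real \<xi>))) = half_line_fourier \<xi> * \<psi> \<xi> * of_real G0"
        by (intro AE_I'[of "{0}"]) auto
      show "(\<lambda>\<xi>. half_line_fourier \<xi> * \<psi> \<xi> * of_real G0) \<in> borel_measurable lborel" unfolding half_line_fourier_def by measurable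
    qed measurable
    finally show ?thesis by simp
  qed
  have "(LINT l|lborel. LINT x|lborel. of_real (w l) * (of_real (indicator {0<..} x * exp (- (l * x))) * fourier \<psi> x)) =
      (LINT l|lborel. LINT \<xi>|lborel. of_real (w l) * (\<psi> \<xi> / (of_real l + \<i> * of_real \<xi>)))"
  proof (rule Bochner_Integration.integral_cong[OF refl])
    fix l :: real
    show "(LINT x|lborel. of_real (w l) * (of_real (indicator {0<..} x * exp (- (l * x))) * fourier \<psi> x)) = (LINT \<xi>|lborel. of_real (w l) * (\<psi> \<xi> / (of_real l + \<i> * of_real \<xi>)))"
    proof (cases "0 < l")
      case True
      show ?thesis by (simp only: integral_mult_right_zero lap[OF True])
    qed (simp add: w_def)
  qed
  then show ?thesis using A B G0_pos by simp
qed

end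

section \<open>Action of the linear group\<close>

lemma power_one_plus_abs_le: "(1 + \<bar>x::real\<bar>) ^ N \<le> 2 ^ N * (1 + \<bar>x\<bar> ^ N)"
proof -
  have "(1 + \<bar>x\<bar>) ^ N \<le> (2 * max 1 \<bar>x\<bar>) ^ N" by (intro power_mono) auto
  also have "\<dots> = 2 ^ N * max 1 \<bar>x\<bar> ^ N" by (simp add: power_mult_distrib)
  also have "\<dots> \<le> 2 ^ N * (1 + \<bar>x\<bar> ^ N)" by (intro mult_left_mono) (auto simp: max_def)
  finally show ?thesis .
qed

lemma tempered_schwartz_integrable:
  assumes f: "tempered_fun f" and \<phi>: "\<phi> \<in> schwartz"
  shows "integrable lborel (\<lambda>x. f x * \<phi> x)"
proof -
  obtain N :: nat where [measurable]: "f \<in> borel_measurable borel" and N: "integrable lborel (\<lambda>x. f x / of_real ((1 + \<bar>x\<bar>) ^ N))"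
    using f unfolding tempered_fun_def by auto
  note [measurable] = schwartz_measurable[OF \<phi>]
  obtain C where C: "\<And>x. \<bar>x\<bar> ^ 0 * cmod (\<phi> x) \<le> C" using schwartz_bound[OF \<phi>] by blast
  obtain D where D: "\<And>x. \<bar>x\<bar> ^ N * cmod (\<phi> x) \<le> D" using schwartz_bound[OF \<phi>] by blast
  have b: "cmod (f x * \<phi> x) \<le> 2 ^ N * (C + D) * cmod (f x / of_real ((1 + \<bar>x\<bar>) ^ N))" for x
  proof -
    have p: "0 < (1 + \<bar>x\<bar>) ^ N" by (intro zero_less_power) auto
    have "(1 + \<bar>x\<bar>) ^ N * cmod (\<phi> x) \<le> 2 ^ N * (1 + \<bar>x\<bar> ^ N) * cmod (\<phi> x)"
      by (intro mult_right_mono power_one_plus_abs_le) auto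
    also have "\<dots> \<le> 2 ^ N * (C + D)" using C[of x] D[of x] by (simp add: distrib_right mult.assoc)
    finally have "cmod (\<phi> x) \<le> 2 ^ N * (C + D) / (1 + \<bar>x\<bar>) ^ N" using p by (simp add: pos_le_divide_eq mult.commute)
    then have "cmod (f x) * cmod (\<phi> x) \<le> cmod (f x) * (2 ^ N * (C + D) / (1 + \<bar>x\<bar>) ^ N)" by (intro mult_left_mono) auto
    then show ?thesis using p unfolding norm_mult norm_divide norm_of_real by (simp add: abs_of_pos mult_ac)
  qed
  show ?thesis
  proof (rule Bochner_Integration.integrable_bound[OF integrable_mult_right[OF integrable_norm[OF N], of "2 ^ N * (C + D)"]])
    show "AE x in lborel. cmod (f x * \<phi> x) \<le> norm (2 ^ N * (C + D) * cmod (f x / of_real ((1 + \<bar>x\<bar>) ^ N)))"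
      by (rule AE_I2, rule order_trans[OF b]) simp
  qed measurable
qed

lemma tempered_mono:
  assumes f: "f \<in> borel_measurable lborel" and N: "integrable lborel (\<lambda>x. f x / of_real ((1 + \<bar>x\<bar>) ^ N))" and "N \<le> M"
  shows "integrable lborel (\<lambda>x. (f x :: complex) / of_real ((1 + \<bar>x\<bar>) ^ M))"
proof (rule Bochner_Integration.integrable_bound[OF N])
  have [measurable]: "f \<in> borel_measurable borel" using f by simp
  show "(\<lambda>x. f x / of_real ((1 + \<bar>x\<bar>) ^ M)) \<in> borel_measurable lborel" by measurable
  show "AE x in lborel. cmod (f x / of_real ((1 + \<bar>x\<bar>) ^ M)) \<le> cmod (f x / of_real ((1 + \<bar>x\<bar>) ^ N))"
  proof (intro AE_I2)
    fix x :: real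
    have "(1 + \<bar>x\<bar>) ^ N \<le> (1 + \<bar>x\<bar>) ^ M" using \<open>N \<le> M\<close> by (intro power_increasing) auto
    then have "cmod (f x) / (1 + \<bar>x\<bar>) ^ M \<le> cmod (f x) / (1 + \<bar>x\<bar>) ^ N"
      by (intro divide_left_mono mult_pos_pos zero_less_power) auto
    then show "cmod (f x / of_real ((1 + \<bar>x\<bar>) ^ M)) \<le> cmod (f x / of_real ((1 + \<bar>x\<bar>) ^ N))"
      unfolding norm_divide norm_of_real by simp
  qed
qed

lemma tempered_combination:
  assumes f: "tempered_fun f" and g: "tempered_fun g"
  shows "tempered_fun (\<lambda>x. c * f x + d * g x)"
proof -
  obtain N :: nat where fm[measurable]: "f \<in> borel_measurable lborel" and N: "integrable lborel (\<lambda>x. f x / of_real ((1 + \<bar>x\<bar>) ^ N))"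
    using f unfolding tempered_fun_def by auto
  obtain M :: nat where gm[measurable]: "g \<in> borel_measurable lborel" and M: "integrable lborel (\<lambda>x. g x / of_real ((1 + \<bar>x\<bar>) ^ M))"
    using g unfolding tempered_fun_def by auto
  have "integrable lborel (\<lambda>x. c * (f x / of_real ((1 + \<bar>x\<bar>) ^ max N M)) + d * (g x / of_real ((1 + \<bar>x\<bar>) ^ max N M)))"
    by (intro Bochner_Integration.integrable_add integrable_mult_right tempered_mono[OF fm N] tempered_mono[OF gm M]) auto
  then have "integrable lborel (\<lambda>x. (c * f x + d * g x) / of_real ((1 + \<bar>x\<bar>) ^ max N M))"
    by (simp add: add_divide_distrib)
  moreover have "(\<lambda>x. c * f x + d * g x) \<in> borel_measurable lborel" by measurable
  ultimately show ?thesis unfolding tempered_fun_def by blast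
qed

lemma normal_density_gauss_exp:
  assumes "0 < r"
  shows "complex_of_real (normal_density m r x) = of_real (1 / sqrt (2 * pi * r\<^sup>2) * exp (- m\<^sup>2 / (2 * r\<^sup>2))) * gauss_exp (m / r\<^sup>2) 0 (1 / r) x"
proof -
  have "- (x - m)\<^sup>2 / (2 * r\<^sup>2) = - m\<^sup>2 / (2 * r\<^sup>2) + (m / r\<^sup>2 * x - (1 / r * x)\<^sup>2 / 2)"
    using assms by (simp add: power2_diff power_divide diff_divide_distrib add_divide_distrib mult_ac)
  then show ?thesis by (simp add: normal_density_def gauss_exp_def exp_add[symmetric] del: of_real_mult flip: of_real_mult)
qed

text \<open>Gaussian densities are multiples of Schwartz functions, on which both representations
  agree; \<open>tempered_AE_zero\<close> then applies to the difference.\<close>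

lemma represents_unique:
  assumes g: "represents g T" and h: "represents h T"
  shows "AE x in lborel. g x = h x"
proof -
  have t: "tempered_fun g" "tempered_fun h" using g h by (auto simp: represents_def)
  have "AE x in lborel. 1 * g x + (- 1) * h x = 0"
  proof (rule tempered_AE_zero[OF tempered_combination[OF t]])
    fix m r :: real assume r: "0 < r"
    let ?e = "gauss_exp (m / r\<^sup>2) 0 (1 / r)"
    have e: "?e \<in> schwartz" using r by (intro gauss_exp_schwartz) auto
    have "T ?e = (LINT x|lborel. g x * ?e x)" "T ?e = (LINT x|lborel. h x * ?e x)"
      using g h e by (auto simp: represents_def fun_distr_def)
    then have "(LINT x|lborel. g x * ?e x - h x * ?e x) = 0"
      using tempered_schwartz_integrable[OF t(1) e] tempered_schwartz_integrable[OF t(2) e] by simp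
    moreover obtain C where "\<And>x. complex_of_real (normal_density m r x) = C * ?e x"
      using normal_density_gauss_exp[OF r] by blast
    ultimately show "(LINT x|lborel. (1 * g x + (- 1) * h x) * of_real (normal_density m r x)) = 0"
      using integral_mult_right_zero[of lborel C "\<lambda>x. g x * ?e x - h x * ?e x"] by (simp add: algebra_simps)
  qed
  then show ?thesis by eventually_elim simp
qed

lemma fourier_multiplier_eq:
  assumes g: "represents g (distr_fourier T)" and m[measurable]: "m \<in> borel_measurable borel" and \<phi>: "\<phi> \<in> schwartz"
  shows "fourier_multiplier m T \<phi> = (LINT \<xi>|lborel. m \<xi> * g \<xi> * inv_fourier \<phi> \<xi>)"
proof -
  define h where "h = (SOME g. represents g (distr_fourier T))"
  have h: "represents h (distr_fourier T)" unfolding h_def by (rule someI[of "\<lambda>g. represents g (distr_fourier T)", OF g])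
  have [measurable]: "g \<in> borel_measurable borel" "h \<in> borel_measurable borel"
    using g h by (auto simp: represents_def tempered_fun_def)
  note [measurable] = inv_fourier_measurable[OF schwartz_integrable[OF \<phi>]]
  have "fourier_multiplier m T \<phi> = (LINT \<xi>|lborel. m \<xi> * h \<xi> * inv_fourier \<phi> \<xi>)"
    by (simp add: fourier_multiplier_def h_def[symmetric] fun_distr_def Let_def)
  also have "\<dots> = (LINT \<xi>|lborel. m \<xi> * g \<xi> * inv_fourier \<phi> \<xi>)"
    by (rule integral_cong_AE) (use represents_unique[OF h g] in auto)
  finally show ?thesis .
qed

lemma lin_group_eq:
  assumes "represents g (distr_fourier T)" and "\<phi> \<in> schwartz"
  shows "lin_group \<alpha> t T \<phi> = (LINT \<xi>|lborel. cis (- (t * \<xi> * \<bar>\<xi>\<bar> powr \<alpha>)) * g \<xi> * inv_fourier \<phi> \<xi>)"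
  unfolding lin_group_def by (rule fourier_multiplier_eq[OF assms(1) _ assms(2)]) measurable

lemma tempered_decay_factor:
  assumes f: "f \<in> borel_measurable borel" and b: "\<And>x. cmod (f x) \<le> K * (\<bar>x\<bar> powr e + 1)" and e: "-1 < e" "e \<le> 0" and K: "0 \<le> K"
  shows "tempered_fun f"
proof -
  have [measurable]: "f \<in> borel_measurable borel" by (rule f)
  let ?q = "\<lambda>x::real. complex_of_real (1 / (1 + \<bar>x\<bar>) ^ 2)"
  have q: "(1 + x\<^sup>2) * cmod (?q x) \<le> 1" for x
  proof -
    have "1 + x\<^sup>2 \<le> (1 + \<bar>x\<bar>)\<^sup>2" by (simp add: power2_sum)
    moreover have "0 < (1 + \<bar>x\<bar>)\<^sup>2" by (intro zero_less_power) auto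
    ultimately show ?thesis unfolding norm_of_real by (simp add: abs_of_pos)
  qed
  have 1: "integrable lborel (\<lambda>x. of_real (\<bar>x\<bar> powr e) * ?q x)" by (rule integrable_powr_decay[OF _ q e]) measurable
  have 2: "integrable lborel ?q" by (rule integrable_decay[OF _ q]) measurable
  have "integrable lborel (\<lambda>x. f x / of_real ((1 + \<bar>x\<bar>) ^ 2))"
  proof (rule Bochner_Integration.integrable_bound)
    show "integrable lborel (\<lambda>x. K * (cmod (of_real (\<bar>x\<bar> powr e) * ?q x) + cmod (?q x)))"
      by (intro integrable_mult_right Bochner_Integration.integrable_add integrable_norm 1 2)
    show "AE x in lborel. cmod (f x / of_real ((1 + \<bar>x\<bar>) ^ 2)) \<le> norm (K * (cmod (of_real (\<bar>x\<bar> powr e) * ?q x) + cmod (?q x)))"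
    proof (intro AE_I2)
      fix x
      have "cmod (f x / of_real ((1 + \<bar>x\<bar>) ^ 2)) = cmod (f x) * cmod (?q x)" by (simp add: divide_inverse norm_mult norm_inverse)
      also have "\<dots> \<le> K * (\<bar>x\<bar> powr e + 1) * cmod (?q x)" by (intro mult_right_mono b) auto
      also have "\<dots> = norm (K * (cmod (of_real (\<bar>x\<bar> powr e) * ?q x) + cmod (?q x)))"
        using K by (simp add: norm_mult abs_mult distrib_right distrib_left add_divide_distrib del: of_real_divide of_real_power)
      finally show "cmod (f x / of_real ((1 + \<bar>x\<bar>) ^ 2)) \<le> norm (K * (cmod (of_real (\<bar>x\<bar> powr e) * ?q x) + cmod (?q x)))" .
    qed
  qed measurable
  then show ?thesis unfolding tempered_fun_def by auto
qed

lemma tempered_bounded: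
  assumes f: "f \<in> borel_measurable borel" and b: "\<And>x. cmod (f x) \<le> K"
  shows "tempered_fun f"
proof (rule tempered_decay_factor[OF f, where e=0])
  have K: "0 \<le> K" using b[of 0] order_trans[OF norm_ge_zero] by auto
  show "cmod (f x) \<le> K * (\<bar>x\<bar> powr 0 + 1)" for x using b[of x] K by (simp add: distrib_left add_increasing)
  show "0 \<le> K" by (rule K)
qed auto

context gkdv begin

lemma schwartz_powr_integrable:
  assumes "\<phi> \<in> schwartz" "-1 < e" "e \<le> 0"
  shows "integrable lborel (\<lambda>\<xi>. of_real (\<bar>\<xi>\<bar> powr e) * \<phi> \<xi>)"
proof -
  obtain C where C: "\<And>x. \<bar>x\<bar> ^ 0 * cmod (\<phi> x) \<le> C" using schwartz_bound[OF assms(1)] by blast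
  obtain D where D: "\<And>x. \<bar>x\<bar> ^ 2 * cmod (\<phi> x) \<le> D" using schwartz_bound[OF assms(1)] by blast
  show ?thesis
  proof (rule integrable_powr_decay[where D="C + D"])
    fix x show "(1 + x\<^sup>2) * cmod (\<phi> x) \<le> C + D" using C[of x] D[of x] by (simp add: distrib_right)
  qed (use assms in auto)
qed

lemma fourier_powr_integrable:
  assumes "\<phi> \<in> schwartz" "-1 < e" "e \<le> 0"
  shows "integrable lborel (\<lambda>x. of_real (\<bar>x\<bar> powr e) * fourier \<phi> x)"
proof -
  have "integrable lborel (\<lambda>x. of_real (2 * pi) * (of_real (\<bar>0 + - 1 * x\<bar> powr e) * inv_fourier \<phi> (0 + - 1 * x)))"
    by (intro integrable_mult_right lborel_integrable_real_affine[OF inv_fourier_integrable_powr[OF assms]]) auto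
  then show ?thesis by (simp add: fourier_eq_inv_fourier mult_ac)
qed

section \<open>Data with one-sided powers and their linear evolution\<close>

definition power_datum :: "real \<Rightarrow> real \<Rightarrow> (real \<Rightarrow> real) \<Rightarrow> bool" where
  "power_datum wp wm \<Phi> \<longleftrightarrow> (\<forall>x>0. \<Phi> x = wp * \<bar>x\<bar> powr (- sg)) \<and> (\<forall>x<0. \<Phi> x = wm * \<bar>x\<bar> powr (- sg))"

text \<open>The coefficient of \<open>\<xi> powr (- gam)\<close> for \<xi> > 0 in the transform of
  the datum; reflecting the half-line conjugates \<open>c0\<close>. It is the c of the overview, the
  one number through which the data enter the equation for the profile.\<close>

definition datum_coeff :: "real \<Rightarrow> real \<Rightarrow> complex" where "datum_coeff wp wm = of_real wp * c0 + of_real wm * cnj c0"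

definition homogeneous :: "complex \<Rightarrow> real \<Rightarrow> complex" where
  "homogeneous c \<xi> = of_real (\<bar>\<xi>\<bar> powr (- gam)) * (if 0 < \<xi> then c else cnj c)"

lemma homogeneous_measurable [measurable]: "homogeneous c \<in> borel_measurable borel"
  unfolding homogeneous_def[abs_def] by measurable

lemma homogeneous_bound: "cmod (homogeneous c \<xi>) = cmod c * \<bar>\<xi>\<bar> powr (- gam)"
  by (simp add: homogeneous_def norm_mult)

lemma homogeneous_tempered: "tempered_fun (homogeneous c)"
  by (rule tempered_decay_factor[where e="- gam" and K="cmod c"]) (use gam_lt gam_pos in \<open>auto simp: homogeneous_bound intro!: mult_left_mono\<close>)

text \<open>The left half-line is reduced to the right one by reflecting \<open>\<psi>\<close>. The
  lemma is used with \<open>\<psi>\<close> a Schwartz function, to identify the transform of the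
  datum, and with \<open>\<psi>\<close> an inverse transform, to return to physical space.\<close>

lemma power_datum_pairing:
  assumes \<Phi>: "power_datum wp wm \<Phi>"
    and \<psi>: "integrable lborel \<psi>" and \<psi>g: "integrable lborel (\<lambda>\<xi>. of_real (\<bar>\<xi>\<bar> powr (- gam)) * \<psi> \<xi>)"
    and \<psi>f: "integrable lborel (\<lambda>x. of_real (\<bar>x\<bar> powr (- sg)) * fourier \<psi> x)"
  shows "(LINT x|lborel. of_real (\<Phi> x) * fourier \<psi> x) = (LINT \<xi>|lborel. homogeneous (datum_coeff wp wm) \<xi> * \<psi> \<xi>)"
proof -
  have pm[measurable]: "\<psi> \<in> borel_measurable borel" using \<psi> by (auto dest: borel_measurable_integrable)
  note [measurable] = fourier_measurable[OF \<psi>]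
  have Pm[measurable]: "\<Phi> \<in> borel_measurable borel"
  proof -
    have "\<Phi> = (\<lambda>x. if 0 < x then wp * \<bar>x\<bar> powr (- sg) else if x < 0 then wm * \<bar>x\<bar> powr (- sg) else \<Phi> 0)"
      using \<Phi> unfolding power_datum_def fun_eq_iff by (metis linorder_neqE_linordered_idom)
    also have "\<dots> \<in> borel_measurable borel" by measurable
    finally show ?thesis .
  qed
  define \<psi>' where "\<psi>' = (\<lambda>\<xi>. \<psi> (0 + - 1 * \<xi>))"
  have f': "fourier \<psi>' x = fourier \<psi> (- x)" for x
    unfolding fourier_def \<psi>'_def by (subst lborel_integral_real_affine[of "- 1" _ 0]) auto
  have \<psi>'i: "integrable lborel \<psi>'" unfolding \<psi>'_def by (rule lborel_integrable_real_affine[OF \<psi>]) simp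
  have \<psi>'g: "integrable lborel (\<lambda>\<xi>. of_real (\<bar>\<xi>\<bar> powr (- gam)) * \<psi>' \<xi>)"
    using lborel_integrable_real_affine[OF \<psi>g, of "- 1" 0] by (simp add: \<psi>'_def)
  have \<psi>'f: "integrable lborel (\<lambda>\<xi>. of_real (\<bar>\<xi>\<bar> powr (- sg)) * fourier \<psi>' \<xi>)"
    using lborel_integrable_real_affine[OF \<psi>f, of "- 1" 0] by (simp add: f')
  let ?P = "\<lambda>x. of_real (indicator {0<..} x * \<bar>x\<bar> powr (- sg)) * fourier \<psi> x"
  let ?M = "\<lambda>x. of_real (indicator {..<0} x * \<bar>x\<bar> powr (- sg)) * fourier \<psi> x"
  have Pi: "integrable lborel ?P" "integrable lborel ?M"
    by (rule Bochner_Integration.integrable_bound[OF \<psi>f]; auto simp: indicator_def)+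
  have "(LINT x|lborel. of_real (\<Phi> x) * fourier \<psi> x) = (LINT x|lborel. of_real wp * ?P x + of_real wm * ?M x)"
  proof (rule integral_cong_AE)
    show "AE x in lborel. of_real (\<Phi> x) * fourier \<psi> x = of_real wp * ?P x + of_real wm * ?M x"
    proof (rule AE_I'[of "{0}"])
      show "{x \<in> space lborel. of_real (\<Phi> x) * fourier \<psi> x \<noteq> of_real wp * ?P x + of_real wm * ?M x} \<subseteq> {0}"
        using \<Phi> unfolding power_datum_def by (auto simp: indicator_def)
    qed auto
  qed measurable
  also have "\<dots> = of_real wp * (LINT x|lborel. ?P x) + of_real wm * (LINT x|lborel. ?M x)"
    using Pi by (simp add: Bochner_Integration.integral_add)
  also have "(LINT x|lborel. ?P x) = (LINT \<xi>|lborel. half_line_fourier \<xi> * \<psi> \<xi>)" by (rule fourier_half_power[OF \<psi> \<psi>g \<psi>f])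
  also have "(LINT x|lborel. ?M x) = (LINT x|lborel. of_real (indicator {0<..} x * \<bar>x\<bar> powr (- sg)) * fourier \<psi>' x)"
    by (subst lborel_integral_real_affine[of "- 1" _ 0]) (auto simp: f' indicator_def)
  also have "\<dots> = (LINT \<xi>|lborel. half_line_fourier \<xi> * \<psi>' \<xi>)" by (rule fourier_half_power[OF \<psi>'i \<psi>'g \<psi>'f])
  also have "\<dots> = (LINT \<xi>|lborel. half_line_fourier (- \<xi>) * \<psi> \<xi>)"
    by (subst lborel_integral_real_affine[of "- 1" _ 0]) (auto simp: \<psi>'_def)
  also have "of_real wp * (LINT \<xi>|lborel. half_line_fourier \<xi> * \<psi> \<xi>) + of_real wm * (LINT \<xi>|lborel. half_line_fourier (- \<xi>) * \<psi> \<xi>) =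
     (LINT \<xi>|lborel. of_real wp * (half_line_fourier \<xi> * \<psi> \<xi>) + of_real wm * (half_line_fourier (- \<xi>) * \<psi> \<xi>))"
  proof -
    have b: "cmod (half_line_fourier \<xi> * \<psi> \<xi>) \<le> norm (cmod c0 * cmod (of_real (\<bar>\<xi>\<bar> powr (- gam)) * \<psi> \<xi>))"
            "cmod (half_line_fourier (- \<xi>) * \<psi> \<xi>) \<le> norm (cmod c0 * cmod (of_real (\<bar>\<xi>\<bar> powr (- gam)) * \<psi> \<xi>))" for \<xi>
      by (auto simp: half_line_fourier_def norm_mult)
    have [measurable]: "half_line_fourier \<in> borel_measurable borel" unfolding half_line_fourier_def[abs_def] by measurable
    have "integrable lborel (\<lambda>\<xi>. half_line_fourier \<xi> * \<psi> \<xi>)"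
      by (rule Bochner_Integration.integrable_bound[OF integrable_mult_right[OF integrable_norm[OF \<psi>g], of "cmod c0"] _ AE_I2[OF b(1)]]) measurable
    moreover have "integrable lborel (\<lambda>\<xi>. half_line_fourier (- \<xi>) * \<psi> \<xi>)"
      by (rule Bochner_Integration.integrable_bound[OF integrable_mult_right[OF integrable_norm[OF \<psi>g], of "cmod c0"] _ AE_I2[OF b(2)]]) measurable
    ultimately show ?thesis by (simp add: Bochner_Integration.integral_add)
  qed
  also have "\<dots> = (LINT \<xi>|lborel. homogeneous (datum_coeff wp wm) \<xi> * \<psi> \<xi>)"
  proof (rule Bochner_Integration.integral_cong[OF refl])
    fix \<xi> :: real
    show "of_real wp * (half_line_fourier \<xi> * \<psi> \<xi>) + of_real wm * (half_line_fourier (- \<xi>) * \<psi> \<xi>) = homogeneous (datum_coeff wp wm) \<xi> * \<psi> \<xi>"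
      by (cases "\<xi> = 0") (auto simp: half_line_fourier_def homogeneous_def datum_coeff_def algebra_simps)
  qed
  finally show ?thesis .
qed

lemma power_datum_fourier:
  assumes \<Phi>: "power_datum wp wm \<Phi>"
  shows "represents (homogeneous (datum_coeff wp wm)) (distr_fourier (fun_distr (\<lambda>x. of_real (\<Phi> x))))"
  unfolding represents_def
proof (intro conjI ballI homogeneous_tempered)
  fix \<phi> assume \<phi>: "\<phi> \<in> schwartz"
  show "distr_fourier (fun_distr (\<lambda>x. complex_of_real (\<Phi> x))) \<phi> = fun_distr (homogeneous (datum_coeff wp wm)) \<phi>"
    unfolding distr_fourier_def fun_distr_def
    by (rule power_datum_pairing[OF \<Phi> schwartz_integrable[OF \<phi>]])
       (use sg_le sg_pos gam_lt gam_pos in \<open>auto intro!: schwartz_powr_integrable fourier_powr_integrable \<phi>\<close>)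
qed

lemma homogeneous_amplitude: "amplitude (cmod c) (\<lambda>\<xi>. c * of_real (\<xi> powr (- gam))) (\<lambda>\<xi>. c * of_real (- gam * \<xi> powr (- gam - 1)))"
  unfolding amplitude_def
proof (intro conjI allI impI)
  show "continuous_on {0<..} (\<lambda>\<xi>. c * of_real (- gam * \<xi> powr (- gam - 1)))" by (intro continuous_intros) auto
next
  fix \<xi> :: real assume x: "0 < \<xi>"
  have "((\<lambda>\<xi>. \<xi> powr (- gam)) has_real_derivative (- gam * \<xi> powr (- gam - 1))) (at \<xi>)"
    using x by (auto intro!: derivative_eq_intros)
  from has_vector_derivative_mult_right[OF has_vector_derivative_of_real[OF this], of c]
  show "((\<lambda>\<xi>. c * of_real (\<xi> powr (- gam))) has_vector_derivative c * of_real (- gam * \<xi> powr (- gam - 1))) (at \<xi>)" .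
next
  fix \<xi> :: real
  have b: "cmod (c * of_real (- gam * \<xi> powr (- gam - 1))) \<le> cmod c * \<xi> powr (- gam - 1)"
    unfolding norm_mult norm_of_real using gam_pos gam_lt by (intro mult_left_mono) (auto simp: abs_mult mult_left_le_one_le)
  { assume "0 < \<xi> \<and> \<xi> \<le> 1"
    show "cmod (c * of_real (\<xi> powr (- gam))) \<le> cmod c * \<xi> powr (- gam)" by (simp add: norm_mult)
    show "cmod (c * of_real (- gam * \<xi> powr (- gam - 1))) \<le> cmod c * \<xi> powr (- gam - 1)" by (rule b) }
  { assume x: "1 \<le> \<xi>"
    show "cmod (c * of_real (\<xi> powr (- gam))) \<le> cmod c * \<xi> powr (- rho)"
      using x rho_lt_gam by (auto simp: norm_mult intro!: mult_left_mono powr_mono)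
    have "cmod c * \<xi> powr (- gam - 1) \<le> cmod c" using x gam_pos by (intro mult_left_le powr_neg_le_one) auto
    with b show "cmod (c * of_real (- gam * \<xi> powr (- gam - 1))) \<le> cmod c" by linarith }
qed

text \<open>The powers of \<open>t\<close> cancel by homogeneity of degree - gam, so the linear
  evolution of the datum is itself self-similar.\<close>

lemma homogeneous_symb:
  assumes t: "0 < t"
  shows "self_similar_symbol (\<lambda>\<xi>. c * of_real (\<xi> powr (- gam))) t \<xi> = cis (- (t * \<xi> * \<bar>\<xi>\<bar> powr \<alpha>)) * homogeneous c \<xi>"
proof -
  have e: "of_real (t powr (bb * gam)) * complex_of_real ((t powr bb * y) powr (- gam)) = of_real (y powr (- gam))" if "0 < y" for y
    using t that by (simp add: powr_mult powr_powr powr_minus mult.assoc[symmetric] flip: of_real_mult)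
  consider "0 < \<xi>" | "\<xi> < 0" | "\<xi> = 0" by linarith
  then show ?thesis
  proof cases
    case 1 then show ?thesis using e[of \<xi>] by (simp add: self_similar_symbol_def homogeneous_def mult_ac)
  next
    case 2 then show ?thesis using e[of "- \<xi>"] by (simp add: self_similar_symbol_def homogeneous_def mult_ac)
  qed (simp add: self_similar_symbol_def homogeneous_def)
qed

definition profile_fun :: "(real \<Rightarrow> complex) \<Rightarrow> real \<Rightarrow> real \<Rightarrow> complex" where
  "profile_fun a t x = of_real (t powr (- aa) * profile a (x / t powr bb))"

lemma profile_fun_cont_represents:
  assumes a: "amplitude K a a'" and t: "0 < t" and T: "\<And>\<phi>. \<phi> \<in> schwartz \<Longrightarrow> T \<phi> = (LINT \<xi>|lborel. self_similar_symbol a t \<xi> * inv_fourier \<phi> \<xi>)"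
  shows "cont_represents (profile_fun a t) T"
proof -
  have c: "continuous_on UNIV (profile_fun a t)"
    unfolding profile_fun_def[abs_def] using t
    by (intro continuous_intros continuous_on_compose2[OF profile_continuous[OF a, of UNIV]]) auto
  have "cmod (profile_fun a t x) \<le> t powr (- aa) * (osc_const * K)" for x
  proof -
    have "\<bar>profile a (x / t powr bb)\<bar> \<le> osc_const * K * dec (x / t powr bb)" by (rule profile_bound[OF a])
    also have "\<dots> \<le> osc_const * K" using osc_const_pos amplitude_K[OF a] dec_le_one by (intro mult_left_le mult_nonneg_nonneg) auto
    finally show ?thesis by (simp add: profile_fun_def norm_mult mult_left_mono)
  qed
  then have "tempered_fun (profile_fun a t)" by (rule tempered_bounded[OF borel_measurable_continuous_onI[OF c]])
  then show ?thesis using c T profile_representation[OF a t]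
    by (simp add: cont_represents_def represents_def fun_distr_def profile_fun_def)
qed

lemma lin_group_power_datum:
  assumes \<Phi>: "power_datum wp wm \<Phi>" and t: "0 < t"
  shows "cont_represents (profile_fun (\<lambda>\<xi>. datum_coeff wp wm * of_real (\<xi> powr (- gam))) t) (lin_group \<alpha> t (fun_distr (\<lambda>x. of_real (\<Phi> x))))"
  by (rule profile_fun_cont_represents[OF homogeneous_amplitude t]) (simp add: lin_group_eq[OF power_datum_fourier[OF \<Phi>]] homogeneous_symb[OF t])

end

section \<open>Smallness of the data\<close>

text \<open>A substitute for Hoelder's inequality that is linear in \<epsilon>. Where |f| \<le>
  \<epsilon> the product is at most \<epsilon> times the Gaussian; elsewhere |f| is at most
  \<open>\<epsilon> powr (1 - q) * cmod (f x) powr q\<close>, whose integral is at most \<epsilon>,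
  and the Gaussian is at most 1.\<close>

lemma gaussian_pairing_small:
  assumes f: "f \<in> borel_measurable lborel" and \<epsilon>: "0 < \<epsilon>" and q: "1 < q"
    and fi: "integrable lborel (\<lambda>x. cmod (f x) powr q)" and fb: "(LINT x|lborel. cmod (f x) powr q) powr (1 / q) \<le> \<epsilon>"
    and r: "0 < r"
  shows "cmod (LINT x|lborel. f x * gaussian m r x) \<le> \<epsilon> * ((LINT x|lborel. cmod (gaussian m r x)) + 1)"
proof -
  let ?g = "gaussian m r"
  define I where "I = (LINT x|lborel. cmod (f x) powr q)"
  have I0: "0 \<le> I" unfolding I_def by (intro integral_nonneg_AE) simp
  have "(I powr (1 / q)) powr q \<le> \<epsilon> powr q" using fb q by (intro powr_mono2) (auto simp: I_def)
  then have I: "I \<le> \<epsilon> powr q" using I0 q by (simp add: powr_powr)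
  have g1: "cmod (?g x) \<le> 1" for x by (simp add: gaussian_def norm_mult)
  have b: "cmod (f x * ?g x) \<le> \<epsilon> * cmod (?g x) + \<epsilon> powr (1 - q) * cmod (f x) powr q" for x
  proof (cases "cmod (f x) \<le> \<epsilon>")
    case True
    then have "cmod (f x) * cmod (?g x) \<le> \<epsilon> * cmod (?g x)" by (intro mult_right_mono) auto
    then show ?thesis by (simp add: norm_mult add_increasing2)
  next
    case False
    then have p: "0 < cmod (f x)" "\<epsilon> \<le> cmod (f x)" using \<epsilon> by linarith+
    have "cmod (f x) powr (1 - q) \<le> \<epsilon> powr (1 - q)" using p \<epsilon> q by (intro powr_mono2') auto
    then have "cmod (f x) powr (1 - q) * cmod (f x) powr q \<le> \<epsilon> powr (1 - q) * cmod (f x) powr q" by (intro mult_right_mono) auto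
    moreover have "cmod (f x) powr (1 - q) * cmod (f x) powr q = cmod (f x)" using p by (simp flip: powr_add)
    moreover have "cmod (f x) * cmod (?g x) \<le> cmod (f x)" using g1 by (intro mult_left_le) auto
    ultimately show ?thesis using \<epsilon> by (simp add: norm_mult add_increasing)
  qed
  have gi: "integrable lborel (\<lambda>x. \<epsilon> * cmod (?g x) + \<epsilon> powr (1 - q) * cmod (f x) powr q)"
    by (intro Bochner_Integration.integrable_add integrable_mult_right integrable_norm fi gaussian_integrable r)
  have [measurable]: "f \<in> borel_measurable borel" "?g \<in> borel_measurable borel"
    using f gaussian_integrable[OF r] by (auto dest: borel_measurable_integrable)
  have fgi: "integrable lborel (\<lambda>x. f x * ?g x)"
  proof (rule Bochner_Integration.integrable_bound[OF gi])
    show "AE x in lborel. cmod (f x * ?g x) \<le> norm (\<epsilon> * cmod (?g x) + \<epsilon> powr (1 - q) * cmod (f x) powr q)"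
      unfolding real_norm_def by (rule AE_I2, rule order_trans[OF b abs_ge_self])
  qed measurable
  have "cmod (LINT x|lborel. f x * ?g x) \<le> (LINT x|lborel. \<epsilon> * cmod (?g x) + \<epsilon> powr (1 - q) * cmod (f x) powr q)"
    by (rule order_trans[OF integral_norm_bound integral_mono[OF integrable_norm[OF fgi] gi b]])
  also have "\<dots> = \<epsilon> * (LINT x|lborel. cmod (?g x)) + \<epsilon> powr (1 - q) * I"
    unfolding I_def using gaussian_integrable[OF r] fi by (simp add: Bochner_Integration.integral_add)
  also have "\<epsilon> powr (1 - q) * I \<le> \<epsilon> powr (1 - q) * \<epsilon> powr q" using I by (intro mult_left_mono) auto
  also have "\<epsilon> powr (1 - q) * \<epsilon> powr q = \<epsilon>" using \<epsilon> by (simp flip: powr_add)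
  finally show ?thesis by (simp add: algebra_simps)
qed

context gkdv begin

text \<open>The functional tested below is linear in \<open>c\<close> and \<open>cnj c\<close> with coefficients \<open>half_pairing 1\<close> and
  \<open>half_pairing (- 1)\<close>. These are linearly independent as functions of the Gaussian, so that two Gaussians determine \<open>c\<close>.\<close>

definition half_symbol :: "real \<Rightarrow> real \<Rightarrow> complex" where
  "half_symbol s \<xi> = (if 0 < s * \<xi> then cis (- (1 * \<xi> * \<bar>\<xi>\<bar> powr \<alpha>)) * of_real (\<bar>\<xi>\<bar> powr (- gam)) else 0)"

lemma half_symbol_measurable [measurable]: "half_symbol s \<in> borel_measurable borel"
  unfolding half_symbol_def[abs_def] by measurable

lemma half_symbol_bound: "cmod (half_symbol s \<xi>) \<le> \<bar>\<xi>\<bar> powr (- gam)"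
  by (simp add: half_symbol_def norm_mult)

lemma half_symbol_tempered: "tempered_fun (half_symbol s)"
proof (rule tempered_decay_factor[where e="- gam" and K=1])
  show "cmod (half_symbol s x) \<le> 1 * (\<bar>x\<bar> powr - gam + 1)" for x using half_symbol_bound[of s x] by simp
qed (use gam_lt gam_pos in auto)

definition half_pairing :: "real \<Rightarrow> real \<Rightarrow> real \<Rightarrow> complex" where
  "half_pairing s m r = (LINT \<xi>|lborel. half_symbol s \<xi> * of_real (normal_density m r \<xi>))"

lemma half_symbol_density_integrable:
  assumes "0 < r" shows "integrable lborel (\<lambda>\<xi>. half_symbol s \<xi> * of_real (normal_density m r \<xi>))"
proof (rule Bochner_Integration.integrable_bound)
  show "integrable lborel (\<lambda>\<xi>. of_real (\<bar>\<xi>\<bar> powr (- gam)) * inv_fourier (gaussian m r) \<xi>)"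
    by (rule inv_fourier_integrable_powr[OF gaussian_schwartz[OF assms]]) (use gam_lt gam_pos in auto)
  show "AE \<xi> in lborel. cmod (half_symbol s \<xi> * of_real (normal_density m r \<xi>)) \<le> cmod (of_real (\<bar>\<xi>\<bar> powr (- gam)) * inv_fourier (gaussian m r) \<xi>)"
    using half_symbol_bound by (intro AE_I2) (auto simp: norm_mult inv_fourier_gaussian[OF assms] intro!: mult_right_mono)
qed measurable

lemma AE_half_line_contradiction:
  assumes "AE \<xi> in lborel. (s::real) * \<xi> \<le> 0" "s = 1 \<or> s = - 1"
  shows False
proof -
  define S where "S = (if s = 1 then {0<..<1} else {-1<..<0::real})"
  have "AE \<xi> in lborel. \<xi> \<notin> S" using assms(1) by eventually_elim (use assms(2) in \<open>auto simp: S_def split: if_splits\<close>)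
  then have "S \<in> null_sets lborel" by (subst (asm) AE_iff_null_sets[symmetric]) (auto simp: S_def)
  then show False by (auto simp: S_def null_sets_def split: if_splits)
qed

text \<open>If the determinant vanished for every second Gaussian, a fixed combination of the two
  half-line symbols would pair to 0 with all normal densities and vanish almost everywhere. On each
  half-line one symbol is 0 and the other is not, so \<open>half_pairing 1 m1 r1\<close> would be
  0.\<close>

lemma half_pairing_independent:
  obtains m1 r1 m2 r2 where "0 < r1" "0 < r2" "half_pairing 1 m1 r1 * half_pairing (- 1) m2 r2 - half_pairing (- 1) m1 r1 * half_pairing 1 m2 r2 \<noteq> 0"
proof -
  have "\<exists>m r. 0 < r \<and> half_pairing 1 m r \<noteq> 0"
  proof (rule ccontr)
    assume "\<not> ?thesis"
    then have "AE \<xi> in lborel. half_symbol 1 \<xi> = 0"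
      by (intro tempered_AE_zero[OF half_symbol_tempered]) (auto simp: half_pairing_def)
    then have "AE \<xi> in lborel. (1::real) * \<xi> \<le> 0" by eventually_elim (auto simp: half_symbol_def split: if_splits)
    then show False using AE_half_line_contradiction by blast
  qed
  then obtain m1 r1 where 1: "0 < r1" "half_pairing 1 m1 r1 \<noteq> 0" by blast
  have "\<exists>m r. 0 < r \<and> half_pairing 1 m1 r1 * half_pairing (- 1) m r - half_pairing (- 1) m1 r1 * half_pairing 1 m r \<noteq> 0"
  proof (rule ccontr)
    assume n: "\<not> ?thesis"
    have "AE \<xi> in lborel. half_pairing 1 m1 r1 * half_symbol (- 1) \<xi> + - half_pairing (- 1) m1 r1 * half_symbol 1 \<xi> = 0"
    proof (rule tempered_AE_zero[OF tempered_combination[OF half_symbol_tempered half_symbol_tempered]])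
      fix m r :: real assume r: "0 < r"
      have "(LINT x|lborel. (half_pairing 1 m1 r1 * half_symbol (- 1) x + - half_pairing (- 1) m1 r1 * half_symbol 1 x) * of_real (normal_density m r x)) =
        (LINT x|lborel. half_pairing 1 m1 r1 * (half_symbol (- 1) x * of_real (normal_density m r x)) - half_pairing (- 1) m1 r1 * (half_symbol 1 x * of_real (normal_density m r x)))"
        by (simp add: algebra_simps)
      also have "\<dots> = half_pairing 1 m1 r1 * half_pairing (- 1) m r - half_pairing (- 1) m1 r1 * half_pairing 1 m r"
        using half_symbol_density_integrable[OF r] by (simp add: half_pairing_def)
      also have "\<dots> = 0" using n r by blast
      finally show "(LINT x|lborel. (half_pairing 1 m1 r1 * half_symbol (- 1) x + - half_pairing (- 1) m1 r1 * half_symbol 1 x) * of_real (normal_density m r x)) = 0" .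
    qed
    then have "AE \<xi> in lborel. (- 1::real) * \<xi> \<le> 0"
      by eventually_elim (use 1 in \<open>auto simp: half_symbol_def split: if_splits\<close>)
    then show False using AE_half_line_contradiction by blast
  qed
  then show ?thesis using 1 that by blast
qed

text \<open>Each of the two Gaussians makes one linear combination of \<open>c\<close> and
  \<open>cnj c\<close> of order \<epsilon>; Cramer's rule solves for \<open>c\<close>. The constant
  depends on the two fixed Gaussians and not on the datum.\<close>

lemma amplitude_small:
  obtains C where "0 < C" "\<And>wp wm \<Phi> \<epsilon>. 0 < \<epsilon> \<Longrightarrow> power_datum wp wm \<Phi> \<Longrightarrow>
    Lp_norm_le (real p + 1) (lin_group \<alpha> 1 (fun_distr (\<lambda>x. of_real (\<Phi> x)))) \<epsilon> \<Longrightarrow> cmod (datum_coeff wp wm) \<le> C * \<epsilon>"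
proof -
  obtain m1 r1 m2 r2 where r: "0 < r1" "0 < r2" and D: "half_pairing 1 m1 r1 * half_pairing (- 1) m2 r2 - half_pairing (- 1) m1 r1 * half_pairing 1 m2 r2 \<noteq> 0"
    by (rule half_pairing_independent)
  define D where "D = half_pairing 1 m1 r1 * half_pairing (- 1) m2 r2 - half_pairing (- 1) m1 r1 * half_pairing 1 m2 r2"
  define N where "N = (\<lambda>m r. (LINT x|lborel. cmod (gaussian m r x)) + 1)"
  define B where "B = cmod (half_pairing (- 1) m2 r2) * N m1 r1 + cmod (half_pairing (- 1) m1 r1) * N m2 r2"
  have N: "1 \<le> N m r" for m r unfolding N_def by (simp add: integral_nonneg_AE)
  have B0: "0 \<le> B" unfolding B_def using N[of m1 r1] N[of m2 r2] by (intro add_nonneg_nonneg mult_nonneg_nonneg) auto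
  show ?thesis
  \<comment> \<open>Adding 1 to \<open>B\<close> makes the constant strictly positive without
    further argument.\<close>
  proof (rule that[of "(B + 1) / cmod D"])
    show "0 < (B + 1) / cmod D" using B0 D unfolding D_def by (intro divide_pos_pos) auto
    fix wp wm \<Phi> \<epsilon>
    assume \<epsilon>: "0 < \<epsilon>" and \<Phi>: "power_datum wp wm \<Phi>"
      and L: "Lp_norm_le (real p + 1) (lin_group \<alpha> 1 (fun_distr (\<lambda>x. complex_of_real (\<Phi> x)))) \<epsilon>"
    let ?T = "lin_group \<alpha> 1 (fun_distr (\<lambda>x. complex_of_real (\<Phi> x)))"
    let ?c = "datum_coeff wp wm"
    obtain f where f: "represents f ?T" "integrable lborel (\<lambda>x. cmod (f x) powr (real p + 1))"
      "(LINT x|lborel. cmod (f x) powr (real p + 1)) powr (1 / (real p + 1)) \<le> \<epsilon>"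
      using L unfolding Lp_norm_le_def by blast
    have fm: "f \<in> borel_measurable lborel" using f(1) by (simp add: represents_def tempered_fun_def)
    have test: "cmod (?c * half_pairing 1 m r + cnj ?c * half_pairing (- 1) m r) \<le> \<epsilon> * N m r" if r: "0 < r" for m r
    proof -
      have g: "gaussian m r \<in> schwartz" by (rule gaussian_schwartz[OF r])
      have "(LINT x|lborel. f x * gaussian m r x) = ?T (gaussian m r)"
        using f(1) g by (simp add: represents_def fun_distr_def)
      also have "\<dots> = (LINT \<xi>|lborel. cis (- (1 * \<xi> * \<bar>\<xi>\<bar> powr \<alpha>)) * homogeneous ?c \<xi> * inv_fourier (gaussian m r) \<xi>)"
        by (rule lin_group_eq[OF power_datum_fourier[OF \<Phi>] g])
      also have "\<dots> = (LINT \<xi>|lborel. ?c * (half_symbol 1 \<xi> * of_real (normal_density m r \<xi>)) + cnj ?c * (half_symbol (- 1) \<xi> * of_real (normal_density m r \<xi>)))"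
      proof (rule Bochner_Integration.integral_cong[OF refl])
        fix \<xi> :: real
        consider "0 < \<xi>" | "\<xi> < 0" | "\<xi> = 0" by linarith
        then show "cis (- (1 * \<xi> * \<bar>\<xi>\<bar> powr \<alpha>)) * homogeneous ?c \<xi> * inv_fourier (gaussian m r) \<xi> =
          ?c * (half_symbol 1 \<xi> * of_real (normal_density m r \<xi>)) + cnj ?c * (half_symbol (- 1) \<xi> * of_real (normal_density m r \<xi>))"
          by cases (auto simp: homogeneous_def half_symbol_def inv_fourier_gaussian[OF r])
      qed
      also have "\<dots> = ?c * half_pairing 1 m r + cnj ?c * half_pairing (- 1) m r"
        using half_symbol_density_integrable[OF r] by (simp add: half_pairing_def)
      finally show ?thesis
        using gaussian_pairing_small[OF fm \<epsilon> _ f(2) f(3) r, of m] p_pos by (simp add: N_def)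
    qed
    \<comment> \<open>Elimination of \<open>cnj ?c\<close> from the two equations.\<close>
    have "?c * D = half_pairing (- 1) m2 r2 * (?c * half_pairing 1 m1 r1 + cnj ?c * half_pairing (- 1) m1 r1) - half_pairing (- 1) m1 r1 * (?c * half_pairing 1 m2 r2 + cnj ?c * half_pairing (- 1) m2 r2)"
      by (simp add: D_def algebra_simps)
    then have "cmod ?c * cmod D \<le> cmod (half_pairing (- 1) m2 r2) * (\<epsilon> * N m1 r1) + cmod (half_pairing (- 1) m1 r1) * (\<epsilon> * N m2 r2)"
      unfolding norm_mult[symmetric] using test[OF r(1), of m1] test[OF r(2), of m2]
      by (auto simp: norm_mult intro!: order_trans[OF norm_triangle_ineq4] add_mono mult_left_mono)
    also have "\<dots> = B * \<epsilon>" by (simp add: B_def algebra_simps)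
    also have "\<dots> \<le> (B + 1) * \<epsilon>" using \<epsilon> by (simp add: algebra_simps)
    finally show "cmod ?c \<le> (B + 1) / cmod D * \<epsilon>" using D unfolding D_def by (simp add: field_simps)
  qed
qed

end

section \<open>The nonlinear part of the profile\<close>

lemma eventually_at_right_nonneg: "\<forall>\<^sub>F x::real in at_right 0. 0 \<le> x"
  by (rule eventually_mono[OF eventually_at_right_less]) auto

context gkdv begin

definition L1_norm :: "(real \<Rightarrow> complex) \<Rightarrow> real" where "L1_norm w = (LINT x|lborel. cmod (w x))"

lemma L1_norm_nonneg: "0 \<le> L1_norm w" by (simp add: L1_norm_def integral_nonneg_AE)

text \<open>The integrand of \<open>H\<close> in the overview; \<open>osc_fourier\<close> is
  \<open>H\<close>.\<close>

definition osc_fourier_deriv :: "(real \<Rightarrow> complex) \<Rightarrow> real \<Rightarrow> complex" where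
  "osc_fourier_deriv w \<eta> = cis (\<eta> powr (\<alpha> + 1)) * of_real (\<eta> powr gam) * fourier w \<eta>"

definition osc_fourier :: "(real \<Rightarrow> complex) \<Rightarrow> real \<Rightarrow> complex" where
  "osc_fourier w \<zeta> = integral {0..\<zeta>} (osc_fourier_deriv w)"

lemma osc_fourier_deriv_continuous: "integrable lborel w \<Longrightarrow> continuous_on {0..} (osc_fourier_deriv w)"
  unfolding osc_fourier_deriv_def[abs_def] using gam_pos alpha_gt
  by (intro continuous_intros fourier_continuous continuous_on_powr') auto

lemma osc_fourier_deriv_integrable: "integrable lborel w \<Longrightarrow> 0 \<le> c \<Longrightarrow> osc_fourier_deriv w integrable_on {c..d}"
  by (intro integrable_continuous_interval continuous_on_subset[OF osc_fourier_deriv_continuous]) auto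

lemma osc_fourier_deriv_bound: "integrable lborel w \<Longrightarrow> cmod (osc_fourier_deriv w \<eta>) \<le> L1_norm w * \<eta> powr gam"
  using mult_right_mono[OF fourier_bound[of w \<eta>], of "\<eta> powr gam"] by (simp add: osc_fourier_deriv_def norm_mult L1_norm_def mult.commute)

lemma osc_fourier_bound_small:
  assumes w: "integrable lborel w" and "0 \<le> \<zeta>"
  shows "cmod (osc_fourier w \<zeta>) \<le> L1_norm w * \<zeta> powr (gam + 1)"
proof -
  have "cmod (osc_fourier w \<zeta>) \<le> L1_norm w * \<zeta> powr (gam + 1) / (gam + 1)"
    unfolding osc_fourier_def using assms gam_pos L1_norm_nonneg by (intro norm_integral_powr_le osc_fourier_deriv_integrable osc_fourier_deriv_bound) auto
  also have "\<dots> \<le> L1_norm w * \<zeta> powr (gam + 1) / 1"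
    using gam_pos L1_norm_nonneg by (intro divide_left_mono) auto
  finally show ?thesis by simp
qed

definition hconst :: real where "hconst = 7 + 6 * gam / (gam - rho)"

lemma hconst_ge: "7 \<le> hconst" using gam_pos rho_lt_gam by (simp add: hconst_def)

text \<open>Interchanging the integrals turns \<open>osc_fourier\<close> into an average over \<open>x\<close> of oscillatory integrals
  with the phase of the linear group, whose bound does not depend on \<open>x\<close>.\<close>

lemma osc_fourier_bound_large:
  assumes w: "integrable lborel w" and z: "1 \<le> \<zeta>"
  shows "cmod (osc_fourier w \<zeta>) \<le> hconst * L1_norm w * \<zeta> powr (gam - rho)"
proof -
  have [measurable]: "w \<in> borel_measurable borel" using w by (auto dest: borel_measurable_integrable)
  let ?k = "\<lambda>\<eta>. complex_of_real (indicator {0..\<zeta>} \<eta> * \<eta> powr gam) * cis (\<eta> powr (\<alpha> + 1))"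
  let ?I = "\<lambda>x. integral {0..\<zeta>} (\<lambda>\<eta>. cis (phase x \<eta>) * of_real (\<eta> powr gam))"
  have sI: "set_integrable lborel {0..\<zeta>} (osc_fourier_deriv w)"
    by (rule borel_integrable_atLeastAtMost') (rule continuous_on_subset[OF osc_fourier_deriv_continuous[OF w]], auto)
  have "osc_fourier w \<zeta> = (LINT \<eta>:{0..\<zeta>}|lborel. osc_fourier_deriv w \<eta>)"
    unfolding osc_fourier_def using set_borel_integral_eq_integral(2)[OF sI] by simp
  also have "\<dots> = (LINT \<eta>|lborel. LINT x|lborel. ?k \<eta> * (cis (- (x * \<eta>)) * w x))"
    unfolding set_lebesgue_integral_def integral_mult_right_zero fourier_def[symmetric]
    by (intro Bochner_Integration.integral_cong) (auto simp: osc_fourier_deriv_def indicator_def)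
  also have "\<dots> = (LINT x|lborel. LINT \<eta>|lborel. ?k \<eta> * (cis (- (x * \<eta>)) * w x))"
  proof (rule LINT_Fubini_product(1)[where g="\<lambda>\<eta>. indicator {0..\<zeta>} \<eta> * \<zeta> powr gam" and h="\<lambda>x. cmod (w x)"])
    show "integrable lborel (\<lambda>\<eta>. indicator {0..\<zeta>} \<eta> * \<zeta> powr gam)"
      using z by (intro integrable_mult_left) (simp add: integrable_indicator_iff)
    fix \<eta> x
    have "indicator {0..\<zeta>} \<eta> * \<eta> powr gam \<le> indicator {0..\<zeta>} \<eta> * \<zeta> powr gam"
      using gam_pos by (auto simp: indicator_def intro: powr_mono2)
    then show "cmod (?k \<eta> * (cis (- (x * \<eta>)) * w x)) \<le> indicator {0..\<zeta>} \<eta> * \<zeta> powr gam * cmod (w x)"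
      unfolding norm_mult norm_cis norm_of_real by (simp add: mult_right_mono)
  qed (use w in auto)
  also have "\<dots> = (LINT x|lborel. w x * cnj (?I x))"
  proof (rule Bochner_Integration.integral_cong[OF refl])
    fix x
    have "set_integrable lborel {0..\<zeta>} (\<lambda>\<eta>. cis (phase x \<eta>) * complex_of_real (\<eta> powr gam))"
      by (rule borel_integrable_atLeastAtMost')
         (use gam_pos in \<open>auto intro!: continuous_intros phase_cont continuous_on_powr'\<close>)
    from set_borel_integral_eq_integral(2)[OF this]
    have "cnj (?I x) = cnj (LINT \<eta>|lborel. indicator {0..\<zeta>} \<eta> *\<^sub>R (cis (phase x \<eta>) * complex_of_real (\<eta> powr gam)))"
      by (simp add: set_lebesgue_integral_def)
    also have "\<dots> = (LINT \<eta>|lborel. cnj (indicator {0..\<zeta>} \<eta> *\<^sub>R (cis (phase x \<eta>) * complex_of_real (\<eta> powr gam))))"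
      by (rule Bochner_Integration.integral_cnj[symmetric])
    finally have e: "w x * cnj (?I x) = (LINT \<eta>|lborel. w x * cnj (indicator {0..\<zeta>} \<eta> *\<^sub>R (cis (phase x \<eta>) * complex_of_real (\<eta> powr gam))))"
      by (simp only: integral_mult_right_zero)
    show "(LINT \<eta>|lborel. ?k \<eta> * (cis (- (x * \<eta>)) * w x)) = w x * cnj (?I x)"
      unfolding e
    proof (rule Bochner_Integration.integral_cong[OF refl])
      fix \<eta> :: real
      have "cis (\<eta> powr (\<alpha> + 1)) * cis (- (x * \<eta>)) = cnj (cis (phase x \<eta>))" by (simp add: cis_mult cis_cnj phase_def)
      then show "?k \<eta> * (cis (- (x * \<eta>)) * w x) = w x * cnj (indicator {0..\<zeta>} \<eta> *\<^sub>R (cis (phase x \<eta>) * complex_of_real (\<eta> powr gam)))"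
        by (simp add: indicator_def mult_ac)
    qed
  qed
  finally have eq: "osc_fourier w \<zeta> = (LINT x|lborel. w x * cnj (?I x))" .
  show ?thesis
  \<comment> \<open>If the function were not integrable, its integral would be 0 by convention and
    the bound would hold as well.\<close>
  proof (cases "integrable lborel (\<lambda>x. w x * cnj (?I x))")
    case True
    have "cmod (osc_fourier w \<zeta>) \<le> (LINT x|lborel. cmod (w x) * (hconst * \<zeta> powr (gam - rho)))"
      unfolding eq
    proof (rule order_trans[OF integral_norm_bound integral_mono[OF integrable_norm[OF True]]])
      show "integrable lborel (\<lambda>x. cmod (w x) * (hconst * \<zeta> powr (gam - rho)))" using w by (intro integrable_mult_left integrable_norm)
      show "cmod (w x * cnj (?I x)) \<le> cmod (w x) * (hconst * \<zeta> powr (gam - rho))" for x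
        unfolding norm_mult complex_mod_cnj hconst_def by (intro mult_left_mono phase_powr_integral_bound z) auto
    qed
    then show ?thesis by (simp add: L1_norm_def mult_ac)
  next
    case False
    then show ?thesis unfolding eq using hconst_ge L1_norm_nonneg by (simp add: not_integrable_integral_eq)
  qed
qed

text \<open>The scaled argument may drop below 1, where the bound for large arguments fails; there
  the trivial bound is at most \<open>L1_norm w\<close>.\<close>

lemma osc_fourier_bound_scaled:
  assumes w: "integrable lborel w" and z: "1 \<le> \<zeta>" and r: "0 \<le> r" "r \<le> 1"
  shows "cmod (osc_fourier w (r * \<zeta>)) \<le> hconst * L1_norm w * \<zeta> powr (gam - rho)"
proof -
  have C: "0 \<le> hconst * L1_norm w" using hconst_ge L1_norm_nonneg by simp
  have g: "0 \<le> gam - rho" using rho_lt_gam by simp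
  show ?thesis
  proof (cases "1 \<le> r * \<zeta>")
    case True
    have "cmod (osc_fourier w (r * \<zeta>)) \<le> hconst * L1_norm w * (r * \<zeta>) powr (gam - rho)" by (rule osc_fourier_bound_large[OF w True])
    also have "\<dots> \<le> hconst * L1_norm w * \<zeta> powr (gam - rho)"
      using C g r z True by (intro mult_left_mono powr_mono2 mult_left_le_one_le) auto
    finally show ?thesis .
  next
    case False
    have p: "(r * \<zeta>) powr (gam + 1) \<le> 1" using False r z gam_pos by (intro powr_le1) auto
    have "cmod (osc_fourier w (r * \<zeta>)) \<le> L1_norm w * (r * \<zeta>) powr (gam + 1)" using r z by (intro osc_fourier_bound_small[OF w]) auto
    also have "\<dots> \<le> L1_norm w * 1" using p L1_norm_nonneg by (intro mult_left_mono) auto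
    also have "\<dots> \<le> hconst * L1_norm w * 1" 
    proof -
      have "1 * L1_norm w \<le> hconst * L1_norm w" by (intro mult_right_mono L1_norm_nonneg) (use hconst_ge in auto)
      then show ?thesis by simp
    qed
    also have "\<dots> \<le> hconst * L1_norm w * \<zeta> powr (gam - rho)" using C g z by (intro mult_left_mono ge_one_powr_ge_zero) auto
    finally show ?thesis .
  qed
qed

text \<open>1 / (p + 1) comes from writing the nonlinearity as a derivative, \<i> from that
  derivative, and \<alpha> + 1 = 1 / bb from the substitution in time.\<close>

definition kap :: complex where "kap = \<i> * of_real ((\<alpha> + 1) / (real p + 1))"

lemma kap_le: "cmod kap \<le> 1"
  unfolding kap_def norm_mult norm_of_real using alpha_gt alpha_le p_pos by (simp add: abs_of_pos)

text \<open>The amplitude of the Duhamel integral over \<open>[\<epsilon>, t]\<close>, with \<open>r = (\<epsilon> / t) powr (1 / (\<alpha> + 1))\<close>.\<close>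

definition duhamel_amp :: "(real \<Rightarrow> complex) \<Rightarrow> real \<Rightarrow> real \<Rightarrow> complex" where
  "duhamel_amp w r \<zeta> = kap * (of_real (\<zeta> powr (- gam)) * (osc_fourier w \<zeta> - osc_fourier w (r * \<zeta>)))"

definition duhamel_amp_deriv :: "(real \<Rightarrow> complex) \<Rightarrow> real \<Rightarrow> real \<Rightarrow> complex" where
  "duhamel_amp_deriv w r \<zeta> = kap * (of_real (\<zeta> powr (- gam)) * (osc_fourier_deriv w \<zeta> - of_real r * osc_fourier_deriv w (r * \<zeta>)) +
     of_real (- gam * \<zeta> powr (- gam - 1)) * (osc_fourier w \<zeta> - osc_fourier w (r * \<zeta>)))"

lemma osc_fourier_derivative:
  assumes w: "integrable lborel w" and z: "0 < \<zeta>"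
  shows "(osc_fourier w has_vector_derivative osc_fourier_deriv w \<zeta>) (at \<zeta>)"
proof -
  have "((\<lambda>u. integral {0..u} (osc_fourier_deriv w)) has_vector_derivative osc_fourier_deriv w \<zeta>) (at \<zeta> within {0..\<zeta> + 1})"
    by (rule integral_has_vector_derivative) (use z in \<open>auto intro: continuous_on_subset[OF osc_fourier_deriv_continuous[OF w]]\<close>)
  moreover have "at \<zeta> within {0..\<zeta> + 1} = at \<zeta>" using z by (intro at_within_interior) auto
  ultimately show ?thesis by (simp add: osc_fourier_def[abs_def])
qed

lemma osc_fourier_scaled_derivative:
  assumes w: "integrable lborel w" and z: "0 < \<zeta>" and r: "0 \<le> r"
  shows "((\<lambda>\<zeta>. osc_fourier w (r * \<zeta>)) has_vector_derivative of_real r * osc_fourier_deriv w (r * \<zeta>)) (at \<zeta>)"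
proof (cases "r = 0")
  case False
  have "((\<lambda>\<zeta>. r * \<zeta>) has_real_derivative r) (at \<zeta>)" by (auto intro!: derivative_eq_intros)
  moreover have "(osc_fourier w has_vector_derivative osc_fourier_deriv w (r * \<zeta>)) (at (r * \<zeta>))" using False r z by (intro osc_fourier_derivative[OF w]) simp
  ultimately show ?thesis
    using vector_diff_chain_at[of "\<lambda>\<zeta>. r * \<zeta>" r \<zeta> "osc_fourier w" "osc_fourier_deriv w (r * \<zeta>)"]
    by (simp add: has_real_derivative_iff_has_vector_derivative comp_def scaleR_conv_of_real)
qed simp

text \<open>Sums the contributions of all ranges to amplitude and derivative: 2 from the two
  integrands, 2 from the two values of \<open>osc_fourier\<close> near the origin, 2 * hconst from
  them at infinity.\<close>

definition aconst :: real where "aconst = 2 * hconst + 4"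

text \<open>The constant is independent of \<open>r\<close>, so the Duhamel integrals over
  \<open>{\<epsilon>..t}\<close> and their limit, r = 0, are controlled together. Scaling by r \<le>
  1 preserves the bounds for \<open>osc_fourier\<close>.\<close>

lemma duhamel_amp_amplitude:
  assumes w: "integrable lborel w" and r: "0 \<le> r" "r \<le> 1"
  shows "amplitude (aconst * L1_norm w) (duhamel_amp w r) (duhamel_amp_deriv w r)"
  unfolding amplitude_def
proof (intro conjI allI impI)
  have cf: "continuous_on {0<..} (osc_fourier w)" 
    unfolding continuous_on_eq_continuous_at[OF open_greaterThan] using osc_fourier_derivative[OF w] has_vector_derivative_continuous by blast
  have cr: "continuous_on {0<..} (\<lambda>\<zeta>. osc_fourier w (r * \<zeta>))"
    unfolding continuous_on_eq_continuous_at[OF open_greaterThan] using osc_fourier_scaled_derivative[OF w _ r(1)] has_vector_derivative_continuous by blast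
  show "continuous_on {0<..} (duhamel_amp_deriv w r)"
    unfolding duhamel_amp_deriv_def[abs_def] using r
    by (intro continuous_intros cf cr continuous_on_subset[OF osc_fourier_deriv_continuous[OF w]] continuous_on_compose2[OF osc_fourier_deriv_continuous[OF w]]) auto
next
  fix \<zeta> :: real assume z: "0 < \<zeta>"
  have "((\<lambda>\<xi>. \<xi> powr (- gam)) has_real_derivative (- gam * \<zeta> powr (- gam - 1))) (at \<zeta>)"
    using z by (auto intro!: derivative_eq_intros)
  from has_vector_derivative_mult_right[OF has_vector_derivative_mult[OF has_vector_derivative_of_real[OF this]
      has_vector_derivative_diff[OF osc_fourier_derivative[OF w z] osc_fourier_scaled_derivative[OF w z r(1)]]], of kap]
  show "(duhamel_amp w r has_vector_derivative duhamel_amp_deriv w r \<zeta>) (at \<zeta>)"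
    unfolding duhamel_amp_def[abs_def] duhamel_amp_deriv_def .
next
  fix \<zeta> :: real
  define N where "N = L1_norm w"
  have N: "0 \<le> N" by (simp add: N_def L1_norm_nonneg)
  have C: "0 \<le> hconst * N" using N hconst_ge by simp
  have k: "cmod (kap * z) \<le> cmod z" for z using kap_le by (simp add: norm_mult mult_left_le_one_le)
  \<comment> \<open>The powers cancel and a bounded Fourier transform without decay remains: the
    origin of the merely bounded derivative in \<open>amplitude\<close>.\<close>
  have d: "cmod (of_real (\<zeta> powr (- gam)) * (osc_fourier_deriv w \<zeta> - of_real r * osc_fourier_deriv w (r * \<zeta>))) \<le> 2 * N" if z: "0 < \<zeta>"
  proof -
    have "cmod (osc_fourier_deriv w \<zeta>) \<le> N * \<zeta> powr gam" unfolding N_def by (rule osc_fourier_deriv_bound[OF w])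
    moreover have "cmod (of_real r * osc_fourier_deriv w (r * \<zeta>)) \<le> 1 * (N * \<zeta> powr gam)"
    proof -
      have "cmod (osc_fourier_deriv w (r * \<zeta>)) \<le> N * (r * \<zeta>) powr gam" unfolding N_def by (rule osc_fourier_deriv_bound[OF w])
      also have "\<dots> \<le> N * \<zeta> powr gam" using N r z gam_pos by (intro mult_left_mono powr_mono2 mult_left_le_one_le) auto
      finally show ?thesis unfolding norm_mult norm_of_real using r by (intro mult_mono) auto
    qed
    ultimately have "cmod (osc_fourier_deriv w \<zeta> - of_real r * osc_fourier_deriv w (r * \<zeta>)) \<le> 2 * N * \<zeta> powr gam"
      using norm_triangle_ineq4[of "osc_fourier_deriv w \<zeta>" "of_real r * osc_fourier_deriv w (r * \<zeta>)"] by simp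
    then have "\<zeta> powr (- gam) * cmod (osc_fourier_deriv w \<zeta> - of_real r * osc_fourier_deriv w (r * \<zeta>)) \<le> \<zeta> powr (- gam) * (2 * N * \<zeta> powr gam)"
      by (intro mult_left_mono) auto
    also have "\<dots> = 2 * N" using z by (simp add: powr_minus field_simps)
    finally show ?thesis by (simp add: norm_mult)
  qed
  have e: "cmod (of_real (- gam * \<zeta> powr (- gam - 1)) * (osc_fourier w \<zeta> - osc_fourier w (r * \<zeta>))) \<le> \<zeta> powr (- gam - 1) * cmod (osc_fourier w \<zeta> - osc_fourier w (r * \<zeta>))"
    unfolding norm_mult norm_of_real using gam_pos gam_lt by (intro mult_right_mono) (auto simp: abs_mult mult_left_le_one_le)
  have t: "cmod (duhamel_amp_deriv w r \<zeta>) \<le> 2 * N + \<zeta> powr (- gam - 1) * cmod (osc_fourier w \<zeta> - osc_fourier w (r * \<zeta>))" if z: "0 < \<zeta>"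
    unfolding duhamel_amp_deriv_def by (rule order_trans[OF k], rule order_trans[OF norm_triangle_ineq]) (intro add_mono d e z)
  have u: "cmod (duhamel_amp w r \<zeta>) \<le> \<zeta> powr (- gam) * cmod (osc_fourier w \<zeta> - osc_fourier w (r * \<zeta>))"
    unfolding duhamel_amp_def by (rule order_trans[OF k]) (simp add: norm_mult)
  have aC: "aconst * N = 2 * (hconst * N) + 4 * N" by (simp add: aconst_def algebra_simps)
  { assume z: "0 < \<zeta> \<and> \<zeta> \<le> 1"
    have "cmod (osc_fourier w \<zeta>) \<le> N * \<zeta> powr (gam + 1)" unfolding N_def using z by (intro osc_fourier_bound_small[OF w]) auto
    moreover have "cmod (osc_fourier w (r * \<zeta>)) \<le> N * \<zeta> powr (gam + 1)"
    proof -
      have "cmod (osc_fourier w (r * \<zeta>)) \<le> N * (r * \<zeta>) powr (gam + 1)" unfolding N_def using r z by (intro osc_fourier_bound_small[OF w]) auto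
      also have "\<dots> \<le> N * \<zeta> powr (gam + 1)" using N r z gam_pos by (intro mult_left_mono powr_mono2 mult_left_le_one_le) auto
      finally show ?thesis .
    qed
    ultimately have h: "cmod (osc_fourier w \<zeta> - osc_fourier w (r * \<zeta>)) \<le> 2 * N * \<zeta> powr (gam + 1)"
      using norm_triangle_ineq4[of "osc_fourier w \<zeta>" "osc_fourier w (r * \<zeta>)"] by simp
    have one: "1 \<le> \<zeta> powr (- gam)" "1 \<le> \<zeta> powr (- gam - 1)"
      using z gam_pos powr_mono'[of "- gam" 0 \<zeta>] powr_mono'[of "- gam - 1" 0 \<zeta>] by auto
    have "cmod (duhamel_amp w r \<zeta>) \<le> \<zeta> powr (- gam) * (2 * N * \<zeta> powr (gam + 1))"
      by (rule order_trans[OF u]) (intro mult_left_mono h, auto)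
    also have "\<dots> = 2 * N * \<zeta>" using z by (simp add: powr_add powr_minus field_simps)
    also have "\<dots> \<le> 2 * N * 1" using z N by (intro mult_left_mono) auto
    also have "\<dots> \<le> aconst * N * 1" using C N unfolding aC by simp
    also have "\<dots> \<le> aconst * N * \<zeta> powr (- gam)" using one C N unfolding aC by (intro mult_left_mono) auto
    finally show "cmod (duhamel_amp w r \<zeta>) \<le> aconst * L1_norm w * \<zeta> powr (- gam)" by (simp add: N_def)
    have "cmod (duhamel_amp_deriv w r \<zeta>) \<le> 2 * N + \<zeta> powr (- gam - 1) * (2 * N * \<zeta> powr (gam + 1))"
      by (rule order_trans[OF t add_left_mono[OF mult_left_mono[OF h]]]) (use z in auto)
    also have "\<zeta> powr (- gam - 1) * (2 * N * \<zeta> powr (gam + 1)) = 2 * N * (\<zeta> powr (- gam - 1) * \<zeta> powr (gam + 1))" by simp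
    also have "\<zeta> powr (- gam - 1) * \<zeta> powr (gam + 1) = 1" using z by (simp flip: powr_add)
    also have "2 * N + 2 * N * 1 \<le> aconst * N * 1" using C N unfolding aC by simp
    also have "\<dots> \<le> aconst * N * \<zeta> powr (- gam - 1)" using one C N unfolding aC by (intro mult_left_mono) auto
    finally show "cmod (duhamel_amp_deriv w r \<zeta>) \<le> aconst * L1_norm w * \<zeta> powr (- gam - 1)" by (simp add: N_def) }
  { assume z: "1 \<le> \<zeta>"
    have h: "cmod (osc_fourier w \<zeta> - osc_fourier w (r * \<zeta>)) \<le> 2 * (hconst * N) * \<zeta> powr (gam - rho)"
      using norm_triangle_ineq4[of "osc_fourier w \<zeta>" "osc_fourier w (r * \<zeta>)"] osc_fourier_bound_scaled[OF w z r] osc_fourier_bound_large[OF w z] by (simp add: N_def)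
    have "cmod (duhamel_amp w r \<zeta>) \<le> \<zeta> powr (- gam) * (2 * (hconst * N) * \<zeta> powr (gam - rho))"
      by (rule order_trans[OF u]) (intro mult_left_mono h, auto)
    also have "\<dots> = 2 * (hconst * N) * (\<zeta> powr (- gam) * \<zeta> powr (gam - rho))" by simp
    also have "\<zeta> powr (- gam) * \<zeta> powr (gam - rho) = \<zeta> powr (- rho)" using z by (simp flip: powr_add)
    also have "2 * (hconst * N) * \<zeta> powr (- rho) \<le> aconst * N * \<zeta> powr (- rho)" using C N unfolding aC by (intro mult_right_mono) auto
    finally show "cmod (duhamel_amp w r \<zeta>) \<le> aconst * L1_norm w * \<zeta> powr (- rho)" by (simp add: N_def)
    have "cmod (duhamel_amp_deriv w r \<zeta>) \<le> 2 * N + \<zeta> powr (- gam - 1) * (2 * (hconst * N) * \<zeta> powr (gam - rho))"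
      by (rule order_trans[OF t add_left_mono[OF mult_left_mono[OF h]]]) (use z in auto)
    also have "\<zeta> powr (- gam - 1) * (2 * (hconst * N) * \<zeta> powr (gam - rho)) = 2 * (hconst * N) * (\<zeta> powr (- gam - 1) * \<zeta> powr (gam - rho))" by simp
    also have "\<zeta> powr (- gam - 1) * \<zeta> powr (gam - rho) = \<zeta> powr (- 1 - rho)" using z by (simp flip: powr_add)
    also have "2 * (hconst * N) * \<zeta> powr (- 1 - rho) \<le> 2 * (hconst * N) * 1"
      using C z rho_ge by (intro mult_left_mono powr_neg_le_one) auto
    also have "2 * N + 2 * (hconst * N) * 1 \<le> aconst * N" using N unfolding aC by simp
    finally show "cmod (duhamel_amp_deriv w r \<zeta>) \<le> aconst * L1_norm w" by (simp add: N_def) }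
qed

text \<open>Tails beyond a large \<open>Z\<close> are small uniformly in \<open>r\<close> by
  \<open>osc_tail\<close>. On \<open>{0..Z}\<close> the two amplitudes differ by a multiple of
  \<open>osc_fourier w (r * \<xi>)\<close>, which is of order
  \<open>r powr (gam + 1)\<close>.\<close>

lemma duhamel_amp_small_r:
  assumes w: "integrable lborel w"
  shows "((\<lambda>r. profile (duhamel_amp w r) x) \<longlongrightarrow> profile (duhamel_amp w 0) x) (at_right 0)"
proof -
  define N where "N = L1_norm w"
  have N: "0 \<le> N" by (simp add: N_def L1_norm_nonneg)
  define T where "T = aconst * N * (4 + 1 / (\<alpha> - 1))"
  have hf0: "osc_fourier w 0 = 0" by (simp add: osc_fourier_def)
  have "((\<lambda>r. osc (duhamel_amp w r) x) \<longlongrightarrow> osc (duhamel_amp w 0) x) (at_right 0)"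
  proof (rule tendstoI)
    fix e :: real assume e: "0 < e"
    have t: "((\<lambda>Z. 2 * T * Z powr (1 - \<alpha>)) \<longlongrightarrow> 0) at_top"
      by (intro tendsto_mult_right_zero tendsto_neg_powr filterlim_ident) (use alpha_gt in auto)
    have "\<forall>\<^sub>F Z in at_top. 2 * T * Z powr (1 - \<alpha>) < e / 2" by (rule order_tendstoD(2)[OF t]) (use e in simp)
    then have "\<forall>\<^sub>F Z in at_top. 2 * T * Z powr (1 - \<alpha>) < e / 2 \<and> 1 + \<bar>x\<bar> \<le> Z" by (intro eventually_conj eventually_ge_at_top)
    then obtain Z where Z: "2 * T * Z powr (1 - \<alpha>) < e / 2" "1 + \<bar>x\<bar> \<le> Z"
      using eventually_happens'[OF trivial_limit_at_top_linorder] by blast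
    have "Z powr 1 \<le> Z powr \<alpha>" using Z alpha_gt by (intro powr_mono) auto
    then have Z1: "1 \<le> Z" "\<bar>x\<bar> \<le> Z powr \<alpha>" using Z by auto
    have b: "dist (osc (duhamel_amp w r) x) (osc (duhamel_amp w 0) x) \<le> 2 * T * Z powr (1 - \<alpha>) + N * r powr (gam + 1) * (Z powr (1 + 1) / (1 + 1))" if r: "0 < r" "r \<le> 1" for r
    proof -
      have a: "amplitude (aconst * N) (duhamel_amp w r) (duhamel_amp_deriv w r)" "amplitude (aconst * N) (duhamel_amp w 0) (duhamel_amp_deriv w 0)"
        unfolding N_def using r by (auto intro: duhamel_amp_amplitude[OF w])
      have "trunc (duhamel_amp w r) x Z - trunc (duhamel_amp w 0) x Z = integral {0..Z} (\<lambda>\<xi>. cis (phase x \<xi>) * duhamel_amp w r \<xi> - cis (phase x \<xi>) * duhamel_amp w 0 \<xi>)"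
        by (rule integral_diff[OF amplitude_integrable[OF a(1) order_refl] amplitude_integrable[OF a(2) order_refl], symmetric])
      also have "cmod \<dots> \<le> N * r powr (gam + 1) * Z powr (1 + 1) / (1 + 1)"
      proof (rule norm_integral_powr_le)
        show "(\<lambda>\<xi>. cis (phase x \<xi>) * duhamel_amp w r \<xi> - cis (phase x \<xi>) * duhamel_amp w 0 \<xi>) integrable_on {0..Z}"
          by (rule integrable_diff[OF amplitude_integrable[OF a(1) order_refl] amplitude_integrable[OF a(2) order_refl]])
        fix \<xi> assume \<xi>: "0 < \<xi>" "\<xi> \<le> Z"
        have "cis (phase x \<xi>) * duhamel_amp w r \<xi> - cis (phase x \<xi>) * duhamel_amp w 0 \<xi> = cis (phase x \<xi>) * (kap * (of_real (\<xi> powr (- gam)) * (- osc_fourier w (r * \<xi>))))"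
          by (simp add: duhamel_amp_def hf0 algebra_simps)
        also have "cmod \<dots> \<le> 1 * (\<xi> powr (- gam) * (N * (r * \<xi>) powr (gam + 1)))"
        proof -
          have h: "cmod (osc_fourier w (r * \<xi>)) \<le> N * (r * \<xi>) powr (gam + 1)"
            unfolding N_def using \<xi> r by (intro osc_fourier_bound_small[OF w]) auto
          have "cmod kap * (\<xi> powr (- gam) * cmod (osc_fourier w (r * \<xi>))) \<le> 1 * (\<xi> powr (- gam) * (N * (r * \<xi>) powr (gam + 1)))"
            by (intro mult_mono mult_left_mono kap_le h mult_nonneg_nonneg) (auto simp: N)
          then show ?thesis by (simp add: norm_mult)
        qed
        also have "\<dots> = N * r powr (gam + 1) * \<xi> powr 1"
          using \<xi> r by (simp add: powr_mult powr_add powr_minus field_simps)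
        finally show "cmod (cis (phase x \<xi>) * duhamel_amp w r \<xi> - cis (phase x \<xi>) * duhamel_amp w 0 \<xi>) \<le> N * r powr (gam + 1) * \<xi> powr 1" .
      qed (use Z1 N in auto)
      finally have m: "cmod (trunc (duhamel_amp w r) x Z - trunc (duhamel_amp w 0) x Z) \<le> N * r powr (gam + 1) * (Z powr (1 + 1) / (1 + 1))" by simp
      have s: "cmod (osc (duhamel_amp w r) x - trunc (duhamel_amp w r) x Z) \<le> T * Z powr (1 - \<alpha>)" "cmod (osc (duhamel_amp w 0) x - trunc (duhamel_amp w 0) x Z) \<le> T * Z powr (1 - \<alpha>)"
        unfolding T_def by (rule osc_tail[OF a(1) Z1], rule osc_tail[OF a(2) Z1])
      have "osc (duhamel_amp w r) x - osc (duhamel_amp w 0) x = (osc (duhamel_amp w r) x - trunc (duhamel_amp w r) x Z) + (trunc (duhamel_amp w r) x Z - trunc (duhamel_amp w 0) x Z) - (osc (duhamel_amp w 0) x - trunc (duhamel_amp w 0) x Z)" by simp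
      then have "dist (osc (duhamel_amp w r) x) (osc (duhamel_amp w 0) x) \<le> cmod (osc (duhamel_amp w r) x - trunc (duhamel_amp w r) x Z) + cmod (trunc (duhamel_amp w r) x Z - trunc (duhamel_amp w 0) x Z) + cmod (osc (duhamel_amp w 0) x - trunc (duhamel_amp w 0) x Z)"
        unfolding dist_norm by (simp only:) (rule order_trans[OF norm_triangle_ineq4 add_right_mono[OF norm_triangle_ineq]])
      then show ?thesis using s m by linarith
    qed
    have "((\<lambda>r. N * r powr (gam + 1) * (Z powr (1 + 1) / (1 + 1))) \<longlongrightarrow> N * 0 powr (gam + 1) * (Z powr (1 + 1) / (1 + 1))) (at_right 0)"
      using gam_pos by (intro tendsto_intros tendsto_powr') (auto intro: eventually_at_right_nonneg)
    then have t0: "((\<lambda>r. N * r powr (gam + 1) * (Z powr (1 + 1) / (1 + 1))) \<longlongrightarrow> 0) (at_right 0)"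
      by (rule tendsto_eq_rhs) simp
    have "\<forall>\<^sub>F r in at_right 0. N * r powr (gam + 1) * (Z powr (1 + 1) / (1 + 1)) < e / 2"
      by (rule order_tendstoD(2)[OF t0]) (use e in simp)
    moreover have "\<forall>\<^sub>F r::real in at_right 0. 0 < r \<and> r < 1" by (auto simp: eventually_at_right_field intro: exI[of _ 1])
    ultimately show "\<forall>\<^sub>F r in at_right 0. dist (osc (duhamel_amp w r) x) (osc (duhamel_amp w 0) x) < e"
    proof eventually_elim
      case (elim r)
      then show ?case using b[of r] Z(1) by auto
    qed
  qed
  then show ?thesis unfolding profile_def by (intro tendsto_intros) auto
qed

end

section \<open>Duhamel's formula for a self-similar profile\<close>

lemma tempered_linear:
  assumes f: "f \<in> borel_measurable borel" and b: "\<And>x. cmod (f x) \<le> K * \<bar>x\<bar>"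
  shows "tempered_fun f"
proof -
  have [measurable]: "f \<in> borel_measurable borel" by (rule f)
  have K: "0 \<le> K" using order_trans[OF norm_ge_zero b[of 1]] by simp
  have "tempered_fun (\<lambda>x. f x / of_real (1 + \<bar>x\<bar>))"
  proof (rule tempered_bounded)
    fix x :: real
    have "cmod (f x) \<le> K * (1 + \<bar>x\<bar>)" using b[of x] K by (simp add: distrib_left)
    then show "cmod (f x / of_real (1 + \<bar>x\<bar>)) \<le> K"
      unfolding norm_divide norm_of_real by (simp add: divide_le_eq)
  qed measurable
  then obtain N :: nat where "integrable lborel (\<lambda>x. f x / of_real (1 + \<bar>x\<bar>) / of_real ((1 + \<bar>x\<bar>) ^ N))"
    unfolding tempered_fun_def by blast
  then have "integrable lborel (\<lambda>x. f x / of_real ((1 + \<bar>x\<bar>) ^ Suc N))"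
    by simp
  moreover have "f \<in> borel_measurable lborel" using f by simp
  ultimately show ?thesis unfolding tempered_fun_def by blast
qed

lemma fourier_cnj_symmetric: "fourier (\<lambda>x. of_real (W x)) (- \<xi>) = cnj (fourier (\<lambda>x. of_real (W x)) \<xi>)"
  unfolding fourier_def Bochner_Integration.integral_cnj[symmetric] by (simp add: cis_cnj)

context gkdv begin

text \<open>The scaling invariance of the equation: the power of s produced by the substitution
  \<eta> = \<open>s powr bb * \<xi>\<close> in the definition of \<open>osc_fourier\<close> equals
  the power carried by the transform of \<open>u ^ (p + 1)\<close> at time s.\<close>

lemma exponent_identity: "bb * gam + bb - 1 = bb - aa * (real p + 1)"
proof -
  have a: "0 < \<alpha> + 1" using alpha_gt by simp
  have "aa = bb * sg" by (simp add: aa_def bb_def sg_def)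
  moreover have "bb * \<alpha> = 1 - bb" using bb_alpha by (simp add: algebra_simps)
  moreover have "sg * real p = \<alpha>" using p_pos by (simp add: sg_def)
  ultimately have "aa * (real p + 1) = bb * sg + (1 - bb)"
    by (simp add: distrib_left mult.assoc)
  then show ?thesis by (simp add: gam_def algebra_simps)
qed

text \<open>The Fourier transform of \<open>u ^ p * u_x\<close> at time s for the self-similar u,
  where w = v ^ (p + 1).\<close>

definition duhamel_symb :: "(real \<Rightarrow> complex) \<Rightarrow> real \<Rightarrow> real \<Rightarrow> complex" where
  "duhamel_symb w s \<xi> = \<i> * of_real \<xi> / of_real (real p + 1) * (of_real (s powr (bb - aa * (real p + 1))) * fourier w (s powr bb * \<xi>))"

text \<open>Since bb * (\<alpha> + 1) = 1, the time-dependent phase becomes exactly the phase in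
  \<open>osc_fourier_deriv\<close>, and the remaining factor \<open>k\<close> is free of s. The
  lower limit \<epsilon> becomes the scaled argument with r =
  \<open>(\<epsilon> / t) powr bb\<close>.\<close>

lemma duhamel_symbol_pos:
  assumes w: "integrable lborel w" and e: "0 < \<epsilon>" "\<epsilon> < t" and \<xi>: "0 < \<xi>"
  shows "(LINT s:{\<epsilon>..t}|lborel. cis (- ((t - s) * \<xi> * \<bar>\<xi>\<bar> powr \<alpha>)) * duhamel_symb w s \<xi>) = self_similar_symbol (duhamel_amp w ((\<epsilon> / t) powr bb)) t \<xi>"
proof -
  have t: "0 < t" using e by simp
  define g where "g = (\<lambda>s. s powr bb * \<xi>)"
  define g' where "g' = (\<lambda>s. bb * s powr (bb - 1) * \<xi>)"
  have gm: "g s \<le> g s'" if "0 \<le> s" "s \<le> s'" for s s'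
    unfolding g_def using that \<xi> bb_pos by (intro mult_right_mono powr_mono2) auto
  have gh: "((\<lambda>s. g' s *\<^sub>R osc_fourier_deriv w (g s)) has_integral integral {g \<epsilon>..g t} (osc_fourier_deriv w)) {\<epsilon>..t}"
  proof (rule has_integral_substitution)
    show "g ` {\<epsilon>..t} \<subseteq> {0..g t}" using gm e \<xi> by (auto simp: g_def)
    show "continuous_on {0..g t} (osc_fourier_deriv w)" by (rule continuous_on_subset[OF osc_fourier_deriv_continuous[OF w]]) auto
    fix s assume "s \<in> {\<epsilon>..t}"
    then have "0 < s" using e(1) by simp
    then have "(g has_real_derivative g' s) (at s)"
      unfolding g_def g'_def by (auto intro!: derivative_eq_intros)
    then show "(g has_real_derivative g' s) (at s within {\<epsilon>..t})" by (rule has_field_derivative_at_within)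
  qed (use e gm in auto)
  have g\<epsilon>: "0 \<le> g \<epsilon>" "g \<epsilon> \<le> g t" using e \<xi> gm by (auto simp: g_def)
  have "integral {0..g \<epsilon>} (osc_fourier_deriv w) + integral {g \<epsilon>..g t} (osc_fourier_deriv w) = integral {0..g t} (osc_fourier_deriv w)"
    by (rule Henstock_Kurzweil_Integration.integral_combine[OF g\<epsilon> osc_fourier_deriv_integrable[OF w order_refl]])
  then have gi: "integral {g \<epsilon>..g t} (osc_fourier_deriv w) = osc_fourier w (g t) - osc_fourier w (g \<epsilon>)"
    by (simp add: osc_fourier_def algebra_simps)
  define k where "k = cis (- (t * \<xi> powr (\<alpha> + 1))) * kap * of_real (\<xi> powr (- gam))"
  have x1: "\<xi> * \<bar>\<xi>\<bar> powr \<alpha> = \<xi> powr (\<alpha> + 1)" using \<xi> by (simp add: powr_add mult.commute)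
  have pw: "cis (- ((t - s) * \<xi> * \<bar>\<xi>\<bar> powr \<alpha>)) * duhamel_symb w s \<xi> = k * (g' s *\<^sub>R osc_fourier_deriv w (g s))" if s: "0 < s" for s
  proof -
    have h: "osc_fourier_deriv w (g s) = cis (s * \<xi> powr (\<alpha> + 1)) * of_real (s powr (bb * gam) * \<xi> powr gam) * fourier w (s powr bb * \<xi>)"
      using s \<xi> by (simp add: osc_fourier_deriv_def g_def powr_mult powr_powr bb_alpha)
    have c: "cis (- (t * \<xi> powr (\<alpha> + 1))) * cis (s * \<xi> powr (\<alpha> + 1)) = cis (- ((t - s) * \<xi> * \<bar>\<xi>\<bar> powr \<alpha>))"
      unfolding cis_mult mult.assoc[of "t - s"] x1 by (simp add: algebra_simps)
    have r: "(\<alpha> + 1) / (real p + 1) * \<xi> powr (- gam) * (bb * s powr (bb - 1) * \<xi>) * (s powr (bb * gam) * \<xi> powr gam) = \<xi> / (real p + 1) * s powr (bb - aa * (real p + 1))"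
    proof -
      have "s powr (bb - aa * (real p + 1)) = s powr (bb - 1) * s powr (bb * gam)"
        unfolding exponent_identity[symmetric] by (simp flip: powr_add add: algebra_simps)
      moreover have "\<xi> powr (- gam) * \<xi> powr gam = 1" using \<xi> by (simp flip: powr_add)
      moreover have "(\<alpha> + 1) / (real p + 1) * \<xi> powr (- gam) * (bb * s powr (bb - 1) * \<xi>) * (s powr (bb * gam) * \<xi> powr gam) =
        ((\<alpha> + 1) * bb) * (\<xi> powr (- gam) * \<xi> powr gam) * (\<xi> / (real p + 1) * (s powr (bb - 1) * s powr (bb * gam)))" by simp
      ultimately show ?thesis using bb_alpha by (simp add: mult.commute)
    qed
    have "k * (g' s *\<^sub>R osc_fourier_deriv w (g s)) = \<i> * (cis (- (t * \<xi> powr (\<alpha> + 1))) * cis (s * \<xi> powr (\<alpha> + 1))) *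
       of_real ((\<alpha> + 1) / (real p + 1) * \<xi> powr (- gam) * (bb * s powr (bb - 1) * \<xi>) * (s powr (bb * gam) * \<xi> powr gam)) * fourier w (s powr bb * \<xi>)"
      unfolding k_def h g'_def kap_def scaleR_conv_of_real of_real_mult by (simp only: mult_ac)
    then show ?thesis unfolding c r duhamel_symb_def by (simp add: mult_ac)
  qed
  have "((\<lambda>s. k * (g' s *\<^sub>R osc_fourier_deriv w (g s))) has_integral k * (osc_fourier w (g t) - osc_fourier w (g \<epsilon>))) {\<epsilon>..t}"
    using has_integral_mult_right[OF gh, of k] unfolding gi by simp
  then have hi: "((\<lambda>s. cis (- ((t - s) * \<xi> * \<bar>\<xi>\<bar> powr \<alpha>)) * duhamel_symb w s \<xi>) has_integral k * (osc_fourier w (g t) - osc_fourier w (g \<epsilon>))) {\<epsilon>..t}"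
    by (rule has_integral_eq[rotated]) (use pw e in auto)
  have "set_integrable lborel {\<epsilon>..t} (\<lambda>s. cis (- ((t - s) * \<xi> * \<bar>\<xi>\<bar> powr \<alpha>)) * duhamel_symb w s \<xi>)"
  proof (rule borel_integrable_atLeastAtMost')
    show "continuous_on {\<epsilon>..t} (\<lambda>s. cis (- ((t - s) * \<xi> * \<bar>\<xi>\<bar> powr \<alpha>)) * duhamel_symb w s \<xi>)"
      unfolding duhamel_symb_def using e
      by (intro continuous_intros continuous_on_compose2[OF fourier_continuous[OF w, of UNIV]]) auto
  qed
  from set_borel_integral_eq_integral(2)[OF this]
  have "(LINT s:{\<epsilon>..t}|lborel. cis (- ((t - s) * \<xi> * \<bar>\<xi>\<bar> powr \<alpha>)) * duhamel_symb w s \<xi>) = k * (osc_fourier w (g t) - osc_fourier w (g \<epsilon>))"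
    using hi by (simp add: integral_unique)
  moreover have "self_similar_symbol (duhamel_amp w ((\<epsilon> / t) powr bb)) t \<xi> = k * (osc_fourier w (g t) - osc_fourier w (g \<epsilon>))"
  proof -
    have q1: "(\<epsilon> / t) powr bb * (t powr bb * \<xi>) = g \<epsilon>" using e t by (simp add: g_def powr_divide)
    have q2: "complex_of_real (t powr (bb * gam)) * of_real ((t powr bb * \<xi>) powr (- gam)) = of_real (\<xi> powr (- gam))"
      using t \<xi> by (simp add: powr_mult powr_powr powr_minus mult.assoc[symmetric] flip: of_real_mult)
    have q3: "self_similar_symbol (duhamel_amp w ((\<epsilon> / t) powr bb)) t \<xi> = cis (- (t * (\<xi> * \<bar>\<xi>\<bar> powr \<alpha>))) * kap *
      (complex_of_real (t powr (bb * gam)) * of_real ((t powr bb * \<xi>) powr (- gam))) * (osc_fourier w (t powr bb * \<xi>) - osc_fourier w ((\<epsilon> / t) powr bb * (t powr bb * \<xi>)))"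
      using \<xi> by (simp add: self_similar_symbol_def duhamel_amp_def mult_ac)
    show ?thesis unfolding q3 q2 q1 x1 by (simp add: k_def g_def)
  qed
  ultimately show ?thesis by simp
qed

text \<open>As \<open>W\<close> is real, its transform is conjugate symmetric, which settles
  negative frequencies; at \<xi> = 0 both sides are 0.\<close>

lemma duhamel_symbol:
  fixes W :: "real \<Rightarrow> real"
  defines "w \<equiv> \<lambda>x. complex_of_real (W x)"
  assumes w: "integrable lborel w" and e: "0 < \<epsilon>" "\<epsilon> < t"
  shows "(LINT s:{\<epsilon>..t}|lborel. cis (- ((t - s) * \<xi> * \<bar>\<xi>\<bar> powr \<alpha>)) * duhamel_symb w s \<xi>) = self_similar_symbol (duhamel_amp w ((\<epsilon> / t) powr bb)) t \<xi>"
proof -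
  consider "0 < \<xi>" | "\<xi> < 0" | "\<xi> = 0" by linarith
  then show ?thesis
  proof cases
    case 1 then show ?thesis by (rule duhamel_symbol_pos[OF w e])
  next
    case 2
    define y where "y = - \<xi>"
    have y: "0 < y" "\<xi> = - y" using 2 by (auto simp: y_def)
    have "cis (- ((t - s) * \<xi> * \<bar>\<xi>\<bar> powr \<alpha>)) * duhamel_symb w s \<xi> = cnj (cis (- ((t - s) * y * \<bar>y\<bar> powr \<alpha>)) * duhamel_symb w s y)" for s
      using fourier_cnj_symmetric[of W "s powr bb * y"] by (simp add: y(2) duhamel_symb_def cis_cnj w_def)
    then have "(LINT s:{\<epsilon>..t}|lborel. cis (- ((t - s) * \<xi> * \<bar>\<xi>\<bar> powr \<alpha>)) * duhamel_symb w s \<xi>) =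
       (LINT s|lborel. cnj (indicator {\<epsilon>..t} s *\<^sub>R (cis (- ((t - s) * y * \<bar>y\<bar> powr \<alpha>)) * duhamel_symb w s y)))"
      by (simp add: set_lebesgue_integral_def)
    also have "\<dots> = cnj (LINT s:{\<epsilon>..t}|lborel. cis (- ((t - s) * y * \<bar>y\<bar> powr \<alpha>)) * duhamel_symb w s y)"
      unfolding set_lebesgue_integral_def by (rule Bochner_Integration.integral_cnj)
    also have "\<dots> = self_similar_symbol (duhamel_amp w ((\<epsilon> / t) powr bb)) t \<xi>"
      unfolding duhamel_symbol_pos[OF w e y(1)] y(2) self_similar_symbol_minus[OF y(1)] ..
    finally show ?thesis .
  next
    case 3 then show ?thesis by (simp add: duhamel_symb_def self_similar_symbol_def set_lebesgue_integral_def)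
  qed
qed

lemma duhamel_symb_bound:
  assumes w: "integrable lborel w"
  shows "cmod (duhamel_symb w s \<xi>) \<le> s powr (bb - aa * (real p + 1)) * L1_norm w * \<bar>\<xi>\<bar>"
proof -
  have "cmod (duhamel_symb w s \<xi>) = \<bar>\<xi>\<bar> / (real p + 1) * (s powr (bb - aa * (real p + 1)) * cmod (fourier w (s powr bb * \<xi>)))"
    unfolding duhamel_symb_def norm_mult norm_divide norm_of_real by simp
  also have "\<dots> \<le> \<bar>\<xi>\<bar> / 1 * (s powr (bb - aa * (real p + 1)) * L1_norm w)"
    unfolding L1_norm_def using fourier_bound[OF w] by (intro mult_mono divide_left_mono) auto
  finally show ?thesis by (simp add: mult_ac)
qed

lemma duhamel_symb_measurable_pair:
  assumes w: "integrable lborel w"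
  shows "(\<lambda>(s, \<xi>). duhamel_symb w s \<xi>) \<in> borel_measurable (lborel \<Otimes>\<^sub>M lborel)"
proof -
  note [measurable] = fourier_measurable[OF w]
  show ?thesis unfolding duhamel_symb_def by measurable
qed

text \<open>Dilation turns the transform of \<open>u ^ (p + 1)\<close> into that of
  \<open>w\<close>. The distributional derivative falls on \<open>fourier \<phi>\<close>, where it
  produces the factor - \<i> y under the integral; Fubini then moves the transform to the other
  function.\<close>

lemma nonlinearity_fourier:
  fixes v :: "real \<Rightarrow> real"
  defines "w \<equiv> \<lambda>x. complex_of_real (v x ^ (p + 1))"
  assumes w: "integrable lborel w" and s: "0 < s"
  shows "tempered_fun (\<lambda>x. of_real (self_similar \<alpha> p v s x ^ (p + 1)))"
    and "represents (duhamel_symb w s) (distr_fourier (nonlinearity p (self_similar \<alpha> p v s)))"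
proof -
  have [measurable]: "w \<in> borel_measurable borel" using w by (auto dest: borel_measurable_integrable)
  define ws where "ws = (\<lambda>x. complex_of_real (self_similar \<alpha> p v s x ^ (p + 1)))"
  have sb: "0 < s powr bb" using s by simp
  have wse: "ws = (\<lambda>x. of_real (s powr (- aa * (real p + 1))) * w (0 + 1 / s powr bb * x))"
  proof
    fix x
    have "(s powr (- aa)) ^ (p + 1) = s powr (- aa * (real p + 1))"
    proof -
      have "(s powr (- aa)) ^ (p + 1) = (s powr (- aa)) powr real (p + 1)" using s by (subst powr_realpow) auto
      also have "\<dots> = s powr (- aa * real (p + 1))" by (rule powr_powr)
      finally show ?thesis by (simp add: add.commute)
    qed
    then have "(s powr (- aa) * v (x / s powr bb)) ^ (p + 1) = s powr (- aa * (real p + 1)) * v (x / s powr bb) ^ (p + 1)"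
      by (simp only: power_mult_distrib)
    then show "ws x = of_real (s powr (- aa * (real p + 1))) * w (0 + 1 / s powr bb * x)"
      unfolding ws_def w_def self_similar_def aa_def[symmetric] bb_def[symmetric]
      by (simp only: of_real_mult[symmetric]) simp
  qed
  have wsi: "integrable lborel ws"
    unfolding wse by (intro integrable_mult_right lborel_integrable_real_affine[OF w]) (use sb in auto)
  then show "tempered_fun (\<lambda>x. of_real (self_similar \<alpha> p v s x ^ (p + 1)))"
    unfolding tempered_fun_def ws_def[symmetric] by (auto intro!: exI[of _ 0])
  have [measurable]: "ws \<in> borel_measurable borel" using wsi by (auto dest: borel_measurable_integrable)
  have wsf: "fourier ws \<xi> = of_real (s powr (bb - aa * (real p + 1))) * fourier w (s powr bb * \<xi>)" for \<xi>
  proof -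
    have "fourier ws \<xi> = of_real (s powr bb) * (LINT x|lborel. cis (- ((0 + s powr bb * x) * \<xi>)) * ws (0 + s powr bb * x))"
      unfolding fourier_def by (rule LINT_substitution[OF sb])
    also have "(LINT x|lborel. cis (- ((0 + s powr bb * x) * \<xi>)) * ws (0 + s powr bb * x)) =
       (LINT x|lborel. of_real (s powr (- aa * (real p + 1))) * (cis (- (x * (s powr bb * \<xi>))) * w x))"
      using sb unfolding wse by (intro Bochner_Integration.integral_cong) (auto simp: mult_ac)
    also have "of_real (s powr bb) * \<dots> = of_real (s powr bb * s powr (- aa * (real p + 1))) * fourier w (s powr bb * \<xi>)"
      unfolding fourier_def integral_mult_right_zero by simp
    also have "s powr bb * s powr (- aa * (real p + 1)) = s powr (bb - aa * (real p + 1))" by (simp flip: powr_add)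
    finally show ?thesis .
  qed
  have duhamel_symb: "duhamel_symb w s \<xi> = \<i> * of_real \<xi> / of_real (real p + 1) * fourier ws \<xi>" for \<xi> by (simp add: duhamel_symb_def wsf)
  show "represents (duhamel_symb w s) (distr_fourier (nonlinearity p (self_similar \<alpha> p v s)))"
    unfolding represents_def
  proof (intro conjI ballI)
    have "duhamel_symb w s \<in> borel_measurable borel"
      using fourier_measurable[OF wsi] unfolding duhamel_symb[abs_def] by measurable
    then show "tempered_fun (duhamel_symb w s)" by (rule tempered_linear) (rule duhamel_symb_bound[OF w])
    fix \<phi> assume \<phi>: "\<phi> \<in> schwartz"
    note [measurable] = schwartz_measurable[OF \<phi>]
    have y1: "integrable lborel (\<lambda>y. cmod (of_real (y ^ 1) * \<phi> y))" by (intro integrable_norm schwartz_integrable_power \<phi>)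
    have "(LINT x|lborel. LINT y|lborel. ws x * (cis (- (y * x)) * (- \<i> * of_real y * \<phi> y))) =
      (LINT y|lborel. LINT x|lborel. ws x * (cis (- (y * x)) * (- \<i> * of_real y * \<phi> y)))"
      by (rule LINT_Fubini_product(1)[OF _ integrable_norm[OF wsi] y1]) (auto simp: norm_mult)
    also have "\<dots> = (LINT y|lborel. - \<i> * of_real y * \<phi> y * fourier ws y)"
      unfolding fourier_def by (subst integral_mult_right_zero[symmetric]) (simp add: mult_ac)
    finally have eq: "(LINT x|lborel. ws x * vderiv (fourier \<phi>) x) = (LINT y|lborel. - \<i> * of_real y * \<phi> y * fourier ws y)"
      by (simp add: vderiv_fourier[OF \<phi>])
    have "distr_fourier (nonlinearity p (self_similar \<alpha> p v s)) \<phi> = of_real (1 / (real p + 1)) * (- (LINT x|lborel. ws x * vderiv (fourier \<phi>) x))"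
      by (simp add: distr_fourier_def nonlinearity_def distr_deriv_def fun_distr_def ws_def)
    also have "\<dots> = (LINT y|lborel. of_real (- 1 / (real p + 1)) * (- \<i> * of_real y * \<phi> y * fourier ws y))"
      unfolding eq integral_mult_right_zero by simp
    also have "\<dots> = fun_distr (duhamel_symb w s) \<phi>"
      unfolding fun_distr_def duhamel_symb by (intro Bochner_Integration.integral_cong) (auto simp: field_simps)
    finally show "distr_fourier (nonlinearity p (self_similar \<alpha> p v s)) \<phi> = fun_distr (duhamel_symb w s) \<phi>" .
  qed
qed

text \<open>Fubini in s and \<xi>: away from s = 0 the symbol is at most a constant times |\<xi>|,
  which the decay of \<open>inv_fourier \<phi>\<close> absorbs. The inner integral in s is
  \<open>duhamel_symbol\<close>.\<close>

lemma duhamel_truncated: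
  fixes v :: "real \<Rightarrow> real"
  defines "w \<equiv> \<lambda>x. complex_of_real (v x ^ (p + 1))"
  assumes w: "integrable lborel w" and e: "0 < \<epsilon>" "\<epsilon> < t"
  defines "Q \<equiv> \<lambda>s. lin_group \<alpha> (t - s) (nonlinearity p (self_similar \<alpha> p v s))"
  shows "weak_integrable Q \<epsilon> t"
    and "cont_represents (profile_fun (duhamel_amp w ((\<epsilon> / t) powr bb)) t) (weak_integral Q \<epsilon> t)"
proof -
  have t: "0 < t" using e by simp
  define E where "E = bb - aa * (real p + 1)"
  define M where "M = (\<epsilon> powr E + t powr E) * L1_norm w"
  \<comment> \<open>A power is monotone in one direction or the other, so the sum of its two end
    values bounds it on \<open>{\<epsilon>..t}\<close>.\<close>
  have sE: "s powr E \<le> \<epsilon> powr E + t powr E" if "s \<in> {\<epsilon>..t}" for s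
  proof (cases "0 \<le> E")
    case True
    then have "s powr E \<le> t powr E" using that e by (intro powr_mono2) auto
    then show ?thesis using powr_ge_zero[of \<epsilon> E] by linarith
  next
    case False
    then have "s powr E \<le> \<epsilon> powr E" using that e by (intro powr_mono2') auto
    then show ?thesis using powr_ge_zero[of t E] by linarith
  qed
  { fix \<phi> assume \<phi>: "\<phi> \<in> schwartz"
    note [measurable] = inv_fourier_measurable[OF schwartz_integrable[OF \<phi>]] duhamel_symb_measurable_pair[OF w]
    let ?k = "\<lambda>s \<xi>. cis (- ((t - s) * \<xi> * \<bar>\<xi>\<bar> powr \<alpha>)) * duhamel_symb w s \<xi> * inv_fourier \<phi> \<xi>"
    let ?f = "\<lambda>s \<xi>. complex_of_real (indicator {\<epsilon>..t} s) * ?k s \<xi>"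
    have Q: "Q s \<phi> = (LINT \<xi>|lborel. ?k s \<xi>)" if "s \<in> {\<epsilon>..t}" for s
      unfolding Q_def by (rule lin_group_eq[OF _ \<phi>]) (use nonlinearity_fourier(2)[of v s] w e that in \<open>auto simp: w_def\<close>)
    have Qf: "indicator {\<epsilon>..t} s *\<^sub>R Q s \<phi> = (LINT \<xi>|lborel. ?f s \<xi>)" for s
      using Q[of s] by (cases "s \<in> {\<epsilon>..t}") auto
    have g: "integrable lborel (\<lambda>s. indicator {\<epsilon>..t} s * M)"
      using e by (intro integrable_mult_left) (simp add: integrable_indicator_iff)
    have h: "integrable lborel (\<lambda>\<xi>. cmod (of_real (\<bar>\<xi>\<bar> ^ 1) * inv_fourier \<phi> \<xi>))"
      by (intro integrable_norm inv_fourier_integrable_power \<phi>)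
    have b: "cmod (?f s \<xi>) \<le> indicator {\<epsilon>..t} s * M * cmod (of_real (\<bar>\<xi>\<bar> ^ 1) * inv_fourier \<phi> \<xi>)" for s \<xi>
    proof (cases "s \<in> {\<epsilon>..t}")
      case True
      have "cmod (duhamel_symb w s \<xi>) \<le> s powr E * L1_norm w * \<bar>\<xi>\<bar>" unfolding E_def by (rule duhamel_symb_bound[OF w])
      also have "\<dots> \<le> M * \<bar>\<xi>\<bar>" unfolding M_def using sE[OF True] L1_norm_nonneg by (intro mult_right_mono) auto
      finally have "cmod (duhamel_symb w s \<xi>) * cmod (inv_fourier \<phi> \<xi>) \<le> M * \<bar>\<xi>\<bar> * cmod (inv_fourier \<phi> \<xi>)" by (intro mult_right_mono) auto
      then show ?thesis using True by (simp add: norm_mult)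
    qed simp
    have m: "(\<lambda>(s, \<xi>). ?f s \<xi>) \<in> borel_measurable (lborel \<Otimes>\<^sub>M lborel)"
    proof -
      have [measurable]: "(\<lambda>x. duhamel_symb w (fst x) (snd x)) \<in> borel_measurable (lborel \<Otimes>\<^sub>M lborel)"
        using duhamel_symb_measurable_pair[OF w] by (simp add: case_prod_unfold)
      show ?thesis unfolding case_prod_unfold by measurable
    qed
    note F = LINT_Fubini_product[OF m g h b]
    have wi: "set_integrable lborel {\<epsilon>..t} (\<lambda>s. Q s \<phi>)"
      unfolding set_integrable_def Qf by (rule F(2))
    have "weak_integral Q \<epsilon> t \<phi> = (LINT \<xi>|lborel. LINT s|lborel. ?f s \<xi>)"
      unfolding weak_integral_def set_lebesgue_integral_def Qf by (rule F(1))
    also have "\<dots> = (LINT \<xi>|lborel. self_similar_symbol (duhamel_amp w ((\<epsilon> / t) powr bb)) t \<xi> * inv_fourier \<phi> \<xi>)"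
    proof (rule Bochner_Integration.integral_cong[OF refl])
      fix \<xi>
      have "(LINT s|lborel. ?f s \<xi>) = (LINT s|lborel. (indicator {\<epsilon>..t} s *\<^sub>R (cis (- ((t - s) * \<xi> * \<bar>\<xi>\<bar> powr \<alpha>)) * duhamel_symb w s \<xi>)) * inv_fourier \<phi> \<xi>)"
        by (simp add: scaleR_conv_of_real mult_ac)
      also have "\<dots> = (LINT s:{\<epsilon>..t}|lborel. cis (- ((t - s) * \<xi> * \<bar>\<xi>\<bar> powr \<alpha>)) * duhamel_symb w s \<xi>) * inv_fourier \<phi> \<xi>"
        unfolding set_lebesgue_integral_def by (rule integral_mult_left_zero)
      finally show "(LINT s|lborel. ?f s \<xi>) = self_similar_symbol (duhamel_amp w ((\<epsilon> / t) powr bb)) t \<xi> * inv_fourier \<phi> \<xi>"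
        using duhamel_symbol[of "\<lambda>x. v x ^ (p + 1)" \<epsilon> t \<xi>] w e by (simp add: w_def)
    qed
    finally have "weak_integral Q \<epsilon> t \<phi> = (LINT \<xi>|lborel. self_similar_symbol (duhamel_amp w ((\<epsilon> / t) powr bb)) t \<xi> * inv_fourier \<phi> \<xi>)" .
    note wi this }
  note P = this
  show "weak_integrable Q \<epsilon> t" unfolding weak_integrable_def using P(1) by blast
  have "(\<epsilon> / t) powr bb \<le> 1" using e bb_pos by (intro powr_le1) auto
  then show "cont_represents (profile_fun (duhamel_amp w ((\<epsilon> / t) powr bb)) t) (weak_integral Q \<epsilon> t)"
    by (intro profile_fun_cont_represents[OF duhamel_amp_amplitude[OF w] t P(2)]) auto
qed

text \<open>The equation for \<open>v\<close> is Duhamel's formula at time 1. Each function involved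
  is a self-similar rescaling of a profile, so it carries over to all t, and the limit \<epsilon> to
  0 becomes the limit r to 0 in \<open>duhamel_amp_small_r\<close>.\<close>

lemma duhamel_from_profile:
  fixes v :: "real \<Rightarrow> real"
  defines "w \<equiv> \<lambda>x. complex_of_real (v x ^ (p + 1))"
  assumes \<Phi>: "power_datum wp wm \<Phi>" and w: "integrable lborel w"
    and v: "\<And>x. v x = profile (\<lambda>\<xi>. datum_coeff wp wm * of_real (\<xi> powr (- gam))) x - profile (duhamel_amp w 0) x"
  shows "duhamel_solution \<alpha> p \<Phi> (self_similar \<alpha> p v)"
  unfolding duhamel_solution_def
proof (intro conjI allI impI)
  show "fourier_is_fun (fun_distr (\<lambda>x. complex_of_real (\<Phi> x)))"
    using power_datum_fourier[OF \<Phi>] by (auto simp: fourier_is_fun_def)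
next
  fix s :: real assume s: "0 < s"
  show "tempered_fun (\<lambda>x. complex_of_real (self_similar \<alpha> p v s x ^ (p + 1)))"
    using nonlinearity_fourier(1)[of v s] w s by (simp add: w_def)
  show "fourier_is_fun (nonlinearity p (self_similar \<alpha> p v s))"
    using nonlinearity_fourier(2)[of v s] w s by (auto simp: fourier_is_fun_def w_def)
next
  fix t :: real assume t: "0 < t"
  let ?L = "profile_fun (\<lambda>\<xi>. datum_coeff wp wm * of_real (\<xi> powr (- gam))) t"
  let ?I = "\<lambda>\<epsilon>. profile_fun (duhamel_amp w ((\<epsilon> / t) powr bb)) t"
  let ?Q = "\<lambda>s. lin_group \<alpha> (t - s) (nonlinearity p (self_similar \<alpha> p v s))"
  have "cont_represents ?L (lin_group \<alpha> t (fun_distr (\<lambda>x. complex_of_real (\<Phi> x))))" by (rule lin_group_power_datum[OF \<Phi> t])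
  moreover have "weak_integrable ?Q \<epsilon> t \<and> cont_represents (?I \<epsilon>) (weak_integral ?Q \<epsilon> t)" if "0 < \<epsilon> \<and> \<epsilon> < t" for \<epsilon>
    using duhamel_truncated[of v \<epsilon> t] w that by (simp add: w_def)
  moreover have "\<exists>J. ((\<lambda>\<epsilon>. ?I \<epsilon> x) \<longlongrightarrow> J) (at_right 0) \<and> of_real (self_similar \<alpha> p v t x) = ?L x - J" for x
  proof (intro exI conjI)
    \<comment> \<open>The scale r must tend to 0 through positive values, since the limit in
      \<open>duhamel_amp_small_r\<close> is taken from the right.\<close>
    have "filterlim (\<lambda>\<epsilon>. (\<epsilon> / t) powr bb) (at_right 0) (at_right 0)"
    proof (rule filterlim_at_withinI)
      have "((\<lambda>\<epsilon>. (\<epsilon> / t) powr bb) \<longlongrightarrow> (0 / t) powr bb) (at_right 0)"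
        using t bb_pos by (intro tendsto_powr' tendsto_intros) (auto intro!: eventually_mono[OF eventually_at_right_less])
      then show "((\<lambda>\<epsilon>. (\<epsilon> / t) powr bb) \<longlongrightarrow> 0) (at_right 0)" by simp
      show "\<forall>\<^sub>F \<epsilon> in at_right 0. (\<epsilon> / t) powr bb \<in> {0<..} - {0}"
        using eventually_at_right_less by eventually_elim (use t in auto)
    qed
    from filterlim_compose[OF duhamel_amp_small_r[OF w] this]
    show "((\<lambda>\<epsilon>. ?I \<epsilon> x) \<longlongrightarrow> profile_fun (duhamel_amp w 0) t x) (at_right 0)"
      unfolding profile_fun_def by (intro tendsto_intros)
    show "of_real (self_similar \<alpha> p v t x) = ?L x - profile_fun (duhamel_amp w 0) t x"
      unfolding self_similar_def aa_def[symmetric] bb_def[symmetric] v[of "x / t powr bb"] profile_fun_def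
      by (simp add: right_diff_distrib)
  qed
  ultimately show "\<exists>L I. cont_represents L (lin_group \<alpha> t (fun_distr (\<lambda>x. complex_of_real (\<Phi> x)))) \<and>
      (\<forall>\<epsilon>. 0 < \<epsilon> \<and> \<epsilon> < t \<longrightarrow> weak_integrable ?Q \<epsilon> t \<and> cont_represents (I \<epsilon>) (weak_integral ?Q \<epsilon> t)) \<and>
      (\<forall>x. \<exists>J. ((\<lambda>\<epsilon>. I \<epsilon> x) \<longlongrightarrow> J) (at_right 0) \<and> complex_of_real (self_similar \<alpha> p v t x) = L x - J)"
    by (intro exI[of _ ?L] exI[of _ ?I]) blast
qed

text \<open>On the Fourier side the linear part is the transform of the datum times a factor of
  modulus 1 tending to 1, so it converges by domination. The symbol of the Duhamel part is at most a
  multiple of \<open>t powr (bb * gam + bb) * \<bar>\<xi>\<bar>\<close> and vanishes in the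
  limit.\<close>

lemma tendsto_from_profile:
  fixes v :: "real \<Rightarrow> real"
  defines "w \<equiv> \<lambda>x. complex_of_real (v x ^ (p + 1))"
  assumes \<Phi>: "power_datum wp wm \<Phi>" and w: "integrable lborel w"
    and v: "\<And>x. v x = profile (\<lambda>\<xi>. datum_coeff wp wm * of_real (\<xi> powr (- gam))) x - profile (duhamel_amp w 0) x"
  shows "tendsto_tempered (self_similar \<alpha> p v) \<Phi> (at_right 0)"
  unfolding tendsto_tempered_def
proof
  fix \<phi> assume \<phi>: "\<phi> \<in> schwartz"
  let ?a = "\<lambda>\<xi>. datum_coeff wp wm * of_real (\<xi> powr (- gam))"
  let ?h = "homogeneous (datum_coeff wp wm)"
  note [measurable] = inv_fourier_measurable[OF schwartz_integrable[OF \<phi>]]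
  have an: "amplitude (aconst * L1_norm w) (duhamel_amp w 0) (duhamel_amp_deriv w 0)" by (rule duhamel_amp_amplitude[OF w]) auto
  have hi: "integrable lborel (\<lambda>\<xi>. ?h \<xi> * inv_fourier \<phi> \<xi>)"
  proof (rule Bochner_Integration.integrable_bound)
    show "integrable lborel (\<lambda>\<xi>. datum_coeff wp wm * (of_real (\<bar>\<xi>\<bar> powr (- gam)) * inv_fourier \<phi> \<xi>))"
      by (intro integrable_mult_right inv_fourier_integrable_powr \<phi>) (use gam_pos gam_lt in auto)
  qed (auto simp: norm_mult homogeneous_bound)
  have pint: "integrable lborel (\<lambda>x. profile_fun a t x * \<phi> x)" if a: "amplitude K a a'" and t: "0 < t" for a a' K t
  proof (rule tempered_schwartz_integrable[OF _ \<phi>])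
    show "tempered_fun (profile_fun a t)"
      using profile_fun_cont_represents[OF a t, of "\<lambda>\<phi>. LINT \<xi>|lborel. self_similar_symbol a t \<xi> * inv_fourier \<phi> \<xi>"] by (simp add: cont_represents_def represents_def)
  qed
  have split: "fun_distr (\<lambda>x. complex_of_real (self_similar \<alpha> p v t x)) \<phi> =
     (LINT \<xi>|lborel. cis (- (t * \<xi> * \<bar>\<xi>\<bar> powr \<alpha>)) * ?h \<xi> * inv_fourier \<phi> \<xi>) - (LINT \<xi>|lborel. self_similar_symbol (duhamel_amp w 0) t \<xi> * inv_fourier \<phi> \<xi>)" if t: "0 < t" for t
  proof -
    have "fun_distr (\<lambda>x. complex_of_real (self_similar \<alpha> p v t x)) \<phi> = (LINT x|lborel. profile_fun ?a t x * \<phi> x - profile_fun (duhamel_amp w 0) t x * \<phi> x)"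
      unfolding fun_distr_def
    proof (rule Bochner_Integration.integral_cong[OF refl])
      fix x
      show "of_real (self_similar \<alpha> p v t x) * \<phi> x = profile_fun ?a t x * \<phi> x - profile_fun (duhamel_amp w 0) t x * \<phi> x"
        unfolding self_similar_def aa_def[symmetric] bb_def[symmetric] v[of "x / t powr bb"] profile_fun_def
        by (simp add: algebra_simps)
    qed
    also have "\<dots> = (LINT x|lborel. profile_fun ?a t x * \<phi> x) - (LINT x|lborel. profile_fun (duhamel_amp w 0) t x * \<phi> x)"
      by (rule Bochner_Integration.integral_diff[OF pint[OF homogeneous_amplitude t] pint[OF an t]])
    also have "(LINT x|lborel. profile_fun ?a t x * \<phi> x) = (LINT \<xi>|lborel. self_similar_symbol ?a t \<xi> * inv_fourier \<phi> \<xi>)"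
      unfolding profile_fun_def by (rule profile_representation[OF homogeneous_amplitude t \<phi>])
    also have "(LINT x|lborel. profile_fun (duhamel_amp w 0) t x * \<phi> x) = (LINT \<xi>|lborel. self_similar_symbol (duhamel_amp w 0) t \<xi> * inv_fourier \<phi> \<xi>)"
      unfolding profile_fun_def by (rule profile_representation[OF an t \<phi>])
    finally show ?thesis unfolding homogeneous_symb[OF t] .
  qed
  have 1: "((\<lambda>t. LINT \<xi>|lborel. cis (- (t * \<xi> * \<bar>\<xi>\<bar> powr \<alpha>)) * ?h \<xi> * inv_fourier \<phi> \<xi>) \<longlongrightarrow> (LINT \<xi>|lborel. ?h \<xi> * inv_fourier \<phi> \<xi>)) (at_right 0)"
    unfolding tendsto_at_iff_sequentially comp_def
  proof (intro allI impI)
    fix X :: "nat \<Rightarrow> real" assume X: "X \<longlonglongrightarrow> 0"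
    show "(\<lambda>n. LINT \<xi>|lborel. cis (- (X n * \<xi> * \<bar>\<xi>\<bar> powr \<alpha>)) * ?h \<xi> * inv_fourier \<phi> \<xi>) \<longlonglongrightarrow> (LINT \<xi>|lborel. ?h \<xi> * inv_fourier \<phi> \<xi>)"
    proof (rule integral_dominated_convergence[where w="\<lambda>\<xi>. cmod (?h \<xi> * inv_fourier \<phi> \<xi>)"])
      show "AE \<xi> in lborel. (\<lambda>n. cis (- (X n * \<xi> * \<bar>\<xi>\<bar> powr \<alpha>)) * ?h \<xi> * inv_fourier \<phi> \<xi>) \<longlonglongrightarrow> ?h \<xi> * inv_fourier \<phi> \<xi>"
      proof (rule AE_I2)
        fix \<xi>
        have "(\<lambda>n. cis (- (X n * \<xi> * \<bar>\<xi>\<bar> powr \<alpha>)) * ?h \<xi> * inv_fourier \<phi> \<xi>) \<longlonglongrightarrow> cis (- (0 * \<xi> * \<bar>\<xi>\<bar> powr \<alpha>)) * ?h \<xi> * inv_fourier \<phi> \<xi>"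
          unfolding cis_conv_exp by (intro tendsto_intros X)
        then show "(\<lambda>n. cis (- (X n * \<xi> * \<bar>\<xi>\<bar> powr \<alpha>)) * ?h \<xi> * inv_fourier \<phi> \<xi>) \<longlonglongrightarrow> ?h \<xi> * inv_fourier \<phi> \<xi>" by simp
      qed
    qed (use integrable_norm[OF hi] in \<open>auto simp: norm_mult\<close>)
  qed
  have 2: "((\<lambda>t. LINT \<xi>|lborel. self_similar_symbol (duhamel_amp w 0) t \<xi> * inv_fourier \<phi> \<xi>) \<longlongrightarrow> 0) (at_right 0)"
  proof (rule Lim_null_comparison)
    define D where "D = (LINT \<xi>|lborel. cmod (of_real (\<bar>\<xi>\<bar> ^ 1) * inv_fourier \<phi> \<xi>))"
    \<comment> \<open>For r = 0 the small-argument bound of \<open>osc_fourier\<close> holds for all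
      arguments, so linear growth is available globally; it is the source of the positive power of
      \<open>t\<close>.\<close>
    have ab: "cmod (duhamel_amp w 0 \<zeta>) \<le> L1_norm w * \<zeta>" if "0 < \<zeta>" for \<zeta>
    proof -
      have "cmod (duhamel_amp w 0 \<zeta>) \<le> 1 * (\<zeta> powr (- gam) * (L1_norm w * \<zeta> powr (gam + 1)))"
        unfolding duhamel_amp_def norm_mult using kap_le that osc_fourier_bound_small[OF w, of \<zeta>]
        by (intro mult_mono) (auto simp: osc_fourier_def)
      also have "\<dots> = L1_norm w * \<zeta>" using that by (simp add: powr_add powr_minus field_simps)
      finally show ?thesis .
    qed
    have sb: "cmod (self_similar_symbol (duhamel_amp w 0) t \<xi>) \<le> L1_norm w * t powr (bb * gam + bb) * \<bar>\<xi>\<bar>" if t: "0 < t" for t \<xi>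
    proof -
      have "cmod (self_similar_symbol (duhamel_amp w 0) t \<xi>) \<le> t powr (bb * gam) * (L1_norm w * (t powr bb * \<bar>\<xi>\<bar>))"
        using ab[OF mult_pos_pos[of "t powr bb" \<xi>]] ab[OF mult_pos_pos[of "t powr bb" "- \<xi>"]] t L1_norm_nonneg[of w]
        by (auto simp: self_similar_symbol_def norm_mult intro!: mult_left_mono)
      also have "\<dots> = L1_norm w * t powr (bb * gam + bb) * \<bar>\<xi>\<bar>" by (simp add: powr_add)
      finally show ?thesis .
    qed
    show "\<forall>\<^sub>F t in at_right 0. norm (LINT \<xi>|lborel. self_similar_symbol (duhamel_amp w 0) t \<xi> * inv_fourier \<phi> \<xi>) \<le> L1_norm w * t powr (bb * gam + bb) * D"
      using eventually_at_right_less
    proof eventually_elim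
      case (elim t)
      have "cmod (LINT \<xi>|lborel. self_similar_symbol (duhamel_amp w 0) t \<xi> * inv_fourier \<phi> \<xi>) \<le> (LINT \<xi>|lborel. L1_norm w * t powr (bb * gam + bb) * cmod (of_real (\<bar>\<xi>\<bar> ^ 1) * inv_fourier \<phi> \<xi>))"
      proof (rule order_trans[OF integral_norm_bound integral_mono])
        show "integrable lborel (\<lambda>\<xi>. cmod (self_similar_symbol (duhamel_amp w 0) t \<xi> * inv_fourier \<phi> \<xi>))"
          by (rule integrable_norm[OF self_similar_symbol_inv_fourier_integrable(2)[OF an elim \<phi>]])
        show "integrable lborel (\<lambda>\<xi>. L1_norm w * t powr (bb * gam + bb) * cmod (of_real (\<bar>\<xi>\<bar> ^ 1) * inv_fourier \<phi> \<xi>))"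
          by (intro integrable_mult_right integrable_norm inv_fourier_integrable_power \<phi>)
        show "cmod (self_similar_symbol (duhamel_amp w 0) t \<xi> * inv_fourier \<phi> \<xi>) \<le> L1_norm w * t powr (bb * gam + bb) * cmod (of_real (\<bar>\<xi>\<bar> ^ 1) * inv_fourier \<phi> \<xi>)" for \<xi>
          using mult_right_mono[OF sb[OF elim, of \<xi>], of "cmod (inv_fourier \<phi> \<xi>)"] by (simp add: norm_mult mult_ac)
      qed
      then show ?case by (simp add: D_def)
    qed
    have "0 < bb * gam + bb" using bb_pos gam_pos by (intro add_pos_pos mult_pos_pos)
    then have "((\<lambda>t. L1_norm w * t powr (bb * gam + bb) * D) \<longlongrightarrow> L1_norm w * 0 powr (bb * gam + bb) * D) (at_right 0)"
      by (intro tendsto_intros tendsto_powr') (auto intro: eventually_at_right_nonneg)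
    then show "((\<lambda>t. L1_norm w * t powr (bb * gam + bb) * D) \<longlongrightarrow> 0) (at_right 0)" by simp
  qed
  \<comment> \<open>\<open>power_datum_pairing\<close> is applied to
    \<open>inv_fourier \<phi>\<close>, whose Fourier transform is \<open>\<phi>\<close> by
    inversion.\<close>
  have "integrable lborel (\<lambda>\<xi>. of_real (\<bar>\<xi>\<bar> powr (- gam)) * inv_fourier \<phi> \<xi>)"
    by (rule inv_fourier_integrable_powr[OF \<phi>]) (use gam_lt gam_pos in auto)
  moreover have "integrable lborel (\<lambda>x. of_real (\<bar>x\<bar> powr (- sg)) * fourier (inv_fourier \<phi>) x)"
    unfolding fourier_inversion[OF \<phi>] by (rule schwartz_powr_integrable[OF \<phi>]) (use sg_le sg_pos in auto)
  ultimately have "(LINT \<xi>|lborel. ?h \<xi> * inv_fourier \<phi> \<xi>) = (LINT x|lborel. of_real (\<Phi> x) * fourier (inv_fourier \<phi>) x)"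
    by (rule power_datum_pairing[OF \<Phi> inv_fourier_integrable[OF \<phi>], symmetric])
  also have "\<dots> = fun_distr (\<lambda>x. of_real (\<Phi> x)) \<phi>" by (simp add: fun_distr_def fourier_inversion[OF \<phi>])
  finally have lim: "(LINT \<xi>|lborel. ?h \<xi> * inv_fourier \<phi> \<xi>) - 0 = fun_distr (\<lambda>x. of_real (\<Phi> x)) \<phi>" by simp
  show "((\<lambda>t. fun_distr (\<lambda>x. complex_of_real (self_similar \<alpha> p v t x)) \<phi>) \<longlongrightarrow> fun_distr (\<lambda>x. complex_of_real (\<Phi> x)) \<phi>) (at_right 0)"
    by (rule Lim_transform_eventually[OF tendsto_diff[OF 1 2, unfolded lim]])
       (rule eventually_mono[OF eventually_at_right_less], simp add: split)
qed

end

section \<open>Existence of the profile\<close>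

lemma power_diff_bound:
  fixes x y M :: real
  assumes "\<bar>x\<bar> \<le> M" "\<bar>y\<bar> \<le> M"
  shows "\<bar>x ^ Suc n - y ^ Suc n\<bar> \<le> (real n + 1) * M ^ n * \<bar>x - y\<bar>"
proof -
  have M: "0 \<le> M" using assms by linarith
  have "\<bar>\<Sum>i<Suc n. x ^ i * y ^ (n - i)\<bar> \<le> (\<Sum>i<Suc n. M ^ n)"
  proof (rule order_trans[OF sum_abs sum_mono])
    fix i assume "i \<in> {..<Suc n}"
    then have "M ^ i * M ^ (n - i) = M ^ n" by (simp flip: power_add)
    moreover have "\<bar>x\<bar> ^ i * \<bar>y\<bar> ^ (n - i) \<le> M ^ i * M ^ (n - i)"
      using assms M by (intro mult_mono power_mono) auto
    ultimately show "\<bar>x ^ i * y ^ (n - i)\<bar> \<le> M ^ n" by (simp add: abs_mult power_abs)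
  qed
  then have s: "\<bar>\<Sum>i<Suc n. x ^ i * y ^ (n - i)\<bar> \<le> (real n + 1) * M ^ n" by (simp add: algebra_simps)
  have "x ^ Suc n - y ^ Suc n = (x - y) * (\<Sum>i<Suc n. x ^ i * y ^ (n - i))"
    by (simp only: power_diff_sumr2 diff_Suc_Suc) (simp add: lessThan_Suc_atMost mult.commute)
  then show ?thesis using mult_left_mono[OF s, of "\<bar>x - y\<bar>"] by (simp only: abs_mult) (simp add: mult_ac)
qed

context gkdv begin

definition dpow :: "real \<Rightarrow> real" where "dpow x = dec x ^ (p + 1)"

text \<open>The exponent is - (1 + 1 / p) < -1.\<close>

lemma dpow_integrable: "integrable lborel dpow"
proof -
  have e: "- ((real p + 1) / real p) < - 1" using p_pos by simp
  have "(\<lambda>x::real. x powr (- ((real p + 1) / real p))) integrable_on {1..}"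
    using has_integral_powr_to_inf[OF e, of 1] by (auto intro: has_integral_integrable)
  then have 1: "integrable lborel (\<lambda>x::real. indicator {1..} x * x powr (- ((real p + 1) / real p)))"
    by (rule integrable_nonneg_of_has_integral) auto
  have 2: "integrable lborel (\<lambda>x::real. indicator {1..} (0 + - 1 * x) * (0 + - 1 * x) powr (- ((real p + 1) / real p)))"
    by (rule lborel_integrable_real_affine[OF 1]) simp
  have 3: "integrable lborel (\<lambda>x::real. indicator {-1..1} x :: real)" by (simp add: integrable_indicator_iff)
  have dp: "dpow x = (1 + \<bar>x\<bar>) powr (- ((real p + 1) / real p))" for x
    using p_pos by (simp add: dpow_def dec_def powr_realpow[symmetric] powr_powr add_divide_distrib add.commute del: power_Suc)
  show ?thesis
  proof (rule Bochner_Integration.integrable_bound[OF Bochner_Integration.integrable_add[OF Bochner_Integration.integrable_add[OF 1 2] 3]])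
    show "dpow \<in> borel_measurable lborel" unfolding dp[abs_def] by measurable
    show "AE x in lborel. norm (dpow x) \<le> norm (indicator {1..} x * x powr (- ((real p + 1) / real p)) +
       indicator {1..} (0 + - 1 * x) * (0 + - 1 * x) powr (- ((real p + 1) / real p)) + indicator {-1..1} x :: real)"
    proof (intro AE_I2)
      fix x :: real
      consider "1 < x" | "x < -1" | "\<bar>x\<bar> \<le> 1" by linarith
      then show "norm (dpow x) \<le> norm (indicator {1..} x * x powr (- ((real p + 1) / real p)) +
       indicator {1..} (0 + - 1 * x) * (0 + - 1 * x) powr (- ((real p + 1) / real p)) + indicator {-1..1} x :: real)"
      proof cases
        case 1
        have "dpow x \<le> x powr (- ((real p + 1) / real p))" unfolding dp using 1 e by (intro powr_mono2') auto
        then show ?thesis using 1 by (simp add: dp)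
      next
        case 2
        have "dpow x \<le> (- x) powr (- ((real p + 1) / real p))" unfolding dp using 2 e by (intro powr_mono2') auto
        then show ?thesis using 2 by (simp add: dp)
      next
        case 3
        have "dpow x \<le> 1" unfolding dp using e by (intro powr_neg_le_one) auto
        moreover have "0 \<le> indicator {1..} x * x powr (- ((real p + 1) / real p))"
          "0 \<le> indicator {1..} (0 + - 1 * x) * (0 + - 1 * x) powr (- ((real p + 1) / real p))" by simp_all
        moreover have "0 \<le> dpow x" "indicator {-1..1} x = (1::real)" using 3 by (auto simp: dp abs_le_iff)
        ultimately show ?thesis unfolding real_norm_def by linarith
      qed
    qed
  qed
qed

lemma dec_continuous: "continuous_on S dec"
  unfolding dec_def[abs_def] by (intro continuous_intros) auto

definition Dint :: real where "Dint = (LINT x|lborel. dpow x)"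

lemma Dint_nonneg: "0 \<le> Dint"
  unfolding Dint_def by (intro integral_nonneg_AE) (simp add: dpow_def dec_pos less_imp_le)

text \<open>The unknown is g = v / dec in the complete space of bounded continuous functions, so
  that the weighted space of the overview becomes an unweighted one; \<open>weighted_power g\<close>
  is then v ^ (p + 1).\<close>

definition weighted_power :: "(real \<Rightarrow>\<^sub>C real) \<Rightarrow> real \<Rightarrow> complex" where
  "weighted_power g x = of_real ((dec x * g x) ^ (p + 1))"

lemma weighted_power_continuous: "continuous_on UNIV (weighted_power g)"
  unfolding weighted_power_def[abs_def] by (intro continuous_intros dec_continuous continuous_on_apply_bcontfun)

lemma weighted_power_diff_bound:
  assumes "norm g \<le> M" "norm h \<le> M"
  shows "cmod (weighted_power g x - weighted_power h x) \<le> (real p + 1) * M ^ p * norm (g - h) * dpow x"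
proof -
  have gx: "\<bar>g x\<bar> \<le> M" "\<bar>h x\<bar> \<le> M"
    using norm_bounded[of g x] norm_bounded[of h x] assms by auto
  have "\<bar>g x - h x\<bar> \<le> norm (g - h)" using norm_bounded[of "g - h" x] by simp
  then have d: "\<bar>g x ^ Suc p - h x ^ Suc p\<bar> \<le> (real p + 1) * M ^ p * norm (g - h)"
    using order_trans[OF power_diff_bound[OF gx] mult_left_mono] gx by (smt (verit) mult_nonneg_nonneg of_nat_0_le_iff zero_le_power)
  have "weighted_power g x - weighted_power h x = of_real (dpow x * (g x ^ Suc p - h x ^ Suc p))"
    by (simp add: weighted_power_def dpow_def power_mult_distrib algebra_simps)
  also have "cmod \<dots> = dpow x * \<bar>g x ^ Suc p - h x ^ Suc p\<bar>"
    unfolding norm_of_real abs_mult using dec_pos[of x] by (simp add: dpow_def abs_of_pos)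
  also have "\<dots> \<le> dpow x * ((real p + 1) * M ^ p * norm (g - h))"
    using d dec_pos[of x] by (intro mult_left_mono) (auto simp: dpow_def)
  finally show ?thesis by (simp add: mult_ac)
qed

lemma weighted_power_zero: "weighted_power 0 x = 0" by (simp add: weighted_power_def)

lemma weighted_power_diff_integrable:
  assumes "norm g \<le> M" "norm h \<le> M"
  shows "integrable lborel (\<lambda>x. weighted_power g x - weighted_power h x)" "L1_norm (\<lambda>x. weighted_power g x - weighted_power h x) \<le> (real p + 1) * M ^ p * Dint * norm (g - h)"
proof -
  have i: "integrable lborel (\<lambda>x. (real p + 1) * M ^ p * norm (g - h) * dpow x)" by (intro integrable_mult_right dpow_integrable)
  have "weighted_power g \<in> borel_measurable borel" "weighted_power h \<in> borel_measurable borel" by (intro borel_measurable_continuous_onI weighted_power_continuous)+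
  then have m: "(\<lambda>x. weighted_power g x - weighted_power h x) \<in> borel_measurable lborel" by simp
  show w: "integrable lborel (\<lambda>x. weighted_power g x - weighted_power h x)"
    by (rule Bochner_Integration.integrable_bound[OF i m])
       (rule AE_I2, rule order_trans[OF weighted_power_diff_bound[OF assms]], simp)
  have "L1_norm (\<lambda>x. weighted_power g x - weighted_power h x) \<le> (LINT x|lborel. (real p + 1) * M ^ p * norm (g - h) * dpow x)"
    unfolding L1_norm_def by (rule integral_mono[OF integrable_norm[OF w] i weighted_power_diff_bound[OF assms]])
  then show "L1_norm (\<lambda>x. weighted_power g x - weighted_power h x) \<le> (real p + 1) * M ^ p * Dint * norm (g - h)"
    by (simp add: Dint_def mult_ac)
qed

lemma weighted_power_integrable: "integrable lborel (weighted_power g)"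
  using weighted_power_diff_integrable(1)[of g "norm g" 0] by (simp add: weighted_power_zero)

text \<open>The Duhamel term is linear in \<open>w\<close>, so a bound on a single profile in terms
  of the L1 norm yields the difference bounds for the contraction.\<close>

lemma duhamel_amp_diff:
  assumes w: "integrable lborel w" and z: "integrable lborel z"
  shows "profile (duhamel_amp w 0) x - profile (duhamel_amp z 0) x = profile (duhamel_amp (\<lambda>x. w x - z x) 0) x"
proof -
  have f: "fourier (\<lambda>x. w x - z x) \<eta> = fourier w \<eta> - fourier z \<eta>" for \<eta>
    unfolding fourier_def using integrable_cis_mult[OF w, of "\<lambda>x. - (x * \<eta>)"] integrable_cis_mult[OF z, of "\<lambda>x. - (x * \<eta>)"]
    by (simp add: right_diff_distrib)
  have "osc_fourier_deriv (\<lambda>x. w x - z x) = (\<lambda>\<eta>. osc_fourier_deriv w \<eta> - osc_fourier_deriv z \<eta>)" by (simp add: fun_eq_iff osc_fourier_deriv_def f right_diff_distrib)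
  then have h: "osc_fourier (\<lambda>x. w x - z x) \<zeta> = osc_fourier w \<zeta> - osc_fourier z \<zeta>" for \<zeta>
    unfolding osc_fourier_def by (simp add: integral_diff[OF osc_fourier_deriv_integrable[OF w order_refl] osc_fourier_deriv_integrable[OF z order_refl]])
  have "duhamel_amp (\<lambda>x. w x - z x) 0 = (\<lambda>\<zeta>. duhamel_amp w 0 \<zeta> - duhamel_amp z 0 \<zeta>)"
    by (simp add: fun_eq_iff duhamel_amp_def h algebra_simps)
  then show ?thesis
    using profile_diff[OF duhamel_amp_amplitude[OF w order_refl zero_le_one] duhamel_amp_amplitude[OF z order_refl zero_le_one], of x] by simp
qed

definition Tconst :: real where "Tconst = osc_const * aconst"

lemma profile_anl_bound:
  assumes w: "integrable lborel w"
  shows "\<bar>profile (duhamel_amp w 0) x\<bar> \<le> Tconst * L1_norm w * dec x"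
  using profile_bound[OF duhamel_amp_amplitude[OF w order_refl zero_le_one], of x] by (simp add: Tconst_def mult.assoc)

lemma Tconst_nonneg: "0 \<le> Tconst"
  unfolding Tconst_def aconst_def using osc_const_pos hconst_ge by simp

definition profile_map :: "complex \<Rightarrow> (real \<Rightarrow>\<^sub>C real) \<Rightarrow> real \<Rightarrow> real" where
  "profile_map c g x = (profile (\<lambda>\<xi>. c * of_real (\<xi> powr (- gam))) x - profile (duhamel_amp (weighted_power g) 0) x) / dec x"

lemma profile_map_bcontfun: "profile_map c g \<in> bcontfun"
  unfolding bcontfun_def
proof (intro CollectI conjI)
  have "dec x \<noteq> 0" for x using dec_pos[of x] by simp
  then show "continuous_on UNIV (profile_map c g)"
    unfolding profile_map_def[abs_def]
    by (intro continuous_intros profile_continuous[OF homogeneous_amplitude] profile_continuous[OF duhamel_amp_amplitude[OF weighted_power_integrable order_refl zero_le_one]] dec_continuous) auto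
  show "bounded (range (profile_map c g))"
    unfolding bounded_iff
  proof (intro exI ballI, safe)
    fix x
    have "\<bar>profile (\<lambda>\<xi>. c * of_real (\<xi> powr (- gam))) x - profile (duhamel_amp (weighted_power g) 0) x\<bar> \<le> (osc_const * cmod c + Tconst * L1_norm (weighted_power g)) * dec x"
      using profile_bound[OF homogeneous_amplitude, of c x] profile_anl_bound[OF weighted_power_integrable, of g x] by (simp add: distrib_right)
    then show "norm (profile_map c g x) \<le> osc_const * cmod c + Tconst * L1_norm (weighted_power g)"
      using dec_pos[of x] by (simp add: profile_map_def abs_divide divide_le_eq)
  qed
qed

definition profile_bmap :: "complex \<Rightarrow> (real \<Rightarrow>\<^sub>C real) \<Rightarrow> real \<Rightarrow>\<^sub>C real" where
  "profile_bmap c g = Bcontfun (profile_map c g)"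

lemma profile_bmap_apply: "apply_bcontfun (profile_bmap c g) = profile_map c g"
  unfolding profile_bmap_def by (rule Bcontfun_inverse[OF profile_map_bcontfun])

text \<open>The linear part cancels in the difference. The power nonlinearity contributes the factor
  \<open>M ^ p\<close>, which is small on small balls.\<close>

lemma profile_bmap_lipschitz:
  assumes "norm g \<le> M" "norm h \<le> M"
  shows "norm (profile_bmap c g - profile_bmap c h) \<le> Tconst * ((real p + 1) * M ^ p * Dint) * norm (g - h)"
proof (rule norm_bound)
  fix x
  have "(profile_bmap c g - profile_bmap c h) x = - (profile (duhamel_amp (weighted_power g) 0) x - profile (duhamel_amp (weighted_power h) 0) x) / dec x"
    by (simp add: profile_bmap_apply profile_map_def diff_divide_distrib)
  also have "\<dots> = - (profile (duhamel_amp (\<lambda>x. weighted_power g x - weighted_power h x) 0) x / dec x)"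
    by (simp only: duhamel_amp_diff[OF weighted_power_integrable weighted_power_integrable] minus_divide_left)
  finally have "norm ((profile_bmap c g - profile_bmap c h) x) = \<bar>profile (duhamel_amp (\<lambda>x. weighted_power g x - weighted_power h x) 0) x\<bar> / dec x"
    using dec_pos[of x] by (simp add: abs_divide)
  also have "\<dots> \<le> (Tconst * L1_norm (\<lambda>x. weighted_power g x - weighted_power h x) * dec x) / dec x"
    using dec_pos[of x] by (intro divide_right_mono profile_anl_bound weighted_power_diff_integrable[OF assms]) auto
  also have "\<dots> = Tconst * L1_norm (\<lambda>x. weighted_power g x - weighted_power h x)" using dec_pos[of x] by simp
  also have "\<dots> \<le> Tconst * ((real p + 1) * M ^ p * Dint * norm (g - h))"
    using Tconst_nonneg by (intro mult_left_mono weighted_power_diff_integrable[OF assms])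
  finally show "norm ((profile_bmap c g - profile_bmap c h) x) \<le> Tconst * ((real p + 1) * M ^ p * Dint) * norm (g - h)" by simp
qed

lemma profile_bmap_zero_bound: "norm (profile_bmap c 0) \<le> osc_const * cmod c"
proof (rule norm_bound)
  fix x
  have "L1_norm (weighted_power 0) = 0" by (simp add: L1_norm_def weighted_power_zero)
  then have "profile (duhamel_amp (weighted_power 0) 0) x = 0" using profile_anl_bound[OF weighted_power_integrable, of 0 x] by simp
  then show "norm (profile_bmap c 0 x) \<le> osc_const * cmod c"
    using profile_bound[OF homogeneous_amplitude, of c x] dec_pos[of x] by (simp add: profile_bmap_apply profile_map_def abs_divide divide_le_eq)
qed

lemma profile_exists:
  obtains \<kappa> where "0 < \<kappa>" "\<And>c. cmod c \<le> \<kappa> \<Longrightarrow> \<exists>v. continuous_on UNIV v \<and> bounded (range v) \<and>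
    integrable lborel (\<lambda>x. complex_of_real (v x ^ (p + 1))) \<and>
    (\<forall>x. v x = profile (\<lambda>\<xi>. c * of_real (\<xi> powr (- gam))) x - profile (duhamel_amp (\<lambda>x. complex_of_real (v x ^ (p + 1))) 0) x)"
proof -
  define L where "L = Tconst * ((real p + 1) * Dint)"
  have L: "0 \<le> L" unfolding L_def using Tconst_nonneg Dint_nonneg by simp
  \<comment> \<open>M \<le> 1 and p \<ge> 1 give \<open>M ^ p \<le> M\<close>, and M \<le> 1 / (2 *
    (L + 1)) then makes the Lipschitz constant at most 1/2.\<close>
  define M where "M = min 1 (1 / (2 * (L + 1)))"
  have M: "0 < M" "M \<le> 1" using L by (auto simp: M_def)
  have "L * M ^ p \<le> L * M"
    using L M p_ge power_decreasing[of 1 p M] by (intro mult_left_mono) auto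
  also have "\<dots> \<le> L * (1 / (2 * (L + 1)))" using L by (intro mult_left_mono) (auto simp: M_def)
  also have "\<dots> \<le> 1 / 2" using L by (simp add: field_simps)
  finally have LM: "L * M ^ p \<le> 1 / 2" .
  show ?thesis
  \<comment> \<open>With this bound on \<open>c\<close> the image of 0 has norm at most M / 2;
    adding the 1/2-Lipschitz bound, the ball of radius \<open>M\<close> is mapped into
    itself.\<close>
  proof (rule that[of "M / (2 * osc_const)"])
    show "0 < M / (2 * osc_const)" using M osc_const_pos by simp
    fix c assume c: "cmod c \<le> M / (2 * osc_const)"
    have lip: "norm (profile_bmap c g - profile_bmap c h) \<le> 1 / 2 * norm (g - h)" if "norm g \<le> M" "norm h \<le> M" for g h
    proof -
      have "norm (profile_bmap c g - profile_bmap c h) \<le> L * M ^ p * norm (g - h)" using profile_bmap_lipschitz[OF that, of c] by (simp add: L_def mult_ac)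
      also have "\<dots> \<le> 1 / 2 * norm (g - h)" using LM by (intro mult_right_mono) auto
      finally show ?thesis .
    qed
    have z: "norm (profile_bmap c 0) \<le> M / 2"
      using profile_bmap_zero_bound[of c] mult_left_mono[OF c, of osc_const] osc_const_pos by simp
    have maps: "norm (profile_bmap c g) \<le> M" if "norm g \<le> M" for g
    proof -
      have "norm (profile_bmap c g) \<le> norm (profile_bmap c g - profile_bmap c 0) + norm (profile_bmap c 0)" using norm_triangle_ineq[of "profile_bmap c g - profile_bmap c 0" "profile_bmap c 0"] by simp
      also have "\<dots> \<le> 1 / 2 * norm (g - 0) + M / 2" using lip[OF that, of 0] z M by (intro add_mono) auto
      finally show ?thesis using that by simp
    qed
    have "\<exists>!g\<in>cball 0 M. profile_bmap c g = g"
    proof (rule Banach_fix[OF complete_eq_closed[THEN iffD2, OF closed_cball], where c="1/2"])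
      show "dist (profile_bmap c g) (profile_bmap c h) \<le> 1 / 2 * dist g h" if "g \<in> cball 0 M" "h \<in> cball 0 M" for g h
        using lip[of g h] that by (simp add: dist_norm)
    qed (use M maps in auto)
    then obtain g where g: "profile_bmap c g = g" by blast
    define v where "v = (\<lambda>x. dec x * g x)"
    have w: "(\<lambda>x. complex_of_real (v x ^ (p + 1))) = weighted_power g" by (simp add: v_def weighted_power_def fun_eq_iff)
    have "v x = profile (\<lambda>\<xi>. c * of_real (\<xi> powr (- gam))) x - profile (duhamel_amp (weighted_power g) 0) x" for x
    proof -
      have "g x = profile_map c g x" using arg_cong[OF g, of apply_bcontfun] by (simp add: profile_bmap_apply)
      then show ?thesis using dec_pos[of x] by (simp add: v_def profile_map_def)
    qed
    moreover have "continuous_on UNIV v" unfolding v_def by (intro continuous_intros dec_continuous continuous_on_apply_bcontfun)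
    moreover have "bounded (range v)"
      unfolding bounded_iff
    proof (intro exI ballI, safe)
      fix x
      have "\<bar>g x\<bar> \<le> norm g" using norm_bounded[of g x] by simp
      then show "norm (v x) \<le> norm g"
        using mult_mono[OF dec_le_one[of x], of "\<bar>g x\<bar>" "norm g"] dec_pos[of x] by (simp add: v_def abs_mult)
    qed
    ultimately show "\<exists>v. continuous_on UNIV v \<and> bounded (range v) \<and>
      integrable lborel (\<lambda>x. complex_of_real (v x ^ (p + 1))) \<and>
      (\<forall>x. v x = profile (\<lambda>\<xi>. c * of_real (\<xi> powr (- gam))) x - profile (duhamel_amp (\<lambda>x. complex_of_real (v x ^ (p + 1))) 0) x)"
      using weighted_power_integrable[of g] w by (intro exI[of _ v]) simp
  qed
qed

end

theorem theorem1:
  fixes \<alpha> :: real and p :: nat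
  assumes "1 < \<alpha>" and "\<alpha> \<le> 2"
    and "p \<ge> 3" and "real p > \<alpha> / (\<alpha> - 1)"
  shows "\<exists>\<epsilon>>0. \<forall>(\<omega>p::real) (\<omega>m::real) (\<Phi>::real \<Rightarrow> real).
    (\<forall>x>0. \<Phi> x = \<omega>p * \<bar>x\<bar> powr (- (\<alpha> / real p))) \<longrightarrow>
    (\<forall>x<0. \<Phi> x = \<omega>m * \<bar>x\<bar> powr (- (\<alpha> / real p))) \<longrightarrow>
    Lp_norm_le (real p + 1) (lin_group \<alpha> 1 (fun_distr (\<lambda>x. of_real (\<Phi> x)))) \<epsilon> \<longrightarrow>
    (\<exists>v::real \<Rightarrow> real. continuous_on UNIV v \<and> bounded (range v) \<and>
       duhamel_solution \<alpha> p \<Phi> (self_similar \<alpha> p v) \<and>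
       tendsto_tempered (self_similar \<alpha> p v) \<Phi> (at_right 0))"
proof -
  interpret gkdv \<alpha> p by unfold_locales (use assms in auto)
  obtain C where C: "0 < C" "\<And>wp wm \<Phi> \<epsilon>. 0 < \<epsilon> \<Longrightarrow> power_datum wp wm \<Phi> \<Longrightarrow>
    Lp_norm_le (real p + 1) (lin_group \<alpha> 1 (fun_distr (\<lambda>x. of_real (\<Phi> x)))) \<epsilon> \<Longrightarrow> cmod (datum_coeff wp wm) \<le> C * \<epsilon>"
    using amplitude_small by blast
  obtain \<kappa> where \<kappa>: "0 < \<kappa>" "\<And>c. cmod c \<le> \<kappa> \<Longrightarrow> \<exists>v. continuous_on UNIV v \<and> bounded (range v) \<and>
    integrable lborel (\<lambda>x. complex_of_real (v x ^ (p + 1))) \<and>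
    (\<forall>x. v x = profile (\<lambda>\<xi>. c * of_real (\<xi> powr (- gam))) x - profile (duhamel_amp (\<lambda>x. complex_of_real (v x ^ (p + 1))) 0) x)"
    using profile_exists by blast
  show ?thesis
  \<comment> \<open>The smallness \<kappa> demanded by the fixed point argument, divided by the
    constant that converts the norm of the linear evolution into a bound on
    \<open>datum_coeff\<close>.\<close>
  proof (intro exI[of _ "\<kappa> / C"] conjI allI impI)
    show "0 < \<kappa> / C" using C \<kappa> by simp
    fix \<omega>p \<omega>m :: real and \<Phi> :: "real \<Rightarrow> real"
    assume "\<forall>x>0. \<Phi> x = \<omega>p * \<bar>x\<bar> powr (- (\<alpha> / real p))" "\<forall>x<0. \<Phi> x = \<omega>m * \<bar>x\<bar> powr (- (\<alpha> / real p))"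
      and L: "Lp_norm_le (real p + 1) (lin_group \<alpha> 1 (fun_distr (\<lambda>x. of_real (\<Phi> x)))) (\<kappa> / C)"
    then have \<Phi>: "power_datum \<omega>p \<omega>m \<Phi>" by (simp add: power_datum_def sg_def)
    have "cmod (datum_coeff \<omega>p \<omega>m) \<le> C * (\<kappa> / C)" using C \<kappa> by (intro C(2)[OF _ \<Phi> L]) simp
    then have "cmod (datum_coeff \<omega>p \<omega>m) \<le> \<kappa>" using C by simp
    from \<kappa>(2)[OF this] obtain v where v: "continuous_on UNIV v" "bounded (range v)"
      "integrable lborel (\<lambda>x. complex_of_real (v x ^ (p + 1)))"
      "\<And>x. v x = profile (\<lambda>\<xi>. datum_coeff \<omega>p \<omega>m * of_real (\<xi> powr (- gam))) x - profile (duhamel_amp (\<lambda>x. complex_of_real (v x ^ (p + 1))) 0) x"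
      by blast
    show "\<exists>v::real \<Rightarrow> real. continuous_on UNIV v \<and> bounded (range v) \<and>
       duhamel_solution \<alpha> p \<Phi> (self_similar \<alpha> p v) \<and>
       tendsto_tempered (self_similar \<alpha> p v) \<Phi> (at_right 0)"
      using v(1,2) duhamel_from_profile[OF \<Phi> v(3,4)] tendsto_from_profile[OF \<Phi> v(3,4)] by blast
  qed
qed

end
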